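(* Let $G$ be a stable abelian group (written additively), and let $a,b,c\in G$ be pairwise independent over $\emptyset$ with $a+b+c=0$. Then: 1. The strong types of $a$, $b$ and $c$ (over $\emptyset$) all have the same stabilizer $U$, and $U$ is connected. 2. Each of $a$, $b$ and $c$ is a generic element, over $\mathrm{acl}^{\mathrm{eq}}(\emptyset)$, of a coset of $U$ which is type-definable over $\mathrm{acl}^{\mathrm{eq}}(\emptyset)$.
   Context: A stable abelian group is an abelian group $(G,+)$, possibly with additional structure, whose complete first-order theory is stable. $G$ is taken to be a sufficiently saturated and strongly homogeneous (monster) model; "small" means of cardinality less than the degree of saturation. Independence means non-forking independence. The strong type of $a\in G$ over $\emptyset$ is $\mathrm{tp}(a/\mathrm{acl}^{\mathrm{eq}}(\emptyset))$; it is stationary. For a strong type $p$ over $\emptyset$ of an element of $G$ and a small set $B$, $p_{|B}$ denotes the unique non-forking extension of $p$ to $\mathrm{acl}^{\mathrm{eq}}(\emptyset)\cup B$, and $p_{|g}=p_{|\{g\}}$. The stabilizer of $p$ is the subgroup $$\mathrm{Stab}(p)=\{g\in G \mid \text{for all } a:\ a\models p_{|g}\Rightarrow a+g\models p_{|g}\},$$ which is type-definable over $\mathrm{acl}^{\mathrm{eq}}(\emptyset)$. A type-definable subgroup $U$ of $G$ is connected if it has no proper type-definable (over a small set) subgroup of bounded (i.e. small) index. Let $U$ be a subgroup and $C$ a coset of $U$, both type-definable over $\mathrm{acl}^{\mathrm{eq}}(\emptyset)$. An element $a\in C$ is a generic element of $C$ over $\mathrm{acl}^{\mathrm{eq}}(\emptyset)$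 if its type over $\mathrm{acl}^{\mathrm{eq}}(\emptyset)$ is a generic type of $C$, i.e. for every formula $\varphi(x)\in \mathrm{tp}(a/\mathrm{acl}^{\mathrm{eq}}(\emptyset))$, finitely many translates of $\varphi(G)\cap C$ by elements of $U$ cover $C$. *)

theory Defs
  imports Main
begin

unbundle cardinal_syntax

section \<open>Many-sorted first-order logic\<close>

text \<open>Variables are de Bruijn indices into a context, i.e. a list of sorts; a finite tuple of
  variables is such a context and a tuple of elements is a list.  In a context of the form
  \<open>ss @ ts\<close> a formula is read as \<open>\<phi>(x; y)\<close> with x of sorts ss and y of sorts ts.\<close>

datatype 'f tm = Var nat | App 'f "'f tm list"

datatype ('s, 'f, 'r) fm =
    Eq "'f tm" "'f tm"
  | Rel 'r "'f tm list"
  | Neg "('s, 'f, 'r) fm"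
  | Conj "('s, 'f, 'r) fm" "('s, 'f, 'r) fm"
  | Exi 's "('s, 'f, 'r) fm"

record ('s, 'f, 'r, 'a) struct =
  sorts :: "'s set"
  fargs :: "'f \<Rightarrow> 's list"
  fres :: "'f \<Rightarrow> 's"
  rargs :: "'r \<Rightarrow> 's list"
  univ :: "'s \<Rightarrow> 'a set"
  fint :: "'f \<Rightarrow> 'a list \<Rightarrow> 'a"
  rint :: "'r \<Rightarrow> 'a list \<Rightarrow> bool"

inductive has_sort :: "('s, 'f, 'r, 'a) struct \<Rightarrow> 's list \<Rightarrow> 'f tm \<Rightarrow> 's \<Rightarrow> bool"
  for M ss where
  "i < length ss \<Longrightarrow> has_sort M ss (Var i) (ss ! i)"
| "fres M f \<in> sorts M \<Longrightarrow> list_all2 (has_sort M ss) ts (fargs M f)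
     \<Longrightarrow> has_sort M ss (App f ts) (fres M f)"

primrec wf_fm :: "('s, 'f, 'r, 'a) struct \<Rightarrow> 's list \<Rightarrow> ('s, 'f, 'r) fm \<Rightarrow> bool" where
  "wf_fm M ss (Eq t u) \<longleftrightarrow> (\<exists>s. has_sort M ss t s \<and> has_sort M ss u s)"
| "wf_fm M ss (Rel r ts) \<longleftrightarrow> list_all2 (has_sort M ss) ts (rargs M r)"
| "wf_fm M ss (Neg \<phi>) \<longleftrightarrow> wf_fm M ss \<phi>"
| "wf_fm M ss (Conj \<phi> \<psi>) \<longleftrightarrow> wf_fm M ss \<phi> \<and> wf_fm M ss \<psi>"
| "wf_fm M ss (Exi s \<phi>) \<longleftrightarrow> s \<in> sorts M \<and> wf_fm M (s # ss) \<phi>"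

primrec eval_tm :: "('s, 'f, 'r, 'a) struct \<Rightarrow> 'a list \<Rightarrow> 'f tm \<Rightarrow> 'a" where
  "eval_tm M as (Var i) = as ! i"
| "eval_tm M as (App f ts) = fint M f (map (eval_tm M as) ts)"

primrec sat :: "('s, 'f, 'r, 'a) struct \<Rightarrow> 'a list \<Rightarrow> ('s, 'f, 'r) fm \<Rightarrow> bool" where
  "sat M as (Eq t u) \<longleftrightarrow> eval_tm M as t = eval_tm M as u"
| "sat M as (Rel r ts) \<longleftrightarrow> rint M r (map (eval_tm M as) ts)"
| "sat M as (Neg \<phi>) \<longleftrightarrow> \<not> sat M as \<phi>"
| "sat M as (Conj \<phi> \<psi>) \<longleftrightarrow> sat M as \<phi> \<and> sat M as \<psi>"
| "sat M as (Exi s \<phi>) \<longleftrightarrow> (\<exists>x\<in>univ M s. sat M (x # as) \<phi>)"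

definition tuples :: "('s, 'f, 'r, 'a) struct \<Rightarrow> 's list \<Rightarrow> 'a list set" where
  "tuples M ss = {as. list_all2 (\<lambda>a s. a \<in> univ M s) as ss}"

section \<open>Types\<close>

text \<open>A formula with parameters \<open>\<phi>(x, b)\<close> is a pair of a parameter-free formula and a tuple.\<close>

type_synonym ('s, 'f, 'r, 'a) pfm = "('s, 'f, 'r) fm \<times> 'a list"

definition formulas_over ::
  "('s, 'f, 'r, 'a) struct \<Rightarrow> 's list \<Rightarrow> 'a set \<Rightarrow> ('s, 'f, 'r, 'a) pfm set" where
  "formulas_over M ss A =
     {(\<phi>, bs). \<exists>ts. wf_fm M (ss @ ts) \<phi> \<and> bs \<in> tuples M ts \<and> set bs \<subseteq> A}"

definition realizes ::
  "('s, 'f, 'r, 'a) struct \<Rightarrow> 'a list \<Rightarrow> ('s, 'f, 'r, 'a) pfm set \<Rightarrow> bool" where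
  "realizes M as \<pi> \<longleftrightarrow> (\<forall>(\<phi>, bs)\<in>\<pi>. sat M (as @ bs) \<phi>)"

definition tp ::
  "('s, 'f, 'r, 'a) struct \<Rightarrow> 's list \<Rightarrow> 'a list \<Rightarrow> 'a set \<Rightarrow> ('s, 'f, 'r, 'a) pfm set" where
  "tp M ss as A = {(\<phi>, bs) \<in> formulas_over M ss A. sat M (as @ bs) \<phi>}"

definition complete_types ::
  "('s, 'f, 'r, 'a) struct \<Rightarrow> 's list \<Rightarrow> 'a set \<Rightarrow> ('s, 'f, 'r, 'a) pfm set set" where
  "complete_types M ss A =
     {q. q \<subseteq> formulas_over M ss A \<and>
         (\<forall>q0. finite q0 \<and> q0 \<subseteq> q \<longrightarrow> (\<exists>as\<in>tuples M ss. realizes M as q0)) \<and>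
         (\<forall>(\<phi>, bs)\<in>formulas_over M ss A. (\<phi>, bs) \<in> q \<or> (Neg \<phi>, bs) \<in> q)}"

definition acl :: "('s, 'f, 'r, 'a) struct \<Rightarrow> 'a set \<Rightarrow> 'a set" where
  "acl M A = {a. \<exists>s\<in>sorts M. a \<in> univ M s \<and>
     (\<exists>(\<phi>, bs)\<in>formulas_over M [s] A.
        sat M (a # bs) \<phi> \<and> finite {x \<in> univ M s. sat M (x # bs) \<phi>})}"

section \<open>Stability and monster models\<close>

text \<open>The order property is evaluated in the structure itself; for an \<open>\<aleph>\<^sub>1\<close>-saturated structure
  its absence is stability of the complete theory.\<close>

definition stable_struct :: "('s, 'f, 'r, 'a) struct \<Rightarrow> bool" where
  "stable_struct M \<longleftrightarrow>
     \<not> (\<exists>ss ts \<phi> a b. wf_fm M (ss @ ts) \<phi> \<and>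
          (\<forall>i::nat. a i \<in> tuples M ss \<and> b i \<in> tuples M ts) \<and>
          (\<forall>i j. sat M (a i @ b j) \<phi> \<longleftrightarrow> i < j))"

text \<open>Here and below, \<open>\<kappa>\<close> is the degree of saturation, and smallness of A is \<open>|A| <o \<kappa>\<close>.\<close>

definition saturated :: "('s, 'f, 'r, 'a) struct \<Rightarrow> 'k rel \<Rightarrow> bool" where
  "saturated M \<kappa> \<longleftrightarrow>
     (\<forall>A. |A| <o \<kappa> \<longrightarrow>
        (\<forall>s\<in>sorts M. \<forall>q\<in>complete_types M [s] A. \<exists>a\<in>univ M s. realizes M [a] q))"

definition automorphism :: "('s, 'f, 'r, 'a) struct \<Rightarrow> ('a \<Rightarrow> 'a) \<Rightarrow> bool" where
  "automorphism M \<sigma> \<longleftrightarrow>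
     (\<forall>s\<in>sorts M. bij_betw \<sigma> (univ M s) (univ M s)) \<and>
     (\<forall>f. \<forall>as\<in>tuples M (fargs M f). \<sigma> (fint M f as) = fint M f (map \<sigma> as)) \<and>
     (\<forall>r. \<forall>as\<in>tuples M (rargs M r). rint M r as \<longleftrightarrow> rint M r (map \<sigma> as))"

definition partial_elementary :: "('s, 'f, 'r, 'a) struct \<Rightarrow> 'a set \<Rightarrow> ('a \<Rightarrow> 'a) \<Rightarrow> bool" where
  "partial_elementary M A h \<longleftrightarrow>
     (\<forall>ss. \<forall>as\<in>tuples M ss. set as \<subseteq> A \<longrightarrow>
        map h as \<in> tuples M ss \<and>
        (\<forall>\<phi>. wf_fm M ss \<phi> \<longrightarrow> (sat M as \<phi> \<longleftrightarrow> sat M (map h as) \<phi>)))"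

definition strongly_homogeneous :: "('s, 'f, 'r, 'a) struct \<Rightarrow> 'k rel \<Rightarrow> bool" where
  "strongly_homogeneous M \<kappa> \<longleftrightarrow>
     (\<forall>A h. A \<subseteq> (\<Union>s\<in>sorts M. univ M s) \<and> |A| <o \<kappa> \<and> partial_elementary M A h \<longrightarrow>
        (\<exists>\<sigma>. automorphism M \<sigma> \<and> (\<forall>a\<in>A. \<sigma> a = h a)))"

text \<open>Sufficient saturation means that \<open>\<kappa>\<close> exceeds the number of formulas of the language
  (which is always infinite).\<close>

definition monster :: "('s, 'f, 'r, 'a) struct \<Rightarrow> 'k rel \<Rightarrow> bool" where
  "monster M \<kappa> \<longleftrightarrow>
     Card_order \<kappa> \<and> |{\<phi>. \<exists>ss. set ss \<subseteq> sorts M \<and> wf_fm M ss \<phi>}| <o \<kappa> \<and>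
     saturated M \<kappa> \<and> strongly_homogeneous M \<kappa>"

section \<open>Forking\<close>

definition divides ::
  "('s, 'f, 'r, 'a) struct \<Rightarrow> 's list \<Rightarrow> 'a set \<Rightarrow> ('s, 'f, 'r, 'a) pfm \<Rightarrow> bool" where
  "divides M ss A = (\<lambda>(\<phi>, bs). \<exists>ts k c.
     wf_fm M (ss @ ts) \<phi> \<and> bs \<in> tuples M ts \<and>
     (\<forall>i::nat. c i \<in> tuples M ts \<and> realizes M (c i) (tp M ts bs A)) \<and>
     (\<forall>I. finite I \<and> card I = k \<longrightarrow>
        \<not> (\<exists>as\<in>tuples M ss. \<forall>i\<in>I. sat M (as @ c i) \<phi>)))"

text \<open>By compactness, a set of formulas implies a formula iff a finite subset of it does.\<close>

definition forks ::
  "('s, 'f, 'r, 'a) struct \<Rightarrow> 's list \<Rightarrow> 'a set \<Rightarrow> ('s, 'f, 'r, 'a) pfm set \<Rightarrow> bool" where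
  "forks M ss A \<pi> \<longleftrightarrow>
     (\<exists>\<pi>0 \<Delta>. finite \<pi>0 \<and> \<pi>0 \<subseteq> \<pi> \<and> finite \<Delta> \<and> \<Delta> \<subseteq> formulas_over M ss UNIV \<and>
        (\<forall>\<delta>\<in>\<Delta>. divides M ss A \<delta>) \<and>
        (\<forall>as\<in>tuples M ss. realizes M as \<pi>0 \<longrightarrow> (\<exists>(\<psi>, cs)\<in>\<Delta>. sat M (as @ cs) \<psi>)))"

section \<open>Imaginaries\<close>

text \<open>From here on G is one-sorted, with sort type \<^typ>\<open>unit\<close>.  The sorts of its expansion by
  imaginaries are the home sort and one sort \<open>Quot n E\<close> for each parameter-free formula E
  that defines an equivalence relation on n-tuples; \<open>Proj n E\<close> is the canonical projection.\<close>

datatype ('f, 'r) eqsort = Home | Quot nat "(unit, 'f, 'r) fm"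

datatype ('f, 'r) eqfun = Base 'f | Proj nat "(unit, 'f, 'r) fm"

datatype ('f, 'r, 'a) eqel = El (the_El: 'a) | Cls nat "(unit, 'f, 'r) fm" "'a list set"

definition def_rel ::
  "(unit, 'f, 'r, 'a) struct \<Rightarrow> nat \<Rightarrow> (unit, 'f, 'r) fm \<Rightarrow> 'a list rel" where
  "def_rel G n E = {(as, bs). as \<in> tuples G (replicate n ()) \<and> bs \<in> tuples G (replicate n ()) \<and>
     sat G (as @ bs) E}"

definition def_equiv :: "(unit, 'f, 'r, 'a) struct \<Rightarrow> nat \<Rightarrow> (unit, 'f, 'r) fm \<Rightarrow> bool" where
  "def_equiv G n E \<longleftrightarrow> wf_fm G (replicate n () @ replicate n ()) E \<and>
     equiv (tuples G (replicate n ())) (def_rel G n E)"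

definition eq_struct ::
  "(unit, 'f, 'r, 'a) struct \<Rightarrow>
   (('f, 'r) eqsort, ('f, 'r) eqfun, 'r, ('f, 'r, 'a) eqel) struct" where
  "eq_struct G = \<lparr>
     sorts = insert Home {Quot n E | n E. def_equiv G n E},
     fargs = (\<lambda>f. case f of Base g \<Rightarrow> map (\<lambda>_. Home) (fargs G g) | Proj n E \<Rightarrow> replicate n Home),
     fres = (\<lambda>f. case f of Base g \<Rightarrow> Home | Proj n E \<Rightarrow> Quot n E),
     rargs = (\<lambda>r. map (\<lambda>_. Home) (rargs G r)),
     univ = (\<lambda>s. case s of
         Home \<Rightarrow> El ` univ G ()
       | Quot n E \<Rightarrow> (if def_equiv G n E
                       then Cls n E ` (tuples G (replicate n ()) // def_rel G n E) else {})),
     fint = (\<lambda>f xs. case f of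
         Base g \<Rightarrow> El (fint G g (map the_El xs))
       | Proj n E \<Rightarrow> Cls n E (def_rel G n E `` {map the_El xs})),
     rint = (\<lambda>r xs. rint G r (map the_El xs)) \<rparr>"

definition acleq0 :: "(unit, 'f, 'r, 'a) struct \<Rightarrow> ('f, 'r, 'a) eqel set" where
  "acleq0 G = acl (eq_struct G) {}"

type_synonym ('f, 'r, 'a) eqtype =
  "(('f, 'r) eqsort, ('f, 'r) eqfun, 'r, ('f, 'r, 'a) eqel) pfm set"

definition stp :: "(unit, 'f, 'r, 'a) struct \<Rightarrow> 'a \<Rightarrow> ('f, 'r, 'a) eqtype" where
  "stp G a = tp (eq_struct G) [Home] [El a] (acleq0 G)"

text \<open>The extension \<open>p\<^sub>|\<^sub>B\<close> of a strong type p.\<close>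

definition nf_ext ::
  "(unit, 'f, 'r, 'a) struct \<Rightarrow> ('f, 'r, 'a) eqtype \<Rightarrow> ('f, 'r, 'a) eqel set
     \<Rightarrow> ('f, 'r, 'a) eqtype" where
  "nf_ext G p B = (THE q. q \<in> complete_types (eq_struct G) [Home] (acleq0 G \<union> B) \<and> p \<subseteq> q \<and>
     \<not> forks (eq_struct G) [Home] (acleq0 G) q)"

section \<open>Stable abelian groups\<close>

definition abelian_group_struct ::
  "(unit, 'f, 'r, 'a::ab_group_add) struct \<Rightarrow> bool" where
  "abelian_group_struct G \<longleftrightarrow> sorts G = {()} \<and> univ G () = UNIV \<and>
     (\<exists>f. fargs G f = [(), ()] \<and> (\<forall>x y. fint G f [x, y] = x + y))"

definition indep0 :: "(unit, 'f, 'r, 'a) struct \<Rightarrow> 'a \<Rightarrow> 'a \<Rightarrow> bool" where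
  "indep0 G a b \<longleftrightarrow> \<not> forks G [()] {} (tp G [()] [a] {b})"

definition pairwise_indep0 :: "(unit, 'f, 'r, 'a) struct \<Rightarrow> 'a list \<Rightarrow> bool" where
  "pairwise_indep0 G xs \<longleftrightarrow>
     (\<forall>i<length xs. \<forall>j<length xs. i \<noteq> j \<longrightarrow> indep0 G (xs ! i) (xs ! j))"

definition Stab ::
  "(unit, 'f, 'r, 'a::ab_group_add) struct \<Rightarrow> ('f, 'r, 'a) eqtype \<Rightarrow> 'a set" where
  "Stab G p = {g. \<forall>a. realizes (eq_struct G) [El a] (nf_ext G p {El g}) \<longrightarrow>
                     realizes (eq_struct G) [El (a + g)] (nf_ext G p {El g})}"

definition is_subgroup :: "'a::ab_group_add set \<Rightarrow> bool" where
  "is_subgroup H \<longleftrightarrow> 0 \<in> H \<and> (\<forall>x\<in>H. \<forall>y\<in>H. x + y \<in> H) \<and> (\<forall>x\<in>H. - x \<in> H)"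

definition coset :: "'a::ab_group_add \<Rightarrow> 'a set \<Rightarrow> 'a set" where
  "coset x H = (\<lambda>h. x + h) ` H"

definition type_definable ::
  "(unit, 'f, 'r, 'a) struct \<Rightarrow> ('f, 'r, 'a) eqel set \<Rightarrow> 'a set \<Rightarrow> bool" where
  "type_definable G A X \<longleftrightarrow>
     (\<exists>\<pi>\<subseteq>formulas_over (eq_struct G) [Home] A.
        X = {x \<in> univ G (). realizes (eq_struct G) [El x] \<pi>})"

definition type_definable_subgroup ::
  "(unit, 'f, 'r, 'a::ab_group_add) struct \<Rightarrow> 'k rel \<Rightarrow> 'a set \<Rightarrow> bool" where
  "type_definable_subgroup G \<kappa> H \<longleftrightarrow>
     is_subgroup H \<and> (\<exists>A. |A| <o \<kappa> \<and> type_definable G A H)"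

definition connected_subgroup ::
  "(unit, 'f, 'r, 'a::ab_group_add) struct \<Rightarrow> 'k rel \<Rightarrow> 'a set \<Rightarrow> bool" where
  "connected_subgroup G \<kappa> U \<longleftrightarrow>
     type_definable_subgroup G \<kappa> U \<and>
     \<not> (\<exists>V. V \<subset> U \<and> type_definable_subgroup G \<kappa> V \<and> |(\<lambda>u. coset u V) ` U| <o \<kappa>)"

definition generic_element ::
  "(unit, 'f, 'r, 'a::ab_group_add) struct \<Rightarrow> 'a set \<Rightarrow> 'a set \<Rightarrow> 'a \<Rightarrow> bool" where
  "generic_element G U C a \<longleftrightarrow> a \<in> C \<and>
     (\<forall>(\<phi>, bs)\<in>stp G a. \<exists>F. finite F \<and> F \<subseteq> U \<and>
        C \<subseteq> (\<Union>u\<in>F. coset u {x \<in> C. sat (eq_struct G) (El x # bs) \<phi>}))"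

end

theory Submission
  imports Defs "HOL-Library.Countable_Set"
begin

text \<open>The global nonforking extension of the strong type of an element x is represented by an
  ultrafilter U on G all of whose definitions are almost 0-definable; it comes from a minimal flow
  of the automorphism group.  The stabilizer is the group of translations that preserve U on
  definable sets.

  Let \<open>x + y + z = 0\<close> with pairwise independent summands.  Independence of x and y and of z and y
  says that the translate by y of the ultrafilter of x and the negative of the ultrafilter of z
  agree on formulas over y, and stationarity lifts this to all formulas.  This then also holds for
  every y' with the strong type of y.  Hence differences of realizations of the strong type of y
  stabilize the type of x.  Conversely, an element of the stabilizer of the type of y is such a
  difference, so all three stabilizers are contained in each other, and the realizations of each of
  the three types lie in a single coset of the common stabilizer.  A type that is concentrated on a
  coset of its own stabilizer is generic there, and no subgroup of bounded index can split it.\<close>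

section \<open>Ultrafilters and stable relations\<close>

text \<open>Ultrafilters on \<open>G\<close> itself replace types over a larger model:
  \<open>U (\<lambda>x. P x)\<close> reads as a quantifier "for almost all x", so limits can be
  iterated and exchanged. The price is that only the trace of \<open>U\<close> on definable sets is
  canonical; where a type-definable set matters, a second ultrafilter with the same trace is taken.
  Formulas over acl^eq of the empty set become relations with finitely many conjugates
  (\<open>adef\<close>), so that imaginaries appear only where \<open>stp\<close>,
  \<open>nf_ext\<close> and the type-definable sets are translated. The obstacle is that forking is
  given by dividing and not by definitions of types. A formula that contradicts the definition of a
  type is made to divide by a Morley sequence, and stability forbids that too many terms satisfy it.
  This is done twice: \<open>nf_ext\<close> forks over acl^eq in the expansion, whereas
  \<open>indep0\<close> forks over the empty set in \<open>G\<close>, where the parameters of an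
  almost 0-definable relation are not fixed. The minimal flow gives existence, because in it each
  definition has a finite orbit, and saturation makes a finite orbit almost 0-definable.\<close>

definition ultra :: "(('x \<Rightarrow> bool) \<Rightarrow> bool) \<Rightarrow> bool" where
  "ultra U \<longleftrightarrow> (\<forall>P Q. U (\<lambda>x. P x \<and> Q x) = (U P \<and> U Q)) \<and> (\<forall>P. U (\<lambda>x. \<not> P x) = (\<not> U P))"

lemma ultra_conj: "ultra U \<Longrightarrow> U (\<lambda>x. P x \<and> Q x) = (U P \<and> U Q)"
  and ultra_not: "ultra U \<Longrightarrow> U (\<lambda>x. \<not> P x) = (\<not> U P)"
  by (auto simp: ultra_def)

lemma ultra_disj: "ultra U \<Longrightarrow> U (\<lambda>x. P x \<or> Q x) = (U P \<or> U Q)"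
  using ultra_conj[of U "\<lambda>x. \<not> P x" "\<lambda>x. \<not> Q x"] ultra_not[of U P] ultra_not[of U Q]
    ultra_not[of U "\<lambda>x. P x \<or> Q x"]
  by auto

text \<open>Properness is not part of \<open>ultra\<close>: if \<open>U\<close> held of the empty
  set, it would by conjunction also hold of the whole set, which is its complement.\<close>

lemma ultra_const:
  assumes "ultra U" shows "U (\<lambda>x. c) = c"
proof -
  have "\<not> U (\<lambda>x. False)"
    using ultra_conj[OF assms, of "\<lambda>x. False" "\<lambda>x. True"] ultra_not[OF assms, of "\<lambda>x. False"] by auto
  then show ?thesis using ultra_not[OF assms, of "\<lambda>x. False"] by (cases c) auto
qed

lemma ultra_mono:
  assumes "ultra U" "U P" "\<And>x. P x \<Longrightarrow> Q x" shows "U Q"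
proof -
  have "(\<lambda>x. P x \<and> Q x) = P" using assms(3) by auto
  then show ?thesis using ultra_conj[OF assms(1), of P Q] assms(2) by auto
qed

lemma ultra_ex: "ultra U \<Longrightarrow> U P \<Longrightarrow> \<exists>x. P x"
  using ultra_const[of U False] ultra_mono[of U P "\<lambda>_. False"] by auto

lemma ultra_iff: "ultra U \<Longrightarrow> U (\<lambda>x. P x = Q x) = (U P = U Q)"
proof -
  assume u: "ultra U"
  have "(\<lambda>x. P x = Q x) = (\<lambda>x. (P x \<and> Q x) \<or> (\<not> P x \<and> \<not> Q x))" by auto
  then show ?thesis by (simp add: ultra_conj[OF u] ultra_disj[OF u] ultra_not[OF u]) blast
qed

lemma ultra_ball:
  assumes "ultra U" "finite I" shows "U (\<lambda>x. \<forall>i\<in>I. P i x) = (\<forall>i\<in>I. U (P i))"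
  using assms(2) by induction (auto simp: ultra_const[OF assms(1)] ultra_conj[OF assms(1)])

lemma ultra_bex:
  assumes "ultra U" "finite I" shows "U (\<lambda>x. \<exists>i\<in>I. P i x) = (\<exists>i\<in>I. U (P i))"
  using assms(2) by induction (auto simp: ultra_const[OF assms(1)] ultra_disj[OF assms(1)])

lemma ultra_map: "ultra U \<Longrightarrow> ultra (\<lambda>P. U (\<lambda>x. P (f x)))"
  by (simp add: ultra_def)

section \<open>Invariant filters and their maximal elements\<close>

definition invfilter :: "('x \<Rightarrow> 'x) set \<Rightarrow> ('x \<Rightarrow> bool) set \<Rightarrow> bool" where
  "invfilter H F \<longleftrightarrow> (\<lambda>x. True) \<in> F \<and> (\<lambda>x. False) \<notin> F \<and>
     (\<forall>P\<in>F. \<forall>Q\<in>F. (\<lambda>x. P x \<and> Q x) \<in> F) \<and>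
     (\<forall>P Q. P \<in> F \<longrightarrow> (\<forall>x. P x \<longrightarrow> Q x) \<longrightarrow> Q \<in> F) \<and>
     (\<forall>P\<in>F. \<forall>\<sigma>\<in>H. (\<lambda>x. P (\<sigma> x)) \<in> F)"

lemma invfilterD:
  assumes "invfilter H F"
  shows "(\<lambda>x. True) \<in> F" "(\<lambda>x. False) \<notin> F"
    and "\<And>P Q. P \<in> F \<Longrightarrow> Q \<in> F \<Longrightarrow> (\<lambda>x. P x \<and> Q x) \<in> F"
    and "\<And>P Q. P \<in> F \<Longrightarrow> (\<And>x. P x \<Longrightarrow> Q x) \<Longrightarrow> Q \<in> F"
    and "\<And>P \<sigma>. P \<in> F \<Longrightarrow> \<sigma> \<in> H \<Longrightarrow> (\<lambda>x. P (\<sigma> x)) \<in> F"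
  using assms by (simp_all add: invfilter_def)

text \<open>An invariant filter stands for the closed invariant set of ultrafilters extending it, so
  a maximal one stands for a minimal flow. All conditions are finitary, hence unions of nonempty
  chains satisfy them and Zorn's lemma applies.\<close>

lemma maximal_invfilter:
  assumes "invfilter H F0"
  shows "\<exists>F. invfilter H F \<and> F0 \<subseteq> F \<and> (\<forall>F'. invfilter H F' \<longrightarrow> F \<subseteq> F' \<longrightarrow> F' = F)"
proof -
  let ?A = "{F. invfilter H F \<and> F0 \<subseteq> F}"
  have "\<exists>U\<in>?A. \<forall>X\<in>C. X \<subseteq> U" if C: "subset.chain ?A C" for C
  proof (cases "C = {}")
    case True then show ?thesis using assms by auto
  next
    case False
    have 1: "X \<subseteq> Y \<or> Y \<subseteq> X" if "X \<in> C" "Y \<in> C" for X Y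
      using C that unfolding subset.chain_def by blast
    have 2: "invfilter H X" "F0 \<subseteq> X" if "X \<in> C" for X using C that by (auto simp: subset.chain_def)
    have c: "(\<lambda>x. P x \<and> Q x) \<in> \<Union>C" if PQ: "P \<in> \<Union>C" "Q \<in> \<Union>C" for P Q
    proof -
      obtain X Y where XY: "P \<in> X" "X \<in> C" "Q \<in> Y" "Y \<in> C" using PQ by auto
      then obtain Z where Z: "Z \<in> C" "P \<in> Z" "Q \<in> Z" using 1 by blast
      show ?thesis using invfilterD(3)[OF 2(1)[OF Z(1)] Z(2,3)] Z(1) by (rule UnionI[rotated])
    qed
    have t: "(\<lambda>x. True) \<in> \<Union>C" using False invfilterD(1)[OF 2(1)] by auto
    have f: "(\<lambda>x. False) \<notin> \<Union>C" using invfilterD(2)[OF 2(1)] by auto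
    have m: "Q \<in> \<Union>C" if PQ: "P \<in> \<Union>C" "\<forall>x. P x \<longrightarrow> Q x" for P Q
    proof -
      obtain X where X: "P \<in> X" "X \<in> C" using PQ by auto
      show ?thesis using invfilterD(4)[OF 2(1)[OF X(2)] X(1)] PQ(2) X(2) by auto
    qed
    have i: "(\<lambda>x. P (\<sigma> x)) \<in> \<Union>C" if P: "P \<in> \<Union>C" "\<sigma> \<in> H" for P \<sigma>
    proof -
      obtain X where X: "P \<in> X" "X \<in> C" using P by auto
      show ?thesis using invfilterD(5)[OF 2(1)[OF X(2)] X(1) P(2)] X(2) by auto
    qed
    have "invfilter H (\<Union>C)" unfolding invfilter_def
    proof (intro conjI ballI allI impI)
      fix P Q assume "P \<in> \<Union>C" "\<forall>x. P x \<longrightarrow> Q x" then show "Q \<in> \<Union>C" by (rule m)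
    next
      fix P Q assume "P \<in> \<Union>C" "Q \<in> \<Union>C" then show "(\<lambda>x. P x \<and> Q x) \<in> \<Union>C" by (rule c)
    next
      fix P \<sigma> assume "P \<in> \<Union>C" "\<sigma> \<in> H" then show "(\<lambda>x. P (\<sigma> x)) \<in> \<Union>C" by (rule i)
    qed (rule t, rule f)
    moreover have "F0 \<subseteq> \<Union>C" using False 2(2) by blast
    ultimately show ?thesis by blast
  qed
  then obtain F where "F \<in> ?A" "\<forall>X\<in>?A. F \<subseteq> X \<longrightarrow> X = F"
    using subset_Zorn[of ?A] by blast
  then show ?thesis by (intro exI[of _ F]) auto
qed

text \<open>For an ultrafilter this is the case of the trivial group.  In general it says that a set
  either is negligible or covers with finitely many translates, which is minimality of the flow
  of ultrafilters extending F.\<close>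

lemma maximal_invfilter_cover:
  assumes F: "invfilter H F" and max: "\<forall>F'. invfilter H F' \<longrightarrow> F \<subseteq> F' \<longrightarrow> F' = F"
    and id: "id \<in> H" and comp: "\<And>\<sigma> \<tau>. \<sigma> \<in> H \<Longrightarrow> \<tau> \<in> H \<Longrightarrow> \<sigma> \<circ> \<tau> \<in> H"
  shows "(\<lambda>x. \<not> Z x) \<in> F \<or> (\<exists>S. finite S \<and> S \<subseteq> H \<and> (\<lambda>x. \<exists>\<sigma>\<in>S. Z (\<sigma> x)) \<in> F)"
proof (rule disjCI, rule ccontr)
  assume n: "\<not> (\<exists>S. finite S \<and> S \<subseteq> H \<and> (\<lambda>x. \<exists>\<sigma>\<in>S. Z (\<sigma> x)) \<in> F)" 
  assume nZ: "(\<lambda>x. \<not> Z x) \<notin> F"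
  note Ft = invfilterD(1)[OF F] and Fc = invfilterD(3)[OF F] and Fm = invfilterD(4)[OF F]
    and Fi = invfilterD(5)[OF F]
  \<comment> \<open>The invariant filter generated by \<open>F\<close> and the complement of
    \<open>Z\<close>. It is proper by \<open>n\<close>, so by maximality it equals \<open>F\<close>,
    which therefore contains that complement. Invariance holds because a translate of a translate is
    a translate.\<close>
  let ?F = "{P. \<exists>A S. A \<in> F \<and> finite S \<and> S \<subseteq> H \<and> (\<forall>x. A x \<and> (\<forall>\<sigma>\<in>S. \<not> Z (\<sigma> x)) \<longrightarrow> P x)}"
  have FE: "\<exists>A S. A \<in> F \<and> finite S \<and> S \<subseteq> H \<and> (\<forall>x. A x \<and> (\<forall>\<sigma>\<in>S. \<not> Z (\<sigma> x)) \<longrightarrow> P x)"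
    if "P \<in> ?F" for P using that by (simp only: mem_Collect_eq)
  have FI: "P \<in> ?F" if "A \<in> F" "finite S" "S \<subseteq> H" "\<And>x. A x \<Longrightarrow> \<forall>\<sigma>\<in>S. \<not> Z (\<sigma> x) \<Longrightarrow> P x" for P A S
    using that by (intro CollectI exI[of _ A] exI[of _ S]) simp
  have "invfilter H ?F" unfolding invfilter_def
  proof (intro conjI ballI allI impI)
    show "(\<lambda>x. True) \<in> ?F" by (rule FI[OF Ft, of "{}"]) simp_all
    show "(\<lambda>x. False) \<notin> ?F"
    proof
      assume "(\<lambda>x. False) \<in> ?F"
      from FE[OF this] obtain A S where A: "A \<in> F" "finite S" "S \<subseteq> H"
        "\<forall>x. A x \<and> (\<forall>\<sigma>\<in>S. \<not> Z (\<sigma> x)) \<longrightarrow> False" by (elim exE conjE)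
      have "(\<lambda>x. \<exists>\<sigma>\<in>S. Z (\<sigma> x)) \<in> F" by (rule Fm[OF A(1)]) (use A(4) in blast)
      then have "\<exists>S. finite S \<and> S \<subseteq> H \<and> (\<lambda>x. \<exists>\<sigma>\<in>S. Z (\<sigma> x)) \<in> F"
        using A(2,3) by (intro exI[of _ S] conjI)
      then show False using n by (rule notE[rotated])
    qed
  next
    fix P Q assume PQ: "P \<in> ?F" "Q \<in> ?F"
    from FE[OF PQ(1)] obtain A S where A: "A \<in> F" "finite S" "S \<subseteq> H"
      "\<forall>x. A x \<and> (\<forall>\<sigma>\<in>S. \<not> Z (\<sigma> x)) \<longrightarrow> P x" by (elim exE conjE)
    from FE[OF PQ(2)] obtain B T where B: "B \<in> F" "finite T" "T \<subseteq> H"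
      "\<forall>x. B x \<and> (\<forall>\<sigma>\<in>T. \<not> Z (\<sigma> x)) \<longrightarrow> Q x" by (elim exE conjE)
    show "(\<lambda>x. P x \<and> Q x) \<in> ?F"
      by (rule FI[OF Fc[OF A(1) B(1)], of "S \<union> T"]) (use A B in auto)
  next
    fix P Q assume P: "P \<in> ?F" and PQ: "\<forall>x. P x \<longrightarrow> Q x"
    from FE[OF P] obtain A S where A: "A \<in> F" "finite S" "S \<subseteq> H"
      "\<forall>x. A x \<and> (\<forall>\<sigma>\<in>S. \<not> Z (\<sigma> x)) \<longrightarrow> P x" by (elim exE conjE)
    show "Q \<in> ?F" by (rule FI[OF A(1-3)]) (use A(4) PQ in auto)
  next
    fix P \<tau> assume P: "P \<in> ?F" and \<tau>: "\<tau> \<in> H"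
    from FE[OF P] obtain A S where A: "A \<in> F" "finite S" "S \<subseteq> H"
      "\<forall>x. A x \<and> (\<forall>\<sigma>\<in>S. \<not> Z (\<sigma> x)) \<longrightarrow> P x" by (elim exE conjE)
    show "(\<lambda>x. P (\<tau> x)) \<in> ?F"
      by (rule FI[OF Fi[OF A(1) \<tau>], of "(\<lambda>\<sigma>. \<sigma> \<circ> \<tau>) ` S"]) (use A \<tau> comp in auto)
  qed
  moreover have "F \<subseteq> ?F"
  proof
    fix P assume "P \<in> F" then show "P \<in> ?F" by (rule FI[of _ "{}"]) simp_all
  qed
  ultimately have "?F = F" using max by blast
  moreover have "(\<lambda>x. \<not> Z x) \<in> ?F" by (rule FI[OF Ft, of "{id}"]) (use id in auto)
  ultimately show False using nZ by blast
qed

lemma invfilter_ball: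
  assumes "invfilter H F" "finite I" "\<And>i. i \<in> I \<Longrightarrow> P i \<in> F" shows "(\<lambda>x. \<forall>i\<in>I. P i x) \<in> F"
  using assms(2,3)
proof induction
  case empty then show ?case using assms(1) by (simp add: invfilter_def)
next
  case (insert i I)
  have "(\<lambda>x. P i x \<and> (\<forall>j\<in>I. P j x)) \<in> F"
    using insert by (intro invfilterD(3)[OF assms(1)]) auto
  then show ?case by simp
qed

text \<open>For the trivial group the translates of \<open>P\<close> are only \<open>P\<close>, so
  \<open>maximal_invfilter_cover\<close> says that a maximal filter decides every set.\<close>

lemma ultra_extend:
  assumes "\<And>B. finite B \<Longrightarrow> B \<subseteq> A \<Longrightarrow> \<exists>x. \<forall>P\<in>B. P x"
  shows "\<exists>U. ultra U \<and> (\<forall>P\<in>A. U P)"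
proof -
  let ?F0 = "{P. \<exists>B. finite B \<and> B \<subseteq> A \<and> (\<forall>x. (\<forall>Q\<in>B. Q x) \<longrightarrow> P x)}"
  have inv: "invfilter {id} ?F0" unfolding invfilter_def
  proof (intro conjI ballI allI impI)
    show "(\<lambda>x. True) \<in> ?F0" by blast
    show "(\<lambda>x. False) \<notin> ?F0" using assms by blast
  next
    fix P Q assume "P \<in> ?F0" "Q \<in> ?F0"
    then obtain B C where "finite B" "B \<subseteq> A" "\<forall>x. (\<forall>Q\<in>B. Q x) \<longrightarrow> P x"
      "finite C" "C \<subseteq> A" "\<forall>x. (\<forall>P\<in>C. P x) \<longrightarrow> Q x" by (simp only: mem_Collect_eq) (elim exE conjE)
    then show "(\<lambda>x. P x \<and> Q x) \<in> ?F0" by (intro CollectI exI[of _ "B \<union> C"]) auto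
  next
    fix P Q assume "P \<in> ?F0" and PQ: "\<forall>x. P x \<longrightarrow> Q x"
    then obtain B where "finite B" "B \<subseteq> A" "\<forall>x. (\<forall>Q\<in>B. Q x) \<longrightarrow> P x"
      by (simp only: mem_Collect_eq) (elim exE conjE)
    then show "Q \<in> ?F0" using PQ by (intro CollectI exI[of _ B]) simp
  next
    fix P and \<sigma> :: "'a \<Rightarrow> 'a" assume "P \<in> ?F0" "\<sigma> \<in> {id}"
    then show "(\<lambda>x. P (\<sigma> x)) \<in> ?F0" by simp
  qed
  from maximal_invfilter[OF inv] obtain F where F: "invfilter {id} F" "?F0 \<subseteq> F"
    and max: "\<forall>F'. invfilter {id} F' \<longrightarrow> F \<subseteq> F' \<longrightarrow> F' = F"
    by (elim exE conjE)
  note Ff = invfilterD(2)[OF F(1)] and Fc = invfilterD(3)[OF F(1)] and Fm = invfilterD(4)[OF F(1)]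
  have or: "(\<lambda>x. \<not> P x) \<in> F \<or> P \<in> F" for P
  proof -
    have "\<not> (\<lambda>x. \<not> P x) \<in> F \<Longrightarrow> \<exists>S. finite S \<and> S \<subseteq> {id} \<and> (\<lambda>x. \<exists>\<sigma>\<in>S. P (\<sigma> x)) \<in> F"
      using maximal_invfilter_cover[OF F(1) max, of P] by auto
    then show ?thesis using Fm[of _ P] by fastforce
  qed
  have "ultra (\<lambda>P. P \<in> F)"
    unfolding ultra_def
  proof (intro conjI allI)
    fix P Q show "((\<lambda>x. P x \<and> Q x) \<in> F) = (P \<in> F \<and> Q \<in> F)"
      using Fc Fm[of "\<lambda>x. P x \<and> Q x" P] Fm[of "\<lambda>x. P x \<and> Q x" Q] by blast
  next
    fix P show "((\<lambda>x. \<not> P x) \<in> F) = (P \<notin> F)"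
      using or Fc[of P "\<lambda>x. \<not> P x"] Ff by auto
  qed
  moreover have "P \<in> F" if "P \<in> A" for P
  proof -
    have "P \<in> ?F0" using that by (intro CollectI exI[of _ "{P}"]) simp
    then show ?thesis by (rule subsetD[OF F(2)])
  qed
  ultimately show ?thesis by (intro exI[of _ "\<lambda>P. P \<in> F"]) simp
qed

section \<open>The order property and the exchange of limits\<close>

definition no_order :: "('x \<Rightarrow> 'y \<Rightarrow> bool) \<Rightarrow> bool" where
  "no_order R \<longleftrightarrow> \<not> (\<exists>a b. \<forall>i j::nat. R (a i) (b j) \<longleftrightarrow> i < j) \<and>
     \<not> (\<exists>a b. \<forall>i j::nat. R (a i) (b j) \<longleftrightarrow> \<not> i < j)"

lemma no_orderD:
  assumes "no_order R"
  shows "\<not> (\<forall>i j::nat. R (a i) (b j) \<longleftrightarrow> i < j)" "\<not> (\<forall>i j::nat. R (a i) (b j) \<longleftrightarrow> \<not> i < j)"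
proof (rule_tac [!] notI)
  assume "\<forall>i j::nat. R (a i) (b j) \<longleftrightarrow> i < j"
  then have "\<exists>a b. \<forall>i j::nat. R (a i) (b j) \<longleftrightarrow> i < j" by (intro exI)
  then show False using assms unfolding no_order_def by (elim conjE notE)
next
  assume "\<forall>i j::nat. R (a i) (b j) \<longleftrightarrow> \<not> i < j"
  then have "\<exists>a b. \<forall>i j::nat. R (a i) (b j) \<longleftrightarrow> \<not> i < j" by (intro exI)
  then show False using assms unfolding no_order_def by (elim conjE notE)
qed

lemma no_orderI:
  assumes "\<And>a b. \<not> (\<forall>i j::nat. R (a i) (b j) \<longleftrightarrow> i < j)"
    and "\<And>a b. \<not> (\<forall>i j::nat. R (a i) (b j) \<longleftrightarrow> \<not> i < j)"
  shows "no_order R"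
  unfolding no_order_def using assms by (simp only: not_ex) simp

lemma no_order_comp:
  assumes "no_order R" shows "no_order (\<lambda>x y. R (f x) (g y))"
proof (rule no_orderI)
  fix a b
  show "\<not> (\<forall>i j::nat. R (f (a i)) (g (b j)) \<longleftrightarrow> i < j)"
    using no_orderD(1)[OF assms, of "\<lambda>i. f (a i)" "\<lambda>j. g (b j)"] .
  show "\<not> (\<forall>i j::nat. R (f (a i)) (g (b j)) \<longleftrightarrow> \<not> i < j)"
    using no_orderD(2)[OF assms, of "\<lambda>i. f (a i)" "\<lambda>j. g (b j)"] .
qed

text \<open>Negation exchanges the two patterns in \<open>no_order\<close>. Both are excluded there
  so that no sequence has to be reversed by compactness.\<close>

lemma no_order_neg:
  assumes "no_order R" shows "no_order (\<lambda>x y. \<not> R x y)"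
proof (rule no_orderI)
  fix a b
  have "(\<not> p) = q \<longleftrightarrow> p = (\<not> q)" for p q by blast
  then show "\<not> (\<forall>i j::nat. (\<not> R (a i) (b j)) = (i < j))" "\<not> (\<forall>i j::nat. (\<not> R (a i) (b j)) = (\<not> i < j))"
    using no_orderD[OF assms, of a b] by simp_all
qed

lemma choose_sequence:
  assumes "\<And>xs. \<exists>y. \<Phi> xs y"
  shows "\<exists>f :: nat \<Rightarrow> 'x. \<forall>n. \<Phi> (map f [0..<n]) (f n)"
proof -
  define c where "c xs = (SOME y. \<Phi> xs y)" for xs
  have c: "\<Phi> xs (c xs)" for xs unfolding c_def by (rule someI_ex[OF assms])
  define L where "L = rec_nat [] (\<lambda>_ xs. xs @ [c xs])"
  have L: "L 0 = []" "\<And>n. L (Suc n) = L n @ [c (L n)]" by (auto simp: L_def)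
  have Lm: "L n = map (\<lambda>i. c (L i)) [0..<n]" for n by (induction n) (auto simp: L)
  have "\<Phi> (map (\<lambda>i. c (L i)) [0..<n]) (c (L n))" for n unfolding Lm[symmetric] by (rule c)
  then show ?thesis by (intro exI[of _ "\<lambda>i. c (L i)"] allI)
qed

text \<open>Harrington's argument: if the two iterated limits differ, points can be chosen
  alternately so that each new y is related to all earlier x and each new x is unrelated to all y
  chosen so far. The result is a half graph.\<close>

lemma ultra_symmetric_imp:
  assumes U: "ultra U" and V: "ultra V" and R: "no_order R"
    and 1: "U (\<lambda>x. V (\<lambda>y. R x y))" and 2: "\<not> V (\<lambda>y. U (\<lambda>x. R x y))"
  shows False
proof -
  let ?X = "\<lambda>x. V (\<lambda>y. R x y)" and ?Y = "\<lambda>y. \<not> U (\<lambda>x. R x y)"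
  have 2: "V ?Y" using 2 ultra_not[OF V] by simp
  \<comment> \<open>The demands on the new pair hold only if the earlier pairs are good, which makes
    \<open>\<Phi>\<close> total as \<open>choose_sequence\<close> requires. Within a pair y is
    picked before x; this gives failure on the diagonal and hence the strict order.\<close>
  define \<Phi> where "\<Phi> ps q \<longleftrightarrow>
    (list_all (\<lambda>p. ?X (fst p) \<and> ?Y (snd p)) ps \<longrightarrow> ?X (fst q) \<and> ?Y (snd q) \<and>
      (\<forall>p\<in>set ps. \<not> R (fst q) (snd p)) \<and> (\<forall>p\<in>set ps. R (fst p) (snd q)) \<and> \<not> R (fst q) (snd q))"
    for ps q
  have "\<exists>q. \<Phi> ps q" for ps
  proof (cases "list_all (\<lambda>p. ?X (fst p) \<and> ?Y (snd p)) ps")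
    case True
    then have a: "\<forall>p\<in>set ps. ?X (fst p)" "\<forall>p\<in>set ps. ?Y (snd p)" by (auto simp: list_all_iff)
    have "V (\<lambda>y. ?Y y \<and> (\<forall>p\<in>set ps. R (fst p) y))"
      using a 2 by (simp only: ultra_conj[OF V] ultra_ball[OF V finite_set])
    then obtain y where y: "?Y y" "\<forall>p\<in>set ps. R (fst p) y" using ultra_ex[OF V] by blast
    have "U (\<lambda>x. ?X x \<and> (\<forall>p\<in>set ps. \<not> R x (snd p)) \<and> \<not> R x y)"
      using a 1 y(1) by (simp add: ultra_conj[OF U] ultra_ball[OF U finite_set] ultra_not[OF U])
    then obtain x where "?X x \<and> (\<forall>p\<in>set ps. \<not> R x (snd p)) \<and> \<not> R x y" using ultra_ex[OF U] by blast
    then show ?thesis using y by (intro exI[of _ "(x, y)"]) (simp add: \<Phi>_def)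
  qed (simp add: \<Phi>_def)
  from choose_sequence[of \<Phi>, OF this] obtain f where "\<forall>n. \<Phi> (map f [0..<n]) (f n)" by (elim exE)
  then have f: "\<Phi> (map f [0..<n]) (f n)" for n by simp
  have global_ext: "?X (fst (f n)) \<and> ?Y (snd (f n))" for n
  proof (induction n rule: less_induct)
    case (less n)
    then have "list_all (\<lambda>p. ?X (fst p) \<and> ?Y (snd p)) (map f [0..<n])" by (simp add: list_all_iff)
    then show ?case using f[of n] unfolding \<Phi>_def by blast
  qed
  have "(\<forall>i<n. \<not> R (fst (f n)) (snd (f i))) \<and> (\<forall>i<n. R (fst (f i)) (snd (f n))) \<and> \<not> R (fst (f n)) (snd (f n))" for n
  proof -
    have "list_all (\<lambda>p. ?X (fst p) \<and> ?Y (snd p)) (map f [0..<n])" using global_ext by (simp add: list_all_iff)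
    then show ?thesis using f[of n] unfolding \<Phi>_def by auto
  qed
  then have "R (fst (f i)) (snd (f j)) \<longleftrightarrow> i < j" for i j
    using linorder_less_linear[of i j] by (auto dest: order_less_asym)
  then have "\<forall>i j. R ((\<lambda>n. fst (f n)) i) ((\<lambda>n. snd (f n)) j) \<longleftrightarrow> i < j" by simp
  then show False using no_orderD(1)[OF R, of "\<lambda>n. fst (f n)" "\<lambda>n. snd (f n)"] by simp
qed

lemma ultra_symmetric:
  assumes U: "ultra U" and V: "ultra V" and R: "no_order R"
  shows "U (\<lambda>x. V (\<lambda>y. R x y)) = V (\<lambda>y. U (\<lambda>x. R x y))"
proof (rule iffI; rule ccontr)
  assume "U (\<lambda>x. V (\<lambda>y. R x y))" "\<not> V (\<lambda>y. U (\<lambda>x. R x y))"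
  then show False by (rule ultra_symmetric_imp[OF U V R])
next
  assume "V (\<lambda>y. U (\<lambda>x. R x y))" "\<not> U (\<lambda>x. V (\<lambda>y. R x y))"
  then have "U (\<lambda>x. V (\<lambda>y. \<not> R x y))" "\<not> V (\<lambda>y. U (\<lambda>x. \<not> R x y))"
    by (simp_all only: ultra_not[OF U] ultra_not[OF V] not_not simp_thms)
  then show False by (rule ultra_symmetric_imp[OF U V no_order_neg[OF R]])
qed

text \<open>If no finite set of instances sufficed, two ultrafilters on the other side would agree on
  all instances of R and differ on the U-definition, contrary to symmetry.\<close>

lemma ultra_finitely_determined:
  assumes U: "ultra U" and R: "no_order R"
  shows "\<exists>F. finite F \<and>
    (\<forall>y y'. (\<forall>x\<in>F. R x y = R x y') \<longrightarrow> U (\<lambda>x. R x y) = U (\<lambda>x. R x y'))"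
proof (rule ccontr)
  assume c: "\<not> ?thesis"
  define d where "d y = U (\<lambda>x. R x y)" for y
  define A where "A F y y' \<longleftrightarrow> (\<forall>x\<in>F. R x y = R x y')" for F y y'
  have sym: "A F y y' \<Longrightarrow> A F y' y" for F y y' by (auto simp: A_def)
  have "\<not> (\<exists>F. finite F \<and> (\<forall>y y'. A F y y' \<longrightarrow> d y = d y'))"
    using c unfolding d_def A_def .
  then have "\<forall>F. finite F \<longrightarrow> (\<exists>y y'. A F y y' \<and> d y \<noteq> d y')" by blast
  then have n: "\<exists>y y'. A F y y' \<and> d y \<and> \<not> d y'" if "finite F" for F
    using that sym by blast
  \<comment> \<open>Compactness is applied to pairs of points: one ultrafilter on pairs carries both
    competing ultrafilters as its two projections.\<close>
  define P where "P x p \<longleftrightarrow> R x (fst p) = R x (snd p) \<and> d (fst p) \<and> \<not> d (snd p)" for x p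
  have fip: "\<exists>p. \<forall>Q\<in>B. Q p" if B: "finite B" "B \<subseteq> range P" for B
  proof -
    obtain K where K: "finite K" "B = P ` K" using finite_subset_image[OF B] by blast
    obtain y y' where "A K y y'" "d y" "\<not> d y'" using n[OF K(1)] by blast
    then show ?thesis unfolding K(2) by (intro exI[of _ "(y, y')"]) (simp add: P_def A_def)
  qed
  have "\<exists>W. ultra W \<and> (\<forall>Q\<in>range P. W Q)" by (rule ultra_extend, rule fip)
  then obtain W where W: "ultra W" "\<forall>Q\<in>range P. W Q" by (elim exE conjE)
  have P: "W (\<lambda>p. R x (fst p) = R x (snd p)) \<and> W (\<lambda>p. d (fst p)) \<and> \<not> W (\<lambda>p. d (snd p))" for x
  proof -
    have "W (P x)" using W(2) by simp
    then show ?thesis unfolding P_def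
      by (simp only: ultra_conj[OF W(1)] ultra_not[OF W(1)] simp_thms)
  qed
  have "W (\<lambda>p. R x (fst p)) = W (\<lambda>p. R x (snd p))" for x
    using P[of x] by (simp only: ultra_iff[OF W(1)])
  then have "W (\<lambda>p. d (fst p)) = W (\<lambda>p. d (snd p))"
    using ultra_symmetric[OF U W(1) no_order_comp[OF R, of "\<lambda>x. x" fst]]
      ultra_symmetric[OF U W(1) no_order_comp[OF R, of "\<lambda>x. x" snd]] unfolding d_def by simp
  then show False using P by blast
qed

text \<open>Otherwise there is a full binary tree of instances of R.  Along countably many nodes each
  branch is definable from finitely many of countably many points, but there are too many branches.\<close>

lemma no_order_unsplittable:
  fixes R :: "'x \<Rightarrow> 'y \<Rightarrow> bool"
  assumes R: "no_order R" and X0: "Good X0" and ne: "\<And>Z. Good Z \<Longrightarrow> \<exists>x. Z x"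
  shows "\<exists>Z. Good Z \<and> (\<forall>b. \<not> (Good (\<lambda>x. Z x \<and> R x b) \<and> Good (\<lambda>x. Z x \<and> \<not> R x b)))"
proof (rule ccontr)
  assume c: "\<not> ?thesis"
  define sp where "sp Z b \<longleftrightarrow> Good (\<lambda>x. Z x \<and> R x b) \<and> Good (\<lambda>x. Z x \<and> \<not> R x b)" for Z b
  have "\<not> (\<exists>Z. Good Z \<and> (\<forall>b. \<not> sp Z b))" using c unfolding sp_def .
  then have "\<forall>Z. \<exists>b. Good Z \<longrightarrow> sp Z b" by blast
  from choice[OF this] obtain f where "\<forall>Z. Good Z \<longrightarrow> sp Z (f Z)" by (elim exE)
  then have f: "Good (\<lambda>x. Z x \<and> R x (f Z))" "Good (\<lambda>x. Z x \<and> \<not> R x (f Z))" if "Good Z" for Z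
    using that by (simp_all add: sp_def)
  \<comment> \<open>\<open>T s\<close> is the set at node \<open>s\<close> of the binary tree; the
    head of the list is the most recent decision, taken at the splitting point
    \<open>f (T s)\<close>.\<close>
  define T where "T = rec_list X0 (\<lambda>c s Z x. Z x \<and> R x (f Z) = c)"
  have T: "T [] = X0" "\<And>c s. T (c # s) = (\<lambda>x. T s x \<and> R x (f (T s)) = c)" by (simp_all add: T_def)
  have global_ext: "Good (T s)" for s
  proof (induction s)
    case (Cons c s) then show ?case using f[of "T s"] by (cases c) (auto simp: T)
  qed (simp add: T X0)
  define x where "x s = (SOME x. T s x)" for s
  have x: "T s (x s)" for s unfolding x_def using ne[OF global_ext] by (rule someI_ex)
  define y where "y s = f (T s)" for s
  define br :: "(nat \<Rightarrow> bool) \<Rightarrow> nat \<Rightarrow> bool list" where "br \<eta> = rec_nat [] (\<lambda>n s. \<eta> n # s)" for \<eta>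
  have br: "br \<eta> 0 = []" "br \<eta> (Suc n) = \<eta> n # br \<eta> n" for \<eta> n by (auto simp: br_def)
  have mono: "T (br \<eta> n) z \<Longrightarrow> m \<le> n \<Longrightarrow> T (br \<eta> m) z" for \<eta> m n z
    by (induction n) (auto simp: br T le_Suc_eq)
  \<comment> \<open>The relation is restricted to nodes, that is, to lists of booleans. Finite sets
    of nodes can then be coded in a countable type.\<close>
  have r: "no_order (\<lambda>t s. R (x t) (y s))" using R by (rule no_order_comp)
  have "\<exists>F H :: _ list. \<forall>n. \<eta> n \<longleftrightarrow> (\<exists>K\<in>set H. \<forall>t\<in>set F. t \<in> set K \<longleftrightarrow> R (x t) (y (br \<eta> n)))" for \<eta>
  proof -
    \<comment> \<open>An ultrafilter containing \<open>?A\<close> converges to the branch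
      \<open>\<eta>\<close>: almost all node points lie in every set along it. Its definition of
      \<open>R\<close> at \<open>br \<eta> n\<close> is then the decision \<open>\<eta> n\<close>,
      and finitely many instances determine it.\<close>
    let ?A = "range (\<lambda>n t. T (br \<eta> n) (x t))"
    have fip: "\<exists>t. \<forall>P\<in>B. P t" if B: "finite B" "B \<subseteq> ?A" for B
    proof -
      obtain K where K: "finite K" "B = (\<lambda>n t. T (br \<eta> n) (x t)) ` K"
        using finite_subset_image[OF B] by blast
      show ?thesis
      proof (cases "K = {}")
        case False
        then have "T (br \<eta> k) (x (br \<eta> (Max K)))" if "k \<in> K" for k
          using mono[OF x, of k] K(1) that by simp
        then show ?thesis using K(2) by auto
      qed (simp add: K)
    qed
    have "\<exists>U. ultra U \<and> (\<forall>P\<in>?A. U P)" by (rule ultra_extend, rule fip)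
    then obtain U where U: "ultra U" "\<forall>P\<in>?A. U P" by (elim exE conjE)
    from ultra_finitely_determined[OF U(1) r]
    obtain F where F: "finite F" "\<forall>s s'. (\<forall>t\<in>F. R (x t) (y s) = R (x t) (y s')) \<longrightarrow>
        U (\<lambda>t. R (x t) (y s)) = U (\<lambda>t. R (x t) (y s'))"
      by (elim exE conjE)
    have d: "U (\<lambda>t. R (x t) (y (br \<eta> n))) = \<eta> n" for n
    proof -
      have "U (\<lambda>t. T (br \<eta> (Suc n)) (x t))" using U(2) by blast
      then have "U (\<lambda>t. R (x t) (y (br \<eta> n)) = \<eta> n)"
        by (rule ultra_mono[OF U(1)]) (simp add: br T y_def)
      then show ?thesis by (simp add: ultra_iff[OF U(1)] ultra_const[OF U(1)])
    qed
    obtain F' where F': "set F' = F" using F(1) finite_list by blast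
    let ?P = "(\<lambda>s. {t\<in>F. R (x t) (y s)}) ` {s. U (\<lambda>t. R (x t) (y s))}"
    have "finite ?P" by (rule finite_subset[of _ "Pow F"]) (use F(1) in auto)
    from finite_list[OF this] obtain Ps where Ps: "set Ps = ?P" by (elim exE)
    define H where "H = map (\<lambda>K. SOME l. set l = K) Ps"
    have "set (SOME l. set l = K) = K" if K: "K \<in> ?P" for K
    proof -
      have "finite K" using K F(1) by auto
      from finite_list[OF this] show ?thesis by (rule someI_ex)
    qed
    then have H: "set ` set H = ?P" unfolding H_def Ps[symmetric] by (simp add: image_image)
    have "\<eta> n \<longleftrightarrow> (\<exists>K\<in>set H. \<forall>t\<in>set F'. t \<in> set K \<longleftrightarrow> R (x t) (y (br \<eta> n)))" for n
    proof
      assume "\<eta> n"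
      then have "{t\<in>F. R (x t) (y (br \<eta> n))} \<in> set ` set H" unfolding H using d by blast
      then show "\<exists>K\<in>set H. \<forall>t\<in>set F'. t \<in> set K \<longleftrightarrow> R (x t) (y (br \<eta> n))" unfolding F' by blast
    next
      assume "\<exists>K\<in>set H. \<forall>t\<in>set F'. t \<in> set K \<longleftrightarrow> R (x t) (y (br \<eta> n))"
      then obtain K where K: "K \<in> set H" "\<forall>t\<in>F. t \<in> set K \<longleftrightarrow> R (x t) (y (br \<eta> n))" unfolding F' by blast
      then have "set K \<in> ?P" using H by blast
      then obtain s where "set K = {t\<in>F. R (x t) (y s)}" "U (\<lambda>t. R (x t) (y s))" by blast
      then show "\<eta> n" using K(2) F(2)[rule_format, of s "br \<eta> n"] d by blast
    qed
    then show ?thesis by blast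
  qed
  then obtain F H :: "_ \<Rightarrow> _ list" where FH:
    "\<And>\<eta> n. \<eta> n \<longleftrightarrow> (\<exists>K\<in>set (H \<eta>). \<forall>t\<in>set (F \<eta>). t \<in> set K \<longleftrightarrow> R (x t) (y (br \<eta> n)))"
    by metis
  \<comment> \<open>The code yields \<open>\<eta> n\<close> from the node
    \<open>br \<eta> n\<close>, which depends only on earlier decisions; so equal codes give equal
    branches by induction. This would inject the subsets of the natural numbers into the natural
    numbers.\<close>
  have "inj (\<lambda>\<eta>. to_nat (F \<eta>, H \<eta>))"
  proof (rule injI)
    fix \<eta> \<eta>' assume "to_nat (F \<eta>, H \<eta>) = to_nat (F \<eta>', H \<eta>')"
    then have e: "F \<eta> = F \<eta>'" "H \<eta> = H \<eta>'" by auto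
    have s: "br \<eta> n = br \<eta>' n \<Longrightarrow> \<eta> n = \<eta>' n" for n using FH[of \<eta> n] FH[of \<eta>' n] e by simp
    have "br \<eta> n = br \<eta>' n" for n by (induction n) (auto simp: br s)
    then show "\<eta> = \<eta>'" using s by blast
  qed
  then have "inj ((\<lambda>\<eta>. to_nat (F \<eta>, H \<eta>)) \<circ> (\<lambda>A n. n \<in> A))"
    by (rule inj_compose) (auto simp: inj_def fun_eq_iff)
  then obtain g :: "nat \<Rightarrow> nat set" where "surj g" by (rule inj_imp_surj_inv[THEN that])
  then have "g ` UNIV = Pow UNIV" by simp
  then show False by (rule notE[OF Cantors_theorem exI])
qed

section \<open>Definable relations\<close>

primrec ren_tm :: "(nat \<Rightarrow> nat) \<Rightarrow> 'f tm \<Rightarrow> 'f tm" where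
  "ren_tm \<rho> (Var i) = Var (\<rho> i)"
| "ren_tm \<rho> (App f ts) = App f (map (ren_tm \<rho>) ts)"

text \<open>The renaming is an argument of the recursive result, so that the \<open>Exi\<close> case
  can lift it past the bound variable.\<close>

primrec ren_fm :: "('s, 'f, 'r) fm \<Rightarrow> (nat \<Rightarrow> nat) \<Rightarrow> ('s, 'f, 'r) fm" where
  "ren_fm (Eq t u) = (\<lambda>\<rho>. Eq (ren_tm \<rho> t) (ren_tm \<rho> u))"
| "ren_fm (Rel r ts) = (\<lambda>\<rho>. Rel r (map (ren_tm \<rho>) ts))"
| "ren_fm (Neg \<phi>) = (\<lambda>\<rho>. Neg (ren_fm \<phi> \<rho>))"
| "ren_fm (Conj \<phi> \<psi>) = (\<lambda>\<rho>. Conj (ren_fm \<phi> \<rho>) (ren_fm \<psi> \<rho>))"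
| "ren_fm (Exi s \<phi>) = (\<lambda>\<rho>. Exi s (ren_fm \<phi> (\<lambda>i. case i of 0 \<Rightarrow> 0 | Suc k \<Rightarrow> Suc (\<rho> k))))"

lemma ren_tm_correct:
  assumes "has_sort M ss t s" "\<And>i. i < length ss \<Longrightarrow> \<rho> i < length ss' \<and> ss' ! \<rho> i = ss ! i \<and> as' ! \<rho> i = as ! i"
  shows "has_sort M ss' (ren_tm \<rho> t) s \<and> eval_tm M as' (ren_tm \<rho> t) = eval_tm M as t"
  using assms(1)
proof induction
  case (1 i)
  then show ?case using assms(2)[of i] has_sort.intros(1)[of "\<rho> i" ss' M] by simp
next
  case (2 f ts)
  have "list_all2 (has_sort M ss') (map (ren_tm \<rho>) ts) (fargs M f)"
    using 2(2) by (simp add: list_all2_conv_all_nth)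
  moreover have e: "map (eval_tm M as') (map (ren_tm \<rho>) ts) = map (eval_tm M as) ts"
    using 2(2) by (auto simp: list_all2_conv_all_nth in_set_conv_nth)
  ultimately show ?case using has_sort.intros(2)[OF 2(1), of ss' "map (ren_tm \<rho>) ts"]
    by (simp only: ren_tm.simps eval_tm.simps e simp_thms)
qed

lemma ren_fm_correct:
  assumes "wf_fm M ss \<phi>" "\<And>i. i < length ss \<Longrightarrow> \<rho> i < length ss' \<and> ss' ! \<rho> i = ss ! i \<and> as' ! \<rho> i = as ! i"
  shows "wf_fm M ss' (ren_fm \<phi> \<rho>) \<and> sat M as' (ren_fm \<phi> \<rho>) = sat M as \<phi>"
  using assms
proof (induction \<phi> arbitrary: ss ss' as as' \<rho>)
  case (Eq t u)
  then obtain s where "has_sort M ss t s" "has_sort M ss u s" by auto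
  with ren_tm_correct[OF this(1) Eq(2)] ren_tm_correct[OF this(2) Eq(2)] show ?case by auto
next
  case (Rel r ts)
  have c: "has_sort M ss t s \<Longrightarrow> has_sort M ss' (ren_tm \<rho> t) s \<and> eval_tm M as' (ren_tm \<rho> t) = eval_tm M as t" for t s
    by (rule ren_tm_correct) (assumption, rule Rel(2))
  have "list_all2 (has_sort M ss') (map (ren_tm \<rho>) ts) (rargs M r)"
    using Rel(1) c by (simp add: list_all2_conv_all_nth)
  moreover have e: "map (eval_tm M as') (map (ren_tm \<rho>) ts) = map (eval_tm M as) ts"
    using Rel(1) c[THEN conjunct2] by (intro nth_equalityI) (auto simp: list_all2_conv_all_nth)
  ultimately show ?case by (simp only: ren_fm.simps sat.simps wf_fm.simps e simp_thms)
next
  case (Neg \<phi>)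
  show ?case using Neg.IH[OF Neg.prems(1)[unfolded wf_fm.simps] Neg.prems(2)] by simp
next
  case (Conj \<phi> \<psi>)
  have "wf_fm M ss \<phi>" "wf_fm M ss \<psi>" using Conj.prems(1) by simp_all
  from Conj.IH(1)[OF this(1) Conj.prems(2)] Conj.IH(2)[OF this(2) Conj.prems(2)] show ?case by simp
next
  case (Exi s \<phi>)
  let ?\<rho> = "\<lambda>i. case i of 0 \<Rightarrow> 0 | Suc k \<Rightarrow> Suc (\<rho> k)"
  have "wf_fm M (s # ss') (ren_fm \<phi> ?\<rho>) \<and> sat M (x # as') (ren_fm \<phi> ?\<rho>) = sat M (x # as) \<phi>" for x
  proof (rule Exi.IH)
    show "wf_fm M (s # ss) \<phi>" using Exi.prems(1) by simp
    fix i assume "i < length (s # ss)"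
    then show "?\<rho> i < length (s # ss') \<and> (s # ss') ! ?\<rho> i = (s # ss) ! i \<and> (x # as') ! ?\<rho> i = (x # as) ! i"
      using Exi.prems(2)[of "i - 1"] by (cases i) simp_all
  qed
  then show ?case using Exi.prems(1) by simp
qed

lemma wf_exs: "wf_fm M ss ((Exi s ^^ n) \<phi>) \<longleftrightarrow> (n = 0 \<or> s \<in> sorts M) \<and> wf_fm M (replicate n s @ ss) \<phi>"
proof (induction n arbitrary: ss)
  case (Suc n)
  show ?case using Suc[of "s # ss"] by (auto simp: replicate_app_Cons_same)
qed simp

lemma sat_exs: "sat M as ((Exi s ^^ n) \<phi>) \<longleftrightarrow>
    (\<exists>bs. length bs = n \<and> set bs \<subseteq> univ M s \<and> sat M (bs @ as) \<phi>)"
proof (induction n arbitrary: as)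
  case (Suc n)
  have "sat M as ((Exi s ^^ Suc n) \<phi>) \<longleftrightarrow>
      (\<exists>x\<in>univ M s. \<exists>bs. length bs = n \<and> set bs \<subseteq> univ M s \<and> sat M (bs @ x # as) \<phi>)"
    using Suc by simp
  also have "\<dots> \<longleftrightarrow> (\<exists>bs. length bs = Suc n \<and> set bs \<subseteq> univ M s \<and> sat M (bs @ as) \<phi>)" (is "?l = ?r")
  proof
    assume ?l
    then obtain x bs where "x \<in> univ M s" "length bs = n" "set bs \<subseteq> univ M s" "sat M (bs @ x # as) \<phi>" by blast
    then show ?r by (intro exI[of _ "bs @ [x]"]) auto
  next
    assume ?r
    then obtain bs where bs: "length bs = Suc n" "set bs \<subseteq> univ M s" "sat M (bs @ as) \<phi>" by blast
    then obtain cs x where "bs = cs @ [x]" by (metis length_Suc_conv_rev)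
    then show ?l using bs by (intro bexI[of _ x] exI[of _ cs]) auto
  qed
  finally show ?case .
qed simp

lemma ex_unit_fun: "(\<exists>u::unit \<Rightarrow> 'a. P (u ())) = (\<exists>x. P x)"
proof
  assume "\<exists>x. P x"
  then obtain x where "P x" by (elim exE)
  then show "\<exists>u::unit \<Rightarrow> 'a. P (u ())" by (intro exI[of _ "\<lambda>_. x"])
qed (elim exE, rule exI)

text \<open>A tuple is a function from an arbitrary index type, of which a formula uses only finitely
  many coordinates.  This makes substitution of variables the composition with a map of index types.\<close>

locale one_sorted =
  fixes G :: "(unit, 'f, 'r, 'a) struct"
  assumes univ_G: "univ G () = UNIV" and sorts_G: "sorts G = {()}"
begin

abbreviation wff :: "nat \<Rightarrow> (unit, 'f, 'r) fm \<Rightarrow> bool" where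
  "wff n \<equiv> wf_fm G (replicate n ())"

lemma unit_list: "(ss :: unit list) = replicate (length ss) ()"
  by (simp add: replicate_length_same[symmetric])

lemma tuples_G [simp]: "as \<in> tuples G ss \<longleftrightarrow> length as = length ss"
  by (simp add: tuples_def list_all2_conv_all_nth univ_G)

section \<open>Predicates and functions definable without parameters\<close>

definition def0 :: "(('i \<Rightarrow> 'a) \<Rightarrow> bool) \<Rightarrow> bool" where
  "def0 P \<longleftrightarrow> (\<exists>xs \<phi>. wff (length xs) \<phi> \<and> (\<forall>v. P v = sat G (map v xs) \<phi>))"

lemma def0I: "wff (length xs) \<phi> \<Longrightarrow> (\<And>v. P v = sat G (map v xs) \<phi>) \<Longrightarrow> def0 P"
  unfolding def0_def by (intro exI[of _ xs] exI[of _ \<phi>]) simp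

text \<open>Lets several formulas be brought into one common context, and lets a caller choose the
  order of the variables.\<close>

lemma def0_formula:
  assumes "def0 P"
  shows "\<exists>xs. \<forall>ys. set xs \<subseteq> set ys \<longrightarrow> (\<exists>\<phi>. wff (length ys) \<phi> \<and> (\<forall>v. P v = sat G (map v ys) \<phi>))"
proof -
  obtain xs \<phi> where x: "wff (length xs) \<phi>" "\<forall>v. P v = sat G (map v xs) \<phi>"
    using assms unfolding def0_def by (elim exE conjE)
  have "\<exists>\<phi>. wff (length ys) \<phi> \<and> (\<forall>v. P v = sat G (map v ys) \<phi>)" if ys: "set xs \<subseteq> set ys" for ys
  proof -
    have "\<forall>i. \<exists>k. i < length xs \<longrightarrow> k < length ys \<and> ys ! k = xs ! i"
      using ys by (metis in_set_conv_nth subsetD)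
    from choice[OF this] obtain \<rho> where \<rho>: "\<forall>i. i < length xs \<longrightarrow> \<rho> i < length ys \<and> ys ! \<rho> i = xs ! i"
      by (elim exE)
    have "wff (length ys) (ren_fm \<phi> \<rho>) \<and> sat G (map v ys) (ren_fm \<phi> \<rho>) = sat G (map v xs) \<phi>" for v
      using x(1) \<rho> by (intro ren_fm_correct[of G "replicate (length xs) ()"]) auto
    then show ?thesis using x(2) by (intro exI[of _ "ren_fm \<phi> \<rho>"]) simp
  qed
  then show ?thesis by (intro exI[of _ xs] allI impI)
qed

lemma def0_finite_support:
  assumes "def0 P"
  shows "\<exists>X. finite X \<and> (\<forall>v v'. (\<forall>i\<in>X. v i = v' i) \<longrightarrow> P v = P v')"
proof -
  obtain xs \<phi> where x: "\<forall>v. P v = sat G (map v xs) \<phi>"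
    using assms unfolding def0_def by (elim exE conjE)
  have "P v = P v'" if "\<forall>i\<in>set xs. v i = v' i" for v v'
    using x that by (metis map_cong)
  then show ?thesis by (intro exI[of _ "set xs"]) simp
qed

lemma def0_not: "def0 P \<Longrightarrow> def0 (\<lambda>v. \<not> P v)"
proof -
  assume "def0 P"
  then obtain xs \<phi> where x: "wff (length xs) \<phi>" "\<forall>v. P v = sat G (map v xs) \<phi>"
    unfolding def0_def by (elim exE conjE)
  then show ?thesis by (intro def0I[of xs "Neg \<phi>"]) simp_all
qed

lemma def0_conj: "def0 P \<Longrightarrow> def0 Q \<Longrightarrow> def0 (\<lambda>v. P v \<and> Q v)"
proof -
  assume "def0 P" "def0 Q"
  from def0_formula[OF this(1)] def0_formula[OF this(2)] obtain xs xs' where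
    "\<forall>ys. set xs \<subseteq> set ys \<longrightarrow> (\<exists>\<phi>. wff (length ys) \<phi> \<and> (\<forall>v. P v = sat G (map v ys) \<phi>))"
    "\<forall>ys. set xs' \<subseteq> set ys \<longrightarrow> (\<exists>\<phi>. wff (length ys) \<phi> \<and> (\<forall>v. Q v = sat G (map v ys) \<phi>))" by (elim exE)
  from this[rule_format, of "xs @ xs'"] obtain \<phi> \<psi> where
    "wff (length (xs @ xs')) \<phi>" "\<forall>v. P v = sat G (map v (xs @ xs')) \<phi>"
    "wff (length (xs @ xs')) \<psi>" "\<forall>v. Q v = sat G (map v (xs @ xs')) \<psi>" by auto
  then show ?thesis by (intro def0I[of "xs @ xs'" "Conj \<phi> \<psi>"]) simp_all
qed

lemma def0_const: "def0 (\<lambda>v. c)"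
proof -
  have "has_sort G [()] (Var 0) ()" using has_sort.intros(1)[of 0 "[()]" G] by simp
  then have t: "wff 0 (Exi () (Eq (Var 0) (Var 0)))" by (auto simp: sorts_G)
  show ?thesis
  proof (cases c)
    case True then show ?thesis using t by (intro def0I[of "[]" "Exi () (Eq (Var 0) (Var 0))"]) (auto simp: univ_G)
  next
    case False then show ?thesis using t by (intro def0I[of "[]" "Neg (Exi () (Eq (Var 0) (Var 0)))"]) (auto simp: univ_G)
  qed
qed

lemma def0_reindex:
  assumes "def0 Q" "\<And>w k. h w k = w (g k)" shows "def0 (\<lambda>w. Q (h w))"
proof -
  have h: "h w = w \<circ> g" for w using assms(2) by auto
  obtain xs \<phi> where x: "wff (length xs) \<phi>" "\<forall>v. Q v = sat G (map v xs) \<phi>"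
    using assms(1) unfolding def0_def by (elim exE conjE)
  then show ?thesis by (intro def0I[of "map g xs" \<phi>]) (simp_all add: h comp_assoc)
qed

text \<open>Quantifying over a possibly infinite tuple is first-order, because only the finitely
  many coordinates that occur in the formula have to be quantified; a witness is arbitrary
  elsewhere.\<close>

lemma def0_ex:
  assumes "def0 (\<lambda>w :: 'i + 'j \<Rightarrow> 'a. P (\<lambda>i. w (Inl i)) (\<lambda>j. w (Inr j)))"
  shows "def0 (\<lambda>v. \<exists>u. P v u)"
proof -
  from def0_formula[OF assms] obtain xs where xs:
    "\<forall>ys. set xs \<subseteq> set ys \<longrightarrow> (\<exists>\<phi>. wff (length ys) \<phi> \<and>
      (\<forall>w. P (\<lambda>i. w (Inl i)) (\<lambda>j. w (Inr j)) = sat G (map w ys) \<phi>))" by (elim exE)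
  have "finite {j. Inr j \<in> set xs}" "finite {i. Inl i \<in> set xs}"
    using finite_vimageI[of "set xs" Inr] finite_vimageI[of "set xs" Inl] by (auto simp: vimage_def)
  then obtain js "is" where l: "set js = {j. Inr j \<in> set xs}" "distinct js" "set is = {i. Inl i \<in> set xs}"
    by (metis finite_distinct_list)
  let ?ys = "map Inr js @ map Inl is"
  have "set xs \<subseteq> set ?ys"
  proof
    fix x assume m: "x \<in> set xs"
    show "x \<in> set ?ys" by (cases x) (use m in \<open>auto simp: l\<close>)
  qed
  with xs obtain \<phi> where \<phi>: "wff (length ?ys) \<phi>"
    "\<forall>w. P (\<lambda>i. w (Inl i)) (\<lambda>j. w (Inr j)) = sat G (map w ?ys) \<phi>" by blast
  have P: "P v u = sat G (map u js @ map v is) \<phi>" for v u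
    using \<phi>(2)[rule_format, of "case_sum v u"] by (simp add: comp_def)
  have ex: "(\<exists>u. P v u) = (\<exists>bs. length bs = length js \<and> sat G (bs @ map v is) \<phi>)" for v
  proof
    assume "\<exists>u. P v u" then show "\<exists>bs. length bs = length js \<and> sat G (bs @ map v is) \<phi>"
      unfolding P by (metis length_map)
  next
    assume "\<exists>bs. length bs = length js \<and> sat G (bs @ map v is) \<phi>"
    then obtain bs where bs: "length bs = length js" "sat G (bs @ map v is) \<phi>" by blast
    have "map (\<lambda>j. the (map_of (zip js bs) j)) js = bs"
      using bs(1) l(2) by (intro nth_equalityI) (simp_all add: map_of_zip_nth)
    then show "\<exists>u. P v u" unfolding P using bs(2) by metis
  qed
  show ?thesis
  proof (rule def0I[of "is" "(Exi () ^^ length js) \<phi>"])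
    show "wff (length is) ((Exi () ^^ length js) \<phi>)"
      using \<phi>(1) by (simp add: wf_exs sorts_G replicate_add)
    show "(\<exists>u. P v u) = sat G (map v is) ((Exi () ^^ length js) \<phi>)" for v
      by (simp add: ex sat_exs univ_G)
  qed
qed

lemma def0_disj: "def0 P \<Longrightarrow> def0 Q \<Longrightarrow> def0 (\<lambda>v. P v \<or> Q v)"
proof -
  assume PQ: "def0 P" "def0 Q"
  have e: "(P v \<or> Q v) = (\<not> (\<not> P v \<and> \<not> Q v))" for v by blast
  show ?thesis unfolding e by (intro def0_not def0_conj PQ)
qed

lemma def0_imp: "def0 P \<Longrightarrow> def0 Q \<Longrightarrow> def0 (\<lambda>v. P v \<longrightarrow> Q v)"
  unfolding imp_conv_disj by (intro def0_disj def0_not)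

lemma def0_iff: "def0 P \<Longrightarrow> def0 Q \<Longrightarrow> def0 (\<lambda>v. P v = Q v)"
  unfolding iff_conv_conj_imp[of "P _"] by (intro def0_conj def0_imp)

lemma def0_all:
  assumes "def0 (\<lambda>w :: 'i + 'j \<Rightarrow> 'a. P (\<lambda>i. w (Inl i)) (\<lambda>j. w (Inr j)))"
  shows "def0 (\<lambda>v. \<forall>u. P v u)"
proof -
  have e: "(\<forall>u. P v u) = (\<not> (\<exists>u. \<not> P v u))" for v by blast
  show ?thesis unfolding e by (intro def0_not def0_ex assms)
qed

lemma def0_ball: "finite I \<Longrightarrow> (\<And>i. i \<in> I \<Longrightarrow> def0 (P i)) \<Longrightarrow> def0 (\<lambda>v. \<forall>i\<in>I. P i v)"
  by (induction rule: finite_induct) (simp_all add: def0_const def0_conj)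

text \<open>A function is treated through its graph, with the value at \<open>None\<close>.
  Functions that are no terms of the language, such as subtraction, are thereby covered.\<close>

definition dfun :: "(('i \<Rightarrow> 'a) \<Rightarrow> 'a) \<Rightarrow> bool" where
  "dfun F \<longleftrightarrow> def0 (\<lambda>w. w None = F (\<lambda>i. w (Some i)))"

lemma def0_var_eq: "def0 (\<lambda>w. w i = w j)"
proof -
  have "has_sort G [(), ()] (Var 0) ()" "has_sort G [(), ()] (Var 1) ()"
    using has_sort.intros(1)[of 0 "[(), ()]" G] has_sort.intros(1)[of 1 "[(), ()]" G] by simp_all
  then show ?thesis by (intro def0I[of "[i, j]" "Eq (Var 0) (Var 1)"]) (auto simp: numeral_2_eq_2)
qed

lemma dfun_var: "dfun (\<lambda>v. v i)"
  unfolding dfun_def by (rule def0_var_eq)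

text \<open>Infinitely many functions may be substituted at once: \<open>P\<close> has finite
  support, so it is enough to tie finitely many coordinates of an auxiliary tuple to their intended
  values.\<close>

lemma def0_subst:
  assumes P: "def0 P" and F: "\<And>i. dfun (F i)"
  shows "def0 (\<lambda>v. P (\<lambda>i. F i v))"
proof -
  obtain X where X: "finite X" "\<forall>v v'. (\<forall>i\<in>X. v i = v' i) \<longrightarrow> P v = P v'"
    using def0_finite_support[OF P] by (elim exE conjE)
  have 1: "def0 (\<lambda>w. w (Inr i) = F i (\<lambda>j. w (Inl j)))" for i
    using def0_reindex[OF F[unfolded dfun_def] refl, of "\<lambda>k. case k of None \<Rightarrow> Inr i | Some j \<Rightarrow> Inl j"]
    by simp
  have 2: "def0 (\<lambda>w. P (\<lambda>i. w (Inr i)))" by (rule def0_reindex[OF P refl])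
  have "def0 (\<lambda>v. \<exists>u. (\<forall>i\<in>X. u i = F i v) \<and> P u)"
    by (intro def0_ex def0_conj def0_ball X 1 2)
  moreover have "(\<exists>u. (\<forall>i\<in>X. u i = F i v) \<and> P u) = P (\<lambda>i. F i v)" for v
  proof
    assume "\<exists>u. (\<forall>i\<in>X. u i = F i v) \<and> P u"
    then obtain u where "\<forall>i\<in>X. u i = F i v" "P u" by (elim exE conjE)
    then show "P (\<lambda>i. F i v)" using X(2)[rule_format, of u "\<lambda>i. F i v"] by simp
  next
    assume "P (\<lambda>i. F i v)" then show "\<exists>u. (\<forall>i\<in>X. u i = F i v) \<and> P u"
      by (intro exI[of _ "\<lambda>i. F i v"]) simp
  qed
  ultimately show ?thesis by (simp only:)
qed

lemma dfun_reindex: "dfun F \<Longrightarrow> dfun (\<lambda>w. F (\<lambda>i. w (g i)))"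
  unfolding dfun_def
  using def0_reindex[OF _ refl, of "\<lambda>w. w None = F (\<lambda>i. w (Some i))" "map_option g"] by simp

lemma dfun_subst:
  assumes "dfun F" "\<And>i. dfun (H i)" shows "dfun (\<lambda>v. F (\<lambda>i. H i v))"
proof -
  have "def0 (\<lambda>w. (\<lambda>w. w None = F (\<lambda>i. w (Some i)))
      (\<lambda>k. (case k of None \<Rightarrow> (\<lambda>w. w None) | Some i \<Rightarrow> (\<lambda>w. H i (\<lambda>j. w (Some j)))) w))"
    using assms(1) unfolding dfun_def
    by (rule def0_subst) (auto split: option.split intro: dfun_var dfun_reindex assms(2))
  then show ?thesis by (simp add: dfun_def)
qed

lemma def0_eq: "dfun F \<Longrightarrow> dfun H \<Longrightarrow> def0 (\<lambda>v. F v = H v)"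
  using def0_subst[OF def0_var_eq[of True False], of "\<lambda>b. if b then F else H"] by simp

lemma dfun_fint:
  assumes "length Fs = length (fargs G f)" "\<And>F. F \<in> set Fs \<Longrightarrow> dfun F"
  shows "dfun (\<lambda>v. fint G f (map (\<lambda>F. F v) Fs))"
proof -
  let ?n = "length Fs" and ?xs = "None # map Some [0..<length Fs]"
  have v: "has_sort G (replicate m ()) (Var i) ()" if "i < m" for i m
    using has_sort.intros(1)[of i "replicate m ()" G] that by simp
  have "has_sort G (replicate (Suc ?n) ()) (App f (map (\<lambda>i. Var (Suc i)) [0..<?n])) (fres G f)"
    using assms(1) v[of "Suc _" "Suc ?n"]
    by (intro has_sort.intros) (auto simp: sorts_G list_all2_conv_all_nth simp del: replicate_Suc)
  moreover have e: "map ((!) (map (\<lambda>i. w (Some i)) [0..<?n])) [0..<?n] = map (\<lambda>i. w (Some i)) [0..<?n]"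
    for w :: "nat option \<Rightarrow> 'a"
    using map_nth[of "map (\<lambda>i. w (Some i)) [0..<?n]"] by simp
  ultimately have "def0 (\<lambda>w. w None = fint G f (map (\<lambda>i. w (Some i)) [0..<?n]))"
    using v[of 0 "Suc ?n"]
    by (intro def0I[of ?xs "Eq (Var 0) (App f (map (\<lambda>i. Var (Suc i)) [0..<?n]))"])
      (simp_all add: comp_def e)
  then have "dfun (\<lambda>v::nat \<Rightarrow> 'a. fint G f (map v [0..<?n]))" unfolding dfun_def by (simp add: comp_def)
  \<comment> \<open>The index type is all of nat, so positions beyond the argument list are filled
    with an arbitrary definable function; they never occur.\<close>
  then have "dfun (\<lambda>v. fint G f (map (\<lambda>i. (if i < ?n then Fs ! i else (\<lambda>v. v undefined)) v) [0..<?n]))"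
    by (rule dfun_subst) (auto intro: assms(2) dfun_var)
  moreover have "map (\<lambda>i. (if i < ?n then Fs ! i else (\<lambda>v. v undefined)) v) [0..<?n] = map (\<lambda>F. F v) Fs" for v
    by (rule nth_equalityI) auto
  ultimately show ?thesis by simp
qed

lemma def0_rint:
  assumes "length Fs = length (rargs G r)" "\<And>F. F \<in> set Fs \<Longrightarrow> dfun F"
  shows "def0 (\<lambda>v. rint G r (map (\<lambda>F. F v) Fs))"
proof -
  let ?n = "length Fs"
  have v: "has_sort G (replicate m ()) (Var i) ()" if "i < m" for i m
    using has_sort.intros(1)[of i "replicate m ()" G] that by simp
  have "def0 (\<lambda>v::nat \<Rightarrow> 'a. rint G r (map v [0..<?n]))"
    using v assms(1)
    by (intro def0I[of "[0..<?n]" "Rel r (map Var [0..<?n])"])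
      (auto simp: list_all2_conv_all_nth intro!: arg_cong[of _ _ "rint G r"] nth_equalityI)
  then have "def0 (\<lambda>v. rint G r (map (\<lambda>i. (if i < ?n then Fs ! i else (\<lambda>v. v undefined)) v) [0..<?n]))"
    by (rule def0_subst) (auto intro: assms(2) dfun_var)
  moreover have "map (\<lambda>i. (if i < ?n then Fs ! i else (\<lambda>v. v undefined)) v) [0..<?n] = map (\<lambda>F. F v) Fs" for v
    by (rule nth_equalityI) auto
  ultimately show ?thesis by simp
qed

text \<open>Parameters are variables that are named by themselves.\<close>

definition dfn :: "(('i \<Rightarrow> 'a) \<Rightarrow> bool) \<Rightarrow> bool" where
  "dfn P \<longleftrightarrow> (\<exists>Q :: ('i + 'a \<Rightarrow> 'a) \<Rightarrow> bool. def0 Q \<and> P = (\<lambda>v. Q (case_sum v id)))"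

text \<open>Any assignment \<open>c\<close> of parameters reduces to parameters named by themselves:
  rename the variable j to the variable \<open>c j\<close>.\<close>

lemma dfnI: "def0 Q \<Longrightarrow> dfn (\<lambda>v. Q (case_sum v c))"
proof -
  assume Q: "def0 Q"
  have e: "(\<lambda>k. case_sum v id (map_sum id c k)) = case_sum v c" for v
    by (rule ext) (simp split: sum.split)
  have "def0 (\<lambda>w. Q (\<lambda>k. w (map_sum id c k)))" by (rule def0_reindex[OF Q refl])
  then show ?thesis unfolding dfn_def
    by (intro exI[of _ "\<lambda>w. Q (\<lambda>k. w (map_sum id c k))"] conjI) (simp_all only: e)
qed

lemma dfnE:
  assumes "dfn P" obtains Q :: "('i + 'a \<Rightarrow> 'a) \<Rightarrow> bool" where "def0 Q" "P = (\<lambda>v. Q (case_sum v id))"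
  using assms unfolding dfn_def by (elim exE conjE)

lemma def0_dfn:
  assumes "def0 P" shows "dfn P"
  using dfnI[OF def0_reindex[OF assms refl, of Inl]] by simp

lemma dfn_not: "dfn P \<Longrightarrow> dfn (\<lambda>v. \<not> P v)"
proof -
  assume "dfn P"
  then obtain Q where Q: "def0 Q" "P = (\<lambda>v. Q (case_sum v id))" by (rule dfnE)
  show ?thesis using dfnI[OF def0_not[OF Q(1)]] by (simp only: Q(2))
qed

lemma dfn_conj: "dfn P \<Longrightarrow> dfn Q \<Longrightarrow> dfn (\<lambda>v. P v \<and> Q v)"
proof -
  assume P: "dfn P" "dfn Q"
  obtain P' where P': "def0 P'" "P = (\<lambda>v. P' (case_sum v id))" using P(1) by (rule dfnE)
  obtain Q' where Q': "def0 Q'" "Q = (\<lambda>v. Q' (case_sum v id))" using P(2) by (rule dfnE)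
  show ?thesis using dfnI[OF def0_conj[OF P'(1) Q'(1)]] by (simp only: P'(2) Q'(2))
qed

lemma dfn_const: "dfn (\<lambda>v. c)"
  by (intro def0_dfn def0_const)

lemma dfn_disj: "dfn P \<Longrightarrow> dfn Q \<Longrightarrow> dfn (\<lambda>v. P v \<or> Q v)"
proof -
  assume PQ: "dfn P" "dfn Q"
  have e: "(P v \<or> Q v) = (\<not> (\<not> P v \<and> \<not> Q v))" for v by blast
  show ?thesis unfolding e by (intro dfn_not dfn_conj PQ)
qed

lemma dfn_ball: "finite I \<Longrightarrow> (\<And>i. i \<in> I \<Longrightarrow> dfn (P i)) \<Longrightarrow> dfn (\<lambda>v. \<forall>i\<in>I. P i v)"
  by (induction rule: finite_induct) (simp_all add: dfn_const dfn_conj)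

lemma dfn_bex: "finite I \<Longrightarrow> (\<And>i. i \<in> I \<Longrightarrow> dfn (P i)) \<Longrightarrow> dfn (\<lambda>v. \<exists>i\<in>I. P i v)"
  by (induction rule: finite_induct) (simp_all add: dfn_const dfn_disj)

lemma dfn_subst:
  assumes "dfn P" "\<And>i. dfun (F i)" shows "dfn (\<lambda>v. P (\<lambda>i. F i v))"
proof -
  obtain Q where Q: "def0 Q" "P = (\<lambda>v. Q (case_sum v id))" using assms(1) by (rule dfnE)
  have "def0 (\<lambda>w. Q (\<lambda>k. (case k of Inl i \<Rightarrow> (\<lambda>w. F i (\<lambda>j. w (Inl j))) | Inr a \<Rightarrow> (\<lambda>w. w (Inr a))) w))"
    by (rule def0_subst[OF Q(1)]) (auto split: sum.split intro: dfun_reindex assms(2) dfun_var)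
  moreover have "(\<lambda>k. (case k of Inl i \<Rightarrow> (\<lambda>w. F i (\<lambda>j. w (Inl j))) | Inr a \<Rightarrow> (\<lambda>w. w (Inr a)))
      (case_sum v id)) = case_sum (\<lambda>i. F i v) id" for v
    by (rule ext) (simp split: sum.split)
  ultimately show ?thesis using dfnI[of "\<lambda>w. Q (\<lambda>k. (case k of Inl i \<Rightarrow> (\<lambda>w. F i (\<lambda>j. w (Inl j)))
      | Inr a \<Rightarrow> (\<lambda>w. w (Inr a))) w)" id] by (simp only: Q(2))
qed

lemma dfn_param:
  assumes "dfn (\<lambda>w :: 'i + 'j \<Rightarrow> 'a. P (\<lambda>i. w (Inl i)) (\<lambda>j. w (Inr j)))"
  shows "dfn (\<lambda>v. P v c)"
proof -
  obtain Q where Q: "def0 Q" "(\<lambda>w. P (\<lambda>i. w (Inl i)) (\<lambda>j. w (Inr j))) = (\<lambda>v. Q (case_sum v id))"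
    using assms by (rule dfnE)
  have P: "P v u = Q (case_sum (case_sum v u) id)" for v u
    using fun_cong[OF Q(2), of "case_sum v u"] by simp
  have "def0 (\<lambda>w. Q (\<lambda>k. w (case k of Inl (Inl i) \<Rightarrow> Inl i | Inl (Inr j) \<Rightarrow> Inr (c j) | Inr a \<Rightarrow> Inr a)))"
    by (rule def0_reindex[OF Q(1) refl])
  from dfnI[OF this, of id] show ?thesis unfolding P
    by (rule back_subst[of dfn]) (rule ext, rule arg_cong[of _ _ Q], rule ext, simp split: sum.split)
qed

lemma dfn_param1:
  assumes "dfn (\<lambda>w :: 'i option \<Rightarrow> 'a. P (w None) (\<lambda>j. w (Some j)))"
  shows "dfn (\<lambda>v. P c v)"
proof -
  have "dfn (\<lambda>w :: 'i + unit \<Rightarrow> 'a. (\<lambda>w. P (w None) (\<lambda>j. w (Some j)))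
      (\<lambda>k. (\<lambda>w. w (case k of None \<Rightarrow> Inr () | Some j \<Rightarrow> Inl j)) w))"
    by (rule dfn_subst[OF assms dfun_var])
  then show ?thesis using dfn_param[of "\<lambda>v u. P (u ()) v" "\<lambda>_. c"] by simp
qed

text \<open>Almost 0-definable relations, that is, relations definable over \<open>acl\<^sup>e\<^sup>q(\<emptyset>)\<close>: as the
  parameters vary in a 0-definable set, Q defines only finitely many relations.\<close>

definition adef :: "(('i \<Rightarrow> 'a) \<Rightarrow> bool) \<Rightarrow> bool" where
  "adef P \<longleftrightarrow> (\<exists>(Q :: ('i + 'a \<Rightarrow> 'a) \<Rightarrow> bool) \<theta>. def0 Q \<and> def0 \<theta> \<and> \<theta> id \<and>
     finite ((\<lambda>y v. Q (case_sum v y)) ` {y. \<theta> y}) \<and> P = (\<lambda>v. Q (case_sum v id)))"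

lemma adefE:
  assumes "adef P"
  obtains Q :: "('i + 'a \<Rightarrow> 'a) \<Rightarrow> bool" and \<theta> where "def0 Q" "def0 \<theta>" "\<theta> id"
    "finite ((\<lambda>y v. Q (case_sum v y)) ` {y. \<theta> y})" "P = (\<lambda>v. Q (case_sum v id))"
  using assms unfolding adef_def by (elim exE conjE)

lemma adefI:
  assumes "def0 Q" "def0 \<theta>" "\<theta> c" "finite ((\<lambda>y v. Q (case_sum v y)) ` {y. \<theta> y})"
  shows "adef (\<lambda>v. Q (case_sum v c))"
proof -
  let ?Q = "\<lambda>w. Q (\<lambda>k. w (map_sum id c k))" and ?\<theta> = "\<lambda>y. \<theta> (\<lambda>j. y (c j))"
  have e: "?Q (case_sum v y) = Q (case_sum v (\<lambda>j. y (c j)))" for v y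
    by (rule arg_cong[of _ _ Q], rule ext) (simp split: sum.split)
  have "(\<lambda>y v. ?Q (case_sum v y)) ` {y. ?\<theta> y} \<subseteq> (\<lambda>y v. Q (case_sum v y)) ` {y. \<theta> y}"
    unfolding e by auto
  from finite_subset[OF this assms(4)] show ?thesis
    unfolding adef_def
    using def0_reindex[OF assms(1) refl, of "map_sum id c"] def0_reindex[OF assms(2) refl, of c] assms(3)
    by (intro exI[of _ ?Q] exI[of _ ?\<theta>]) (simp add: e)
qed

lemma adef_dfn: "adef P \<Longrightarrow> dfn P"
  unfolding adef_def dfn_def by (elim exE conjE) (rule exI, rule conjI)

lemma def0_adef:
  assumes "def0 P" shows "adef P"
proof -
  have "finite ((\<lambda>y v. P (\<lambda>i. case_sum v y (Inl i))) ` {y::'a \<Rightarrow> 'a. True})"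
    by (rule finite_subset[of _ "{P}"]) auto
  from adefI[OF def0_reindex[OF assms refl] def0_const[of True] _ this, of id]
  show ?thesis by simp
qed

text \<open>An operation applied to finitely many relations yields finitely many relations, so the
  same \<open>\<theta>\<close> works; only uniform definability of the result has to be
  checked.\<close>

lemma adef_op:
  assumes P: "adef P" and \<Phi>: "\<forall>Q :: ('i + 'a \<Rightarrow> 'a) \<Rightarrow> bool. def0 Q \<longrightarrow> def0 (\<lambda>w. \<Phi> (\<lambda>v. Q (case_sum v (\<lambda>a. w (Inr a)))) (\<lambda>i. w (Inl i)))"
  shows "adef (\<Phi> P)"
proof -
  obtain Q \<theta> where Q: "def0 Q" "def0 \<theta>" "\<theta> id"
    "finite ((\<lambda>y v. Q (case_sum v y)) ` {y. \<theta> y})" "P = (\<lambda>v. Q (case_sum v id))" using P by (rule adefE)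
  have "(\<lambda>y v. \<Phi> (\<lambda>v. Q (case_sum v y)) v) ` {y. \<theta> y} \<subseteq> \<Phi> ` (\<lambda>y v. Q (case_sum v y)) ` {y. \<theta> y}" by auto
  from finite_subset[OF this finite_imageI[OF Q(4)]]
  show ?thesis using adefI[OF \<Phi>[rule_format, OF Q(1)] Q(2,3)] by (simp add: Q(5) id_def)
qed

lemma adef_not: "adef P \<Longrightarrow> adef (\<lambda>v. \<not> P v)"
proof -
  assume P: "adef P"
  have "def0 (\<lambda>w. \<not> Q (case_sum (\<lambda>i. w (Inl i)) (\<lambda>a. w (Inr a))))" if Q: "def0 Q"
    for Q :: "('b + 'a \<Rightarrow> 'a) \<Rightarrow> bool"
    by (intro def0_not def0_reindex[OF Q, where g = id]) (simp split: sum.split)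
  then show ?thesis by (intro adef_op[OF P, of "\<lambda>P v. \<not> P v"] allI impI)
qed

lemma adef_conj: "adef P \<Longrightarrow> adef P' \<Longrightarrow> adef (\<lambda>v. P v \<and> P' v)"
proof -
  assume P: "adef P" "adef P'"
  obtain Q \<theta> where Q: "def0 Q" "def0 \<theta>" "\<theta> id"
    "finite ((\<lambda>y v. Q (case_sum v y)) ` {y. \<theta> y})" "P = (\<lambda>v. Q (case_sum v id))" using P(1) by (rule adefE)
  obtain Q' \<theta>' where Q': "def0 Q'" "def0 \<theta>'" "\<theta>' id"
    "finite ((\<lambda>y v. Q' (case_sum v y)) ` {y. \<theta>' y})" "P' = (\<lambda>v. Q' (case_sum v id))" using P(2) by (rule adefE)
  have "(\<lambda>y v. Q (case_sum v y) \<and> Q' (case_sum v y)) ` {y. \<theta> y \<and> \<theta>' y} \<subseteq>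
     (\<lambda>(A, B) v. A v \<and> B v) ` (((\<lambda>y v. Q (case_sum v y)) ` {y. \<theta> y}) \<times> ((\<lambda>y v. Q' (case_sum v y)) ` {y. \<theta>' y}))"
    by auto
  from finite_subset[OF this finite_imageI[OF finite_cartesian_product[OF Q(4) Q'(4)]]]
  have "adef (\<lambda>v. Q (case_sum v id) \<and> Q' (case_sum v id))"
    using Q Q' by (intro adefI[of "\<lambda>w. Q w \<and> Q' w" "\<lambda>w. \<theta> w \<and> \<theta>' w"] def0_conj) simp_all
  then show ?thesis by (simp add: Q(5) Q'(5))
qed

lemma adef_const: "adef (\<lambda>v. c)"
  by (intro def0_adef def0_const)

lemma adef_disj: "adef P \<Longrightarrow> adef Q \<Longrightarrow> adef (\<lambda>v. P v \<or> Q v)"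
proof -
  assume PQ: "adef P" "adef Q"
  have e: "(P v \<or> Q v) = (\<not> (\<not> P v \<and> \<not> Q v))" for v by blast
  show ?thesis unfolding e by (intro adef_not adef_conj PQ)
qed

lemma adef_iff: "adef P \<Longrightarrow> adef Q \<Longrightarrow> adef (\<lambda>v. P v = Q v)"
  unfolding iff_conv_conj_imp[of "P _"] imp_conv_disj by (intro adef_conj adef_disj adef_not)

lemma adef_ball: "finite I \<Longrightarrow> (\<And>i. i \<in> I \<Longrightarrow> adef (P i)) \<Longrightarrow> adef (\<lambda>v. \<forall>i\<in>I. P i v)"
  by (induction rule: finite_induct) (simp_all add: adef_const adef_conj)

lemma adef_bex: "finite I \<Longrightarrow> (\<And>i. i \<in> I \<Longrightarrow> adef (P i)) \<Longrightarrow> adef (\<lambda>v. \<exists>i\<in>I. P i v)"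
  by (induction rule: finite_induct) (simp_all add: adef_const adef_disj)

lemma adef_ex:
  assumes P: "adef (\<lambda>w :: 'i + 'j \<Rightarrow> 'a. P (\<lambda>i. w (Inl i)) (\<lambda>j. w (Inr j)))"
  shows "adef (\<lambda>v. \<exists>u. P v u)"
proof -
  have "def0 (\<lambda>w. \<exists>u. Q (case_sum (case_sum (\<lambda>i. w (Inl i)) u) (\<lambda>a. w (Inr a))))"
    if Q: "def0 Q" for Q :: "(('i + 'j) + 'a \<Rightarrow> 'a) \<Rightarrow> bool"
    by (rule def0_ex, rule def0_reindex[OF Q, of _ "\<lambda>k. case k of Inl (Inl i) \<Rightarrow> Inl (Inl i) | Inl (Inr j) \<Rightarrow> Inr j | Inr a \<Rightarrow> Inl (Inr a)"])
      (simp split: sum.split)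
  then have "adef (\<lambda>v. \<exists>u. (\<lambda>w. P (\<lambda>i. w (Inl i)) (\<lambda>j. w (Inr j))) (case_sum v u))"
    by (intro adef_op[OF P, of "\<lambda>P v. \<exists>u. P (case_sum v u)"] allI impI)
  then show ?thesis by simp
qed

lemma adef_subst:
  assumes P: "adef P" and F: "\<And>i. dfun (F i)" shows "adef (\<lambda>v. P (\<lambda>i. F i v))"
proof -
  have "def0 (\<lambda>w. Q (case_sum (\<lambda>i. F i (\<lambda>j. w (Inl j))) (\<lambda>a. w (Inr a))))"
    if Q: "def0 Q" for Q :: "('b + 'a \<Rightarrow> 'a) \<Rightarrow> bool"
  proof -
    have "def0 (\<lambda>w. Q (\<lambda>k. (case k of Inl i \<Rightarrow> (\<lambda>w. F i (\<lambda>j. w (Inl j))) | Inr a \<Rightarrow> (\<lambda>w. w (Inr a))) w))"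
      by (rule def0_subst[OF Q(1)]) (auto split: sum.split intro: dfun_reindex F dfun_var)
    then show ?thesis
      by (rule back_subst[of def0]) (rule ext, rule arg_cong[of _ _ Q], rule ext, simp split: sum.split)
  qed
  then show ?thesis by (intro adef_op[OF P, of "\<lambda>P v. P (\<lambda>i. F i v)"] allI impI)
qed

lemma adef_reindex:
  assumes "adef Q" "\<And>w k. h w k = w (g k)" shows "adef (\<lambda>w. Q (h w))"
proof -
  have "h w = (\<lambda>k. w (g k))" for w using assms(2) by auto
  then show ?thesis using adef_subst[OF assms(1) dfun_var, of g] by simp
qed

lemma adef_ex1:
  assumes "adef (\<lambda>w :: 'i option \<Rightarrow> 'a. P (w None) (\<lambda>j. w (Some j)))"
  shows "adef (\<lambda>v. \<exists>x. P x v)"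
proof -
  have "adef (\<lambda>w :: 'i + unit \<Rightarrow> 'a. (\<lambda>w. P (w None) (\<lambda>j. w (Some j)))
      (\<lambda>k. w (case k of None \<Rightarrow> Inr () | Some j \<Rightarrow> Inl j)))"
    by (rule adef_reindex[OF assms]) (rule refl)
  then have "adef (\<lambda>v. \<exists>u::unit \<Rightarrow> 'a. P (u ()) v)" by (intro adef_ex) simp
  then show ?thesis by (simp only: ex_unit_fun[of "\<lambda>x. P x _"])
qed

text \<open>The finite equivalence relation of Shelah: two tuples are equivalent if all relations
  obtained from parameters in \<open>\<theta>\<close> agree on them. A class is determined by the
  members of a finite family that hold on it.\<close>

lemma adef_equivalence:
  assumes "adef P"
  shows "\<exists>E. def0 (\<lambda>w. E (\<lambda>i. w (Inl i)) (\<lambda>i. w (Inr i))) \<and> equivp E \<and>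
    finite (range E) \<and> (\<forall>v v'. E v v' \<longrightarrow> P v = P v')"
proof -
  obtain Q \<theta> where Q: "def0 Q" "def0 \<theta>" "\<theta> id"
    "finite ((\<lambda>y v. Q (case_sum v y)) ` {y. \<theta> y})" "P = (\<lambda>v. Q (case_sum v id))" using assms by (rule adefE)
  define F where "F = (\<lambda>y v. Q (case_sum v y)) ` {y. \<theta> y}"
  have F: "finite F" unfolding F_def by (rule Q(4))
  let ?E = "\<lambda>v v'. \<forall>y. \<theta> y \<longrightarrow> Q (case_sum v y) = Q (case_sum v' y)"
  have E: "?E v v' = ({A\<in>F. A v} = {A\<in>F. A v'})" for v v'
  proof -
    have "?E v v' \<longleftrightarrow> (\<forall>A\<in>F. A v = A v')" by (simp add: F_def)
    then show ?thesis by blast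
  qed
  have "def0 (\<lambda>w. ?E (\<lambda>i. w (Inl i)) (\<lambda>i. w (Inr i)))"
  proof -
    have "def0 (\<lambda>w :: ('b + 'b) + 'a \<Rightarrow> 'a. \<theta> (\<lambda>j. w (Inr j)))" by (rule def0_reindex[OF Q(2) refl])
    moreover have "def0 (\<lambda>w :: ('b + 'b) + 'a \<Rightarrow> 'a. Q (case_sum (\<lambda>i. w (Inl (Inl i))) (\<lambda>j. w (Inr j))))"
      by (rule def0_reindex[OF Q(1), where g = "map_sum Inl id"]) (simp split: sum.split)
    moreover have "def0 (\<lambda>w :: ('b + 'b) + 'a \<Rightarrow> 'a. Q (case_sum (\<lambda>i. w (Inl (Inr i))) (\<lambda>j. w (Inr j))))"
      by (rule def0_reindex[OF Q(1), where g = "map_sum Inr id"]) (simp split: sum.split)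
    ultimately show ?thesis by (intro def0_all def0_imp def0_iff)
  qed
  moreover have "equivp ?E" by (intro equivpI reflpI sympI transpI) auto
  moreover have "finite (range ?E)"
  proof (rule finite_subset)
    show "range ?E \<subseteq> (\<lambda>S v'. S = {A\<in>F. A v'}) ` Pow F"
    proof (rule image_subsetI)
      fix v
      show "?E v \<in> (\<lambda>S v'. S = {A\<in>F. A v'}) ` Pow F"
        unfolding E by (rule image_eqI[OF refl]) simp
    qed
    show "finite ((\<lambda>S v'. S = {A\<in>F. A v'}) ` Pow F)" using F by simp
  qed
  moreover have "\<forall>v v'. ?E v v' \<longrightarrow> P v = P v'" using Q(3,5) by simp
  ultimately show ?thesis by (intro exI[of _ ?E] conjI)
qed

section \<open>Elementary permutations and their action on relations\<close>

definition elem :: "('a \<Rightarrow> 'a) \<Rightarrow> bool" where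
  "elem \<sigma> \<longleftrightarrow> bij \<sigma> \<and> (\<forall>n \<phi> as. wff n \<phi> \<longrightarrow> length as = n \<longrightarrow> sat G (map \<sigma> as) \<phi> = sat G as \<phi>)"

lemma elem_def0:
  assumes "elem \<sigma>" "def0 P" shows "P (\<lambda>i. \<sigma> (v i)) = P v"
proof -
  obtain xs \<phi> where x: "wff (length xs) \<phi>" "\<forall>v. P v = sat G (map v xs) \<phi>"
    using assms(2) unfolding def0_def by (elim exE conjE)
  have "sat G (map \<sigma> (map v xs)) \<phi> = sat G (map v xs) \<phi>"
    using assms(1) x(1) length_map[of v xs] unfolding elem_def by blast
  then show ?thesis using x(2) by (simp add: comp_def)
qed

lemma elem_id: "elem id"
  by (simp add: elem_def)

lemma elem_comp: "elem \<sigma> \<Longrightarrow> elem \<tau> \<Longrightarrow> elem (\<sigma> \<circ> \<tau>)"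
  unfolding elem_def by (auto simp: bij_comp simp flip: map_map)

lemma elem_inv: "elem \<sigma> \<Longrightarrow> elem (inv \<sigma>)"
  unfolding elem_def
proof (intro conjI allI impI; elim conjE)
  fix n \<phi> and as :: "'a list"
  assume b: "bij \<sigma>" and s: "\<forall>n \<phi> as. wff n \<phi> \<longrightarrow> length as = n \<longrightarrow> sat G (map \<sigma> as) \<phi> = sat G as \<phi>"
    and "wff n \<phi>" "length as = n"
  then have "sat G (map \<sigma> (map (inv \<sigma>) as)) \<phi> = sat G (map (inv \<sigma>) as) \<phi>"
    using s[rule_format, of n \<phi> "map (inv \<sigma>) as"] by (simp only: length_map)
  moreover have "map \<sigma> (map (inv \<sigma>) as) = as" using b by (simp add: comp_def bij_is_surj surj_f_inv_f)
  ultimately show "sat G (map (inv \<sigma>) as) \<phi> = sat G as \<phi>" by (simp only:)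
qed (rule bij_imp_bij_inv)

lemma elem_inv_left: "elem \<sigma> \<Longrightarrow> inv \<sigma> (\<sigma> x) = x" and elem_inv_right: "elem \<sigma> \<Longrightarrow> \<sigma> (inv \<sigma> x) = x"
  by (simp_all add: elem_def bij_is_inj bij_is_surj surj_f_inv_f)

text \<open>Moving the variables of \<open>P\<close> by \<open>\<sigma>\<close> amounts to moving
  its parameters by the inverse of \<open>\<sigma>\<close>, and the moved parameters still satisfy
  \<open>\<theta>\<close>.\<close>

lemma
  assumes "adef P"
  shows adef_elem: "elem \<sigma> \<Longrightarrow> adef (\<lambda>v. P (\<lambda>i. \<sigma> (v i)))"
    and adef_finite_orbit: "finite ((\<lambda>\<sigma> v. P (\<lambda>i. \<sigma> (v i))) ` {\<sigma>. elem \<sigma>})"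
proof -
  obtain Q \<theta> where Q: "def0 Q" "def0 \<theta>" "\<theta> id"
    "finite ((\<lambda>y v. Q (case_sum v y)) ` {y. \<theta> y})" "P = (\<lambda>v. Q (case_sum v id))" using assms by (rule adefE)
  have P: "P (\<lambda>i. \<sigma> (v i)) = Q (case_sum v (inv \<sigma>))" if \<sigma>: "elem \<sigma>" for \<sigma> v
  proof -
    have "(\<lambda>k. \<sigma> (case_sum v (inv \<sigma>) k)) = case_sum (\<lambda>i. \<sigma> (v i)) id"
      by (auto simp: fun_eq_iff elem_inv_right[OF \<sigma>] split: sum.split)
    then show ?thesis using elem_def0[OF \<sigma> Q(1), of "case_sum v (inv \<sigma>)"] Q(5) by simp
  qed
  have \<theta>: "\<theta> (inv \<sigma>)" if "elem \<sigma>" for \<sigma>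
    using elem_def0[OF elem_inv[OF that] Q(2), of id] Q(3) by simp
  show "adef (\<lambda>v. P (\<lambda>i. \<sigma> (v i)))" if \<sigma>: "elem \<sigma>"
    unfolding P[OF \<sigma>] using Q \<theta>[OF \<sigma>] by (intro adefI)
  have "(\<lambda>\<sigma> v. P (\<lambda>i. \<sigma> (v i))) ` {\<sigma>. elem \<sigma>} \<subseteq> (\<lambda>y v. Q (case_sum v y)) ` {y. \<theta> y}"
    using \<theta> by (auto simp: P)
  then show "finite ((\<lambda>\<sigma> v. P (\<lambda>i. \<sigma> (v i))) ` {\<sigma>. elem \<sigma>})" using Q(4) by (rule finite_subset)
qed

lemma dfn_ex:
  assumes "dfn (\<lambda>w :: 'i + 'j \<Rightarrow> 'a. P (\<lambda>i. w (Inl i)) (\<lambda>j. w (Inr j)))"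
  shows "dfn (\<lambda>v. \<exists>u. P v u)"
proof -
  obtain Q where Q: "def0 Q" "(\<lambda>w. P (\<lambda>i. w (Inl i)) (\<lambda>j. w (Inr j))) = (\<lambda>v. Q (case_sum v id))"
    using assms by (rule dfnE)
  have P: "P v u = Q (case_sum (case_sum v u) id)" for v u
    using fun_cong[OF Q(2), of "case_sum v u"] by simp
  have "def0 (\<lambda>w. Q (case_sum (case_sum (\<lambda>i. w (Inl (Inl i))) (\<lambda>j. w (Inr j))) (\<lambda>a. w (Inl (Inr a)))))"
    by (rule def0_reindex[OF Q(1), of _ "\<lambda>k. case k of Inl (Inl i) \<Rightarrow> Inl (Inl i) | Inl (Inr j) \<Rightarrow> Inr j | Inr a \<Rightarrow> Inl (Inr a)"])
      (simp split: sum.split)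
  from def0_ex[of "\<lambda>w u. Q (case_sum (case_sum (\<lambda>i. w (Inl i)) u) (\<lambda>a. w (Inr a)))", OF this]
  have "def0 (\<lambda>w. \<exists>u. Q (case_sum (case_sum (\<lambda>i. w (Inl i)) u) (\<lambda>a. w (Inr a))))" .
  from dfnI[OF this, of id] show ?thesis unfolding P by (simp add: id_def)
qed

lemma dfn_reindex: "dfn P \<Longrightarrow> dfn (\<lambda>w. P (\<lambda>i. w (g i)))"
  by (rule dfn_subst[OF _ dfun_var])

lemma dfn_formula:
  assumes "dfn (\<lambda>v :: unit \<Rightarrow> 'a. A (v ()))"
  shows "\<exists>\<phi> cs. wff (Suc (length cs)) \<phi> \<and> (\<forall>x. A x = sat G (x # cs) \<phi>)"
proof -
  obtain Q where Q: "def0 Q" "(\<lambda>v :: unit \<Rightarrow> 'a. A (v ())) = (\<lambda>v. Q (case_sum v id))"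
    using assms by (rule dfnE)
  have A: "A x = Q (case_sum (\<lambda>_. x) id)" for x using fun_cong[OF Q(2), of "\<lambda>_. x"] by simp
  obtain xs where xs: "\<forall>ys. set xs \<subseteq> set ys \<longrightarrow> (\<exists>\<phi>. wff (length ys) \<phi> \<and> (\<forall>v. Q v = sat G (map v ys) \<phi>))"
    using def0_formula[OF Q(1)] by (elim exE)
  have "finite {a. Inr a \<in> set xs}" using finite_vimageI[of "set xs" Inr] by (simp add: vimage_def)
  then obtain cs where cs: "set cs = {a. Inr a \<in> set xs}" using finite_list by auto
  have "set xs \<subseteq> set (Inl () # map Inr cs)"
  proof
    fix x assume m: "x \<in> set xs"
    show "x \<in> set (Inl () # map Inr cs)" by (cases x) (use m in \<open>auto simp: cs\<close>)
  qed
  with xs obtain \<phi> where \<phi>: "wff (length (Inl () # map Inr cs)) \<phi>"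
    "\<forall>v. Q v = sat G (map v (Inl () # map Inr cs)) \<phi>" by blast
  then show ?thesis unfolding A
    by (intro exI[of _ \<phi>] exI[of _ cs]) (simp add: comp_def)
qed

text \<open>Stability of the structure excludes the first pattern for every formula; the second
  pattern is the first one for the negated formula.\<close>

lemma no_order_formula:
  assumes st: "stable_struct G" and R: "def0 (\<lambda>w :: 'i + 'j \<Rightarrow> 'a. R (\<lambda>i. w (Inl i)) (\<lambda>j. w (Inr j)))"
  shows "no_order R"
proof -
  obtain xs where xs: "\<forall>ys. set xs \<subseteq> set ys \<longrightarrow> (\<exists>\<phi>. wff (length ys) \<phi> \<and>
      (\<forall>w. R (\<lambda>i. w (Inl i)) (\<lambda>j. w (Inr j)) = sat G (map w ys) \<phi>))"
    using def0_formula[OF R] by (elim exE)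
  have "finite {j. Inr j \<in> set xs}" "finite {i. Inl i \<in> set xs}"
    using finite_vimageI[of "set xs" Inr] finite_vimageI[of "set xs" Inl] by (auto simp: vimage_def)
  then obtain js "is" where l: "set js = {j. Inr j \<in> set xs}" "set is = {i. Inl i \<in> set xs}"
    by (metis finite_list)
  let ?ys = "map Inl is @ map Inr js"
  have "set xs \<subseteq> set ?ys"
  proof
    fix x assume m: "x \<in> set xs"
    show "x \<in> set ?ys" by (cases x) (use m in \<open>auto simp: l\<close>)
  qed
  with xs obtain \<phi> where \<phi>: "wff (length ?ys) \<phi>"
    "\<forall>w. R (\<lambda>i. w (Inl i)) (\<lambda>j. w (Inr j)) = sat G (map w ?ys) \<phi>" by blast
  have P: "R v u = sat G (map v is @ map u js) \<phi>" for v u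
    using \<phi>(2)[rule_format, of "case_sum v u"] by (simp add: comp_def)
  let ?ss = "replicate (length is) ()" and ?ts = "replicate (length js) ()"
  have n: "\<not> (wf_fm G (ss @ ts) \<psi> \<and> (\<forall>i::nat. a i \<in> tuples G ss \<and> b i \<in> tuples G ts) \<and>
      (\<forall>i j. sat G (a i @ b j) \<psi> \<longleftrightarrow> i < j))" for ss ts \<psi> a b
    using st unfolding stable_struct_def not_ex by (elim allE)
  have w: "wf_fm G (?ss @ ?ts) \<phi>" "wf_fm G (?ss @ ?ts) (Neg \<phi>)" using \<phi>(1) by (simp_all add: replicate_add)
  show ?thesis
  proof (rule no_orderI)
    fix a b
    show "\<not> (\<forall>i j::nat. R (a i) (b j) \<longleftrightarrow> i < j)"
      using n[of ?ss ?ts \<phi> "\<lambda>i. map (a i) is" "\<lambda>j. map (b j) js"] w(1) unfolding P by simp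
    have e: "(\<not> p) = q \<longleftrightarrow> p = (\<not> q)" for p q by blast
    show "\<not> (\<forall>i j::nat. R (a i) (b j) \<longleftrightarrow> \<not> i < j)"
      using n[of ?ss ?ts "Neg \<phi>" "\<lambda>i. map (a i) is" "\<lambda>j. map (b j) js"] w(2) unfolding P by (simp add: e)
  qed
qed

text \<open>The parameters are absorbed into the tuple on the right, which leaves a relation without
  parameters.\<close>

lemma no_order_dfn:
  assumes st: "stable_struct G" and R: "dfn (\<lambda>w :: 'i + 'j \<Rightarrow> 'a. R (\<lambda>i. w (Inl i)) (\<lambda>j. w (Inr j)))"
  shows "no_order R"
proof -
  obtain Q where Q: "def0 Q" "(\<lambda>w. R (\<lambda>i. w (Inl i)) (\<lambda>j. w (Inr j))) = (\<lambda>v. Q (case_sum v id))"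
    using R by (rule dfnE)
  have P: "R v u = Q (case_sum (case_sum v u) id)" for v u
    using fun_cong[OF Q(2), of "case_sum v u"] by simp
  let ?R = "\<lambda>v w. Q (case_sum (case_sum v (\<lambda>j. w (Inl j))) (\<lambda>a. w (Inr a)))"
  have "def0 (\<lambda>w. Q (case_sum (case_sum (\<lambda>i. w (Inl i)) (\<lambda>j. w (Inr (Inl j)))) (\<lambda>a. w (Inr (Inr a)))))"
    by (rule def0_reindex[OF Q(1), of _ "\<lambda>k. case k of Inl (Inl i) \<Rightarrow> Inl i | Inl (Inr j) \<Rightarrow> Inr (Inl j) | Inr a \<Rightarrow> Inr (Inr a)"])
      (simp split: sum.split)
  from no_order_formula[of ?R, OF st this] have "no_order ?R" .
  from no_order_comp[OF this, of "\<lambda>v. v" "\<lambda>u. case_sum u id"] show ?thesis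
    unfolding P by (simp add: id_def)
qed

lemma no_order_dfn1:
  assumes st: "stable_struct G" and R: "dfn (\<lambda>w :: 'j option \<Rightarrow> 'a. R (w None) (\<lambda>j. w (Some j)))"
  shows "no_order R"
proof -
  have "dfn (\<lambda>w :: unit + 'j \<Rightarrow> 'a. (\<lambda>w. R (w None) (\<lambda>j. w (Some j)))
      (\<lambda>k. w (case k of None \<Rightarrow> Inl () | Some j \<Rightarrow> Inr j)))"
    by (rule dfn_reindex[OF R])
  then have "no_order (\<lambda>(v :: unit \<Rightarrow> 'a) u. R (v ()) u)"
    by (intro no_order_dfn[OF st]) simp
  from no_order_comp[OF this, of "\<lambda>x _. x" "\<lambda>u. u"] show ?thesis by simp
qed

lemma automorphism_elem:
  assumes "automorphism G \<sigma>" shows "elem \<sigma>"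
proof -
  have b: "bij \<sigma>" using assms by (auto simp: automorphism_def sorts_G univ_G)
  have f: "\<forall>f. \<forall>as\<in>tuples G (fargs G f). \<sigma> (fint G f as) = fint G f (map \<sigma> as)"
    and r: "\<forall>r. \<forall>as\<in>tuples G (rargs G r). rint G r as \<longleftrightarrow> rint G r (map \<sigma> as)"
    by (rule assms[unfolded automorphism_def, THEN conjunct2, THEN conjunct1],
        rule assms[unfolded automorphism_def, THEN conjunct2, THEN conjunct2])
  have t: "eval_tm G (map \<sigma> as) t = \<sigma> (eval_tm G as t)" if "has_sort G ss t s" "length as = length ss" for as ss t s
    using that
  proof induction
    case (2 f ts)
    have e: "map (eval_tm G (map \<sigma> as)) ts = map \<sigma> (map (eval_tm G as) ts)"
      using 2 by (intro nth_equalityI) (auto simp: list_all2_conv_all_nth)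
    have "length ts = length (fargs G f)" using 2 by (auto simp: list_all2_lengthD)
    then have "\<sigma> (fint G f (map (eval_tm G as) ts)) = fint G f (map \<sigma> (map (eval_tm G as) ts))"
      by (intro f[THEN spec, THEN bspec]) simp
    then show ?case by (simp only: eval_tm.simps e)
  qed simp
  have "sat G (map \<sigma> as) \<phi> = sat G as \<phi>" if "wf_fm G ss \<phi>" "length as = length ss" for ss as \<phi>
    using that
  proof (induction \<phi> arbitrary: ss as)
    case (Eq u v)
    then show ?case using t b by (auto simp: bij_is_inj inj_eq)
  next
    case (Rel r ts)
    have e: "map (eval_tm G (map \<sigma> as)) ts = map \<sigma> (map (eval_tm G as) ts)"
      using Rel t[of ss _ _ as] by (intro nth_equalityI) (auto simp: list_all2_conv_all_nth)
    have "length ts = length (rargs G r)" using Rel by (auto simp: list_all2_lengthD)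
    then have "rint G r (map (eval_tm G as) ts) = rint G r (map \<sigma> (map (eval_tm G as) ts))"
      by (intro r[THEN spec, THEN bspec]) simp
    then show ?case by (simp only: sat.simps e)
  next
    case (Neg \<phi>) then show ?case by simp
  next
    case (Conj \<phi> \<psi>)
    have "wf_fm G ss \<phi>" "wf_fm G ss \<psi>" using Conj.prems by simp_all
    then show ?case using Conj.IH Conj.prems(2) by simp
  next
    case (Exi s \<phi>)
    have "sat G (map \<sigma> (x # as)) \<phi> = sat G (x # as) \<phi>" for x
      using Exi.prems by (intro Exi.IH[of "s # ss"]) simp_all
    then have 1: "sat G (\<sigma> x # map \<sigma> as) \<phi> = sat G (x # as) \<phi>" for x by simp
    have "(\<exists>x. sat G (x # map \<sigma> as) \<phi>) = (\<exists>x. sat G (\<sigma> x # map \<sigma> as) \<phi>)"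
    proof
      assume "\<exists>x. sat G (x # map \<sigma> as) \<phi>"
      then obtain x where "sat G (x # map \<sigma> as) \<phi>" by (elim exE)
      then show "\<exists>x. sat G (\<sigma> x # map \<sigma> as) \<phi>"
        using b by (intro exI[of _ "inv \<sigma> x"]) (simp add: bij_is_surj surj_f_inv_f)
    qed (elim exE, rule exI)
    then show ?case by (simp add: univ_G 1)
  qed
  then show ?thesis unfolding elem_def using b by auto
qed

end

section \<open>Saturation\<close>

locale stable_group =
  fixes G :: "(unit, 'f, 'r, 'a::ab_group_add) struct" and \<kappa> :: "'k rel"
  assumes abelian: "abelian_group_struct G" and monster: "monster G \<kappa>" and stable: "stable_struct G"
begin

sublocale one_sorted G
  using abelian by unfold_locales (auto simp: abelian_group_struct_def)

lemma dfun_add: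
  assumes "dfun F" "dfun H" shows "dfun (\<lambda>v. F v + H v)"
proof -
  obtain f where f: "fargs G f = [(), ()]" "\<forall>x y. fint G f [x, y] = x + y"
    using abelian[unfolded abelian_group_struct_def, THEN conjunct2, THEN conjunct2] by (elim exE conjE)
  have "dfun (\<lambda>v. fint G f (map (\<lambda>F. F v) [F, H]))"
    using f(1) assms by (intro dfun_fint) auto
  then show ?thesis using f(2) by simp
qed

text \<open>The structure is only known to have a symbol for addition; the graph of a difference is
  an equation between sums.\<close>

lemma dfun_diff:
  assumes "dfun F" "dfun H" shows "dfun (\<lambda>v. F v - H v)"
proof -
  have "def0 (\<lambda>w. w None + H (\<lambda>i. w (Some i)) = F (\<lambda>i. w (Some i)))"
    by (intro def0_eq dfun_add dfun_var dfun_reindex[OF assms(1)] dfun_reindex[OF assms(2)])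
  then show ?thesis unfolding dfun_def by (simp add: eq_diff_eq)
qed

lemma dfun_uminus:
  assumes "dfun F" shows "dfun (\<lambda>v. - F v)"
  using dfun_diff[OF dfun_diff[OF assms assms] assms] by simp

section \<open>Cardinal arithmetic below \<kappa>\<close>

definition small :: "'x set \<Rightarrow> bool" where
  "small A \<longleftrightarrow> |A| <o \<kappa>"

definition formulas :: "(unit, 'f, 'r) fm set" where
  "formulas = {\<phi>. \<exists>ss. set ss \<subseteq> sorts G \<and> wf_fm G ss \<phi>}"

lemma wff_formulas: "wff n \<phi> \<Longrightarrow> \<phi> \<in> formulas"
  unfolding formulas_def by (intro CollectI exI[of _ "replicate n ()"]) (auto simp: sorts_G)

lemma card_order_\<kappa>: "Card_order \<kappa>"
  using monster by (simp add: monster_def)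

lemma small_formulas: "small formulas"
  using monster by (simp add: monster_def small_def formulas_def)

lemma infinite_formulas: "infinite formulas"
proof -
  have "has_sort G [()] (Var 0) ()" using has_sort.intros(1)[of 0 "[()]" G] by simp
  then have "wff 1 (Eq (Var 0) (Var 0))" by auto
  then have "wff 1 ((Neg ^^ n) (Eq (Var 0) (Var 0)))" for n by (induction n) auto
  then have r: "range (\<lambda>n. (Neg ^^ n) (Eq (Var 0) (Var 0) :: (unit, 'f, 'r) fm)) \<subseteq> formulas"
    using wff_formulas by blast
  have "size ((Neg ^^ n) (Eq (Var 0) (Var 0) :: (unit, 'f, 'r) fm)) = n + size (Eq (Var 0) (Var 0) :: (unit, 'f, 'r) fm)" for n
    by (induction n) auto
  then have "inj (\<lambda>n. (Neg ^^ n) (Eq (Var 0) (Var 0) :: (unit, 'f, 'r) fm))"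
    by (intro injI) (metis add_right_cancel)
  then show ?thesis using r by (metis infinite_UNIV_nat finite_imageD finite_subset)
qed

lemma small_ordLeq: "|A| \<le>o |B| \<Longrightarrow> small B \<Longrightarrow> small A"
  unfolding small_def by (rule ordLeq_ordLess_trans)

lemma small_subset: "A \<subseteq> B \<Longrightarrow> small B \<Longrightarrow> small A"
  by (rule small_ordLeq[OF card_of_mono1])

lemma small_image: "small A \<Longrightarrow> small (f ` A)"
  by (rule small_ordLeq[OF card_of_image])

text \<open>Absorption of products needs an infinite set. The set of formulas is infinite and small,
  so it serves as a bound when \<open>A\<close> itself is too small; the sum type accommodates both
  cases.\<close>

lemma small_infinite_bound:
  fixes A :: "'x set"
  assumes "small A"
  shows "\<exists>B :: ('x + (unit, 'f, 'r) fm) set. infinite B \<and> small B \<and> |A| \<le>o |B|"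
proof (cases "|A| \<le>o |formulas|")
  case True
  have "|A| \<le>o |Inr ` formulas :: ('x + (unit, 'f, 'r) fm) set|"
    using True by (rule ordLeq_transitive) (auto intro!: card_of_ordLeqI[of Inr])
  moreover have "infinite (Inr ` formulas :: ('x + (unit, 'f, 'r) fm) set)"
    using infinite_formulas by (simp add: finite_image_iff)
  ultimately show ?thesis using small_image[OF small_formulas] by blast
next
  case False
  then have "|formulas| \<le>o |A|" using ordLeq_total[OF card_of_Well_order card_of_Well_order] by blast
  then have "infinite A" using infinite_formulas by (rule card_of_ordLeq_infinite)
  then have "infinite (Inl ` A :: ('x + (unit, 'f, 'r) fm) set)" by (simp add: finite_image_iff)
  moreover have "|A| \<le>o |Inl ` A :: ('x + (unit, 'f, 'r) fm) set|"
    by (auto intro!: card_of_ordLeqI[of Inl])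
  ultimately show ?thesis using small_image[OF assms] by blast
qed

lemma small_times:
  fixes A :: "'x set" and A' :: "'y set"
  assumes "small A" "small A'" shows "small (A \<times> A')"
proof -
  obtain B :: "('x + (unit, 'f, 'r) fm) set" where B: "infinite B" "small B" "|A| \<le>o |B|"
    using small_infinite_bound[OF assms(1)] by (elim exE conjE)
  obtain B' :: "('y + (unit, 'f, 'r) fm) set" where B': "infinite B'" "small B'" "|A'| \<le>o |B'|"
    using small_infinite_bound[OF assms(2)] by (elim exE conjE)
  have "|B| \<le>o |B'| \<or> |B'| \<le>o |B|" using ordLeq_total[OF card_of_Well_order card_of_Well_order] by blast
  then show ?thesis
  proof
    assume "|B| \<le>o |B'|"
    then have "|A| \<le>o |B'|" using B(3) ordLeq_transitive by blast
    then have "|A \<times> A'| \<le>o |B'|" using B' by (intro card_of_Sigma_ordLeq_infinite) auto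
    then show ?thesis using B'(2) by (rule small_ordLeq)
  next
    assume "|B'| \<le>o |B|"
    then have "|A'| \<le>o |B|" using B'(3) ordLeq_transitive by blast
    then have "|A \<times> A'| \<le>o |B|" using B by (intro card_of_Sigma_ordLeq_infinite) auto
    then show ?thesis using B(2) by (rule small_ordLeq)
  qed
qed

lemma small_countable: "countable A \<Longrightarrow> small A"
proof -
  assume "countable A"
  then obtain f :: "'b \<Rightarrow> nat" where "inj_on f A" by (rule countableE)
  then have "|A| \<le>o |UNIV :: nat set|" by (rule card_of_ordLeqI) simp
  moreover have "|UNIV :: nat set| \<le>o |formulas|" using infinite_formulas infinite_iff_card_of_nat by blast
  ultimately show ?thesis using small_formulas ordLeq_transitive small_ordLeq by blast
qed

lemma small_finite: "finite A \<Longrightarrow> small A"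
  by (intro small_countable countable_finite)

text \<open>\<kappa> is not assumed to be regular, so the union is bounded by a product of
  \<open>I\<close> with the natural numbers and the members have to be countable.\<close>

lemma small_UNION:
  fixes I :: "'x set"
  assumes "small I" "\<And>i. i \<in> I \<Longrightarrow> countable (A i)" shows "small (\<Union>i\<in>I. A i)"
proof -
  have "(\<Union>i\<in>I. A i) \<subseteq> (\<lambda>(i, n). from_nat_into (A i) n) ` (I \<times> UNIV)"
  proof
    fix x assume "x \<in> (\<Union>i\<in>I. A i)"
    then obtain i where i: "i \<in> I" "x \<in> A i" by blast
    then have "from_nat_into (A i) (to_nat_on (A i) x) = x" using assms(2) by simp
    then show "x \<in> (\<lambda>(i, n). from_nat_into (A i) n) ` (I \<times> UNIV)"
      using i(1) by (intro image_eqI[of _ _ "(i, to_nat_on (A i) x)"]) auto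
  qed
  moreover have "small (I \<times> (UNIV :: nat set))" by (intro small_times assms(1) small_countable) simp
  ultimately show ?thesis using small_image small_subset by blast
qed

lemma small_Un: "small A \<Longrightarrow> small B \<Longrightarrow> small (A \<union> B)"
proof -
  have "|formulas| \<le>o \<kappa>" using small_formulas unfolding small_def by (rule ordLess_imp_ordLeq)
  from card_of_mono2[OF this] have "|formulas| \<le>o |Field \<kappa>|" by (simp add: Field_card_of)
  then have "infinite (Field \<kappa>)" using infinite_formulas by (rule card_of_ordLeq_infinite)
  then show "small A \<Longrightarrow> small B \<Longrightarrow> small (A \<union> B)"
    unfolding small_def using card_order_\<kappa> by (rule card_of_Un_ordLess_infinite_Field)
qed

lemma small_lists:
  fixes A :: "'x set"
  assumes "small A" shows "small (lists A)"
proof -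
  obtain B :: "('x + (unit, 'f, 'r) fm) set" where B: "infinite B" "small B" "|A| \<le>o |B|"
    using small_infinite_bound[OF assms(1)] by (elim exE conjE)
  have "|{xs \<in> lists A. length xs = n}| \<le>o |B|" for n
  proof (induction n)
    case 0
    have "finite {xs \<in> lists A. length xs = 0}" by simp
    then have "\<not> |B| \<le>o |{xs \<in> lists A. length xs = 0}|" using card_of_ordLeq_finite B(1) by blast
    then show ?case using ordLeq_total[OF card_of_Well_order card_of_Well_order] by blast
  next
    case (Suc n)
    have "{xs \<in> lists A. length xs = Suc n} \<subseteq> (\<lambda>(x, xs). x # xs) ` (A \<times> {xs \<in> lists A. length xs = n})"
    proof
      fix xs assume "xs \<in> {xs \<in> lists A. length xs = Suc n}"
      then show "xs \<in> (\<lambda>(x, xs). x # xs) ` (A \<times> {xs \<in> lists A. length xs = n})"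
        by (cases xs) (auto simp: image_iff)
    qed
    then have "|{xs \<in> lists A. length xs = Suc n}| \<le>o |A \<times> {xs \<in> lists A. length xs = n}|"
      by (rule ordLeq_transitive[OF card_of_mono1 card_of_image])
    also have "|A \<times> {xs \<in> lists A. length xs = n}| \<le>o |B|"
      using B Suc by (intro card_of_Sigma_ordLeq_infinite) auto
    finally show ?case .
  qed
  then have "|\<Union>n. {xs \<in> lists A. length xs = n}| \<le>o |B|"
    using B(1) infinite_iff_card_of_nat by (intro card_of_UNION_ordLeq_infinite) auto
  moreover have "(\<Union>n. {xs \<in> lists A. length xs = n}) = lists A" by auto
  ultimately show ?thesis using B(2) small_ordLeq by metis
qed

lemma small_finite_subsets: "small A \<Longrightarrow> small {B. finite B \<and> B \<subseteq> A}"
proof -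
  assume "small A"
  have "{B. finite B \<and> B \<subseteq> A} \<subseteq> set ` lists A"
  proof
    fix B assume B: "B \<in> {B. finite B \<and> B \<subseteq> A}"
    then obtain l where "set l = B" using finite_list by blast
    then show "B \<in> set ` lists A" using B by (intro image_eqI[of _ _ l]) auto
  qed
  then show ?thesis by (rule small_subset[OF _ small_image[OF small_lists[OF \<open>small A\<close>]]])
qed

lemma small_def0: "small {P :: ('i::countable \<Rightarrow> 'a) \<Rightarrow> bool. def0 P}"
proof -
  have "{P :: ('i \<Rightarrow> 'a) \<Rightarrow> bool. def0 P} \<subseteq> (\<lambda>(\<phi>, xs) v. sat G (map v xs) \<phi>) ` (formulas \<times> UNIV)"
  proof
    fix P :: "('i \<Rightarrow> 'a) \<Rightarrow> bool" assume "P \<in> {P. def0 P}"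
    then obtain xs \<phi> where x: "wff (length xs) \<phi>" "\<forall>v. P v = sat G (map v xs) \<phi>"
      unfolding def0_def by (simp only: mem_Collect_eq) (elim exE conjE)
    then have "P = (\<lambda>v. sat G (map v xs) \<phi>)" by (intro ext) (simp only:)
    then show "P \<in> (\<lambda>(\<phi>, xs) v. sat G (map v xs) \<phi>) ` (formulas \<times> UNIV)"
      using wff_formulas[OF x(1)] by (intro image_eqI[of _ _ "(\<phi>, xs)"]) auto
  qed
  moreover have "small (formulas \<times> (UNIV :: 'i list set))"
    by (intro small_times small_formulas small_countable) simp
  ultimately show ?thesis using small_image small_subset by blast
qed

text \<open>Each almost 0-definable relation is a union of classes of a 0-definable equivalence
  relation with finitely many classes. There are few such equivalence relations, and each has only
  finitely many unions of classes.\<close>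

lemma small_adef: "small {P :: ('i::countable \<Rightarrow> 'a) \<Rightarrow> bool. adef P}"
proof -
  define E where "E D v v' = D (case_sum v v')" for D :: "('i + 'i \<Rightarrow> 'a) \<Rightarrow> bool" and v v'
  define I where "I = {D. def0 D \<and> equivp (E D) \<and> finite (range (E D))}"
  define A :: "_ \<Rightarrow> (('i \<Rightarrow> 'a) \<Rightarrow> bool) set"
    where "A D = {P. \<forall>v v'. E D v v' \<longrightarrow> P v = P v'}" for D
  have "{P :: ('i \<Rightarrow> 'a) \<Rightarrow> bool. adef P} \<subseteq> (\<Union>D\<in>I. A D)"
  proof
    fix P :: "('i \<Rightarrow> 'a) \<Rightarrow> bool" assume "P \<in> {P. adef P}"
    then have "adef P" by simp
    from adef_equivalence[OF this] obtain E' where E': "def0 (\<lambda>w. E' (\<lambda>i. w (Inl i)) (\<lambda>i. w (Inr i)))" "equivp E'"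
      "finite (range E')" "\<forall>v v'. E' v v' \<longrightarrow> P v = P v'" by (elim exE conjE)
    let ?D = "\<lambda>w. E' (\<lambda>i. w (Inl i)) (\<lambda>i. w (Inr i))"
    have e: "E ?D = E'" unfolding E_def by (intro ext) simp
    have "?D \<in> I" unfolding I_def mem_Collect_eq e using E' by (intro conjI)
    moreover have "P \<in> A ?D" unfolding A_def mem_Collect_eq e by (rule E'(4))
    ultimately show "P \<in> (\<Union>D\<in>I. A D)" by (rule UN_I[of ?D])
  qed
  moreover have "finite (A D)" if "D \<in> I" for D
  proof -
    have D: "equivp (E D)" "finite (range (E D))" using that by (simp_all add: I_def)
    have "A D \<subseteq> (\<lambda>S v. E D v \<in> S) ` Pow (range (E D))"
    proof
      fix P assume P: "P \<in> A D"
      have "P v = (E D v \<in> E D ` {v. P v})" for v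
      proof
        assume "E D v \<in> E D ` {v. P v}"
        then obtain v' where v': "E D v = E D v'" "P v'" by blast
        then have "E D v' v" using D(1) by (metis equivp_reflp)
        then show "P v" using P v'(2) by (simp add: A_def)
      qed simp
      then have "P = (\<lambda>v. E D v \<in> E D ` {v. P v})" by (rule ext)
      then show "P \<in> (\<lambda>S v. E D v \<in> S) ` Pow (range (E D))" by (rule image_eqI) blast
    qed
    then show ?thesis using D(2) by (metis finite_Pow_iff finite_imageI finite_subset)
  qed
  moreover have "small I" by (rule small_subset[OF _ small_def0]) (auto simp: I_def)
  ultimately show ?thesis using small_UNION[of I A] small_subset countable_finite by blast
qed

text \<open>Saturation is stated for complete types over small sets. An ultrafilter containing the
  family completes it over the parameters that occur in chosen formulas for its members.\<close>

lemma saturated1: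
  assumes dfn: "\<And>A. A \<in> \<A> \<Longrightarrow> dfn (\<lambda>v :: unit \<Rightarrow> 'a. A (v ()))" and sm: "small \<A>"
    and fip: "\<And>B. finite B \<Longrightarrow> B \<subseteq> \<A> \<Longrightarrow> \<exists>x. \<forall>A\<in>B. A x"
  shows "\<exists>x. \<forall>A\<in>\<A>. A x"
proof -
  have "\<forall>A\<in>\<A>. \<exists>p. wff (Suc (length (snd p))) (fst p) \<and> (\<forall>x. A x = sat G (x # snd p) (fst p))"
  proof
    fix A assume "A \<in> \<A>"
    from dfn_formula[of A, OF dfn[OF this]] obtain \<phi> cs where
      "wff (Suc (length cs)) \<phi>" "\<forall>x. A x = sat G (x # cs) \<phi>" by (elim exE conjE)
    then show "\<exists>p. wff (Suc (length (snd p))) (fst p) \<and> (\<forall>x. A x = sat G (x # snd p) (fst p))"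
      by (intro exI[of _ "(\<phi>, cs)"]) simp
  qed
  from bchoice[OF this] obtain p where
    p: "\<forall>A\<in>\<A>. wff (Suc (length (snd (p A)))) (fst (p A)) \<and> (\<forall>x. A x = sat G (x # snd (p A)) (fst (p A)))"
    by (elim exE)
  define B where "B = (\<Union>A\<in>\<A>. set (snd (p A)))"
  have B: "|B| <o \<kappa>" using small_UNION[OF sm, of "\<lambda>A. set (snd (p A))"]
    by (simp add: B_def small_def countable_finite)
  have "\<exists>U. ultra U \<and> (\<forall>A\<in>\<A>. U A)" by (rule ultra_extend, rule fip)
  then obtain U where U: "ultra U" "\<forall>A\<in>\<A>. U A" by (elim exE conjE)
  define q where "q = {(\<phi>, bs) \<in> formulas_over G [()] B. U (\<lambda>x. sat G (x # bs) \<phi>)}"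
  have "q \<in> complete_types G [()] B"
    unfolding complete_types_def mem_Collect_eq
  proof (intro conjI allI impI)
    show "q \<subseteq> formulas_over G [()] B" by (auto simp: q_def)
  next
    fix q0 assume q0: "finite q0 \<and> q0 \<subseteq> q"
    have "U (\<lambda>x. \<forall>p\<in>q0. sat G (x # snd p) (fst p))"
      using q0 by (subst ultra_ball[OF U(1)]) (auto simp: q_def)
    then obtain x where "\<forall>p\<in>q0. sat G (x # snd p) (fst p)" using ultra_ex[OF U(1)] by blast
    then show "\<exists>as\<in>tuples G [()]. realizes G as q0"
      by (intro bexI[of _ "[x]"]) (auto simp: realizes_def)
  next
    show "\<forall>(\<phi>, bs)\<in>formulas_over G [()] B. (\<phi>, bs) \<in> q \<or> (Neg \<phi>, bs) \<in> q"
    proof (rule ballI, clarify)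
      fix \<phi> bs assume f: "(\<phi>, bs) \<in> formulas_over G [()] B" "(Neg \<phi>, bs) \<notin> q"
      have "(Neg \<phi>, bs) \<in> formulas_over G [()] B" using f(1) by (auto simp: formulas_over_def)
      then have "\<not> U (\<lambda>x. \<not> sat G (x # bs) \<phi>)" using f(2) by (simp add: q_def)
      then show "(\<phi>, bs) \<in> q" using f(1) ultra_not[OF U(1), of "\<lambda>x. sat G (x # bs) \<phi>"] by (simp add: q_def)
    qed
  qed
  then obtain a where a: "realizes G [a] q"
    using monster B unfolding monster_def saturated_def by (auto simp: sorts_G)
  have "A a" if A: "A \<in> \<A>" for A
  proof -
    have pA: "wff (Suc (length (snd (p A)))) (fst (p A))" "\<And>x. A x = sat G (x # snd (p A)) (fst (p A))"
      using p A by simp_all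
    have "(fst (p A), snd (p A)) \<in> formulas_over G [()] B"
      using pA(1) A unfolding formulas_over_def B_def
      by (auto intro!: exI[of _ "replicate (length (snd (p A))) ()"])
    moreover have "U (\<lambda>x. sat G (x # snd (p A)) (fst (p A)))"
      unfolding pA(2)[symmetric] using U(2) A by simp
    ultimately have "(fst (p A), snd (p A)) \<in> q" by (simp add: q_def split_beta)
    then show ?thesis using a pA(2) by (auto simp: realizes_def)
  qed
  then show ?thesis by blast
qed

lemma dfn_update:
  assumes "dfn A" shows "dfn (\<lambda>w. A (\<lambda>k. if k = j then w a else w (f k)))"
  using dfn_reindex[OF assms, of "\<lambda>k. if k = j then a else f k"] by (simp add: if_distrib cong: if_cong)

text \<open>Induction on the coordinates that matter: first a value at j is found that satisfies the
  projections \<open>C B\<close> of all finite subfamilies \<open>B\<close>, and then the other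
  coordinates are filled with this value fixed.\<close>

lemma saturated_tuple:
  assumes "finite F"
  shows "(\<And>A. A \<in> \<A> \<Longrightarrow> dfn A) \<Longrightarrow> small \<A> \<Longrightarrow>
    (\<And>A v v'. A \<in> \<A> \<Longrightarrow> \<forall>i\<in>F. v i = v' i \<Longrightarrow> A v = A v') \<Longrightarrow>
    (\<And>B. finite B \<Longrightarrow> B \<subseteq> \<A> \<Longrightarrow> \<exists>y. \<forall>A\<in>B. A y) \<Longrightarrow> \<exists>y :: 'j \<Rightarrow> 'a. \<forall>A\<in>\<A>. A y"
  using assms
proof (induction F arbitrary: \<A>)
  case empty
  have "A undefined" if "A \<in> \<A>" for A
  proof -
    have "\<exists>y. \<forall>K\<in>{A}. K y" by (rule empty(4)) (use that in simp_all)
    then obtain y where "A y" by auto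
    then show ?thesis using empty(3)[OF that, of y undefined] by simp
  qed
  then show ?case by blast
next
  case (insert j F)
  define C where "C B x = (\<exists>y. \<forall>A\<in>B. A (y(j := x)))" for B :: "(('j \<Rightarrow> 'a) \<Rightarrow> bool) set" and x
  note d = dfn_update[OF insert(4)]
  have u: "y(j := x) = (\<lambda>k. if k = j then x else y k)" for x and y :: "'j \<Rightarrow> 'a" by (rule ext) simp
  have "\<exists>x. \<forall>K\<in>C ` {B. finite B \<and> B \<subseteq> \<A>}. K x"
  proof (rule saturated1)
    fix K assume "K \<in> C ` {B. finite B \<and> B \<subseteq> \<A>}"
    then obtain B where B: "finite B" "B \<subseteq> \<A>" "K = C B" by blast
    have "dfn (\<lambda>w :: unit + 'j \<Rightarrow> 'a. \<forall>A\<in>B. A (\<lambda>k. if k = j then w (Inl ()) else w (Inr k)))"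
    proof (rule dfn_ball[OF B(1)])
      fix A assume "A \<in> B"
      then have "A \<in> \<A>" using B(2) by blast
      from d[OF this, of j "Inl ()" Inr]
      show "dfn (\<lambda>w :: unit + 'j \<Rightarrow> 'a. A (\<lambda>k. if k = j then w (Inl ()) else w (Inr k)))" .
    qed
    from dfn_ex[of "\<lambda>v y. \<forall>A\<in>B. A (\<lambda>k. if k = j then v () else y k)", OF this]
    show "dfn (\<lambda>v. K (v ()))" unfolding B(3) C_def u .
  next
    show "small (C ` {B. finite B \<and> B \<subseteq> \<A>})" by (rule small_image[OF small_finite_subsets[OF insert(5)]])
  next
    fix Ks assume Ks: "finite Ks" "Ks \<subseteq> C ` {B. finite B \<and> B \<subseteq> \<A>}"
    from finite_subset_image[OF this]
    obtain Bs where Bs: "Bs \<subseteq> {B. finite B \<and> B \<subseteq> \<A>}" "finite Bs" "Ks = C ` Bs" by (elim exE conjE)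
    have "finite (\<Union>Bs)" "\<Union>Bs \<subseteq> \<A>" using Bs(1,2) by auto
    from insert(7)[OF this] obtain y where y: "\<forall>A\<in>\<Union>Bs. A y" by (elim exE)
    have "C B (y j)" if "B \<in> Bs" for B
      unfolding C_def
    proof (intro exI[of _ y] ballI)
      fix A assume "A \<in> B"
      then have "A \<in> \<Union>Bs" using that by (rule UnionI[rotated])
      from y[rule_format, OF this] show "A (y(j := y j))" by (simp only: fun_upd_triv)
    qed
    then show "\<exists>x. \<forall>K\<in>Ks. K x" using Bs(3) by blast
  qed
  then obtain x where "\<forall>K\<in>C ` {B. finite B \<and> B \<subseteq> \<A>}. K x" by (elim exE)
  then have x: "C B x" if "finite B" "B \<subseteq> \<A>" for B using that by simp
  have "\<exists>y. \<forall>K\<in>(\<lambda>A y. A (y(j := x))) ` \<A>. K y"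
  proof (rule insert.IH)
    fix K assume "K \<in> (\<lambda>A y. A (y(j := x))) ` \<A>"
    then obtain A where A: "A \<in> \<A>" "K = (\<lambda>y. A (y(j := x)))" by blast
    show "dfn K" unfolding A(2) u by (rule dfn_param1[of "\<lambda>x y. A (\<lambda>k. if k = j then x else y k)"], rule d[OF A(1)])
    fix v v' :: "'j \<Rightarrow> 'a" assume "\<forall>i\<in>F. v i = v' i"
    then show "K v = K v'" unfolding A(2) by (intro insert(6)[OF A(1)]) auto
  next
    show "small ((\<lambda>A y. A (y(j := x))) ` \<A>)" by (rule small_image[OF insert(5)])
  next
    fix Ks assume Ks: "finite Ks" "Ks \<subseteq> (\<lambda>A y. A (y(j := x))) ` \<A>"
    from finite_subset_image[OF this]
    obtain B where B: "B \<subseteq> \<A>" "finite B" "Ks = (\<lambda>A y. A (y(j := x))) ` B" by (elim exE conjE)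
    from x[OF B(2,1)] obtain y where "\<forall>A\<in>B. A (y(j := x))" unfolding C_def by (elim exE)
    then show "\<exists>y. \<forall>K\<in>Ks. K y" unfolding B(3) by (intro exI[of _ y]) simp
  qed
  then obtain y where y: "\<forall>K\<in>(\<lambda>A y. A (y(j := x))) ` \<A>. K y" by (elim exE)
  show ?case
  proof (intro exI[of _ "y(j := x)"] ballI)
    fix A assume "A \<in> \<A>"
    from y[rule_format, OF imageI[OF this]] show "A (y(j := x))" .
  qed
qed

text \<open>One direction of the equivalence of types suffices, by passing to negations; formulas
  about other tuples from \<open>F\<close> are formulas about \<open>ys\<close> after
  renaming.\<close>

lemma homogeneous:
  assumes F: "finite F" "F = set ys" and y: "\<And>\<phi>. wff (length ys) \<phi> \<Longrightarrow> sat G ys \<phi> \<Longrightarrow> sat G (map y ys) \<phi>"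
  shows "\<exists>\<sigma>. elem \<sigma> \<and> (\<forall>a\<in>F. \<sigma> a = y a)"
proof -
  have y': "sat G ys \<phi> = sat G (map y ys) \<phi>" if "wff (length ys) \<phi>" for \<phi>
    using y[of \<phi>] y[of "Neg \<phi>"] that by auto
  have "sat G as \<phi> = sat G (map y as) \<phi>" if as: "set as \<subseteq> F" "wff (length as) \<phi>" for as \<phi>
  proof -
    have "\<forall>i. \<exists>k. i < length as \<longrightarrow> k < length ys \<and> ys ! k = as ! i"
      using as(1) F(2) by (metis in_set_conv_nth nth_mem subsetD)
    from choice[OF this] obtain \<rho> where \<rho>: "\<forall>i. i < length as \<longrightarrow> \<rho> i < length ys \<and> ys ! \<rho> i = as ! i"
      by (elim exE)
    have "wff (length ys) (ren_fm \<phi> \<rho>) \<and> sat G (map h ys) (ren_fm \<phi> \<rho>) = sat G (map h as) \<phi>" for h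
      using as(2) \<rho> by (intro ren_fm_correct[of G "replicate (length as) ()"]) auto
    from this[of id] this[of y] show ?thesis using y'[of "ren_fm \<phi> \<rho>"] by simp
  qed
  then have "partial_elementary G F y"
    unfolding partial_elementary_def using unit_list by (metis length_map tuples_G)
  moreover have "|F| <o \<kappa>" using small_finite[OF F(1)] by (simp add: small_def)
  moreover have "strongly_homogeneous G \<kappa>" using monster by (simp only: monster_def)
  moreover have "F \<subseteq> (\<Union>s\<in>sorts G. univ G s)" by (simp add: sorts_G univ_G)
  ultimately have "\<exists>\<sigma>. automorphism G \<sigma> \<and> (\<forall>a\<in>F. \<sigma> a = y a)"
    unfolding strongly_homogeneous_def by blast
  then show ?thesis using automorphism_elem by blast
qed

text \<open>Otherwise saturation gives a conjugate of the parameters that defines a set outside of the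
  orbit of P.\<close>

lemma finite_orbit_adef:
  fixes P :: "('i \<Rightarrow> 'a) \<Rightarrow> bool"
  assumes P: "dfn P" and fin: "finite ((\<lambda>\<sigma> v. P (\<lambda>i. \<sigma> (v i))) ` {\<sigma>. elem \<sigma>})"
  shows "adef P"
proof -
  obtain Q where Q: "def0 Q" "P = (\<lambda>v. Q (case_sum v id))" using P by (rule dfnE)
  obtain X where X: "finite X" "\<forall>v v'. (\<forall>i\<in>X. v i = v' i) \<longrightarrow> Q v = Q v'"
    using def0_finite_support[OF Q(1)] by (elim exE conjE)
  define F where "F = {a. Inr a \<in> X}"
  have F: "finite F" using finite_vimageI[OF X(1), of Inr] by (simp add: F_def vimage_def)
  then obtain ys where ys: "set ys = F" using finite_list by blast
  define O' where "O' = (\<lambda>\<sigma> v. P (\<lambda>i. \<sigma> (v i))) ` {\<sigma>. elem \<sigma>}"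
  have cong: "Q (case_sum v y) = Q (case_sum v y')" if "\<forall>a\<in>F. y a = y' a" for v y y'
    using that by (intro X(2)[rule_format]) (auto simp: F_def split: sum.split)
  have orb: "(\<lambda>v. P (\<lambda>i. \<sigma> (v i))) = (\<lambda>v. Q (case_sum v (inv \<sigma>)))" if \<sigma>: "elem \<sigma>" for \<sigma>
  proof
    fix v :: "'i \<Rightarrow> 'a"
    have "(\<lambda>k. \<sigma> (case_sum v (inv \<sigma>) k)) = case_sum (\<lambda>i. \<sigma> (v i)) id"
      by (rule ext) (simp add: elem_inv_right[OF \<sigma>] split: sum.split)
    then show "P (\<lambda>i. \<sigma> (v i)) = Q (case_sum v (inv \<sigma>))"
      using elem_def0[OF \<sigma> Q(1), of "case_sum v (inv \<sigma>)"] Q(2) by simp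
  qed
  \<comment> \<open>\<open>N y\<close> says that the parameters \<open>y\<close> define a relation
    outside the orbit of \<open>P\<close>. It is definable because the orbit is finite.\<close>
  define N where "N y \<longleftrightarrow> (\<forall>A\<in>O'. \<exists>v. Q (case_sum v y) \<noteq> A v)" for y
  define S where "S \<phi> y = sat G (map y ys) \<phi>" for \<phi> y
  define \<Phi> where "\<Phi> = {\<phi>. wff (length ys) \<phi> \<and> sat G ys \<phi>}"
  have S: "def0 (S \<phi>)" if "\<phi> \<in> \<Phi>" for \<phi>
    using that unfolding S_def \<Phi>_def by (intro def0I[of ys \<phi>]) simp_all
  have dN: "dfn N"
    unfolding N_def
  proof (rule dfn_ball)
    show "finite O'" using fin by (simp add: O'_def)
    fix A assume "A \<in> O'"
    then obtain \<sigma> where \<sigma>: "elem \<sigma>" "A = (\<lambda>v. P (\<lambda>i. \<sigma> (v i)))" unfolding O'_def by blast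
    have A: "A = (\<lambda>v. Q (case_sum v (inv \<sigma>)))" using orb[OF \<sigma>(1)] \<sigma>(2) by simp
    have "dfn A" unfolding A by (rule dfnI[OF Q(1)])
    then have 1: "dfn (\<lambda>w :: 'a + 'i \<Rightarrow> 'a. A (\<lambda>i. w (Inr i)))" by (rule dfn_reindex)
    have "def0 (\<lambda>w :: 'a + 'i \<Rightarrow> 'a. Q (case_sum (\<lambda>i. w (Inr i)) (\<lambda>a. w (Inl a))))"
      by (rule def0_reindex[OF Q(1), of _ "\<lambda>k. case k of Inl i \<Rightarrow> Inr i | Inr a \<Rightarrow> Inl a"]) (simp split: sum.split)
    then have 2: "dfn (\<lambda>w :: 'a + 'i \<Rightarrow> 'a. Q (case_sum (\<lambda>i. w (Inr i)) (\<lambda>a. w (Inl a))))" by (rule def0_dfn)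
    have e: "(p \<noteq> q) = (p \<and> \<not> q \<or> \<not> p \<and> q)" for p q by blast
    show "dfn (\<lambda>y. \<exists>v. Q (case_sum v y) \<noteq> A v)"
      unfolding e by (intro dfn_ex dfn_disj dfn_conj dfn_not 1 2)
  qed
  have "\<not> (\<forall>B. finite B \<longrightarrow> B \<subseteq> insert N (S ` \<Phi>) \<longrightarrow> (\<exists>y. \<forall>A\<in>B. A y))"
  proof
    assume fip: "\<forall>B. finite B \<longrightarrow> B \<subseteq> insert N (S ` \<Phi>) \<longrightarrow> (\<exists>y. \<forall>A\<in>B. A y)"
    have "\<exists>y. \<forall>A\<in>insert N (S ` \<Phi>). A y"
    proof (rule saturated_tuple[OF F])
      show "dfn A" if "A \<in> insert N (S ` \<Phi>)" for A using that dN S def0_dfn by blast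
      have "\<Phi> \<subseteq> formulas" using wff_formulas by (auto simp: \<Phi>_def)
      then have "small \<Phi>" using small_formulas by (rule small_subset)
      then have "small ({N} \<union> S ` \<Phi>)" by (intro small_Un small_finite[of "{N}"] small_image) simp_all
      then show "small (insert N (S ` \<Phi>))" by simp
      show "A v = A v'" if "A \<in> insert N (S ` \<Phi>)" "\<forall>i\<in>F. v i = v' i" for A v v'
      proof -
        have "N v = N v'" unfolding N_def using cong[OF that(2)] by simp
        moreover have "S \<phi> v = S \<phi> v'" for \<phi>
          unfolding S_def using that(2) ys by (metis map_cong)
        ultimately show ?thesis using that(1) by blast
      qed
      show "\<exists>y. \<forall>A\<in>B. A y" if "finite B" "B \<subseteq> insert N (S ` \<Phi>)" for B using fip that by blast
    qed
    then obtain y where y: "N y" "\<forall>\<phi>\<in>\<Phi>. S \<phi> y" by auto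
    have "\<exists>\<sigma>. elem \<sigma> \<and> (\<forall>a\<in>F. \<sigma> a = y a)"
      using y(2) by (intro homogeneous[OF F ys[symmetric]]) (simp add: \<Phi>_def S_def)
    then obtain \<sigma> where \<sigma>: "elem \<sigma>" "\<forall>a\<in>F. \<sigma> a = y a" by (elim exE conjE)
    have "(\<lambda>v. P (\<lambda>i. inv \<sigma> (v i))) = (\<lambda>v. Q (case_sum v \<sigma>))"
      using orb[OF elem_inv[OF \<sigma>(1)]] \<sigma>(1) by (simp add: elem_def inv_inv_eq)
    also have "\<dots> = (\<lambda>v. Q (case_sum v y))" using cong[OF \<sigma>(2)] by simp
    finally have "(\<lambda>v. Q (case_sum v y)) \<in> O'"
      unfolding O'_def by (intro image_eqI[of _ _ "inv \<sigma>"]) (simp_all add: elem_inv[OF \<sigma>(1)])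
    then show False using y(1) unfolding N_def by auto
  qed
  then obtain B where B: "finite B" "B \<subseteq> insert N (S ` \<Phi>)" "\<not> (\<exists>y. \<forall>A\<in>B. A y)"
    by (simp only: not_all not_imp) (elim exE conjE)
  have "finite (B - {N})" "B - {N} \<subseteq> S ` \<Phi>" using B(1,2) by auto
  from finite_subset_image[OF this]
  obtain \<Psi> where \<Psi>: "\<Psi> \<subseteq> \<Phi>" "finite \<Psi>" "B - {N} = S ` \<Psi>" by (elim exE conjE)
  \<comment> \<open>By compactness a finite part of the type of the parameters already keeps the
    defined relation inside the orbit; this part is the condition required by
    \<open>adef\<close>.\<close>
  define \<theta> where "\<theta> y \<longleftrightarrow> (\<forall>\<phi>\<in>\<Psi>. S \<phi> y)" for y
  have "def0 \<theta>" unfolding \<theta>_def by (rule def0_ball[OF \<Psi>(2)], rule S) (use \<Psi>(1) in blast)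
  moreover have "\<theta> id" using \<Psi>(1) by (auto simp: \<theta>_def S_def \<Phi>_def)
  moreover have "(\<lambda>v. Q (case_sum v y)) \<in> O'" if "\<theta> y" for y
  proof -
    have "\<not> N y"
    proof
      assume "N y"
      have "A y" if "A \<in> B" for A
      proof (cases "A = N")
        case False
        then have "A \<in> S ` \<Psi>" using that \<Psi>(3) by blast
        then show ?thesis using \<open>\<theta> y\<close> unfolding \<theta>_def by blast
      qed (simp add: \<open>N y\<close>)
      then have "\<forall>A\<in>B. A y" by (rule ballI)
      then have "\<exists>y. \<forall>A\<in>B. A y" by (rule exI[of "\<lambda>y. \<forall>A\<in>B. A y" y])
      with B(3) show False by (rule notE)
    qed
    then obtain A where A: "A \<in> O'" "\<forall>v. Q (case_sum v y) = A v" unfolding N_def by auto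
    have "(\<lambda>v. Q (case_sum v y)) = A" by (rule ext) (rule A(2)[rule_format])
    then show ?thesis using A(1) by (simp only:)
  qed
  then have "(\<lambda>y v. Q (case_sum v y)) ` {y. \<theta> y} \<subseteq> O'" by blast
  then have "finite ((\<lambda>y v. Q (case_sum v y)) ` {y. \<theta> y})"
    by (rule finite_subset) (use fin in \<open>simp add: O'_def\<close>)
  ultimately show ?thesis unfolding Q(2) by (intro adefI[OF Q(1)])
qed

end

section \<open>Ultrafilters with almost 0-definable definitions\<close>

context one_sorted
begin

abbreviation adef1 :: "('a \<Rightarrow> bool) \<Rightarrow> bool" where
  "adef1 P \<equiv> adef (\<lambda>v :: unit \<Rightarrow> 'a. P (v ()))"

abbreviation adef2 :: "('a \<Rightarrow> 'a \<Rightarrow> bool) \<Rightarrow> bool" where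
  "adef2 R \<equiv> adef (\<lambda>v :: bool \<Rightarrow> 'a. R (v True) (v False))"

abbreviation dfn1 :: "('a \<Rightarrow> bool) \<Rightarrow> bool" where
  "dfn1 P \<equiv> dfn (\<lambda>v :: unit \<Rightarrow> 'a. P (v ()))"

lemma adef1_app: "adef1 P \<Longrightarrow> dfun f \<Longrightarrow> adef (\<lambda>v. P (f v))"
  using adef_subst[of "\<lambda>v :: unit \<Rightarrow> 'a. P (v ())" "\<lambda>_. f"] by simp

lemma adef2_app:
  assumes "adef2 R" "dfun f" "dfun g" shows "adef (\<lambda>v. R (f v) (g v))"
proof -
  have "adef (\<lambda>v. R ((if True then f else g) v) ((if False then f else g) v))"
    by (rule adef_subst[OF assms(1), of "\<lambda>b. if b then f else g"]) (simp add: assms)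
  then show ?thesis by simp
qed

lemma adef_option_app:
  assumes "adef (\<lambda>w :: 'k option \<Rightarrow> 'a. R (w None) (\<lambda>j. w (Some j)))" "dfun f" "\<And>j. dfun (H j)"
  shows "adef (\<lambda>v. R (f v) (\<lambda>j. H j v))"
proof -
  have "adef (\<lambda>v. (\<lambda>w. R (w None) (\<lambda>j. w (Some j))) (\<lambda>i. case_option f H i v))"
    by (rule adef_subst[OF assms(1)]) (simp add: assms split: option.split)
  then show ?thesis by simp
qed

lemma adef_sum_app:
  assumes "adef (\<lambda>w :: 'k + 'l \<Rightarrow> 'a. R (\<lambda>i. w (Inl i)) (\<lambda>j. w (Inr j)))" "\<And>i. dfun (F i)" "\<And>j. dfun (H j)"
  shows "adef (\<lambda>v. R (\<lambda>i. F i v) (\<lambda>j. H j v))"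
proof -
  have "adef (\<lambda>v. (\<lambda>w. R (\<lambda>i. w (Inl i)) (\<lambda>j. w (Inr j))) (\<lambda>k. case_sum F H k v))"
    by (rule adef_subst[OF assms(1)]) (simp add: assms split: sum.split)
  then show ?thesis by simp
qed

lemma dfn_option_app:
  assumes "dfn (\<lambda>w :: 'k option \<Rightarrow> 'a. R (w None) (\<lambda>j. w (Some j)))" "dfun f" "\<And>j. dfun (H j)"
  shows "dfn (\<lambda>v. R (f v) (\<lambda>j. H j v))"
proof -
  have "dfn (\<lambda>v. (\<lambda>w. R (w None) (\<lambda>j. w (Some j))) (\<lambda>i. case_option f H i v))"
    by (rule dfn_subst[OF assms(1)]) (simp add: assms split: option.split)
  then show ?thesis by simp
qed

lemma dfn_fix:
  assumes "dfn (\<lambda>w :: 'k option \<Rightarrow> 'a. R (w None) (\<lambda>j. w (Some j)))" shows "dfn1 (\<lambda>x. R x c)"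
proof -
  have "dfn (\<lambda>w :: unit + 'k \<Rightarrow> 'a. R (w (Inl ())) (\<lambda>j. w (Inr j)))"
    by (rule dfn_option_app[OF assms dfun_var dfun_var])
  from dfn_param[of "\<lambda>v u. R (v ()) u", OF this] show ?thesis .
qed

lemma dfun_if: "dfun f \<Longrightarrow> dfun g \<Longrightarrow> dfun (\<lambda>v. if c then f v else g v)"
  by (cases c) simp_all

end

context stable_group
begin

lemma dfun_zero: "dfun (\<lambda>v. 0)"
proof -
  have "def0 (\<lambda>w. w None + w None = w None)" by (intro def0_eq dfun_add dfun_var)
  then show ?thesis unfolding dfun_def by simp
qed

text \<open>Definability of types: the value at v depends only on the instances of \<open>R\<close>
  at finitely many points x of \<open>F\<close>, and \<open>H\<close> collects the patterns on
  \<open>F\<close> for which it is true.\<close>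

lemma ultra_dfn:
  assumes U: "ultra U" and R: "dfn (\<lambda>w :: 'j option \<Rightarrow> 'a. R (w None) (\<lambda>j. w (Some j)))"
  shows "dfn (\<lambda>v. U (\<lambda>x. R x v))"
proof -
  have "no_order R" by (rule no_order_dfn1[OF stable R])
  from ultra_finitely_determined[OF U this] obtain F where F: "finite F"
    "\<forall>y y'. (\<forall>x\<in>F. R x y = R x y') \<longrightarrow> U (\<lambda>x. R x y) = U (\<lambda>x. R x y')" by (elim exE conjE)
  define H where "H = (\<lambda>v. {x\<in>F. R x v}) ` {v. U (\<lambda>x. R x v)}"
  have H: "finite H" by (rule finite_subset[of _ "Pow F"]) (use F(1) in \<open>auto simp: H_def\<close>)
  have e: "U (\<lambda>x. R x v) = (\<exists>T\<in>H. \<forall>x\<in>F. x \<in> T \<and> R x v \<or> x \<notin> T \<and> \<not> R x v)" for v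
  proof
    assume "U (\<lambda>x. R x v)"
    then have "{x\<in>F. R x v} \<in> H" unfolding H_def by (intro imageI CollectI)
    then show "\<exists>T\<in>H. \<forall>x\<in>F. x \<in> T \<and> R x v \<or> x \<notin> T \<and> \<not> R x v" by (rule bexI[rotated]) blast
  next
    assume "\<exists>T\<in>H. \<forall>x\<in>F. x \<in> T \<and> R x v \<or> x \<notin> T \<and> \<not> R x v"
    then obtain T where T: "T \<in> H" "\<forall>x\<in>F. x \<in> T \<and> R x v \<or> x \<notin> T \<and> \<not> R x v" by (elim bexE)
    obtain v' where v': "T = {x\<in>F. R x v'}" "U (\<lambda>x. R x v')" using T(1) unfolding H_def by (elim imageE CollectE)
    have "\<forall>x\<in>F. R x v = R x v'" using T(2) v'(1) by blast
    then show "U (\<lambda>x. R x v)" using F(2)[rule_format, of v v'] v'(2) by simp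
  qed
  have 1: "dfn (\<lambda>v. R x v)" for x by (rule dfn_param1[of R, OF R])
  show ?thesis unfolding e
    by (rule dfn_bex[OF H], rule dfn_ball[OF F(1)]) (intro dfn_disj dfn_conj dfn_const dfn_not 1)
qed

text \<open>The ultrafilters that extend F form a minimal flow, which contains only finitely many
  R-types because one of its nonempty open sets contains only one.\<close>

lemma minimal_flow_adef:
  assumes F: "invfilter {\<sigma>. elem \<sigma>} F"
    and max: "\<forall>F'. invfilter {\<sigma>. elem \<sigma>} F' \<longrightarrow> F \<subseteq> F' \<longrightarrow> F' = F"
    and U: "ultra U" "\<forall>P\<in>F. U P"
    and R: "def0 (\<lambda>w :: 'j option \<Rightarrow> 'a. R (w None) (\<lambda>j. w (Some j)))"
  shows "adef (\<lambda>v. U (\<lambda>x. R x v))"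
proof -
  have inv: "R (\<sigma> x) (\<lambda>j. \<sigma> (v j)) = R x v" if "elem \<sigma>" for \<sigma> x v
    using elem_def0[OF that R, of "case_option x v"] by simp
  have dR: "dfn (\<lambda>w :: 'j option \<Rightarrow> 'a. R (w None) (\<lambda>j. w (Some j)))" by (rule def0_dfn[OF R])
  have nR: "no_order R" by (rule no_order_dfn1[OF stable dR])
  \<comment> \<open>\<open>Z\<close> is good if it is not negligible, that is, if some ultrafilter
    of the minimal flow contains it.\<close>
  let ?Good = "\<lambda>Z. (\<lambda>x. \<not> Z x) \<notin> F"
  have "\<exists>Z. ?Good Z \<and> (\<forall>b. \<not> (?Good (\<lambda>x. Z x \<and> R x b) \<and> ?Good (\<lambda>x. Z x \<and> \<not> R x b)))"
  proof (rule no_order_unsplittable[OF nR, of ?Good "\<lambda>x. True"])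
    show "(\<lambda>x. \<not> True) \<notin> F" using invfilterD(2)[OF F] by simp
    fix Z assume Z: "(\<lambda>x. \<not> Z x) \<notin> F"
    show "\<exists>x. Z x"
    proof (rule ccontr)
      assume "\<not> (\<exists>x. Z x)"
      then have "\<not> Z x" for x by blast
      then have "(\<lambda>x. \<not> Z x) \<in> F" using invfilterD(1)[OF F] by simp
      with Z show False by (rule notE)
    qed
  qed
  then obtain Z where Z: "(\<lambda>x. \<not> Z x) \<notin> F"
    "\<forall>b. \<not> ((\<lambda>x. \<not> (Z x \<and> R x b)) \<notin> F \<and> (\<lambda>x. \<not> (Z x \<and> \<not> R x b)) \<notin> F)"
    by (elim exE conjE)
  have "\<exists>S. finite S \<and> S \<subseteq> {\<sigma>. elem \<sigma>} \<and> (\<lambda>x. \<exists>\<sigma>\<in>S. Z (\<sigma> x)) \<in> F"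
    using maximal_invfilter_cover[OF F max, of Z] Z(1) elem_id elem_comp by (simp only: mem_Collect_eq simp_thms)
  then obtain S where S: "finite S" "S \<subseteq> {\<sigma>. elem \<sigma>}" "(\<lambda>x. \<exists>\<sigma>\<in>S. Z (\<sigma> x)) \<in> F" by (elim exE conjE)
  \<comment> \<open>No instance of \<open>R\<close> splits \<open>Z\<close>, so all ultrafilters of
    the flow that contain \<open>Z\<close> have the same R-type. \<open>t \<sigma>\<close> is this
    type pulled back along \<open>\<sigma>\<close>; since the translates of \<open>Z\<close> by
    \<open>S\<close> cover, every R-type of the flow is among these finitely many.\<close>
  define t :: "('a \<Rightarrow> 'a) \<Rightarrow> ('j \<Rightarrow> 'a) \<Rightarrow> bool" where "t \<sigma> b \<longleftrightarrow> (\<lambda>x. \<not> (Z x \<and> \<not> R x (\<lambda>j. \<sigma> (b j)))) \<in> F" for \<sigma> b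
  have V: "\<exists>\<sigma>\<in>S. \<forall>b. V (\<lambda>x. R x b) = t \<sigma> b" if V: "ultra V" "\<forall>P\<in>F. V P" for V
  proof -
    have "V (\<lambda>x. \<exists>\<sigma>\<in>S. Z (\<sigma> x))" using V(2) S(3) by blast
    then obtain \<sigma> where \<sigma>: "\<sigma> \<in> S" "V (\<lambda>x. Z (\<sigma> x))" unfolding ultra_bex[OF V(1) S(1)] by blast
    have el: "elem \<sigma>" using \<sigma>(1) S(2) by blast
    have VF: "V (\<lambda>x. P (\<sigma> x))" if "P \<in> F" for P using V(2) invfilterD(5)[OF F that] el by simp
    have "V (\<lambda>x. R x b) = t \<sigma> b" for b
    proof
      assume r: "V (\<lambda>x. R x b)"
      have "\<not> (\<lambda>x. \<not> (Z x \<and> R x (\<lambda>j. \<sigma> (b j)))) \<in> F"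
      proof
        assume "(\<lambda>x. \<not> (Z x \<and> R x (\<lambda>j. \<sigma> (b j)))) \<in> F"
        from VF[OF this] show False using r \<sigma>(2)
          by (simp only: inv[OF el] ultra_not[OF V(1)] ultra_conj[OF V(1)] simp_thms)
      qed
      then show "t \<sigma> b" using Z(2)[THEN spec, of "\<lambda>j. \<sigma> (b j)"] unfolding t_def by blast
    next
      assume "t \<sigma> b"
      from VF[OF this[unfolded t_def]] show "V (\<lambda>x. R x b)" using \<sigma>(2)
        by (simp only: inv[OF el] ultra_not[OF V(1)] ultra_conj[OF V(1)] simp_thms)
    qed
    then show ?thesis using \<sigma>(1) by blast
  qed
  show ?thesis
  proof (rule finite_orbit_adef)
    show "dfn (\<lambda>v. U (\<lambda>x. R x v))" by (rule ultra_dfn[OF U(1) dR])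
    have "(\<lambda>\<tau> v. U (\<lambda>x. R x (\<lambda>j. \<tau> (v j)))) ` {\<tau>. elem \<tau>} \<subseteq> t ` S"
    proof (rule image_subsetI)
      fix \<tau> assume "\<tau> \<in> {\<tau>. elem \<tau>}"
      then have \<tau>: "elem \<tau>" by simp
      let ?V = "\<lambda>P. U (\<lambda>x. P (inv \<tau> x))"
      have "\<forall>P\<in>F. ?V P"
      proof
        fix P assume "P \<in> F"
        then have "(\<lambda>x. P (inv \<tau> x)) \<in> F" by (rule invfilterD(5)[OF F]) (simp add: elem_inv[OF \<tau>])
        then show "?V P" using U(2) by (rule bspec[rotated])
      qed
      from V[OF ultra_map[OF U(1)] this] obtain \<sigma> where \<sigma>: "\<sigma> \<in> S" "\<forall>b. U (\<lambda>x. R (inv \<tau> x) b) = t \<sigma> b"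
        by (elim bexE)
      have "R x (\<lambda>j. \<tau> (v j)) = R (inv \<tau> x) v" for x v
        using inv[OF \<tau>, of "inv \<tau> x" v] by (simp only: elem_inv_right[OF \<tau>])
      then have "(\<lambda>v. U (\<lambda>x. R x (\<lambda>j. \<tau> (v j)))) = t \<sigma>" using \<sigma>(2) by (intro ext) simp
      then show "(\<lambda>v. U (\<lambda>x. R x (\<lambda>j. \<tau> (v j)))) \<in> t ` S" using \<sigma>(1) by (rule image_eqI)
    qed
    then show "finite ((\<lambda>\<tau> v. U (\<lambda>x. R x (\<lambda>j. \<tau> (v j)))) ` {\<tau>. elem \<tau>})"
      using finite_imageI[OF S(1)] by (rule finite_subset)
  qed
qed

text \<open>This describes the global nonforking extension of the strong type of a, up to its trace
  on definable sets.\<close>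

definition global_ext :: "'a \<Rightarrow> (('a \<Rightarrow> bool) \<Rightarrow> bool) \<Rightarrow> bool" where
  "global_ext a U \<longleftrightarrow> ultra U \<and> (\<forall>P. adef1 P \<longrightarrow> P a \<longrightarrow> U P) \<and>
     (\<forall>R. adef (\<lambda>w :: nat option \<Rightarrow> 'a. R (w None) (\<lambda>j. w (Some j))) \<longrightarrow>
        adef (\<lambda>v :: nat \<Rightarrow> 'a. U (\<lambda>x. R x v)))"

text \<open>As the representative c varies over everything only finitely many classes arise, so the
  trivial condition serves as \<open>\<theta>\<close>.\<close>

lemma adef_class:
  assumes "def0 (\<lambda>w :: 'i + 'i \<Rightarrow> 'a. E (\<lambda>i. w (Inl i)) (\<lambda>i. w (Inr i)))" "finite (range E)"
  shows "adef (E c)"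
proof -
  have "def0 (\<lambda>w :: 'i + 'i \<Rightarrow> 'a. (\<lambda>w. E (\<lambda>i. w (Inl i)) (\<lambda>i. w (Inr i)))
     (\<lambda>k. w (case k of Inl i \<Rightarrow> Inr i | Inr i \<Rightarrow> Inl i)))" by (rule def0_reindex[OF assms(1) refl])
  then have "def0 (\<lambda>w :: 'i + 'i \<Rightarrow> 'a. E (\<lambda>i. w (Inr i)) (\<lambda>i. w (Inl i)))" by simp
  from adefI[OF this def0_const[of True], of c] show ?thesis using assms(2) by simp
qed

text \<open>A minimal flow is taken inside the ultrafilters concentrated on the orbit of a. It meets
  the strong type of a, and any ultrafilter in the intersection has almost 0-definable
  definitions.\<close>

lemma global_ext_exists: "\<exists>U. global_ext a U"
proof -
  let ?H = "{\<sigma>. elem \<sigma>}"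
  define F0 where "F0 = {P. \<forall>\<sigma>. elem \<sigma> \<longrightarrow> P (\<sigma> a)}"
  have "invfilter ?H F0" unfolding invfilter_def
  proof (intro conjI ballI allI impI)
    show "(\<lambda>x. False) \<notin> F0" using elem_id by (auto simp: F0_def)
    fix P \<sigma> assume "P \<in> F0" "\<sigma> \<in> ?H"
    then have P: "P (\<tau> a)" if "elem \<tau>" for \<tau> using that by (simp add: F0_def)
    have "P (\<sigma> (\<tau> a))" if "elem \<tau>" for \<tau>
      using P[OF elem_comp[OF _ that, of \<sigma>]] \<open>\<sigma> \<in> ?H\<close> by simp
    then show "(\<lambda>x. P (\<sigma> x)) \<in> F0" unfolding F0_def by simp
  qed (simp_all add: F0_def)
  from maximal_invfilter[OF this] obtain F where F: "invfilter ?H F" "F0 \<subseteq> F"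
    and max: "\<forall>F'. invfilter ?H F' \<longrightarrow> F \<subseteq> F' \<longrightarrow> F' = F" by (elim exE conjE)
  define p where "p = {P. adef1 P \<and> P a}"
  have fip: "\<exists>x. \<forall>P\<in>B. P x" if B: "finite B" "B \<subseteq> F \<union> p" for B
  proof (rule ccontr)
    assume n: "\<not> (\<exists>x. \<forall>P\<in>B. P x)"
    define P where "P x \<longleftrightarrow> (\<forall>P\<in>B - F. P x)" for x
    have Bp: "adef1 Q \<and> Q a" if "Q \<in> B - F" for Q using that B(2) by (auto simp: p_def)
    have aP: "adef1 P" unfolding P_def using Bp B(1) by (intro adef_ball) simp_all
    have Pa: "P a" unfolding P_def using Bp by blast
    have "(\<lambda>x. \<forall>P\<in>B \<inter> F. P x) \<in> F" using B(1) by (intro invfilter_ball[OF F(1)]) simp_all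
    then have nP: "(\<lambda>x. \<not> P x) \<in> F"
    proof (rule invfilterD(4)[OF F(1)])
      fix x assume x: "\<forall>P\<in>B \<inter> F. P x"
      show "\<not> P x"
      proof
        assume "P x"
        have "\<forall>Q\<in>B. Q x"
        proof
          fix Q assume Q: "Q \<in> B"
          show "Q x"
          proof (cases "Q \<in> F")
            case True
            then have "Q \<in> B \<inter> F" using Q by blast
            from x[THEN bspec, OF this] show ?thesis .
          next
            case False
            then have "Q \<in> B - F" using Q by blast
            from \<open>P x\<close>[unfolded P_def, THEN bspec, OF this] show ?thesis .
          qed
        qed
        then have "\<exists>x. \<forall>P\<in>B. P x" by (rule exI[of "\<lambda>x. \<forall>P\<in>B. P x" x])
        with n show False by (rule notE)
      qed
    qed
    \<comment> \<open>If a member \<open>P\<close> of the strong type were negligible, its finitely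
      many conjugates would be jointly negligible. But they cover the orbit of a, and sets
      containing the orbit belong to \<open>F0\<close>.\<close>
    define K where "K = (\<lambda>\<sigma> v. P (\<sigma> (v ()))) ` ?H"
    have K: "finite K" unfolding K_def using adef_finite_orbit[OF aP] .
    have 1: "(\<lambda>x. \<forall>k\<in>K. \<not> k (\<lambda>_. x)) \<in> F"
    proof (rule invfilter_ball[OF F(1) K])
      fix k assume "k \<in> K"
      then obtain \<sigma> where \<sigma>: "\<sigma> \<in> ?H" "k = (\<lambda>v. P (\<sigma> (v ())))" unfolding K_def by (elim imageE)
      show "(\<lambda>x. \<not> k (\<lambda>_. x)) \<in> F" unfolding \<sigma>(2) by (rule invfilterD(5)[OF F(1) nP \<sigma>(1)])
    qed
    have 2: "(\<lambda>x. \<exists>\<sigma>\<in>?H. P (\<sigma> x)) \<in> F"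
    proof (rule subsetD[OF F(2)])
      have "\<exists>\<sigma>\<in>?H. P (\<sigma> (\<tau> a))" if "elem \<tau>" for \<tau>
        using elem_inv[OF that] elem_inv_left[OF that] Pa by (intro bexI[of _ "inv \<tau>"]) simp_all
      then show "(\<lambda>x. \<exists>\<sigma>\<in>?H. P (\<sigma> x)) \<in> F0" by (simp add: F0_def)
    qed
    have "((\<forall>k\<in>K. \<not> k (\<lambda>_. x)) \<and> (\<exists>\<sigma>\<in>?H. P (\<sigma> x))) = False" for x by (auto simp: K_def)
    then show False using invfilterD(3)[OF F(1) 1 2] invfilterD(2)[OF F(1)] by (simp only:)
  qed
  have "\<exists>U. ultra U \<and> (\<forall>P\<in>F \<union> p. U P)" by (rule ultra_extend, rule fip)
  then obtain U where U: "ultra U" "\<forall>P\<in>F \<union> p. U P" by (elim exE conjE)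
  have UF: "\<forall>P\<in>F. U P" using U(2) by blast
  have "adef (\<lambda>v :: nat \<Rightarrow> 'a. U (\<lambda>x. R x v))"
    if R: "adef (\<lambda>w :: nat option \<Rightarrow> 'a. R (w None) (\<lambda>j. w (Some j)))" for R
  proof -
    \<comment> \<open>\<open>minimal_flow_adef\<close> treats relations without parameters. Hence it
      is applied to the equivalence relation \<open>E\<close> with a representative z as extra
      variable; afterwards z is confined to the class of c, and \<open>R\<close> is a union of
      finitely many classes.\<close>
    let ?R = "\<lambda>w. R (w None) (\<lambda>j. w (Some j))"
    from adef_equivalence[OF R] obtain E where
      E: "def0 (\<lambda>w :: nat option + nat option \<Rightarrow> 'a. E (\<lambda>i. w (Inl i)) (\<lambda>i. w (Inr i)))" "equivp E" "finite (range E)"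
        "\<forall>v v'. E v v' \<longrightarrow> ?R v = ?R v'" by (elim exE conjE)
    have Er: "E v v" for v using E(2) by (rule equivp_reflp)
    have Ec: "E z = E c" if "E c z" for c z using E(2) that by (simp add: equivp_def)
    have 1: "def0 (\<lambda>w :: (nat + nat option) option \<Rightarrow> 'a. E (\<lambda>i. w (Some (Inr i))) (case_option (w None) (\<lambda>j. w (Some (Inl j)))))"
      by (rule def0_reindex[OF E(1), of "\<lambda>w. case_sum (\<lambda>i. w (Some (Inr i))) (case_option (w None) (\<lambda>j. w (Some (Inl j))))"
          "\<lambda>k. case k of Inl i \<Rightarrow> Some (Inr i) | Inr None \<Rightarrow> None | Inr (Some j) \<Rightarrow> Some (Inl j)", simplified])
        (simp split: sum.split option.split)
    have 2: "adef (\<lambda>u :: nat + nat option \<Rightarrow> 'a. U (\<lambda>x. E (\<lambda>i. u (Inr i)) (case_option x (\<lambda>j. u (Inl j)))))"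
      by (rule minimal_flow_adef[OF F(1) max U(1) UF, of "\<lambda>x u. E (\<lambda>i. u (Inr i)) (case_option x (\<lambda>j. u (Inl j)))", OF 1])
    have 3: "adef (\<lambda>v. U (\<lambda>x. E c (case_option x v)))" for c
    proof -
      have "adef (\<lambda>u :: nat + nat option \<Rightarrow> 'a. E c (\<lambda>i. u (Inr i)))"
        by (rule adef_reindex[OF adef_class[OF E(1,3)] refl])
      from adef_conj[OF this 2]
      have "adef (\<lambda>v. \<exists>z. E c z \<and> U (\<lambda>x. E z (case_option x v)))" by (rule adef_ex)
      moreover have "(\<exists>z. E c z \<and> U (\<lambda>x. E z (case_option x v))) = U (\<lambda>x. E c (case_option x v))" for v
      proof
        assume "\<exists>z. E c z \<and> U (\<lambda>x. E z (case_option x v))"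
        then obtain z where "E c z" "U (\<lambda>x. E z (case_option x v))" by (elim exE conjE)
        then show "U (\<lambda>x. E c (case_option x v))" by (simp only: Ec)
      next
        assume "U (\<lambda>x. E c (case_option x v))"
        with Er[of c] show "\<exists>z. E c z \<and> U (\<lambda>x. E z (case_option x v))" by (intro exI[of _ c] conjI)
      qed
      ultimately show ?thesis by (simp only:)
    qed
    define C where "C = E ` {w. ?R w}"
    have C: "finite C" by (rule finite_subset[OF _ E(3)]) (auto simp: C_def)
    have "R x v = (\<exists>k\<in>C. k (case_option x v))" for x v
    proof
      assume "R x v"
      then have "E (case_option x v) \<in> C" unfolding C_def by (intro imageI) simp
      with Er show "\<exists>k\<in>C. k (case_option x v)" by (intro bexI[of _ "E (case_option x v)"])
    next
      assume "\<exists>k\<in>C. k (case_option x v)"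
      then obtain c where "?R c" "E c (case_option x v)" unfolding C_def by auto
      then show "R x v" using E(4)[rule_format, of c "case_option x v"] by simp
    qed
    then have "U (\<lambda>x. R x v) = (\<exists>k\<in>C. U (\<lambda>x. k (case_option x v)))" for v
      by (simp only: ultra_bex[OF U(1) C])
    moreover have "adef (\<lambda>v. \<exists>k\<in>C. U (\<lambda>x. k (case_option x v)))"
    proof (rule adef_bex[OF C])
      fix k assume "k \<in> C"
      then obtain c where "k = E c" unfolding C_def by (elim imageE)
      then show "adef (\<lambda>v. U (\<lambda>x. k (case_option x v)))" using 3 by (simp only:)
    qed
    ultimately show ?thesis by (simp only:)
  qed
  then have "global_ext a U" unfolding global_ext_def using U by (auto simp: p_def)
  then show ?thesis by (rule exI[of "global_ext a" U])
qed

lemma global_ext_ultra: "global_ext a U \<Longrightarrow> ultra U"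
  unfolding global_ext_def by (elim conjE)

text \<open>\<open>global_ext\<close> had to fix one index type; any countable one is coded in
  nat.\<close>

lemma global_ext_adef:
  assumes U: "global_ext a U" and R: "adef (\<lambda>w :: 'j::countable option \<Rightarrow> 'a. R (w None) (\<lambda>j. w (Some j)))"
  shows "adef (\<lambda>v. U (\<lambda>x. R x v))"
proof -
  have "adef (\<lambda>w :: nat option \<Rightarrow> 'a. R (w None) (\<lambda>j. w (Some (to_nat j))))"
    by (rule adef_option_app[OF R dfun_var dfun_var])
  then have "adef (\<lambda>v :: nat \<Rightarrow> 'a. U (\<lambda>x. R x (\<lambda>j. v (to_nat j))))"
    by (rule U[unfolded global_ext_def, THEN conjunct2, THEN conjunct2, rule_format, of "\<lambda>x v. R x (\<lambda>j. v (to_nat j))"])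
  from adef_reindex[OF this, of "\<lambda>v n. v (from_nat n)" "from_nat :: nat \<Rightarrow> 'j"] show ?thesis by simp
qed

lemma global_ext_iff:
  assumes U: "global_ext a U" and P: "adef1 P" shows "U P = P a"
proof -
  have t: "\<forall>P. adef1 P \<longrightarrow> P a \<longrightarrow> U P" using U[unfolded global_ext_def] by (elim conjE)
  show ?thesis using t[rule_format, OF P] t[rule_format, OF adef_not[OF P]] ultra_not[OF global_ext_ultra[OF U], of P] by blast
qed

lemma no_order_adef2: "adef2 R \<Longrightarrow> no_order R"
proof -
  assume R: "adef2 R"
  have "adef (\<lambda>w :: unit option \<Rightarrow> 'a. R (w None) (w (Some ())))"
    by (rule adef2_app[OF R dfun_var dfun_var])
  then have "no_order (\<lambda>x (v :: unit \<Rightarrow> 'a). R x (v ()))" by (intro no_order_dfn1[OF stable] adef_dfn)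
  from no_order_comp[OF this, of "\<lambda>x. x" "\<lambda>y _. y"] show ?thesis by simp
qed

lemma global_ext_adef2:
  assumes U: "global_ext a U" and R: "adef2 R" shows "adef1 (\<lambda>y. U (\<lambda>x. R x y))"
proof -
  have "adef (\<lambda>w :: unit option \<Rightarrow> 'a. R (w None) (w (Some ())))"
    by (rule adef2_app[OF R dfun_var dfun_var])
  from global_ext_adef[OF U, of "\<lambda>x v. R x (v ())", OF this] show ?thesis .
qed

lemma adef2_swap: "adef2 R \<Longrightarrow> adef2 (\<lambda>x y. R y x)"
  by (rule adef2_app[OF _ dfun_var dfun_var])

text \<open>Both sides equal the iterated limits of R.\<close>

lemma global_ext_symmetric:
  assumes U: "global_ext a U" and V: "global_ext b V" and R: "adef2 R"
  shows "U (\<lambda>x. R x b) = V (\<lambda>y. R a y)"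
proof -
  have "U (\<lambda>x. R x b) = V (\<lambda>y. U (\<lambda>x. R x y))"
    using global_ext_iff[OF V global_ext_adef2[OF U R]] by simp
  also have "\<dots> = U (\<lambda>x. V (\<lambda>y. R x y))"
    using ultra_symmetric[OF global_ext_ultra[OF U] global_ext_ultra[OF V] no_order_adef2[OF R]] by simp
  also have "\<dots> = V (\<lambda>y. R a y)"
    using global_ext_iff[OF U global_ext_adef2[OF V adef2_swap[OF R]]] by simp
  finally show ?thesis .
qed

section \<open>Morley sequences\<close>

text \<open>Padding turns a finite initial segment into a total tuple, so that one index type serves
  for all lengths.\<close>

definition initial :: "nat \<Rightarrow> (nat \<Rightarrow> 'a) \<Rightarrow> nat \<Rightarrow> 'a" where
  "initial n g i = (if i < n then g i else 0)"

text \<open>The witnesses s play the role of further parameters, chosen from initial segments.\<close>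

lemma morley_sequence:
  fixes h :: "'h::countable \<Rightarrow> 'a" and s :: "nat \<Rightarrow> (nat \<Rightarrow> 'a) \<Rightarrow> 'j \<Rightarrow> 'a"
  assumes U: "ultra U" and S: "dfn (\<lambda>w :: 'j option \<Rightarrow> 'a. S (w None) (\<lambda>j. w (Some j)))"
  shows "\<exists>g. \<forall>n. (\<forall>Q. adef (\<lambda>w :: ('h + nat) option \<Rightarrow> 'a. Q (w None) (\<lambda>k. w (Some k))) \<longrightarrow>
      Q (g n) (case_sum h (initial n g)) = U (\<lambda>y. Q y (case_sum h (initial n g)))) \<and>
    (\<forall>m\<le>n. S (g n) (s m (initial m g)) = U (\<lambda>y. S y (s m (initial m g))))"
proof -
  define Qs where "Qs = {P :: (('h + nat) option \<Rightarrow> 'a) \<Rightarrow> bool. adef P}"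
  define app where "app P y c = P (case_option y c)" for P :: "(('h + nat) option \<Rightarrow> 'a) \<Rightarrow> bool" and y c
  \<comment> \<open>The new term decides almost 0-definable relations over \<open>h\<close> and the
    earlier terms as \<open>U\<close> does, and likewise the instances of \<open>S\<close> at the
    witnesses \<open>s m\<close>. The latter depend only on the first m terms, so for m up to the
    current length they are already known and finite in number.\<close>
  define \<Phi> where "\<Phi> xs y \<longleftrightarrow>
     (\<forall>P\<in>Qs. app P y (case_sum h (initial (length xs) (\<lambda>i. xs ! i))) =
        U (\<lambda>y. app P y (case_sum h (initial (length xs) (\<lambda>i. xs ! i))))) \<and>
     (\<forall>m\<in>{..length xs}. S y (s m (initial m (\<lambda>i. xs ! i))) = U (\<lambda>y. S y (s m (initial m (\<lambda>i. xs ! i)))))" for xs y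
  have "\<exists>y. \<Phi> xs y" for xs
  proof -
    let ?c = "case_sum h (initial (length xs) (\<lambda>i. xs ! i))"
    define A where "A P y \<longleftrightarrow> app P y ?c = U (\<lambda>y. app P y ?c)" for P y
    define B where "B m y \<longleftrightarrow> S y (s m (initial m (\<lambda>i. xs ! i))) = U (\<lambda>y. S y (s m (initial m (\<lambda>i. xs ! i))))" for m y
    have eqc: "dfn1 (\<lambda>y. P y = c)" if "dfn1 P" for P c
      using that dfn_not[OF that] by (cases c) simp_all
    have UA: "U (\<lambda>y. (K y) = U K)" for K by (simp add: ultra_iff[OF U] ultra_const[OF U])
    have U1: "U K" if "K \<in> A ` Qs \<union> B ` {..length xs}" for K
      using that UA unfolding A_def B_def by (elim UnE imageE) (simp_all only:)
    have "\<exists>y. \<forall>K\<in>A ` Qs \<union> B ` {..length xs}. K y"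
    proof (rule saturated1)
      fix K assume "K \<in> A ` Qs \<union> B ` {..length xs}"
      then show "dfn1 K"
      proof (elim UnE imageE)
        fix P assume "K = A P" "P \<in> Qs"
        have "dfn (\<lambda>w :: ('h + nat) option \<Rightarrow> 'a. app P (w None) (\<lambda>k. w (Some k)))"
        proof -
          have "case_option (w None) (\<lambda>k. w (Some k)) = w" for w :: "('h + nat) option \<Rightarrow> 'a"
            by (rule ext) (simp split: option.split)
          then show ?thesis using \<open>P \<in> Qs\<close> by (simp add: app_def Qs_def adef_dfn)
        qed
        from eqc[OF dfn_fix[of "app P", OF this]] show "dfn1 K" unfolding \<open>K = A P\<close> A_def .
      next
        fix m assume "K = B m"
        show "dfn1 K" unfolding \<open>K = B m\<close> B_def by (rule eqc[OF dfn_fix[of S, OF S]])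
      qed
    next
      have "small (A ` Qs)" unfolding Qs_def by (rule small_image[OF small_adef])
      then show "small (A ` Qs \<union> B ` {..length xs})" by (rule small_Un) (rule small_finite, simp)
    next
      fix C assume C: "finite C" "C \<subseteq> A ` Qs \<union> B ` {..length xs}"
      have "U (\<lambda>y. \<forall>K\<in>C. K y)" unfolding ultra_ball[OF U C(1)] using U1 C(2) by blast
      from ultra_ex[OF U this] show "\<exists>y. \<forall>K\<in>C. K y" .
    qed
    then obtain y where y: "\<forall>K\<in>A ` Qs \<union> B ` {..length xs}. K y" by (elim exE)
    have "\<Phi> xs y" unfolding \<Phi>_def
    proof (intro conjI ballI)
      fix P assume "P \<in> Qs"
      then have "A P y" using y by (simp add: ball_Un)
      then show "app P y ?c = U (\<lambda>y. app P y ?c)" unfolding A_def .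
    next
      fix m assume "m \<in> {..length xs}"
      then have "B m y" using y by (simp add: ball_Un)
      then show "S y (s m (initial m (\<lambda>i. xs ! i))) = U (\<lambda>y. S y (s m (initial m (\<lambda>i. xs ! i))))"
        unfolding B_def .
    qed
    then show ?thesis by (rule exI)
  qed
  from choose_sequence[of \<Phi>, OF this] obtain g where g: "\<forall>n. \<Phi> (map g [0..<n]) (g n)" by (elim exE)
  have i: "initial m (\<lambda>i. map g [0..<n] ! i) = initial m g" if "m \<le> n" for m n
    using that by (intro ext) (simp add: initial_def)
  have g': "(\<forall>P\<in>Qs. app P (g n) (case_sum h (initial n g)) = U (\<lambda>y. app P y (case_sum h (initial n g)))) \<and>
     (\<forall>m\<in>{..n}. S (g n) (s m (initial m g)) = U (\<lambda>y. S y (s m (initial m g))))" for n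
    using g[rule_format, of n] unfolding \<Phi>_def by (simp add: i)
  show ?thesis
  proof (intro exI[of _ g] allI conjI impI)
    fix n and Q :: "'a \<Rightarrow> ('h + nat \<Rightarrow> 'a) \<Rightarrow> bool"
    assume "adef (\<lambda>w :: ('h + nat) option \<Rightarrow> 'a. Q (w None) (\<lambda>k. w (Some k)))"
    then have "(\<lambda>w. Q (w None) (\<lambda>k. w (Some k))) \<in> Qs" by (simp add: Qs_def)
    from g'[of n, THEN conjunct1, rule_format, OF this]
    show "Q (g n) (case_sum h (initial n g)) = U (\<lambda>y. Q y (case_sum h (initial n g)))" by (simp add: app_def)
  next
    fix n m :: nat assume "m \<le> n"
    then show "S (g n) (s m (initial m g)) = U (\<lambda>y. S y (s m (initial m g)))" using g'[of n] by simp
  qed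
qed

text \<open>The n-fold product of \<open>U\<close>: coordinate 0 is the outermost quantifier and the
  last coordinate the innermost, as in the type of a Morley sequence. Coordinates from n on stay at
  0.\<close>

primrec iter :: "(('a \<Rightarrow> bool) \<Rightarrow> bool) \<Rightarrow> nat \<Rightarrow> ((nat \<Rightarrow> 'a) \<Rightarrow> bool) \<Rightarrow> bool" where
  "iter U 0 P = P (\<lambda>_. 0)"
| "iter U (Suc n) P = iter U n (\<lambda>v. U (\<lambda>y. P (v(n := y))))"

text \<open>Every increasing n-tuple realizes the n-fold product over \<open>h\<close>: the term
  with the last index is generic over all earlier terms, so it can be replaced by the innermost
  quantifier, and induction handles the rest.\<close>

lemma morley_indiscernible:
  fixes h :: "'h::countable \<Rightarrow> 'a"
  assumes U: "global_ext a U"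
    and g: "\<forall>n. \<forall>Q. adef (\<lambda>w :: ('h + nat) option \<Rightarrow> 'a. Q (w None) (\<lambda>k. w (Some k))) \<longrightarrow>
      Q (g n) (case_sum h (initial n g)) = U (\<lambda>y. Q y (case_sum h (initial n g)))"
  shows "adef (\<lambda>w :: 'h + nat \<Rightarrow> 'a. Q (\<lambda>i. w (Inl i)) (\<lambda>j. w (Inr j))) \<Longrightarrow>
    (\<forall>c v v'. (\<forall>j<n. v j = v' j) \<longrightarrow> Q c v = Q c v') \<Longrightarrow>
    (\<forall>j<n. \<forall>j'<j. i j' < (i j :: nat)) \<Longrightarrow> Q h (\<lambda>j. g (i j)) = iter U n (Q h)"
proof (induction n arbitrary: Q)
  case 0
  have "Q h (\<lambda>j. g (i j)) = Q h (\<lambda>_. 0)" by (rule 0(2)[rule_format]) simp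
  then show ?case by (simp only: iter.simps)
next
  case (Suc n)
  note Q = Suc.prems(1) and supp = Suc.prems(2)[rule_format] and mono = Suc.prems(3)[rule_format]
  have "adef (\<lambda>w :: ('h + nat) option \<Rightarrow> 'a. Q (\<lambda>i. w (Some (Inl i))) (\<lambda>j. if j = n then w None else w (Some (Inr j))))"
    by (rule adef_sum_app[OF Q dfun_var]) (intro dfun_if dfun_var)
  from global_ext_adef[OF U, of "\<lambda>y u. Q (\<lambda>i. u (Inl i)) (\<lambda>j. if j = n then y else u (Inr j))", OF this]
  have Q': "adef (\<lambda>u. U (\<lambda>y. Q (\<lambda>i. u (Inl i)) ((\<lambda>j. u (Inr j))(n := y))))" by (simp only: fun_upd_def)
  have IH: "U (\<lambda>y. Q h ((\<lambda>j. g (i j))(n := y))) = iter U n (\<lambda>v. U (\<lambda>y. Q h (v(n := y))))"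
  proof (rule Suc.IH[of "\<lambda>c v. U (\<lambda>y. Q c (v(n := y)))", OF Q'])
    show "\<forall>c v v'. (\<forall>j<n. v j = v' j) \<longrightarrow> U (\<lambda>y. Q c (v(n := y))) = U (\<lambda>y. Q c (v'(n := y)))"
    proof (intro allI impI)
      fix c v v' assume "\<forall>j<n. v j = (v' j :: 'a)"
      then have "Q c (v(n := y)) = Q c (v'(n := y))" for y by (intro supp) (auto simp: less_Suc_eq)
      then show "U (\<lambda>y. Q c (v(n := y))) = U (\<lambda>y. Q c (v'(n := y)))" by (simp only:)
    qed
    show "\<forall>j<n. \<forall>j'<j. i j' < i j" using mono by simp
  qed
  have "adef (\<lambda>w :: ('h + nat) option \<Rightarrow> 'a. Q (\<lambda>k. w (Some (Inl k))) (\<lambda>j. if j = n then w None else w (Some (Inr (i j)))))"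
    by (rule adef_sum_app[OF Q dfun_var]) (intro dfun_if dfun_var)
  from g[rule_format, of "\<lambda>y u. Q (\<lambda>k. u (Inl k)) (\<lambda>j. if j = n then y else u (Inr (i j)))" "i n", OF this]
  have 1: "Q h (\<lambda>j. if j = n then g (i n) else initial (i n) g (i j)) =
    U (\<lambda>y. Q h (\<lambda>j. if j = n then y else initial (i n) g (i j)))" unfolding sum.case .
  have 2: "Q h (\<lambda>j. if j = n then y else initial (i n) g (i j)) = Q h ((\<lambda>j. g (i j))(n := y))" for y
    using mono[of n] by (intro supp) (auto simp: less_Suc_eq initial_def)
  have "(\<lambda>j. g (i j))(n := g (i n)) = (\<lambda>j. g (i j))" by (rule ext) simp
  then have "Q h (\<lambda>j. g (i j)) = U (\<lambda>y. Q h ((\<lambda>j. g (i j))(n := y)))" using 1 unfolding 2 by (simp only:)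
  then show ?case using IH by simp
qed

text \<open>A Morley sequence in the type of b witnesses that R(x, b) divides together with the failure of
  the definition of R.\<close>

lemma global_ext_divides:
  assumes V: "global_ext b V" and R: "adef2 R"
  shows "\<exists>g k. (\<forall>i P. adef1 P \<longrightarrow> P (g i) = P b) \<and>
    (\<forall>I :: nat set. finite I \<and> card I = k \<longrightarrow> \<not> (\<exists>x. \<forall>i\<in>I. R x (g i) \<and> \<not> V (\<lambda>y. R x y)))"
proof -
  define W where "W x y \<longleftrightarrow> R x y \<and> \<not> V (\<lambda>y. R x y)" for x y
  have W: "adef2 W" unfolding W_def
    by (intro adef_conj adef_not R adef1_app[OF global_ext_adef2[OF V adef2_swap[OF R]] dfun_var])
  \<comment> \<open>A point satisfying \<open>W\<close> with the first m terms if there is one. The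
    later terms of the sequence are to be generic over it.\<close>
  define s where "s m v = (\<lambda>_ :: unit. SOME x. \<forall>i<m. W x (v i))" for m and v :: "nat \<Rightarrow> 'a"
  have "adef (\<lambda>w :: unit option \<Rightarrow> 'a. R (w (Some ())) (w None))" by (rule adef2_app[OF R dfun_var dfun_var])
  from morley_sequence[OF global_ext_ultra[OF V], where S = "\<lambda>y s. R (s ()) y" and s = s and h = "\<lambda>_ :: unit. 0", OF adef_dfn[OF this]]
  obtain g where g: "\<forall>n. (\<forall>Q. adef (\<lambda>w :: (unit + nat) option \<Rightarrow> 'a. Q (w None) (\<lambda>k. w (Some k))) \<longrightarrow>
      Q (g n) (case_sum (\<lambda>_. 0) (initial n g)) = V (\<lambda>y. Q y (case_sum (\<lambda>_. 0) (initial n g)))) \<and>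
    (\<forall>m\<le>n. R (s m (initial m g) ()) (g n) = V (\<lambda>y. R (s m (initial m g) ()) y))" by (elim exE)
  have g1: "\<forall>n. \<forall>Q. adef (\<lambda>w :: (unit + nat) option \<Rightarrow> 'a. Q (w None) (\<lambda>k. w (Some k))) \<longrightarrow>
      Q (g n) (case_sum (\<lambda>_. 0) (initial n g)) = V (\<lambda>y. Q y (case_sum (\<lambda>_. 0) (initial n g)))" using g by simp
  have g2: "R (s m (initial m g) ()) (g n) = V (\<lambda>y. R (s m (initial m g) ()) y)" if "m \<le> n" for m n
    using g that by simp
  have t: "P (g i) = P b" if P: "adef1 P" for P i
  proof -
    have "adef (\<lambda>w :: (unit + nat) option \<Rightarrow> 'a. P (w None))" by (rule adef1_app[OF P dfun_var])
    from g1[rule_format, of "\<lambda>y _. P y", OF this] show ?thesis using global_ext_iff[OF V P] by simp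
  qed
  have "\<exists>k. \<forall>I :: nat set. finite I \<and> card I = k \<longrightarrow> \<not> (\<exists>x. \<forall>i\<in>I. W x (g i))"
  proof (rule ccontr)
    assume "\<not> ?thesis"
    then have c: "\<exists>I :: nat set. finite I \<and> card I = k \<and> (\<exists>x. \<forall>i\<in>I. W x (g i))" for k by blast
    \<comment> \<open>Consistency along some set of k indices is consistency along the first k,
      because both index tuples are increasing and so realize the same product.\<close>
    have ex: "\<exists>x. \<forall>i<k. W x (g i)" for k
    proof -
      obtain I x where I: "finite I" "card I = k" "\<forall>i\<in>I. W x (g i)" using c[of k] by blast
      define i where "i j = sorted_list_of_set I ! j" for j
      have iI: "i j \<in> I" if "j < k" for j
        using that I(1,2) unfolding i_def by (metis length_sorted_list_of_set nth_mem set_sorted_list_of_set)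
      have mono: "\<forall>j<k. \<forall>j'<j. i j' < i j"
        using sorted_wrt_nth_less[OF strict_sorted_list_of_set[of I]] I(2) unfolding i_def by simp
      have q: "adef (\<lambda>w :: unit + nat \<Rightarrow> 'a. \<exists>x. \<forall>i\<in>{..<k}. W x (w (Inr i)))"
        by (rule adef_ex1, rule adef_ball, simp, rule adef2_app[OF W dfun_var dfun_var])
      have sp: "\<forall>c v v'. (\<forall>j<k. v j = v' j) \<longrightarrow> (\<exists>x. \<forall>i\<in>{..<k}. W x (v i)) = (\<exists>x. \<forall>i\<in>{..<k}. W x (v' i))"
        by simp
      note m = morley_indiscernible[OF V g1, where Q = "\<lambda>c v. \<exists>x. \<forall>i\<in>{..<k}. W x (v i)", OF q sp]
      have "\<exists>x. \<forall>j\<in>{..<k}. W x (g (i j))" using I(3) iI by (intro exI[of _ x]) simp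
      then have "\<exists>x. \<forall>j\<in>{..<k}. W x (g j)" using m[of i, OF mono] m[of "\<lambda>j. j"] by simp
      then show ?thesis unfolding Ball_def lessThan_iff .
    qed
    have x: "\<forall>i<k. W (s k (initial k g) ()) (g i)" for k
    proof -
      have "\<exists>x. \<forall>i<k. W x (initial k g i)" using ex[of k] by (simp add: initial_def)
      from someI_ex[OF this] show ?thesis unfolding s_def by (simp add: initial_def)
    qed
    \<comment> \<open>The witness for the first \<open>Suc k\<close> terms is related to exactly the
      terms with index at most k: later terms follow the definition of \<open>R\<close> in
      \<open>V\<close>, which fails at the witness. This is the second forbidden pattern, and
      \<open>Suc\<close> makes the indices fit.\<close>
    have "R (s (Suc k) (initial (Suc k) g) ()) (g n) \<longleftrightarrow> \<not> k < n" for k n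
    proof -
      let ?x = "s (Suc k) (initial (Suc k) g) ()"
      have "\<not> V (\<lambda>y. R ?x y)" using x[of "Suc k"] unfolding W_def by blast
      then have "\<not> R ?x (g n)" if "k < n" using g2[of "Suc k" n] that by simp
      moreover have "R ?x (g n)" if "\<not> k < n" using x[of "Suc k"] that unfolding W_def by simp
      ultimately show ?thesis by blast
    qed
    then show False
      using no_orderD(2)[OF no_order_adef2[OF R], of "\<lambda>k. s (Suc k) (initial (Suc k) g) ()" g] by simp
  qed
  then obtain k where k: "\<forall>I :: nat set. finite I \<and> card I = k \<longrightarrow> \<not> (\<exists>x. \<forall>i\<in>I. W x (g i))" by (elim exE)
  have "\<forall>i P. adef1 P \<longrightarrow> P (g i) = P b" by (intro allI impI t)
  from conjI[OF this k[unfolded W_def]] show ?thesis by (intro exI)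
qed

lemma iter_mono: "ultra U \<Longrightarrow> (\<forall>v. P v \<longrightarrow> Q v) \<Longrightarrow> iter U n P \<Longrightarrow> iter U n Q"
proof (induction n arbitrary: P Q)
  case 0
  from 0(2)[THEN spec, THEN mp] 0(3) show ?case by (simp only: iter.simps)
next
  case (Suc n)
  have "\<forall>v. U (\<lambda>y. P (v(n := y))) \<longrightarrow> U (\<lambda>y. Q (v(n := y)))"
  proof (intro allI impI)
    fix v assume "U (\<lambda>y. P (v(n := y)))"
    then show "U (\<lambda>y. Q (v(n := y)))" by (rule ultra_mono[OF Suc.prems(1)]) (rule Suc.prems(2)[THEN spec, THEN mp])
  qed
  from Suc.IH[OF Suc.prems(1) this] Suc.prems(3) show ?case by (simp only: iter.simps)
qed

lemma iter_all: 
  assumes U: "ultra U" and D: "U D" shows "iter U n (\<lambda>v. \<forall>i<n. D (v i))"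
proof (induction n)
  case (Suc n)
  have "\<forall>v. (\<forall>i<n. D (v i)) \<longrightarrow> U (\<lambda>y. \<forall>i<Suc n. D ((v(n := y)) i))"
  proof (intro allI impI)
    fix v assume v: "\<forall>i<n. D (v i)"
    show "U (\<lambda>y. \<forall>i<Suc n. D ((v(n := y)) i))"
      by (rule ultra_mono[OF U D]) (use v in \<open>auto simp: less_Suc_eq\<close>)
  qed
  from iter_mono[OF U this Suc] show ?case by (simp only: iter.simps)
qed simp

lemma iter_adef:
  assumes V: "global_ext a V"
  shows "adef (\<lambda>w :: 'h::countable + nat \<Rightarrow> 'a. P (\<lambda>i. w (Inl i)) (\<lambda>j. w (Inr j))) \<Longrightarrow> adef (\<lambda>c. iter V n (P c))"
proof (induction n arbitrary: P)
  case 0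
  show ?case unfolding iter.simps by (rule adef_sum_app[OF 0 dfun_var dfun_zero])
next
  case (Suc n)
  have "adef (\<lambda>w :: ('h + nat) option \<Rightarrow> 'a. P (\<lambda>i. w (Some (Inl i))) (\<lambda>j. if j = n then w None else w (Some (Inr j))))"
    by (rule adef_sum_app[OF Suc.prems dfun_var]) (intro dfun_if dfun_var)
  from global_ext_adef[OF V, of "\<lambda>y u. P (\<lambda>i. u (Inl i)) (\<lambda>j. if j = n then y else u (Inr j))", OF this]
  have "adef (\<lambda>u. V (\<lambda>y. P (\<lambda>i. u (Inl i)) ((\<lambda>j. u (Inr j))(n := y))))" by (simp only: fun_upd_def)
  from Suc.IH[of "\<lambda>c v. V (\<lambda>y. P c (v(n := y)))", OF this] show ?case by (simp only: iter.simps)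
qed

text \<open>\<open>ultra_symmetric\<close> moves \<open>V\<close> past one factor of the product at
  a time; definability of the intermediate relations keeps them without the order property.\<close>

lemma iter_commute:
  assumes U: "ultra U" and V: "ultra V"
  shows "dfn (\<lambda>w :: nat option \<Rightarrow> 'a. P (w None) (\<lambda>j. w (Some j))) \<Longrightarrow>
    V (\<lambda>y. iter U n (P y)) = iter U n (\<lambda>v. V (\<lambda>y. P y v))"
proof (induction n arbitrary: P)
  case 0
  show ?case by (simp only: iter.simps)
next
  case (Suc n)
  have "dfn (\<lambda>u :: nat option option \<Rightarrow> 'a. P (u (Some None)) (\<lambda>j. if j = n then u None else u (Some (Some j))))"
    by (rule dfn_option_app[OF Suc.prems dfun_var]) (intro dfun_if dfun_var)
  from ultra_dfn[OF U, of "\<lambda>x u. P (u None) (\<lambda>j. if j = n then x else u (Some j))", OF this]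
  have "dfn (\<lambda>u. U (\<lambda>x. P (u None) ((\<lambda>j. u (Some j))(n := x))))" by (simp only: fun_upd_def)
  from Suc.IH[of "\<lambda>y v. U (\<lambda>x. P y (v(n := x)))", OF this]
  have "V (\<lambda>y. iter U n (\<lambda>v. U (\<lambda>x. P y (v(n := x))))) = iter U n (\<lambda>v. V (\<lambda>y. U (\<lambda>x. P y (v(n := x)))))" .
  moreover have "V (\<lambda>y. U (\<lambda>x. P y (v(n := x)))) = U (\<lambda>x. V (\<lambda>y. P y (v(n := x))))" for v
    using ultra_symmetric[OF V U no_order_comp[OF no_order_dfn1[OF stable Suc.prems], of "\<lambda>y. y" "\<lambda>x. v(n := x)"]] .
  ultimately show ?case by (simp only: iter.simps)
qed

text \<open>The case needed of the stationarity of types over g: mixed Morley sequences of the two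
  types over g all have the same type, so a formula that distinguishes the types would have the
  independence property.\<close>

lemma translate_eq:
  assumes U: "global_ext a U" and V: "global_ext c V"
    and eq: "\<And>R. adef2 R \<Longrightarrow> U (\<lambda>x. R (x + g) g) = V (\<lambda>x. R x g)" and D: "dfn1 D"
  shows "U (\<lambda>x. D (x + g)) = V D"
proof -
  define U' where "U' P = U (\<lambda>x. P (x + g))" for P
  have uU: "ultra U'" unfolding U'_def by (rule ultra_map[OF global_ext_ultra[OF U]])
  have uV: "ultra V" by (rule global_ext_ultra[OF V])
  define h where "h = (\<lambda>_ :: unit. g)"
  \<comment> \<open>The hypothesis compares the translate \<open>U'\<close> and \<open>V\<close> on
    relations in one variable over g. This extends the agreement to products of arbitrary length,
    still over g.\<close>
  have agree: "iter V n (Q h) = iter U' n (Q h)"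
    if "adef (\<lambda>w :: unit + nat \<Rightarrow> 'a. Q (\<lambda>i. w (Inl i)) (\<lambda>j. w (Inr j)))" for n Q
    using that
  proof (induction n arbitrary: Q)
    case 0
    show ?case by (simp only: iter.simps)
  next
    case (Suc n)
    note Q = Suc.prems
    have "adef (\<lambda>w :: (unit + nat) option \<Rightarrow> 'a. Q (\<lambda>i. w (Some (Inl i)))
       (\<lambda>j. if j = n then w None + w (Some (Inl ())) else w (Some (Inr j))))"
      by (rule adef_sum_app[OF Q dfun_var]) (intro dfun_if dfun_add dfun_var)
    from global_ext_adef[OF U, of "\<lambda>y u. Q (\<lambda>i. u (Inl i)) (\<lambda>j. if j = n then y + u (Inl ()) else u (Inr j))", OF this]
    have "adef (\<lambda>u. U (\<lambda>y. Q (\<lambda>i. u (Inl i)) ((\<lambda>j. u (Inr j))(n := y + u (Inl ())))))" by (simp only: fun_upd_def)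
    note IH = Suc.IH[of "\<lambda>c v. U (\<lambda>y. Q c (v(n := y + c ())))", OF this]
    have e: "U' (\<lambda>y. Q h (v(n := y))) = U (\<lambda>y. Q h (v(n := y + h ())))" for v
      by (simp only: U'_def h_def)
    have 1: "iter V n (\<lambda>v. U' (\<lambda>y. Q h (v(n := y)))) = iter U' n (\<lambda>v. U' (\<lambda>y. Q h (v(n := y))))"
      unfolding e by (rule IH)
    have "dfn (\<lambda>w :: nat option + unit \<Rightarrow> 'a. Q (\<lambda>i. w (Inr i)) (\<lambda>j. if j = n then w (Inl None) else w (Inl (Some j))))"
      by (rule adef_dfn, rule adef_sum_app[OF Q dfun_var]) (intro dfun_if dfun_var)
    from dfn_param[of "\<lambda>w c. Q c (\<lambda>j. if j = n then w None else w (Some j))" h, OF this]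
    have d: "dfn (\<lambda>w :: nat option \<Rightarrow> 'a. Q h ((\<lambda>j. w (Some j))(n := w None)))" by (simp only: fun_upd_def)
    have "adef (\<lambda>w :: bool + nat \<Rightarrow> 'a. Q (\<lambda>i. w (Inl False)) (\<lambda>j. if j = n then w (Inl True) else w (Inr j)))"
      by (rule adef_sum_app[OF Q dfun_var]) (intro dfun_if dfun_var)
    from iter_adef[OF V, of "\<lambda>c v. Q (\<lambda>i. c False) (\<lambda>j. if j = n then c True else v j)", OF this]
    have "adef2 (\<lambda>x z. iter V n (\<lambda>v. Q (\<lambda>i. z) (v(n := x))))" by (simp only: fun_upd_def)
    from eq[OF this] have 2: "U' (\<lambda>y. iter V n (\<lambda>v. Q h (v(n := y)))) = V (\<lambda>y. iter V n (\<lambda>v. Q h (v(n := y))))"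
      by (simp only: U'_def h_def)
    \<comment> \<open>The induction hypothesis replaces the outer n factors. The remaining factor is
      moved to the outside, where \<open>eq\<close> applies because the n-fold product is almost
      0-definable in that variable and g; then it is moved back.\<close>
    have "iter U' (Suc n) (Q h) = iter V n (\<lambda>v. U' (\<lambda>y. Q h (v(n := y))))" using 1 by (simp only: iter.simps)
    also have "\<dots> = U' (\<lambda>y. iter V n (\<lambda>v. Q h (v(n := y))))"
      using iter_commute[OF uV uU, of "\<lambda>y v. Q h (v(n := y))", OF d] by (simp only:)
    also have "\<dots> = V (\<lambda>y. iter V n (\<lambda>v. Q h (v(n := y))))" by (rule 2)
    also have "\<dots> = iter V (Suc n) (Q h)"
      using iter_commute[OF uV uV, of "\<lambda>y v. Q h (v(n := y))", OF d] by (simp only: iter.simps)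
    finally show ?case by (simp only:)
  qed
  have imp: False if D: "dfn1 D" and 1: "U' D" and 2: "\<not> V D" for D
  proof -
    obtain \<phi> cs where \<phi>: "wff (Suc (length cs)) \<phi>" "\<forall>x. D x = sat G (x # cs) \<phi>"
      using dfn_formula[of D, OF D] by (elim exE conjE)
    define R where "R x z = sat G (x # map z [0..<length cs]) \<phi>" for x and z :: "nat \<Rightarrow> 'a"
    have "def0 (\<lambda>w :: nat option \<Rightarrow> 'a. R (w None) (\<lambda>j. w (Some j)))"
      unfolding R_def using \<phi>(1) by (intro def0I[of "None # map Some [0..<length cs]" \<phi>]) (simp_all add: comp_def)
    then have R: "adef (\<lambda>w :: nat option \<Rightarrow> 'a. R (w None) (\<lambda>j. w (Some j)))" by (rule def0_adef)
    have DR: "R x (\<lambda>i. cs ! i) = D x" for x unfolding R_def \<phi>(2)[rule_format] by (simp add: map_nth)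
    \<comment> \<open>\<open>K g z\<close> says that the instance of \<open>R\<close> at z
      distinguishes the translate of \<open>U\<close> by g from \<open>V\<close>. Written with y for
      g it is almost 0-definable, so \<open>agree\<close> can be applied to it.\<close>
    define K where "K y z \<longleftrightarrow> U (\<lambda>x. R (x + y) z) \<and> \<not> V (\<lambda>x. R x z)" for y z
    have "adef (\<lambda>w :: nat option option \<Rightarrow> 'a. R (w None + w (Some None)) (\<lambda>j. w (Some (Some j))))"
      by (rule adef_option_app[OF R]) (intro dfun_add dfun_var)+
    from global_ext_adef[OF U, of "\<lambda>x u. R (x + u None) (\<lambda>j. u (Some j))", OF this]
    have K1: "adef (\<lambda>w :: nat option \<Rightarrow> 'a. U (\<lambda>x. R (x + w None) (\<lambda>j. w (Some j))))" .
    have K2: "adef (\<lambda>w :: nat option \<Rightarrow> 'a. V (\<lambda>x. R x (\<lambda>j. w (Some j))))"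
      by (rule adef_reindex[OF global_ext_adef[OF V R] refl])
    have K: "adef (\<lambda>w :: nat option \<Rightarrow> 'a. K (w None) (\<lambda>j. w (Some j)))"
      unfolding K_def by (intro adef_conj adef_not K1 K2)
    have Kg: "K g z \<longleftrightarrow> U' (\<lambda>x. R x z) \<and> \<not> V (\<lambda>x. R x z)" for z unfolding K_def U'_def by (rule refl)
    define s where "s m v = (SOME z. K g z \<and> (\<forall>i<m. R (v i) z))" for m and v :: "nat \<Rightarrow> 'a"
    from morley_sequence[OF uV, where S = R and s = s and h = h, OF adef_dfn[OF R]]
    obtain f where f: "\<forall>n. (\<forall>Q. adef (\<lambda>w :: (unit + nat) option \<Rightarrow> 'a. Q (w None) (\<lambda>k. w (Some k))) \<longrightarrow>
        Q (f n) (case_sum h (initial n f)) = V (\<lambda>y. Q y (case_sum h (initial n f)))) \<and>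
      (\<forall>m\<le>n. R (f n) (s m (initial m f)) = V (\<lambda>y. R y (s m (initial m f))))" by (elim exE)
    have f1: "\<forall>n. \<forall>Q. adef (\<lambda>w :: (unit + nat) option \<Rightarrow> 'a. Q (w None) (\<lambda>k. w (Some k))) \<longrightarrow>
      Q (f n) (case_sum h (initial n f)) = V (\<lambda>y. Q y (case_sum h (initial n f)))" using f by simp
    have f2: "R (f n) (s m (initial m f)) = V (\<lambda>y. R y (s m (initial m f)))" if "m \<le> n" for m n
      using f that by simp
    have ex: "\<exists>z. K g z \<and> (\<forall>i<m. R (f i) z)" for m
    proof -
      have "adef (\<lambda>w :: (unit + nat) + nat \<Rightarrow> 'a. R (w (Inl (Inr i))) (\<lambda>j. w (Inr j)))" for i
        by (rule adef_option_app[OF R dfun_var dfun_var])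
      then have q: "adef (\<lambda>w :: unit + nat \<Rightarrow> 'a. \<exists>z. K (w (Inl ())) z \<and> (\<forall>i\<in>{..<m}. R (w (Inr i)) z))"
        by (intro adef_ex adef_conj adef_option_app[OF K dfun_var dfun_var] adef_ball) simp_all
      have sp: "\<forall>c v v'. (\<forall>j<m. v j = v' j) \<longrightarrow>
          (\<exists>z. K (c ()) z \<and> (\<forall>i\<in>{..<m}. R (v i) z)) = (\<exists>z. K (c ()) z \<and> (\<forall>i\<in>{..<m}. R (v' i) z))" by simp
      let ?Q = "\<lambda>c v. \<exists>z. K (c ()) z \<and> (\<forall>i\<in>{..<m}. R (v i) z)"
      \<comment> \<open>The original parameters \<open>cs\<close> witness the existential statement
        for almost all m-tuples of the product of \<open>U'\<close>. By \<open>agree\<close> it also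
        holds for the product of \<open>V\<close>, hence for the first m terms of the Morley
        sequence.\<close>
      have "\<forall>v. (\<forall>i<m. D (v i)) \<longrightarrow> ?Q h v"
      proof (intro allI impI)
        fix v assume v: "\<forall>i<m. D (v i)"
        have "K g (\<lambda>i. cs ! i)" unfolding Kg DR using 1 2 by (rule conjI)
        then show "?Q h v" using v DR by (intro exI[of _ "\<lambda>i. cs ! i"]) (simp add: h_def)
      qed
      from iter_mono[OF uU this iter_all[OF uU 1]] have "iter U' m (?Q h)" .
      then have "iter V m (?Q h)" using agree[of ?Q m, OF q] by (simp only:)
      moreover have "?Q h (\<lambda>j. f j) = iter V m (?Q h)"
        by (rule morley_indiscernible[OF V f1, where i = "\<lambda>j. j" and Q = ?Q, OF q sp]) simp
      ultimately show ?thesis unfolding Ball_def lessThan_iff h_def by (simp only:)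
    qed
    have s: "K g (s m (initial m f)) \<and> (\<forall>i<m. R (f i) (s m (initial m f)))" for m
    proof -
      have "\<exists>z. K g z \<and> (\<forall>i<m. R (initial m f i) z)" using ex[of m] by (simp add: initial_def)
      from someI_ex[OF this] show ?thesis unfolding s_def by (simp add: initial_def)
    qed
    \<comment> \<open>The witness is related to the first m terms by choice, and to no later term
      because those are generic over it and \<open>V\<close> rejects the instance.\<close>
    have "R (f i) (s m (initial m f)) \<longleftrightarrow> i < m" for i m
      using s[of m] f2[of m i] unfolding Kg by (cases "i < m") simp_all
    then show False
      using no_orderD(1)[OF no_order_dfn1[OF stable adef_dfn[OF R]], of f "\<lambda>m. s m (initial m f)"] by simp
  qed
  have "U' D = V D"
    using imp[OF D] imp[OF dfn_not[OF D]] by (auto simp: ultra_not[OF uU] ultra_not[OF uV])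
  then show ?thesis unfolding U'_def .
qed

text \<open>Turns the extension of the type of a summand into that of its negative, which is the sum
  of the other two.\<close>

lemma global_ext_uminus:
  assumes "global_ext a U" shows "global_ext (- a) (\<lambda>P. U (\<lambda>x. P (- x)))"
  unfolding global_ext_def
proof (intro conjI allI impI)
  show "ultra (\<lambda>P. U (\<lambda>x. P (- x)))" by (rule ultra_map[OF global_ext_ultra[OF assms]])
next
  fix P assume P: "adef1 P" "P (- a)"
  have "adef1 (\<lambda>x. P (- x))" by (rule adef1_app[OF P(1) dfun_uminus[OF dfun_var]])
  from global_ext_iff[OF assms this] P(2) show "U (\<lambda>x. P (- x))" by simp
next
  fix R assume R: "adef (\<lambda>w :: nat option \<Rightarrow> 'a. R (w None) (\<lambda>j. w (Some j)))"
  have "adef (\<lambda>w :: nat option \<Rightarrow> 'a. R (- w None) (\<lambda>j. w (Some j)))"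
    by (rule adef_option_app[OF R dfun_uminus[OF dfun_var] dfun_var])
  from global_ext_adef[OF assms, of "\<lambda>x. R (- x)", OF this] show "adef (\<lambda>v :: nat \<Rightarrow> 'a. U (\<lambda>x. R (- x) v))" .
qed

end

section \<open>Imaginaries\<close>

context one_sorted
begin

abbreviation Geq where "Geq \<equiv> eq_struct G"

text \<open>An element of the expansion is named by a sequence of home elements representing it, of
  which only the first coordinates count. Formulas of the expansion thereby become predicates on
  home tuples; in \<open>tup\<close> the index (i, j) is coordinate j of a representative of entry
  i.\<close>

definition cl :: "('f, 'r) eqsort \<Rightarrow> (nat \<Rightarrow> 'a) \<Rightarrow> ('f, 'r, 'a) eqel" where
  "cl s u = (case s of Home \<Rightarrow> El (u 0) | Quot n E \<Rightarrow> Cls n E (def_rel G n E `` {map u [0..<n]}))"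

definition tup :: "('f, 'r) eqsort list \<Rightarrow> (nat \<times> nat \<Rightarrow> 'a) \<Rightarrow> ('f, 'r, 'a) eqel list" where
  "tup ss w = map (\<lambda>i. cl (ss ! i) (\<lambda>j. w (i, j))) [0..<length ss]"

lemma length_tup [simp]: "length (tup ss w) = length ss"
  by (simp add: tup_def)

lemma nth_tup [simp]: "i < length ss \<Longrightarrow> tup ss w ! i = cl (ss ! i) (\<lambda>j. w (i, j))"
  by (simp add: tup_def)

lemma eq_sel:
  "sorts Geq = insert Home {Quot n E | n E. def_equiv G n E}"
  "fargs Geq (Base g) = map (\<lambda>_. Home) (fargs G g)" "fargs Geq (Proj n E) = replicate n Home"
  "fres Geq (Base g) = Home" "fres Geq (Proj n E) = Quot n E"
  "rargs Geq r = map (\<lambda>_. Home) (rargs G r)"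
  "fint Geq (Base g) xs = El (fint G g (map the_El xs))"
  "fint Geq (Proj n E) xs = Cls n E (def_rel G n E `` {map the_El xs})"
  "rint Geq r xs = rint G r (map the_El xs)"
  "univ Geq Home = range El"
  by (simp_all add: eq_struct_def univ_G)

lemma univ_Quot: "univ Geq (Quot n E) =
   (if def_equiv G n E then Cls n E ` (tuples G (replicate n ()) // def_rel G n E) else {})"
  by (simp add: eq_struct_def)

lemma cl_univ: "s \<in> sorts Geq \<Longrightarrow> cl s u \<in> univ Geq s"
proof (cases s)
  case Home then show ?thesis by (simp add: cl_def eq_sel)
next
  case (Quot n E)
  assume "s \<in> sorts Geq"
  then have "def_equiv G n E" using Quot by (simp add: eq_sel)
  moreover have "map u [0..<n] \<in> tuples G (replicate n ())" by simp
  ultimately show ?thesis unfolding Quot univ_Quot by (simp add: cl_def imageI quotientI)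
qed

lemma univ_cl:
  assumes "b \<in> univ Geq s" shows "s \<in> sorts Geq \<and> (\<exists>u. b = cl s u)"
proof (cases s)
  case Home then show ?thesis using assms by (auto simp: cl_def eq_sel)
next
  case (Quot n E)
  then have d: "def_equiv G n E" using assms by (auto simp: univ_Quot split: if_splits)
  then have "b \<in> Cls n E ` (tuples G (replicate n ()) // def_rel G n E)" using assms Quot by (simp add: univ_Quot)
  then obtain as where as: "as \<in> tuples G (replicate n ())" "b = Cls n E (def_rel G n E `` {as})"
    by (elim imageE quotientE) simp
  have "map (\<lambda>i. as ! i) [0..<n] = as" using as(1) map_nth[of as] by simp
  then have "b = cl s (\<lambda>i. as ! i)" unfolding as(2) Quot cl_def by simp
  then show ?thesis using d Quot by (auto simp: eq_sel)
qed

lemma univ_sort_unique: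
  assumes "b \<in> univ Geq s" "b \<in> univ Geq s'" shows "s = s'"
  using univ_cl[OF assms(1)] univ_cl[OF assms(2)]
  by (cases s; cases s') (auto simp: cl_def)

lemma tuples_eq_sorts: "bs \<in> tuples Geq ts \<Longrightarrow> set ts \<subseteq> sorts Geq"
  using univ_cl by (fastforce simp: tuples_def list_all2_conv_all_nth in_set_conv_nth)

lemma tuples_eq_tup:
  assumes "bs \<in> tuples Geq ts" shows "\<exists>w. bs = tup ts w"
proof -
  have b: "length bs = length ts" "\<And>i. i < length ts \<Longrightarrow> bs ! i \<in> univ Geq (ts ! i)"
    using assms by (auto simp: tuples_def list_all2_conv_all_nth)
  have "\<forall>i. \<exists>u. i < length ts \<longrightarrow> bs ! i = cl (ts ! i) u" using univ_cl[OF b(2)] by blast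
  from choice[OF this] obtain u where "\<forall>i. i < length ts \<longrightarrow> bs ! i = cl (ts ! i) (u i)" by (elim exE)
  then have "bs = tup ts (\<lambda>(i, j). u i j)" using b(1) by (intro nth_equalityI) simp_all
  then show ?thesis by (intro exI[of _ "\<lambda>(i, j). u i j"])
qed

lemma home_term:
  assumes "has_sort Geq ss t s"
  shows "s = Home \<Longrightarrow> \<exists>F. dfun F \<and> (\<forall>w. eval_tm Geq (tup ss w) t = El (F w))"
  using assms
proof induction
  case (1 i)
  then show ?case by (intro exI[of _ "\<lambda>w. w (i, 0)"]) (simp add: dfun_var cl_def)
next
  case (2 f ts)
  obtain g where f: "f = Base g" using 2 by (cases f) (simp_all add: eq_sel)
  have l: "length ts = length (fargs G g)" using 2(2) by (auto simp: f eq_sel dest: list_all2_lengthD)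
  have "\<forall>i. \<exists>F. i < length ts \<longrightarrow> dfun F \<and> (\<forall>w. eval_tm Geq (tup ss w) (ts ! i) = El (F w))"
    using 2(2) by (auto simp: f eq_sel list_all2_conv_all_nth)
  from choice[OF this] obtain F where
    F: "\<forall>i. i < length ts \<longrightarrow> dfun (F i) \<and> (\<forall>w. eval_tm Geq (tup ss w) (ts ! i) = El (F i w))" by (elim exE)
  let ?Fs = "map F [0..<length ts]"
  have "dfun (\<lambda>w. fint G g (map (\<lambda>F. F w) ?Fs))" using l F by (intro dfun_fint) auto
  moreover have e: "map the_El (map (eval_tm Geq (tup ss w)) ts) = map (\<lambda>F. F w) ?Fs" for w
    using F by (intro nth_equalityI) simp_all
  have "eval_tm Geq (tup ss w) (App f ts) = El (fint G g (map (\<lambda>F. F w) ?Fs))" for w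
    unfolding eval_tm.simps f eq_sel e by (rule refl)
  ultimately show ?case by (intro exI[of _ "\<lambda>w. fint G g (map (\<lambda>F. F w) ?Fs)"]) simp
qed

lemma home_terms:
  assumes "list_all2 (has_sort Geq ss) ts (replicate n Home)"
  shows "\<exists>Fs. length Fs = n \<and> (\<forall>F\<in>set Fs. dfun F) \<and>
    (\<forall>w. map the_El (map (eval_tm Geq (tup ss w)) ts) = map (\<lambda>F. F w) Fs)"
proof -
  have l: "length ts = n" using assms by (auto dest: list_all2_lengthD)
  have "\<forall>i. \<exists>F. i < n \<longrightarrow> dfun F \<and> (\<forall>w. eval_tm Geq (tup ss w) (ts ! i) = El (F w))"
    using assms home_term by (auto simp: list_all2_conv_all_nth)
  from choice[OF this] obtain F where
    F: "\<forall>i. i < n \<longrightarrow> dfun (F i) \<and> (\<forall>w. eval_tm Geq (tup ss w) (ts ! i) = El (F i w))" by (elim exE)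
  have "map the_El (map (eval_tm Geq (tup ss w)) ts) = map (\<lambda>F. F w) (map F [0..<n])" for w
    using F l by (intro nth_equalityI) simp_all
  then show ?thesis using F by (intro exI[of _ "map F [0..<n]"]) auto
qed

lemma quot_term:
  assumes "has_sort Geq ss t (Quot n E)" "set ss \<subseteq> sorts Geq"
  shows "def_equiv G n E \<and> (\<exists>Fs. length Fs = n \<and> (\<forall>F\<in>set Fs. dfun F) \<and>
    (\<forall>w. eval_tm Geq (tup ss w) t = Cls n E (def_rel G n E `` {map (\<lambda>F. F w) Fs})))"
  using assms(1)
proof cases
  case (1 i)
  have "Quot n E \<in> set ss" using 1 by (metis nth_mem)
  then have "def_equiv G n E" using assms(2) by (auto simp: eq_sel)
  moreover have "eval_tm Geq (tup ss w) t = Cls n E (def_rel G n E `` {map (\<lambda>F. F w) (map (\<lambda>j w. w (i, j)) [0..<n])})" for w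
    using 1(3) by (simp add: 1(1) cl_def 1(2)[symmetric] comp_def)
  ultimately show ?thesis
    by (intro conjI exI[of _ "map (\<lambda>j w. w (i, j)) [0..<n]"]) (auto simp: dfun_var)
next
  case (2 f ts)
  have f: "f = Proj n E" using 2(2) by (cases f) (simp_all add: eq_sel)
  have d: "def_equiv G n E" using 2(3) by (auto simp: f eq_sel)
  have "list_all2 (has_sort Geq ss) ts (replicate n Home)" using 2(4) by (simp add: f eq_sel)
  from home_terms[OF this] obtain Fs where Fs: "length Fs = n" "\<forall>F\<in>set Fs. dfun F"
    "\<forall>w. map the_El (map (eval_tm Geq (tup ss w)) ts) = map (\<lambda>F. F w) Fs" by (elim exE conjE)
  have "eval_tm Geq (tup ss w) t = Cls n E (def_rel G n E `` {map (\<lambda>F. F w) Fs})" for w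
    unfolding 2(1) eval_tm.simps f eq_sel Fs(3)[rule_format] by (rule refl)
  then show ?thesis using d Fs(1,2) by blast
qed

lemma class_eq_iff:
  assumes "def_equiv G n E" "length as = n" "length bs = n"
  shows "def_rel G n E `` {as} = def_rel G n E `` {bs} \<longleftrightarrow> sat G (as @ bs) E"
proof -
  have "equiv (tuples G (replicate n ())) (def_rel G n E)" using assms(1) by (simp add: def_equiv_def)
  from eq_equiv_class_iff[OF this, of as bs] show ?thesis using assms(2,3) by (simp add: def_rel_def)
qed

text \<open>The expansion defines no new relations on the home sort: equality of classes is the
  formula E, and a quantifier over a quotient sort becomes one over representatives.\<close>

lemma eq_formula_def0:
  "wf_fm Geq ss \<phi> \<Longrightarrow> set ss \<subseteq> sorts Geq \<Longrightarrow> def0 (\<lambda>w. sat Geq (tup ss w) \<phi>)"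
proof (induction \<phi> arbitrary: ss)
  case (Eq t u)
  then obtain s where s: "has_sort Geq ss t s" "has_sort Geq ss u s" by auto
  show ?case
  proof (cases s)
    case Home
    from home_term[OF s(1) Home] home_term[OF s(2) Home] obtain F H where
      "dfun F" "\<forall>w. eval_tm Geq (tup ss w) t = El (F w)" "dfun H" "\<forall>w. eval_tm Geq (tup ss w) u = El (H w)"
      by (elim exE conjE)
    then show ?thesis using def0_eq[of F H] by simp
  next
    case (Quot n E)
    from quot_term[OF s(1)[unfolded Quot] Eq(2)] obtain Fs where
      Fs: "def_equiv G n E" "length Fs = n" "\<forall>F\<in>set Fs. dfun F"
        "\<forall>w. eval_tm Geq (tup ss w) t = Cls n E (def_rel G n E `` {map (\<lambda>F. F w) Fs})" by (elim exE conjE)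
    from quot_term[OF s(2)[unfolded Quot] Eq(2)] obtain Hs where
      Hs: "length Hs = n" "\<forall>F\<in>set Hs. dfun F"
        "\<forall>w. eval_tm Geq (tup ss w) u = Cls n E (def_rel G n E `` {map (\<lambda>F. F w) Hs})" by (elim exE conjE)
    have "wff (n + n) E" using Fs(1) by (simp add: def_equiv_def replicate_add)
    then have "def0 (\<lambda>v :: nat \<Rightarrow> 'a. sat G (map v [0..<n + n]) E)" by (intro def0I[of "[0..<n + n]" E]) simp_all
    then have "def0 (\<lambda>w. sat G (map (\<lambda>i. (if i < n + n then (Fs @ Hs) ! i else (\<lambda>w. w undefined)) w) [0..<n + n]) E)"
    proof (rule def0_subst)
      fix i
      have "(Fs @ Hs) ! i \<in> set (Fs @ Hs)" if "i < n + n" using that Fs(2) Hs(1) by (intro nth_mem) simp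
      then show "dfun (if i < n + n then (Fs @ Hs) ! i else (\<lambda>w. w undefined))"
        using Fs(3) Hs(2) by (auto simp: dfun_var)
    qed
    moreover have "map (\<lambda>i. (if i < n + n then (Fs @ Hs) ! i else (\<lambda>w. w undefined)) w) [0..<n + n] =
        map (\<lambda>F. F w) Fs @ map (\<lambda>F. F w) Hs" for w
      using Fs(2) Hs(1) by (intro nth_equalityI) (auto simp: nth_append)
    moreover have "sat Geq (tup ss w) (Eq t u) = sat G (map (\<lambda>F. F w) Fs @ map (\<lambda>F. F w) Hs) E" for w
      using class_eq_iff[OF Fs(1), of "map (\<lambda>F. F w) Fs" "map (\<lambda>F. F w) Hs"] Fs(2,4) Hs(1,3) by simp
    ultimately show ?thesis by (simp only:)
  qed
next
  case (Rel r ts)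
  have "list_all2 (has_sort Geq ss) ts (replicate (length (rargs G r)) Home)"
    using Rel(1) by (simp add: eq_sel map_replicate_const)
  from home_terms[OF this] obtain Fs where Fs: "length Fs = length (rargs G r)" "\<forall>F\<in>set Fs. dfun F"
    "\<forall>w. map the_El (map (eval_tm Geq (tup ss w)) ts) = map (\<lambda>F. F w) Fs" by (elim exE conjE)
  have "sat Geq (tup ss w) (Rel r ts) = rint G r (map (\<lambda>F. F w) Fs)" for w
    unfolding sat.simps eq_sel Fs(3)[rule_format] by (rule refl)
  then show ?case using def0_rint[OF Fs(1)] Fs(2) by simp
next
  case (Neg \<phi>)
  have "wf_fm Geq ss \<phi>" using Neg.prems by simp
  from def0_not[OF Neg.IH[OF this Neg.prems(2)]] show ?case by simp
next
  case (Conj \<phi> \<psi>)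
  have "wf_fm Geq ss \<phi>" "wf_fm Geq ss \<psi>" using Conj.prems by simp_all
  from def0_conj[OF Conj.IH(1)[OF this(1) Conj.prems(2)] Conj.IH(2)[OF this(2) Conj.prems(2)]] show ?case by simp
next
  case (Exi s \<phi>)
  have s: "s \<in> sorts Geq" "wf_fm Geq (s # ss) \<phi>" "set (s # ss) \<subseteq> sorts Geq" using Exi.prems by auto
  have c: "cl s u # tup ss w = tup (s # ss) (\<lambda>(i, j). case i of 0 \<Rightarrow> u j | Suc i \<Rightarrow> w (i, j))" for u w
  proof (rule nth_equalityI)
    fix i assume "i < length (cl s u # tup ss w)"
    then show "(cl s u # tup ss w) ! i = tup (s # ss) (\<lambda>(i, j). case i of 0 \<Rightarrow> u j | Suc i \<Rightarrow> w (i, j)) ! i"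
      by (cases i) simp_all
  qed simp
  have "def0 (\<lambda>w :: nat \<times> nat + nat \<Rightarrow> 'a. sat Geq (tup (s # ss) (\<lambda>k. w (case k of (i, j) \<Rightarrow> case i of 0 \<Rightarrow> Inr j | Suc i \<Rightarrow> Inl (i, j)))) \<phi>)"
    by (rule def0_reindex[OF Exi.IH[OF s(2,3)] refl])
  moreover have "(\<lambda>k. w (case k of (i, j) \<Rightarrow> case i of 0 \<Rightarrow> Inr j | Suc i \<Rightarrow> Inl (i, j))) =
      (\<lambda>(i, j). case i of 0 \<Rightarrow> w (Inr j) | Suc i \<Rightarrow> w (Inl (i, j)))" for w :: "nat \<times> nat + nat \<Rightarrow> 'a"
    by (rule ext) (simp split: prod.split nat.split)
  ultimately have "def0 (\<lambda>w :: nat \<times> nat + nat \<Rightarrow> 'a. sat Geq (cl s (\<lambda>j. w (Inr j)) # tup ss (\<lambda>k. w (Inl k))) \<phi>)"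
    unfolding c by (simp only:)
  then have "def0 (\<lambda>w. \<exists>u. sat Geq (cl s u # tup ss w) \<phi>)" by (rule def0_ex)
  moreover have "sat Geq (tup ss w) (Exi s \<phi>) = (\<exists>u. sat Geq (cl s u # tup ss w) \<phi>)" for w
  proof
    assume "sat Geq (tup ss w) (Exi s \<phi>)"
    then obtain x where "x \<in> univ Geq s" "sat Geq (x # tup ss w) \<phi>" by auto
    then show "\<exists>u. sat Geq (cl s u # tup ss w) \<phi>" using univ_cl by blast
  next
    assume "\<exists>u. sat Geq (cl s u # tup ss w) \<phi>"
    then obtain u where "sat Geq (cl s u # tup ss w) \<phi>" by (elim exE)
    then show "sat Geq (tup ss w) (Exi s \<phi>)" using cl_univ[OF s(1)] by auto
  qed
  ultimately show ?case by (simp only:)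
qed

lemma eq_formula_option_def0:
  assumes "wf_fm Geq (Home # ts) \<psi>" "set ts \<subseteq> sorts Geq"
  shows "def0 (\<lambda>w :: (nat \<times> nat) option \<Rightarrow> 'a. sat Geq (El (w None) # tup ts (\<lambda>k. w (Some k))) \<psi>)"
proof -
  have hs: "set (Home # ts) \<subseteq> sorts Geq" using assms(2) by (simp add: eq_sel)
  have "def0 (\<lambda>w :: (nat \<times> nat) option \<Rightarrow> 'a. sat Geq (tup (Home # ts)
      (\<lambda>k. w (case k of (i, j) \<Rightarrow> case i of 0 \<Rightarrow> None | Suc i \<Rightarrow> Some (i, j)))) \<psi>)"
    by (rule def0_reindex[OF eq_formula_def0[OF assms(1) hs] refl])
  moreover have "tup (Home # ts) (\<lambda>k. w (case k of (i, j) \<Rightarrow> case i of 0 \<Rightarrow> None | Suc i \<Rightarrow> Some (i, j))) =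
      El (w None) # tup ts (\<lambda>k. w (Some k))" (is "?l = ?r") for w :: "(nat \<times> nat) option \<Rightarrow> 'a"
  proof (rule nth_equalityI)
    fix i assume "i < length ?l"
    then show "?l ! i = ?r ! i" by (cases i) (simp_all add: cl_def[of Home])
  qed simp
  ultimately show ?thesis by (simp only:)
qed

lemma acleq0_formula:
  assumes "b \<in> acleq0 G" "b \<in> univ Geq s"
  shows "\<exists>\<theta>. wf_fm Geq [s] \<theta> \<and> sat Geq [b] \<theta> \<and> finite {x \<in> univ Geq s. sat Geq [x] \<theta>}"
proof -
  obtain s' \<phi> bs where b: "b \<in> univ Geq s'" "(\<phi>, bs) \<in> formulas_over Geq [s'] {}" "sat Geq (b # bs) \<phi>"
    "finite {x \<in> univ Geq s'. sat Geq (x # bs) \<phi>}"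
    using assms(1) unfolding acleq0_def acl_def by auto
  have s: "s' = s" using univ_sort_unique[OF b(1) assms(2)] .
  have bs: "bs = []" "wf_fm Geq [s'] \<phi>" using b(2) by (auto simp: formulas_over_def tuples_def)
  show ?thesis using b bs unfolding s by auto
qed

text \<open>K is the set of positions of the parameters that are equal to g.\<close>

lemma eq_formula_adef:
  assumes wf: "wf_fm Geq (Home # ts) \<phi>" and bs: "bs \<in> tuples Geq ts"
    and K: "\<And>i. i < length ts \<Longrightarrow> i \<in> K \<Longrightarrow> bs ! i = El g"
    and nK: "\<And>i. i < length ts \<Longrightarrow> i \<notin> K \<Longrightarrow> bs ! i \<in> acleq0 G"
  shows "\<exists>R. adef2 R \<and> (\<forall>x. sat Geq (El x # bs) \<phi> = R x g) \<and> (K = {} \<longrightarrow> (\<forall>x y. R x y = R x g))"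
proof -
  let ?n = "length ts"
  obtain w where w: "bs = tup ts w" using tuples_eq_tup[OF bs] by (elim exE)
  have so: "set ts \<subseteq> sorts Geq" by (rule tuples_eq_sorts[OF bs])
  have bu: "bs ! i \<in> univ Geq (ts ! i)" if "i < ?n" for i
    using bs that by (auto simp: tuples_def list_all2_conv_all_nth)
  have home: "ts ! i = Home" if "i < ?n" "i \<in> K" for i
    using univ_sort_unique[OF bu[OF that(1)], of Home] K[OF that] by (simp add: eq_sel)
  have "\<forall>i. \<exists>\<theta>. i < ?n \<and> i \<notin> K \<longrightarrow> wf_fm Geq [ts ! i] \<theta> \<and> sat Geq [bs ! i] \<theta> \<and> finite {x \<in> univ Geq (ts ! i). sat Geq [x] \<theta>}"
    using acleq0_formula[OF nK bu] by blast
  from choice[OF this] obtain \<theta> where \<theta>: "\<forall>i. i < ?n \<and> i \<notin> K \<longrightarrow>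
    wf_fm Geq [ts ! i] (\<theta> i) \<and> sat Geq [bs ! i] (\<theta> i) \<and> finite {x \<in> univ Geq (ts ! i). sat Geq [x] (\<theta> i)}" by (elim exE)
  define I where "I = {i. i < ?n \<and> i \<notin> K}"
  have I: "finite I" by (simp add: I_def)
  \<comment> \<open>Representatives satisfying the algebraic formulas of the parameters outside
    \<open>K\<close>. They name only finitely many tuples of imaginaries, so only finitely many
    relations arise.\<close>
  define \<Theta> where "\<Theta> z \<longleftrightarrow> (\<forall>i\<in>I. sat Geq [cl (ts ! i) (\<lambda>j. z (i, j))] (\<theta> i))" for z
  have d\<Theta>: "def0 \<Theta>" unfolding \<Theta>_def
  proof (rule def0_ball[OF I])
    fix i assume i: "i \<in> I"
    then have "ts ! i \<in> sorts Geq" using so by (auto simp: I_def)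
    then have "def0 (\<lambda>w. sat Geq (tup [ts ! i] w) (\<theta> i))" using i \<theta> by (intro eq_formula_def0) (simp_all add: I_def)
    from def0_reindex[OF this refl, of "\<lambda>(i', j). (i, j)"]
    show "def0 (\<lambda>z. sat Geq [cl (ts ! i) (\<lambda>j. z (i, j))] (\<theta> i))" by (simp add: tup_def)
  qed
  define \<Psi> where "\<Psi> l v = sat Geq (El (v True) # map (\<lambda>i. if i \<in> K then El (v False) else l ! i) [0..<?n]) \<phi>"
    for l and v :: "bool \<Rightarrow> 'a"
  define L where "L z = map (\<lambda>i. if i \<in> K then El g else cl (ts ! i) (\<lambda>j. z (i, j))) [0..<?n]" for z
  define Q where "Q u = \<Psi> (L (\<lambda>k. u (Inr k))) (\<lambda>b. u (Inl b))" for u :: "bool + nat \<times> nat \<Rightarrow> 'a"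
  have "def0 (\<lambda>u :: bool + nat \<times> nat \<Rightarrow> 'a. sat Geq (tup (Home # ts)
     (\<lambda>k. u (case k of (i, j) \<Rightarrow> case i of 0 \<Rightarrow> Inl True | Suc i \<Rightarrow> if i \<in> K then Inl False else Inr (i, j)))) \<phi>)"
    using so wf by (intro def0_reindex[OF eq_formula_def0 refl]) (auto simp: eq_sel)
  moreover have "tup (Home # ts) (\<lambda>k. u (case k of (i, j) \<Rightarrow> case i of 0 \<Rightarrow> Inl True | Suc i \<Rightarrow> if i \<in> K then Inl False else Inr (i, j)))
      = El (u (Inl True)) # map (\<lambda>i. if i \<in> K then El (u (Inl False)) else L (\<lambda>k. u (Inr k)) ! i) [0..<?n]" (is "?l u = ?r u") for u
  proof (rule nth_equalityI)
    fix i assume "i < length (?l u)"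
    then show "?l u ! i = ?r u ! i"
    proof (cases i)
      case 0 then show ?thesis by (simp add: cl_def)
    next
      case (Suc k)
      then have k: "k < ?n" using \<open>i < length (?l u)\<close> by simp
      show ?thesis
      proof (cases "k \<in> K")
        case True then show ?thesis using k home[OF k True] Suc by (simp add: cl_def)
      next
        case False then show ?thesis using k Suc by (simp add: L_def)
      qed
    qed
  qed simp
  ultimately have dQ: "def0 Q" unfolding Q_def \<Psi>_def by (simp only:)
  have "finite ((\<lambda>y v. Q (case_sum v y)) ` {y. \<Theta> y})"
  proof (rule finite_subset)
    let ?D = "insert (El g) (\<Union>i\<in>I. {x \<in> univ Geq (ts ! i). sat Geq [x] (\<theta> i)})"
    show "(\<lambda>y v. Q (case_sum v y)) ` {y. \<Theta> y} \<subseteq> \<Psi> ` {l. set l \<subseteq> ?D \<and> length l = ?n}"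
    proof (rule image_subsetI)
      fix z assume "z \<in> {y. \<Theta> y}"
      then have z: "\<Theta> z" by simp
      have D0: "(if i \<in> K then El g else cl (ts ! i) (\<lambda>j. z (i, j))) \<in> ?D" if "i < ?n" for i
      proof (cases "i \<in> K")
        case False
        then have "i \<in> I" using that by (simp add: I_def)
        moreover have "ts ! i \<in> sorts Geq" using so that by auto
        ultimately show ?thesis using False z cl_univ[of "ts ! i"] unfolding \<Theta>_def by auto
      qed simp
      have "set (L z) \<subseteq> ?D" unfolding L_def set_map by (rule image_subsetI, rule D0) simp
      moreover have "(\<lambda>v. Q (case_sum v z)) = \<Psi> (L z)" unfolding Q_def by (rule ext) simp
      ultimately show "(\<lambda>v. Q (case_sum v z)) \<in> \<Psi> ` {l. set l \<subseteq> ?D \<and> length l = ?n}"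
        by (intro image_eqI[of _ _ "L z"]) (simp_all add: L_def)
    qed
    have "finite ?D" using I \<theta> by (auto simp: I_def)
    then show "finite (\<Psi> ` {l. set l \<subseteq> ?D \<and> length l = ?n})" by (intro finite_imageI finite_lists_length_eq)
  qed
  moreover have "\<Theta> w" unfolding \<Theta>_def using \<theta> by (auto simp: I_def w)
  ultimately have a: "adef (\<lambda>v. Q (case_sum v w))" using dQ d\<Theta> by (intro adefI)
  let ?R = "\<lambda>x y. Q (case_sum (\<lambda>b. if b then x else y) w)"
  have "(\<lambda>b. if b then v True else v False) = v" for v :: "bool \<Rightarrow> 'a" by (rule ext) simp
  then have A1: "adef2 ?R" using a by simp
  have A2: "sat Geq (El x # bs) \<phi> = ?R x g" for x
  proof -
    have "map (\<lambda>i. if i \<in> K then El g else L w ! i) [0..<?n] = bs"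
      using K w by (intro nth_equalityI) (auto simp: L_def)
    then show ?thesis by (simp add: Q_def \<Psi>_def)
  qed
  have A3: "K = {} \<longrightarrow> (\<forall>x y. ?R x y = ?R x g)" by (simp add: Q_def \<Psi>_def)
  show ?thesis by (intro exI[of _ ?R] conjI allI) (rule A1, rule A2, rule A3)
qed

text \<open>The case of no position occupied by g: \<open>R\<close> ignores its second argument, so
  the default g and the diagonal are harmless.\<close>

lemma over_acleq0_adef1:
  assumes wf: "wf_fm Geq (Home # ts) \<phi>" and bs: "bs \<in> tuples Geq ts" "set bs \<subseteq> acleq0 G"
  shows "adef1 (\<lambda>x. sat Geq (El x # bs) \<phi>)"
proof -
  have l: "length bs = length ts" using bs(1) by (auto simp: tuples_def list_all2_lengthD)
  have "\<exists>R. adef2 R \<and> (\<forall>x. sat Geq (El x # bs) \<phi> = R x undefined) \<and>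
      (({} :: nat set) = {} \<longrightarrow> (\<forall>x y. R x y = R x undefined))"
    by (rule eq_formula_adef[OF wf bs(1)]) (use l bs(2) nth_mem in auto)
  then obtain R where
    R: "adef2 R" "\<forall>x. sat Geq (El x # bs) \<phi> = R x undefined" "\<forall>x y. R x y = R x undefined" by auto
  have "adef1 (\<lambda>x. R x x)" by (rule adef2_app[OF R(1) dfun_var dfun_var])
  moreover have "R x x = sat Geq (El x # bs) \<phi>" for x using R(2,3) by metis
  ultimately show ?thesis by simp
qed

lemma over_acleq0_adef2:
  assumes "(\<phi>, bs) \<in> formulas_over Geq [Home] (acleq0 G \<union> {El g})"
  shows "\<exists>R. adef2 R \<and> (\<forall>x. sat Geq (El x # bs) \<phi> = R x g)"
proof -
  obtain ts where ts: "wf_fm Geq (Home # ts) \<phi>" "bs \<in> tuples Geq ts" "set bs \<subseteq> acleq0 G \<union> {El g}"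
    using assms by (auto simp: formulas_over_def)
  have l: "length bs = length ts" using ts(2) by (auto simp: tuples_def list_all2_lengthD)
  have "bs ! i \<in> acleq0 G" if "i < length ts" "i \<notin> {i. bs ! i = El g}" for i
  proof -
    have "bs ! i \<in> set bs" using that(1) l by simp
    then show ?thesis using that(2) ts(3) by auto
  qed
  from eq_formula_adef[OF ts(1,2), of "{i. bs ! i = El g}" g, OF _ this] show ?thesis by auto
qed

section \<open>From almost 0-definable relations back to formulas over acl^eq\<close>

primrec disj :: "('s, 'f2, 'r) fm list \<Rightarrow> ('s, 'f2, 'r) fm" where
  "disj [] = Neg (Eq (Var 0) (Var 0))"
| "disj (\<phi> # \<phi>s) = Neg (Conj (Neg \<phi>) (Neg (disj \<phi>s)))"

lemma wf_disj: "ss \<noteq> [] \<Longrightarrow> wf_fm M ss (disj \<phi>s) \<longleftrightarrow> (\<forall>\<phi>\<in>set \<phi>s. wf_fm M ss \<phi>)"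
proof (induction \<phi>s)
  case Nil
  then have "has_sort M ss (Var 0) (ss ! 0)" by (intro has_sort.intros) simp
  then show ?case by auto
qed simp

lemma sat_disj: "sat M as (disj \<phi>s) \<longleftrightarrow> (\<exists>\<phi>\<in>set \<phi>s. sat M as \<phi>)"
  by (induction \<phi>s) auto

text \<open>Membership in a finite union of E-classes, with the classes themselves as the k
  parameters placed from position \<open>off\<close> on.\<close>

definition class_formula :: "nat \<Rightarrow> (unit, 'f, 'r) fm \<Rightarrow> nat list \<Rightarrow> nat \<Rightarrow> nat \<Rightarrow>
    (('f, 'r) eqsort, ('f, 'r) eqfun, 'r) fm" where
  "class_formula n E pos off k = disj (map (\<lambda>j. Eq (App (Proj n E) (map Var pos)) (Var (off + j))) [0..<k])"

lemma class_formula_wf: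
  assumes "def_equiv G n E" "ss \<noteq> []" "length pos = n" "\<forall>p\<in>set pos. p < length ss \<and> ss ! p = Home"
  shows "wf_fm Geq (ss @ replicate k (Quot n E)) (class_formula n E pos (length ss) k)"
proof -
  let ?ss = "ss @ replicate k (Quot n E)"
  have v: "has_sort Geq ?ss (Var i) (?ss ! i)" if "i < length ?ss" for i
    using that by (rule has_sort.intros)
  have "list_all2 (has_sort Geq ?ss) (map Var pos) (fargs Geq (Proj n E))"
  proof -
    have "has_sort Geq ?ss (Var p) Home" if "p \<in> set pos" for p
      using v[of p] assms(4)[rule_format, OF that] by (simp add: nth_append)
    then show ?thesis using assms(3) by (auto simp: eq_sel list_all2_conv_all_nth)
  qed
  then have "has_sort Geq ?ss (App (Proj n E) (map Var pos)) (Quot n E)"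
    using has_sort.intros(2)[of Geq "Proj n E" ?ss "map Var pos"] assms(1) by (simp add: eq_sel)
  moreover have "has_sort Geq ?ss (Var (length ss + j)) (Quot n E)" if "j < k" for j
    using v[of "length ss + j"] that by (simp add: nth_append)
  ultimately have "wf_fm Geq ?ss (Eq (App (Proj n E) (map Var pos)) (Var (length ss + j)))" if "j < k" for j
    using that by auto
  then show ?thesis unfolding class_formula_def using assms(2) by (subst wf_disj) auto
qed

lemma class_formula_sat:
  assumes "length cs = k"
  shows "sat Geq (as @ cs) (class_formula n E pos (length as) k) \<longleftrightarrow>
    Cls n E (def_rel G n E `` {map (\<lambda>p. the_El ((as @ cs) ! p)) pos}) \<in> set cs"
proof -
  define X where "X = Cls n E (def_rel G n E `` {map (\<lambda>p. the_El ((as @ cs) ! p)) pos})"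
  have "sat Geq (as @ cs) (class_formula n E pos (length as) k) \<longleftrightarrow> (\<exists>j<k. X = cs ! j)"
    by (auto simp: class_formula_def sat_disj eq_sel comp_def X_def)
  then show ?thesis unfolding X_def[symmetric] using assms by (auto simp: in_set_conv_nth)
qed

text \<open>Converse to \<open>eq_formula_adef\<close>: a relation with finitely many conjugates is
  a union of classes of a 0-definable finite equivalence relation, and these classes are algebraic
  imaginaries. The relation is first cut down to the coordinates \<open>xs\<close> that its formula
  mentions.\<close>

lemma adef_classes:
  fixes P :: "('i \<Rightarrow> 'a) \<Rightarrow> bool"
  assumes "adef P"
  shows "\<exists>xs E cs. def_equiv G (length xs) E \<and> set cs \<subseteq> acleq0 G \<and>
    cs \<in> tuples Geq (replicate (length cs) (Quot (length xs) E)) \<and>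
    (\<forall>v. P v \<longleftrightarrow> Cls (length xs) E (def_rel G (length xs) E `` {map v xs}) \<in> set cs)"
proof -
  from adef_equivalence[OF assms] obtain D where D: "def0 (\<lambda>w :: 'i + 'i \<Rightarrow> 'a. D (\<lambda>i. w (Inl i)) (\<lambda>i. w (Inr i)))"
    "equivp D" "finite (range D)" "\<forall>v v'. D v v' \<longrightarrow> P v = P v'" by (elim exE conjE)
  obtain zs where zs: "\<forall>ys. set zs \<subseteq> set ys \<longrightarrow> (\<exists>\<phi>. wff (length ys) \<phi> \<and>
    (\<forall>w. D (\<lambda>i. w (Inl i)) (\<lambda>i. w (Inr i)) = sat G (map w ys) \<phi>))" using def0_formula[OF D(1)] by (elim exE)
  have "finite ({i. Inl i \<in> set zs} \<union> {i. Inr i \<in> set zs})"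
    using finite_vimageI[of "set zs" Inl] finite_vimageI[of "set zs" Inr] by (simp add: vimage_def)
  from finite_distinct_list[OF this] obtain xs where
    xs: "set xs = {i. Inl i \<in> set zs} \<union> {i. Inr i \<in> set zs}" "distinct xs" by (elim exE conjE)
  define n where "n = length xs"
  have "set zs \<subseteq> set (map Inl xs @ map Inr xs)"
  proof
    fix x assume m: "x \<in> set zs"
    show "x \<in> set (map Inl xs @ map Inr xs)" by (cases x) (use m in \<open>auto simp: xs\<close>)
  qed
  with zs obtain E where E: "wff (length (map Inl xs @ map Inr xs :: ('i + 'i) list)) E"
    "\<forall>w. D (\<lambda>i. w (Inl i)) (\<lambda>i. w (Inr i)) = sat G (map w (map Inl xs @ map Inr xs)) E" by blast
  have DE: "D v v' = sat G (map v xs @ map v' xs) E" for v v'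
    using E(2)[rule_format, of "case_sum v v'"] by (simp add: comp_def)
  have Dc: "D v v' \<longleftrightarrow> D v = D v'" for v v' using D(2) by (simp add: equivp_def)
  have surj: "\<exists>v. as = map v xs" if "length as = n" for as :: "'a list"
    using that xs(2) unfolding n_def
    by (intro exI[of _ "\<lambda>i. the (map_of (zip xs as) i)"] nth_equalityI) (simp_all add: map_of_zip_nth)
  have rel: "def_rel G n E = {(as, bs). length as = n \<and> length bs = n \<and> sat G (as @ bs) E}"
    by (auto simp: def_rel_def)
  have rel': "(map v xs, map v' xs) \<in> def_rel G n E \<longleftrightarrow> D v = D v'" for v v'
    by (simp add: rel n_def[symmetric] DE[symmetric] Dc)
  have eq: "equiv (tuples G (replicate n ())) (def_rel G n E)"
  proof (intro equivI refl_onI symI transI)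
    show "def_rel G n E \<subseteq> tuples G (replicate n ()) \<times> tuples G (replicate n ())" by (auto simp: rel)
  next
    fix as assume "as \<in> tuples G (replicate n ())"
    then obtain v where "as = map v xs" using surj by auto
    then show "(as, as) \<in> def_rel G n E" by (simp only: rel')
  next
    fix as bs assume h: "(as, bs) \<in> def_rel G n E"
    then obtain v v' where e: "as = map v xs" "bs = map v' xs" using surj unfolding rel by blast
    show "(bs, as) \<in> def_rel G n E" using h unfolding e rel' by (rule sym)
  next
    fix as bs cs assume h: "(as, bs) \<in> def_rel G n E" "(bs, cs) \<in> def_rel G n E"
    then obtain u v v' where e: "as = map u xs" "bs = map v xs" "cs = map v' xs"
      using surj unfolding rel by blast
    show "(as, cs) \<in> def_rel G n E" using h unfolding e rel' by (rule trans)
  qed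
  have de: "def_equiv G n E" unfolding def_equiv_def using eq E(1) by (simp add: n_def replicate_add)
  have ceq: "def_rel G n E `` {map v xs} = def_rel G n E `` {map v' xs} \<longleftrightarrow> D v = D v'" for v v'
    using eq_equiv_class_iff[OF eq, of "map v xs" "map v' xs"] by (simp add: rel' n_def[symmetric])
  define c where "c v = Cls n E (def_rel G n E `` {map v xs})" for v
  have cD: "c v = c v' \<longleftrightarrow> D v = D v'" for v v' unfolding c_def using ceq by simp
  have "finite (range c)"
  proof -
    have "c v = (\<lambda>d. c (SOME v. D v = d)) (D v)" for v
      unfolding cD using someI[of "\<lambda>v'. D v' = D v" v] by simp
    then have "range c \<subseteq> (\<lambda>d. c (SOME v. D v = d)) ` range D" by blast
    then show ?thesis using D(3) by (metis finite_imageI finite_subset)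
  qed
  moreover have uc: "univ Geq (Quot n E) = range c"
  proof -
    have "tuples G (replicate n ()) = range (\<lambda>v. map v xs)"
    proof (intro set_eqI iffI)
      fix as assume "as \<in> tuples G (replicate n ())"
      then obtain v where "as = map v xs" using surj by auto
      then show "as \<in> range (\<lambda>v. map v xs)" by (intro image_eqI[of _ _ v]) simp_all
    qed (auto simp: n_def)
    then have "tuples G (replicate n ()) // def_rel G n E = range (\<lambda>v. def_rel G n E `` {map v xs})"
      by (auto simp: quotient_def)
    then show ?thesis unfolding univ_Quot c_def using de by auto
  qed
  ultimately have fu: "finite (univ Geq (Quot n E))" by simp
  have acl: "c v \<in> acleq0 G" for v
  proof -
    \<comment> \<open>The whole quotient sort is finite, so the formula x = x witnesses that each
      class is algebraic over the empty set.\<close>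
    have "has_sort Geq [Quot n E] (Var 0) (Quot n E)"
      using has_sort.intros(1)[of 0 "[Quot n E]" Geq] by simp
    then have "(Eq (Var 0) (Var 0), []) \<in> formulas_over Geq [Quot n E] {}"
      by (auto simp: formulas_over_def tuples_def)
    then show ?thesis unfolding acleq0_def acl_def
      using fu uc de by (auto simp: eq_sel intro!: exI[of _ "Quot n E"] bexI[of _ "(Eq (Var 0) (Var 0), [])"])
  qed
  have "finite (c ` {v. P v})" using \<open>finite (range c)\<close> by (rule finite_subset[rotated]) blast
  from finite_list[OF this] obtain cs where cs: "set cs = c ` {v. P v}" by (elim exE)
  have "P v \<longleftrightarrow> c v \<in> set cs" for v
  proof
    assume "c v \<in> set cs"
    then obtain v' where "c v = c v'" "P v'" unfolding cs by blast
    then have "D v v'" by (simp add: cD Dc)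
    then show "P v" using D(4) \<open>P v'\<close> by blast
  qed (simp add: cs)
  moreover have "set cs \<subseteq> acleq0 G" using cs acl by auto
  moreover have "cs \<in> tuples Geq (replicate (length cs) (Quot n E))"
  proof -
    have "cs ! i \<in> range c" if "i < length cs" for i using nth_mem[OF that] cs by auto
    then show ?thesis by (simp add: tuples_def list_all2_conv_all_nth uc)
  qed
  ultimately show ?thesis using de unfolding c_def n_def
    by (intro exI[of _ xs] exI[of _ E] exI[of _ cs]) simp
qed

lemma adef1_formula:
  assumes "adef1 P"
  shows "\<exists>\<phi> cs. (\<phi>, cs) \<in> formulas_over Geq [Home] (acleq0 G) \<and> (\<forall>x. sat Geq (El x # cs) \<phi> = P x)"
proof -
  from adef_classes[OF assms] obtain xs E cs where
    h: "def_equiv G (length xs) E" "set cs \<subseteq> acleq0 G" "cs \<in> tuples Geq (replicate (length cs) (Quot (length xs) E))"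
    "\<forall>v. P (v ()) \<longleftrightarrow> Cls (length xs) E (def_rel G (length xs) E `` {map v xs}) \<in> set cs" by (elim exE conjE)
  let ?\<phi> = "class_formula (length xs) E (map (\<lambda>_. 0) xs) 1 (length cs)"
  have "wf_fm Geq ([Home] @ replicate (length cs) (Quot (length xs) E)) ?\<phi>"
    using class_formula_wf[OF h(1), of "[Home]" "map (\<lambda>_. 0) xs" "length cs"] by auto
  then have "(?\<phi>, cs) \<in> formulas_over Geq [Home] (acleq0 G)" unfolding formulas_over_def using h(2,3) by blast
  moreover have "sat Geq (El x # cs) ?\<phi> = P x" for x
    using class_formula_sat[of cs "length cs" "[El x]" "length xs" E "map (\<lambda>_. 0) xs"] h(4)[rule_format, of "\<lambda>_. x"]
    by (simp add: comp_def)
  ultimately show ?thesis by blast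
qed

lemma adef2_formula:
  assumes "adef2 R"
  shows "\<exists>\<phi> ts cs. wf_fm Geq (Home # Home # ts) \<phi> \<and> cs \<in> tuples Geq ts \<and> set cs \<subseteq> acleq0 G \<and>
    (\<forall>x y. sat Geq (El x # El y # cs) \<phi> = R x y)"
proof -
  from adef_classes[OF assms] obtain xs E cs where
    h: "def_equiv G (length xs) E" "set cs \<subseteq> acleq0 G" "cs \<in> tuples Geq (replicate (length cs) (Quot (length xs) E))"
    "\<forall>v. R (v True) (v False) \<longleftrightarrow> Cls (length xs) E (def_rel G (length xs) E `` {map v xs}) \<in> set cs" by (elim exE conjE)
  let ?p = "map (\<lambda>b. if b then 0 else Suc 0) xs"
  let ?\<phi> = "class_formula (length xs) E ?p 2 (length cs)"
  have "wf_fm Geq ([Home, Home] @ replicate (length cs) (Quot (length xs) E)) ?\<phi>"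
  proof -
    have p: "\<forall>p\<in>set ?p. p < length [Home, Home] \<and> [Home, Home] ! p = Home" by auto
    from class_formula_wf[OF h(1) _ _ p, of "length cs"] show ?thesis by (simp add: numeral_2_eq_2)
  qed
  moreover have "sat Geq (El x # El y # cs) ?\<phi> = R x y" for x y
  proof -
    have "map (\<lambda>b. the_El ((El x # El y # cs) ! (if b then 0 else Suc 0))) xs = map (\<lambda>b. if b then x else y) xs"
      by (rule map_cong) simp_all
    then show ?thesis
      using class_formula_sat[of cs "length cs" "[El x, El y]" "length xs" E ?p] h(4)[rule_format, of "\<lambda>b. if b then x else y"]
      by (simp add: comp_def numeral_2_eq_2 del: map_eq_conv)
  qed
  ultimately show ?thesis using h(2,3)
    by (intro exI[of _ ?\<phi>] exI[of _ "replicate (length cs) (Quot (length xs) E)"] exI[of _ cs]) simp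
qed

text \<open>\<open>d\<close> is a condition on representatives, while a formula about imaginaries is
  wanted. The formula quantifies existentially over home variables, says with the projections that
  they represent the given tuple, and asserts \<open>d\<close> of them.\<close>

lemma adef_tup_formula:
  assumes d: "adef d" and ts: "set ts \<subseteq> sorts Geq"
  shows "\<exists>\<xi> us cs. wf_fm Geq (ts @ us) \<xi> \<and> cs \<in> tuples Geq us \<and> set cs \<subseteq> acleq0 G \<and>
    (\<forall>zs. length zs = length ts \<longrightarrow> sat Geq (zs @ cs) \<xi> = (\<exists>w. tup ts w = zs \<and> d w))"
proof -
  from adef_classes[OF d] obtain xs E cs where
    h: "def_equiv G (length xs) E" "set cs \<subseteq> acleq0 G" "cs \<in> tuples Geq (replicate (length cs) (Quot (length xs) E))"
    "\<forall>v. d v \<longleftrightarrow> Cls (length xs) E (def_rel G (length xs) E `` {map v xs}) \<in> set cs" by (elim exE conjE)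
  define ar where "ar s = (case s of Home \<Rightarrow> 1 | Quot n E \<Rightarrow> n)" for s :: "('f, 'r) eqsort"
  have "finite ({(i, j). i < length ts \<and> j < ar (ts ! i)} \<union> set xs \<union> {(0, 0)})"
  proof -
    have "{(i, j). i < length ts \<and> j < ar (ts ! i)} = (SIGMA i:{..<length ts}. {..<ar (ts ! i)})" by auto
    then show ?thesis by simp
  qed
  from finite_distinct_list[OF this] obtain L where
    \<comment> \<open>\<open>L\<close> lists the home coordinates to be quantified. The index (0, 0)
      is added so that the context is never empty, as \<open>class_formula_wf\<close>
      requires.\<close>
    L: "set L = {(i, j). i < length ts \<and> j < ar (ts ! i)} \<union> set xs \<union> {(0, 0)}" "distinct L" by (elim exE conjE)
  define N where "N = length L"
  have "\<forall>p. \<exists>k. p \<in> set L \<longrightarrow> k < N \<and> L ! k = p" by (auto simp: N_def in_set_conv_nth)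
  from choice[OF this] obtain idx where idx: "\<forall>p. p \<in> set L \<longrightarrow> idx p < N \<and> L ! idx p = p" by (elim exE)
  have "L \<noteq> []" using L(1) by auto
  then have N: "N > 0" by (simp add: N_def)
  define us where "us = replicate (length cs) (Quot (length xs) E)"
  let ?ss = "replicate N Home @ ts"
  define \<chi> where "\<chi> = class_formula (length xs) E (map idx xs) (length ?ss) (length cs)"
  define e :: "nat \<Rightarrow> (('f, 'r) eqsort, ('f, 'r) eqfun, 'r) fm" where "e i = (case ts ! i of Home \<Rightarrow> Eq (Var (idx (i, 0))) (Var (N + i))
    | Quot n E \<Rightarrow> Eq (App (Proj n E) (map (\<lambda>j. Var (idx (i, j))) [0..<n])) (Var (N + i)))" for i
  define \<xi> where "\<xi> = (Exi Home ^^ N) (foldr Conj (map e [0..<length ts]) \<chi>)"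
  have wff_foldr: "wf_fm M ss (foldr Conj \<phi>s \<psi>) \<longleftrightarrow> (\<forall>\<phi>\<in>set \<phi>s. wf_fm M ss \<phi>) \<and> wf_fm M ss \<psi>"
    for M :: "(('f, 'r) eqsort, ('f, 'r) eqfun, 'r, ('f, 'r, 'a) eqel) struct" and ss \<phi>s \<psi> by (induction \<phi>s) auto
  have sat_foldr: "sat M as (foldr Conj \<phi>s \<psi>) \<longleftrightarrow> (\<forall>\<phi>\<in>set \<phi>s. sat M as \<phi>) \<and> sat M as \<psi>"
    for M :: "(('f, 'r) eqsort, ('f, 'r) eqfun, 'r, ('f, 'r, 'a) eqel) struct" and as \<phi>s \<psi> by (induction \<phi>s) auto
  have v: "has_sort Geq (?ss @ us) (Var i) ((?ss @ us) ! i)" if "i < length (?ss @ us)" for i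
    using that by (rule has_sort.intros)
  have vh: "has_sort Geq (?ss @ us) (Var (idx p)) Home" if "p \<in> set L" for p
  proof -
    have "idx p < N" using idx that by blast
    then show ?thesis using v[of "idx p"] by (simp add: nth_append)
  qed
  have vt: "has_sort Geq (?ss @ us) (Var (N + i)) (ts ! i)" if "i < length ts" for i
    using v[of "N + i"] that by (simp add: nth_append)
  have wfe: "wf_fm Geq (?ss @ us) (e i)" if i: "i < length ts" for i
  proof (cases "ts ! i")
    case Home
    then have "(i, 0) \<in> set L" using i by (simp add: L(1) ar_def)
    then show ?thesis unfolding e_def Home using vh vt[OF i] Home by auto
  next
    case (Quot n E')
    have "(i, j) \<in> set L" if "j < n" for j using i that Quot by (simp add: L(1) ar_def)
    then have "list_all2 (has_sort Geq (?ss @ us)) (map (\<lambda>j. Var (idx (i, j))) [0..<n]) (fargs Geq (Proj n E'))"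
      using vh by (auto simp: eq_sel list_all2_conv_all_nth)
    moreover have "Quot n E' \<in> sorts Geq" using ts nth_mem[OF i] Quot by auto
    ultimately have "has_sort Geq (?ss @ us) (App (Proj n E') (map (\<lambda>j. Var (idx (i, j))) [0..<n])) (Quot n E')"
      using has_sort.intros(2)[of Geq "Proj n E'"] by (simp add: eq_sel)
    then show ?thesis unfolding e_def Quot using vt[OF i] Quot by auto
  qed
  have "wf_fm Geq (?ss @ us) \<chi>" unfolding \<chi>_def us_def
  proof (rule class_formula_wf[OF h(1)])
    show "?ss \<noteq> []" using N by simp
    show "length (map idx xs) = length xs" by simp
    show "\<forall>p\<in>set (map idx xs). p < length ?ss \<and> ?ss ! p = Home"
    proof
      fix p assume "p \<in> set (map idx xs)"
      then obtain q where "q \<in> set L" "p = idx q" by (auto simp: L(1))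
      then have "p < N" using idx by blast
      then show "p < length ?ss \<and> ?ss ! p = Home" by (simp add: nth_append)
    qed
  qed
  then have wf: "wf_fm Geq (ts @ us) \<xi>" unfolding \<xi>_def wf_exs wff_foldr using wfe by (auto simp: eq_sel)
  have "sat Geq (zs @ cs) \<xi> = (\<exists>w. tup ts w = zs \<and> d w)" if zs: "length zs = length ts" for zs
  proof -
    have body: "sat Geq (map (\<lambda>p. El (w p)) L @ zs @ cs) (foldr Conj (map e [0..<length ts]) \<chi>) \<longleftrightarrow> tup ts w = zs \<and> d w" for w
    proof -
      let ?as = "map (\<lambda>p. El (w p)) L @ zs @ cs"
      have ni: "?as ! idx p = El (w p)" if "p \<in> set L" for p
      proof -
        have "idx p < N" "L ! idx p = p" using idx that by blast+
        then show ?thesis by (simp add: nth_append N_def)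
      qed
      have nz: "?as ! (N + i) = zs ! i" if "i < length ts" for i
        using that zs by (simp add: nth_append N_def)
      have se: "sat Geq ?as (e i) \<longleftrightarrow> cl (ts ! i) (\<lambda>j. w (i, j)) = zs ! i" if i: "i < length ts" for i
      proof (cases "ts ! i")
        case Home
        then have "(i, 0) \<in> set L" using i by (simp add: L(1) ar_def)
        then show ?thesis unfolding e_def Home using ni nz[OF i] by (simp add: cl_def)
      next
        case (Quot n E')
        have "(i, j) \<in> set L" if "j < n" for j using i that Quot by (simp add: L(1) ar_def)
        then have "map (\<lambda>j. the_El (?as ! idx (i, j))) [0..<n] = map (\<lambda>j. w (i, j)) [0..<n]"
          using ni by (intro map_cong) auto
        then show ?thesis unfolding e_def Quot using nz[OF i] by (simp add: cl_def eq_sel comp_def del: map_eq_conv)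
      qed
      have "tup ts w = zs \<longleftrightarrow> (\<forall>i<length ts. cl (ts ! i) (\<lambda>j. w (i, j)) = zs ! i)"
        using zs by (simp add: list_eq_iff_nth_eq)
      moreover have "sat Geq ?as \<chi> = d w"
      proof -
        have e: "map (\<lambda>p. the_El (?as ! p)) (map idx xs) = map w xs" using ni by (simp add: L(1))
        have l: "length ?ss = length (map (\<lambda>p. El (w p)) L @ zs)" by (simp add: N_def zs)
        have "sat Geq ?as \<chi> \<longleftrightarrow>
            Cls (length xs) E (def_rel G (length xs) E `` {map (\<lambda>p. the_El (?as ! p)) (map idx xs)}) \<in> set cs"
          using class_formula_sat[of cs "length cs" "map (\<lambda>p. El (w p)) L @ zs" "length xs" E "map idx xs", OF refl]
          unfolding \<chi>_def l append_assoc .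
        also have "\<dots> = d w" unfolding e by (rule h(4)[rule_format, symmetric])
        finally show ?thesis .
      qed
      moreover have "(\<forall>\<phi>\<in>set (map e [0..<length ts]). sat Geq ?as \<phi>) \<longleftrightarrow>
          (\<forall>i<length ts. cl (ts ! i) (\<lambda>j. w (i, j)) = zs ! i)"
      proof -
        have "(\<forall>\<phi>\<in>set (map e [0..<length ts]). sat Geq ?as \<phi>) \<longleftrightarrow> (\<forall>i<length ts. sat Geq ?as (e i))"
          by (simp only: set_map set_upt ball_simps atLeast0LessThan lessThan_iff Ball_def imp_ex) blast
        then show ?thesis using se by (simp only:) blast
      qed
      ultimately show ?thesis unfolding sat_foldr by (simp only:)
    qed
    show ?thesis
    proof
      assume "sat Geq (zs @ cs) \<xi>"
      then obtain bs where bs: "length bs = N" "set bs \<subseteq> univ Geq Home"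
        "sat Geq (bs @ zs @ cs) (foldr Conj (map e [0..<length ts]) \<chi>)" unfolding \<xi>_def sat_exs by blast
      define w where "w p = the_El (the (map_of (zip L bs) p))" for p
      have "bs = map (\<lambda>p. El (w p)) L"
      proof (rule nth_equalityI)
        fix i assume i: "i < length bs"
        then have "bs ! i \<in> range El" using bs(2) nth_mem[OF i] by (auto simp: eq_sel)
        then have "El (the_El (bs ! i)) = bs ! i" by auto
        then show "bs ! i = map (\<lambda>p. El (w p)) L ! i"
          using i bs(1) L(2) by (simp add: w_def N_def map_of_zip_nth)
      qed (simp add: bs(1) N_def)
      then show "\<exists>w. tup ts w = zs \<and> d w" using bs(3) body by blast
    next
      assume "\<exists>w. tup ts w = zs \<and> d w"
      then obtain w where "tup ts w = zs \<and> d w" by (elim exE)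
      then show "sat Geq (zs @ cs) \<xi>" unfolding \<xi>_def sat_exs
        using body[of w] by (intro exI[of _ "map (\<lambda>p. El (w p)) L"]) (auto simp: N_def eq_sel)
    qed
  qed
  then show ?thesis using wf h(2,3) unfolding us_def[symmetric]
    by (intro exI[of _ \<xi>] exI[of _ us] exI[of _ cs]) simp
qed

end

section \<open>Nonforking extensions\<close>

context stable_group
begin

lemma realizes_Home: "as \<in> tuples Geq [Home] \<longleftrightarrow> (\<exists>x. as = [El x])"
  by (auto simp: tuples_def eq_sel list_all2_Cons2)

lemma stp_global_ext:
  assumes U: "global_ext a U" and f: "(\<phi>, bs) \<in> formulas_over Geq [Home] (acleq0 G)"
  shows "U (\<lambda>x. sat Geq (El x # bs) \<phi>) = sat Geq (El a # bs) \<phi>"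
proof -
  obtain ts where "wf_fm Geq (Home # ts) \<phi>" "bs \<in> tuples Geq ts" "set bs \<subseteq> acleq0 G"
    using f by (auto simp: formulas_over_def)
  from global_ext_iff[OF U over_acleq0_adef1[OF this]] show ?thesis .
qed

lemma formulas_over_mono: "A \<subseteq> B \<Longrightarrow> formulas_over M ss A \<subseteq> formulas_over M ss B"
  unfolding formulas_over_def by blast

text \<open>A formula in the trace of a global extension does not divide, because its definition holds
  of all conjugates over \<open>acl\<^sup>e\<^sup>q(\<emptyset>)\<close> of the parameters.\<close>

lemma global_ext_not_divides:
  assumes U: "global_ext a U" and d: "divides Geq [Home] (acleq0 G) (\<psi>, cs)"
  shows "\<not> U (\<lambda>x. sat Geq (El x # cs) \<psi>)"
proof
  assume Ucs: "U (\<lambda>x. sat Geq (El x # cs) \<psi>)"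
  obtain ts k c where ts: "wf_fm Geq ([Home] @ ts) \<psi>" "cs \<in> tuples Geq ts"
    "\<forall>i::nat. c i \<in> tuples Geq ts \<and> realizes Geq (c i) (tp Geq ts cs (acleq0 G))"
    "\<forall>I. finite I \<and> card I = k \<longrightarrow> \<not> (\<exists>as\<in>tuples Geq [Home]. \<forall>i\<in>I. sat Geq (as @ c i) \<psi>)"
    using d unfolding divides_def prod.case by (elim exE conjE)
  have so: "set ts \<subseteq> sorts Geq" by (rule tuples_eq_sorts[OF ts(2)])
  have wf: "wf_fm Geq (Home # ts) \<psi>" using ts(1) by simp
  define d where "d w \<longleftrightarrow> U (\<lambda>x. sat Geq (El x # tup ts w) \<psi>)" for w
  from global_ext_adef[OF U, of "\<lambda>x w. sat Geq (El x # tup ts w) \<psi>", OF def0_adef[OF eq_formula_option_def0[OF wf so]]]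
  have "adef d" unfolding d_def .
  from adef_tup_formula[OF this so] obtain \<xi> us es where \<xi>: "wf_fm Geq (ts @ us) \<xi>" "es \<in> tuples Geq us"
    "set es \<subseteq> acleq0 G" "\<forall>zs. length zs = length ts \<longrightarrow> sat Geq (zs @ es) \<xi> = (\<exists>w. tup ts w = zs \<and> d w)"
    by (elim exE conjE)
  have len: "length zs = length ts" if "zs \<in> tuples Geq ts" for zs
    using that by (auto simp: tuples_def list_all2_lengthD)
  obtain w0 where w0: "cs = tup ts w0" using tuples_eq_tup[OF ts(2)] by (elim exE)
  have "d w0" using Ucs unfolding d_def w0 .
  then have "sat Geq (cs @ es) \<xi>" using \<xi>(4) w0 by auto
  then have tp: "(\<xi>, es) \<in> tp Geq ts cs (acleq0 G)"
    unfolding tp_def formulas_over_def using \<xi>(1-3) by blast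
  have Uc: "U (\<lambda>x. sat Geq (El x # c i) \<psi>)" for i
  proof -
    have "sat Geq (c i @ es) \<xi>" using ts(3) tp unfolding realizes_def by blast
    then obtain w where "tup ts w = c i" "d w" using \<xi>(4) len[of "c i"] ts(3) by auto
    then show ?thesis unfolding d_def by simp
  qed
  have "U (\<lambda>x. \<forall>i\<in>{..<k}. sat Geq (El x # c i) \<psi>)"
    unfolding ultra_ball[OF global_ext_ultra[OF U] finite_lessThan] using Uc by blast
  from ultra_ex[OF global_ext_ultra[OF U] this] obtain x where x: "\<forall>i\<in>{..<k}. sat Geq (El x # c i) \<psi>" by (elim exE)
  have "\<exists>as\<in>tuples Geq [Home]. \<forall>i\<in>{..<k}. sat Geq (as @ c i) \<psi>"
    by (rule bexI[of _ "[El x]"]) (use x realizes_Home in auto)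
  then show False using ts(4)[rule_format, of "{..<k}"] by simp
qed

text \<open>The trace of \<open>U\<close> is complete and contains no dividing formula. For
  uniqueness, a formula \<open>R x g\<close> rejected by \<open>U\<close> is by symmetry rejected by
  the definition of \<open>R\<close> at a; the strong type of a then contains the failure of that
  definition, and together with \<open>R x g\<close> this divides.\<close>

lemma nf_ext_global_ext:
  assumes U: "global_ext a U"
  shows "nf_ext G (stp G a) {El g} =
    {(\<phi>, bs) \<in> formulas_over Geq [Home] (acleq0 G \<union> {El g}). U (\<lambda>x. sat Geq (El x # bs) \<phi>)}" (is "_ = ?q")
  unfolding nf_ext_def
proof (rule the_equality)
  have uU: "ultra U" by (rule global_ext_ultra[OF U])
  have Uq: "U (\<lambda>x. \<forall>p\<in>q0. sat Geq (El x # snd p) (fst p))" if "finite q0" "q0 \<subseteq> ?q" for q0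
    unfolding ultra_ball[OF uU that(1)] using that(2) by auto
  show "?q \<in> complete_types Geq [Home] (acleq0 G \<union> {El g}) \<and> stp G a \<subseteq> ?q \<and> \<not> forks Geq [Home] (acleq0 G) ?q"
  proof (intro conjI)
    show "?q \<in> complete_types Geq [Home] (acleq0 G \<union> {El g})"
      unfolding complete_types_def
    proof (rule CollectI, intro conjI allI impI)
      fix q0 assume "finite q0 \<and> q0 \<subseteq> ?q"
      with ultra_ex[OF uU Uq] obtain x where "\<forall>p\<in>q0. sat Geq (El x # snd p) (fst p)" by blast
      then show "\<exists>as\<in>tuples Geq [Home]. realizes Geq as q0"
        by (intro bexI[of _ "[El x]"]) (auto simp: realizes_def realizes_Home)
    next
      show "\<forall>(\<phi>, bs)\<in>formulas_over Geq [Home] (acleq0 G \<union> {El g}). (\<phi>, bs) \<in> ?q \<or> (Neg \<phi>, bs) \<in> ?q"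
      proof (rule ballI)
        fix p assume p: "p \<in> formulas_over Geq [Home] (acleq0 G \<union> {El g})"
        obtain \<phi> bs where pe: "p = (\<phi>, bs)" by (cases p)
        have f: "(\<phi>, bs) \<in> formulas_over Geq [Home] (acleq0 G \<union> {El g})" using p pe by simp
        then have f': "(Neg \<phi>, bs) \<in> formulas_over Geq [Home] (acleq0 G \<union> {El g})"
          unfolding formulas_over_def by simp
        have "U (\<lambda>x. sat Geq (El x # bs) \<phi>) \<or> U (\<lambda>x. sat Geq (El x # bs) (Neg \<phi>))"
          by (simp add: ultra_not[OF uU])
        then show "case p of (\<phi>, bs) \<Rightarrow> (\<phi>, bs) \<in> ?q \<or> (Neg \<phi>, bs) \<in> ?q"
          using f f' unfolding pe by simp
      qed
    qed blast
  next
    show "stp G a \<subseteq> ?q"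
    proof (rule subsetI, clarify)
      fix \<phi> bs assume "(\<phi>, bs) \<in> stp G a"
      then have "(\<phi>, bs) \<in> formulas_over Geq [Home] (acleq0 G)" "sat Geq (El a # bs) \<phi>"
        by (auto simp: stp_def tp_def)
      then show "(\<phi>, bs) \<in> formulas_over Geq [Home] (acleq0 G \<union> {El g}) \<and> U (\<lambda>x. sat Geq (El x # bs) \<phi>)"
        using stp_global_ext[OF U] formulas_over_mono[of "acleq0 G" "acleq0 G \<union> {El g}" Geq "[Home]"] by auto
    qed
  next
    show "\<not> forks Geq [Home] (acleq0 G) ?q"
    proof
      assume "forks Geq [Home] (acleq0 G) ?q"
      then obtain \<pi>0 \<Delta> where f: "finite \<pi>0" "\<pi>0 \<subseteq> ?q" "finite \<Delta>" "\<forall>\<delta>\<in>\<Delta>. divides Geq [Home] (acleq0 G) \<delta>"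
        "\<forall>as\<in>tuples Geq [Home]. realizes Geq as \<pi>0 \<longrightarrow> (\<exists>(\<psi>, cs)\<in>\<Delta>. sat Geq (as @ cs) \<psi>)"
        unfolding forks_def by (elim exE conjE)
      have "U (\<lambda>x. \<exists>\<delta>\<in>\<Delta>. sat Geq (El x # snd \<delta>) (fst \<delta>))"
      proof (rule ultra_mono[OF uU Uq[OF f(1,2)]])
        fix x assume "\<forall>p\<in>\<pi>0. sat Geq (El x # snd p) (fst p)"
        then have "realizes Geq [El x] \<pi>0" by (auto simp: realizes_def)
        then have "\<exists>(\<psi>, cs)\<in>\<Delta>. sat Geq ([El x] @ cs) \<psi>" using f(5) realizes_Home by blast
        then show "\<exists>\<delta>\<in>\<Delta>. sat Geq (El x # snd \<delta>) (fst \<delta>)" by (elim bexE) (rule bexI, auto)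
      qed
      then obtain \<delta> where \<delta>: "\<delta> \<in> \<Delta>" "U (\<lambda>x. sat Geq (El x # snd \<delta>) (fst \<delta>))"
        unfolding ultra_bex[OF uU f(3)] by (elim bexE)
      have "divides Geq [Home] (acleq0 G) (fst \<delta>, snd \<delta>)" using f(4) \<delta>(1) by simp
      from global_ext_not_divides[OF U this] \<delta>(2) show False by (rule notE)
    qed
  qed
next
  have uU: "ultra U" by (rule global_ext_ultra[OF U])
  fix q' assume "q' \<in> complete_types Geq [Home] (acleq0 G \<union> {El g}) \<and> stp G a \<subseteq> q' \<and> \<not> forks Geq [Home] (acleq0 G) q'"
  then have c: "q' \<subseteq> formulas_over Geq [Home] (acleq0 G \<union> {El g})"
      "\<forall>(\<phi>, bs)\<in>formulas_over Geq [Home] (acleq0 G \<union> {El g}). (\<phi>, bs) \<in> q' \<or> (Neg \<phi>, bs) \<in> q'"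
    and s: "stp G a \<subseteq> q'" and nf: "\<not> forks Geq [Home] (acleq0 G) q'"
    unfolding complete_types_def mem_Collect_eq by (blast, blast, blast, blast)
  have sub: "U (\<lambda>x. sat Geq (El x # bs) \<phi>)" if \<phi>: "(\<phi>, bs) \<in> q'" for \<phi> bs
  proof (rule ccontr)
    assume nU: "\<not> U (\<lambda>x. sat Geq (El x # bs) \<phi>)"
    have "(\<phi>, bs) \<in> formulas_over Geq [Home] (acleq0 G \<union> {El g})" using c(1) \<phi> by blast
    from over_acleq0_adef2[OF this] obtain R where R: "adef2 R" "\<forall>x. sat Geq (El x # bs) \<phi> = R x g" by (elim exE conjE)
    obtain V where V: "global_ext g V" using global_ext_exists[of g] by (elim exE)
    define T where "T x \<longleftrightarrow> V (\<lambda>y. R x y)" for x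
    have T: "adef1 T" unfolding T_def by (rule global_ext_adef2[OF V adef2_swap[OF R(1)]])
    have "\<not> T a" using nU global_ext_symmetric[OF U V R(1)] R(2) unfolding T_def by simp
    from adef1_formula[OF adef_not[OF T]] obtain \<tau> es where \<tau>: "(\<tau>, es) \<in> formulas_over Geq [Home] (acleq0 G)"
      "\<forall>x. sat Geq (El x # es) \<tau> = (\<not> T x)" by (elim exE conjE)
    have \<tau>q: "(\<tau>, es) \<in> q'" using s \<tau> \<open>\<not> T a\<close> by (auto simp: stp_def tp_def)
    have W: "adef2 (\<lambda>x y. R x y \<and> \<not> T x)" by (intro adef_conj adef_not R(1) adef1_app[OF T dfun_var])
    from adef2_formula[OF W] obtain \<chi> ts cs where \<chi>: "wf_fm Geq (Home # Home # ts) \<chi>" "cs \<in> tuples Geq ts"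
      "set cs \<subseteq> acleq0 G" "\<forall>x y. sat Geq (El x # El y # cs) \<chi> = (R x y \<and> \<not> T x)" by (elim exE conjE)
    have tup: "El y # cs \<in> tuples Geq (Home # ts)" for y using \<chi>(2) by (simp add: tuples_def eq_sel)
    obtain h k where h: "\<forall>i P. adef1 P \<longrightarrow> P (h i) = P g"
      "\<forall>I :: nat set. finite I \<and> card I = k \<longrightarrow> \<not> (\<exists>x. \<forall>i\<in>I. R x (h i) \<and> \<not> V (\<lambda>y. R x y))"
      using global_ext_divides[OF V R(1)] by (elim exE conjE)
    \<comment> \<open>The Morley terms have the strong type of g, and \<open>cs\<close> consists of
      algebraic elements, so appending \<open>cs\<close> does not disturb the type over
      acl^eq.\<close>
    have rz: "realizes Geq (El (h i) # cs) (tp Geq (Home # ts) (El g # cs) (acleq0 G))" for i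
      unfolding realizes_def
    proof (rule ballI, clarify)
      fix \<rho> ds assume "(\<rho>, ds) \<in> tp Geq (Home # ts) (El g # cs) (acleq0 G)"
      then obtain us where us: "wf_fm Geq (Home # (ts @ us)) \<rho>" "ds \<in> tuples Geq us" "set ds \<subseteq> acleq0 G"
        "sat Geq (El g # (cs @ ds)) \<rho>" by (auto simp: tp_def formulas_over_def)
      have "cs @ ds \<in> tuples Geq (ts @ us)" using \<chi>(2) us(2) by (auto simp: tuples_def list_all2_appendI)
      from over_acleq0_adef1[OF us(1) this] \<chi>(3) us(3) have "adef1 (\<lambda>x. sat Geq (El x # (cs @ ds)) \<rho>)" by simp
      from h(1)[rule_format, OF this, of i] us(4) show "sat Geq ((El (h i) # cs) @ ds) \<rho>" by simp
    qed
    have "divides Geq [Home] (acleq0 G) (\<chi>, El g # cs)"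
      unfolding divides_def prod.case
    proof (intro exI[of _ "Home # ts"] exI[of _ k] exI[of _ "\<lambda>i. El (h i) # cs"] conjI allI impI)
      fix I :: "nat set" assume I: "finite I \<and> card I = k"
      show "\<not> (\<exists>as\<in>tuples Geq [Home]. \<forall>i\<in>I. sat Geq (as @ El (h i) # cs) \<chi>)"
        using h(2)[rule_format, OF I] \<chi>(4) unfolding T_def by (auto simp: realizes_Home)
    qed (use \<chi>(1) tup rz in auto)
    moreover have "(\<chi>, El g # cs) \<in> formulas_over Geq [Home] UNIV"
      unfolding formulas_over_def using \<chi>(1) tup by (auto intro!: exI[of _ "Home # ts"])
    ultimately have "forks Geq [Home] (acleq0 G) q'"
      unfolding forks_def
      \<comment> \<open>Two members of \<open>q'\<close>, the formula and the failure of its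
        definition, imply the single dividing formula \<open>\<chi>\<close>.\<close>
      using \<phi> \<tau>q R(2) \<tau>(2) \<chi>(4)
      by (intro exI[of _ "{(\<phi>, bs), (\<tau>, es)}"] exI[of _ "{(\<chi>, El g # cs)}"])
        (auto simp: realizes_Home realizes_def)
    with nf show False by (rule notE)
  qed
  show "q' = ?q"
  proof (rule subset_antisym)
    show "q' \<subseteq> ?q" using c(1) sub by auto
    show "?q \<subseteq> q'"
    proof (rule subsetI, clarify)
      fix \<phi> bs assume f: "(\<phi>, bs) \<in> formulas_over Geq [Home] (acleq0 G \<union> {El g})" "U (\<lambda>x. sat Geq (El x # bs) \<phi>)"
      have "(Neg \<phi>, bs) \<notin> q'"
      proof
        assume "(Neg \<phi>, bs) \<in> q'"
        from sub[OF this] f(2) show False by (simp add: ultra_not[OF uU])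
      qed
      then show "(\<phi>, bs) \<in> q'" using c(2) f(1) by blast
    qed
  qed
qed

text \<open>From here on imaginaries are gone: a formula over acl^eq and g is the same as an almost
  0-definable binary relation with g as second argument.\<close>

lemma realizes_nf_ext:
  assumes U: "global_ext a U"
  shows "realizes Geq [El x] (nf_ext G (stp G a) {El g}) \<longleftrightarrow> (\<forall>R. adef2 R \<longrightarrow> U (\<lambda>x. R x g) \<longrightarrow> R x g)"
proof
  assume r: "realizes Geq [El x] (nf_ext G (stp G a) {El g})"
  show "\<forall>R. adef2 R \<longrightarrow> U (\<lambda>x. R x g) \<longrightarrow> R x g"
  proof (intro allI impI)
    fix R assume R: "adef2 R" "U (\<lambda>x. R x g)"
    from adef2_formula[OF R(1)] obtain \<phi> ts cs where \<phi>: "wf_fm Geq (Home # Home # ts) \<phi>" "cs \<in> tuples Geq ts"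
      "set cs \<subseteq> acleq0 G" "\<forall>x y. sat Geq (El x # El y # cs) \<phi> = R x y" by (elim exE conjE)
    have "El g # cs \<in> tuples Geq (Home # ts)" using \<phi>(2) by (simp add: tuples_def eq_sel)
    then have "(\<phi>, El g # cs) \<in> formulas_over Geq [Home] (acleq0 G \<union> {El g})"
      unfolding formulas_over_def using \<phi>(1,3) by (auto intro!: exI[of _ "Home # ts"])
    then have "(\<phi>, El g # cs) \<in> nf_ext G (stp G a) {El g}" using R(2) \<phi>(4) unfolding nf_ext_global_ext[OF U] by simp
    then have "sat Geq ([El x] @ El g # cs) \<phi>" using r unfolding realizes_def by blast
    then show "R x g" using \<phi>(4) by simp
  qed
next
  assume r: "\<forall>R. adef2 R \<longrightarrow> U (\<lambda>x. R x g) \<longrightarrow> R x g"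
  show "realizes Geq [El x] (nf_ext G (stp G a) {El g})"
    unfolding realizes_def nf_ext_global_ext[OF U]
  proof (rule ballI, clarify)
    fix \<phi> bs assume f: "(\<phi>, bs) \<in> formulas_over Geq [Home] (acleq0 G \<union> {El g})" "U (\<lambda>x. sat Geq (El x # bs) \<phi>)"
    from over_acleq0_adef2[OF f(1)] obtain R where R: "adef2 R" "\<forall>x. sat Geq (El x # bs) \<phi> = R x g" by (elim exE conjE)
    then show "sat Geq ([El x] @ bs) \<phi>" using r[rule_format, OF R(1)] f(2) by simp
  qed
qed

section \<open>Independence\<close>

lemma global_ext_elem:
  assumes V: "global_ext b V" and \<sigma>: "elem \<sigma>" shows "global_ext (\<sigma> b) (\<lambda>P. V (\<lambda>y. P (\<sigma> y)))"
  unfolding global_ext_def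
proof (intro conjI allI impI)
  show "ultra (\<lambda>P. V (\<lambda>y. P (\<sigma> y)))" by (rule ultra_map[OF global_ext_ultra[OF V]])
next
  fix P assume P: "adef1 P" "P (\<sigma> b)"
  have "adef1 (\<lambda>x. P (\<sigma> x))" by (rule adef_elem[OF P(1) \<sigma>])
  from global_ext_iff[OF V this] P(2) show "V (\<lambda>y. P (\<sigma> y))" by simp
next
  fix R assume R: "adef (\<lambda>w :: nat option \<Rightarrow> 'a. R (w None) (\<lambda>j. w (Some j)))"
  have "adef (\<lambda>w :: nat option \<Rightarrow> 'a. R (\<sigma> (w None)) (\<lambda>j. \<sigma> (w (Some j))))" by (rule adef_elem[OF R \<sigma>])
  from global_ext_adef[OF V, of "\<lambda>x v. R (\<sigma> x) (\<lambda>j. \<sigma> (v j))", OF this]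
  have "adef (\<lambda>v :: nat \<Rightarrow> 'a. V (\<lambda>x. R (\<sigma> x) (\<lambda>j. \<sigma> (v j))))" .
  from adef_elem[OF this elem_inv[OF \<sigma>]] show "adef (\<lambda>v :: nat \<Rightarrow> 'a. V (\<lambda>x. R (\<sigma> x) v))"
    by (simp add: elem_inv_right[OF \<sigma>])
qed

text \<open>As in \<open>global_ext_divides\<close>, but now the parameters of the relation have to be moved along with b.\<close>

lemma global_ext_divides0:
  assumes V: "global_ext b V" and R: "adef2 R"
  shows "\<exists>\<psi> cs. (\<psi>, cs) \<in> formulas_over G [()] UNIV \<and> divides G [()] {} (\<psi>, cs) \<and>
    (\<forall>x. sat G (x # cs) \<psi> = (R x b \<and> \<not> V (\<lambda>y. R x y)))"
proof -
  define W where "W x y \<longleftrightarrow> R x y \<and> \<not> V (\<lambda>y. R x y)" for x y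
  have W: "adef2 W" unfolding W_def
    by (intro adef_conj adef_not R adef1_app[OF global_ext_adef2[OF V adef2_swap[OF R]] dfun_var])
  obtain Q :: "(bool + 'a \<Rightarrow> 'a) \<Rightarrow> bool" and \<theta> where Q: "def0 Q" "def0 \<theta>" "\<theta> id"
    "finite ((\<lambda>y v. Q (case_sum v y)) ` {y. \<theta> y})" "(\<lambda>v :: bool \<Rightarrow> 'a. W (v True) (v False)) = (\<lambda>v. Q (case_sum v id))"
    using W by (rule adefE)
  have WQ: "Q (case_sum v id) = W (v True) (v False)" for v using fun_cong[OF Q(5), of v] by simp
  obtain xs where xs: "\<forall>ys. set xs \<subseteq> set ys \<longrightarrow> (\<exists>\<phi>. wff (length ys) \<phi> \<and> (\<forall>v. Q v = sat G (map v ys) \<phi>))"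
    using def0_formula[OF Q(1)] by (elim exE)
  have "finite {a. Inr a \<in> set xs}" using finite_vimageI[of "set xs" Inr] by (simp add: vimage_def)
  from finite_list[OF this] obtain cs where cs: "set cs = {a. Inr a \<in> set xs}" by (elim exE)
  let ?ys = "Inl True # Inl False # map Inr cs"
  have "set xs \<subseteq> set ?ys"
  proof
    fix x assume m: "x \<in> set xs"
    show "x \<in> set ?ys" by (cases x) (use m in \<open>auto simp: cs\<close>)
  qed
  with xs obtain \<psi> where \<psi>: "wff (length ?ys) \<psi>" "\<forall>v. Q v = sat G (map v ?ys) \<psi>" by blast
  have Q\<psi>: "Q (case_sum v u) = sat G (v True # v False # map u cs) \<psi>" for v u
    using \<psi>(2)[rule_format, of "case_sum v u"] by (simp add: comp_def)
  have sat\<psi>: "sat G (x # y # cs) \<psi> = W x y" for x y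
    using Q\<psi>[of "\<lambda>b. if b then x else y" id] WQ[of "\<lambda>b. if b then x else y"] by simp
  obtain h k where h: "\<forall>i P. adef1 P \<longrightarrow> P (h i) = P b"
    "\<forall>I :: nat set. finite I \<and> card I = k \<longrightarrow> \<not> (\<exists>x. \<forall>i\<in>I. R x (h i) \<and> \<not> V (\<lambda>y. R x y))"
    using global_ext_divides[OF V R] by (elim exE conjE)
  define S where "S \<rho> y u = sat G (y # map u cs) \<rho>" for \<rho> y and u :: "'a \<Rightarrow> 'a"
  define \<Phi> where "\<Phi> = {\<rho>. wff (Suc (length cs)) \<rho> \<and> sat G (b # cs) \<rho>}"
  have dS: "def0 (\<lambda>w :: 'a option \<Rightarrow> 'a. S \<rho> (w None) (\<lambda>j. w (Some j)))" if "\<rho> \<in> \<Phi>" for \<rho>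
    unfolding S_def using that by (intro def0I[of "None # map Some cs" \<rho>]) (simp_all add: comp_def \<Phi>_def)
  \<comment> \<open>The conjugates over the empty set have to include parameters \<open>u i\<close>
    moved along with \<open>h i\<close>, but \<open>h\<close> is only known to make R and its
    definition jointly k-inconsistent for the original parameters. So the moved parameters are
    required to define the same relation.\<close>
  define E where "E u u' \<longleftrightarrow> (\<forall>v. Q (case_sum v u) = Q (case_sum v u'))" for u u'
  have "def0 (\<lambda>w :: ('a + 'a) + bool \<Rightarrow> 'a. Q (case_sum (\<lambda>i. w (Inr i)) (\<lambda>j. w (Inl (Inl j)))))"
    "def0 (\<lambda>w :: ('a + 'a) + bool \<Rightarrow> 'a. Q (case_sum (\<lambda>i. w (Inr i)) (\<lambda>j. w (Inl (Inr j)))))"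
    by (rule def0_reindex[OF Q(1), where g = "case_sum Inr (\<lambda>j. Inl (Inl j))"], simp split: sum.split,
        rule def0_reindex[OF Q(1), where g = "case_sum Inr (\<lambda>j. Inl (Inr j))"], simp split: sum.split)
  then have dE: "def0 (\<lambda>w :: 'a + 'a \<Rightarrow> 'a. E (\<lambda>i. w (Inl i)) (\<lambda>i. w (Inr i)))"
    unfolding E_def by (intro def0_all def0_iff)
  have ex: "\<exists>u. (\<forall>\<rho>\<in>\<Phi>. S \<rho> (h i) u) \<and> E u id" for i
  proof -
    have "\<exists>u. \<forall>A\<in>insert (\<lambda>u. E u id) ((\<lambda>\<rho>. S \<rho> (h i)) ` \<Phi>). A u"
    proof (rule saturated_tuple[of "set cs"])
      fix A assume A: "A \<in> insert (\<lambda>u. E u id) ((\<lambda>\<rho>. S \<rho> (h i)) ` \<Phi>)"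
      have "dfn (\<lambda>u. E u id)" by (rule dfn_param[of E id, OF def0_dfn[OF dE]])
      moreover have "dfn (S \<rho> (h i))" if "\<rho> \<in> \<Phi>" for \<rho>
        by (rule dfn_param1[of "S \<rho>", OF def0_dfn[OF dS[OF that]]])
      ultimately show "dfn A" using A by blast
      fix v v' :: "'a \<Rightarrow> 'a" assume vv: "\<forall>j\<in>set cs. v j = v' j"
      have "map v cs = map v' cs" using vv by (intro map_cong) auto
      then have "E v id = E v' id" unfolding E_def Q\<psi> by (simp only:)
      moreover have "S \<rho> (h i) v = S \<rho> (h i) v'" for \<rho> unfolding S_def using vv by (simp cong: map_cong)
      ultimately show "A v = A v'" using A by blast
    next
      have "\<Phi> \<subseteq> formulas" unfolding \<Phi>_def by (intro subsetI, elim CollectE conjE) (rule wff_formulas)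
      then have "small \<Phi>" using small_formulas by (rule small_subset)
      from small_Un[OF small_finite[of "{\<lambda>u. E u id}"] small_image[OF this]]
      show "small (insert (\<lambda>u. E u id) ((\<lambda>\<rho>. S \<rho> (h i)) ` \<Phi>))" by simp
    next
      fix B assume B: "finite B" "B \<subseteq> insert (\<lambda>u. E u id) ((\<lambda>\<rho>. S \<rho> (h i)) ` \<Phi>)"
      have "finite (B - {\<lambda>u. E u id})" "B - {\<lambda>u. E u id} \<subseteq> (\<lambda>\<rho>. S \<rho> (h i)) ` \<Phi>" using B by auto
      from finite_subset_image[OF this] obtain \<Psi> where
        \<Psi>: "\<Psi> \<subseteq> \<Phi>" "finite \<Psi>" "B - {\<lambda>u. E u id} = (\<lambda>\<rho>. S \<rho> (h i)) ` \<Psi>" by (elim exE conjE)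
      \<comment> \<open>Together with \<open>\<theta>\<close> the condition of defining the same
        relation is almost 0-definable, since \<open>\<theta>\<close> leaves only finitely many
        relations. Hence solvability at b transfers to each \<open>h i\<close>, which has the same
        strong type.\<close>
      define N where "N u \<longleftrightarrow> \<theta> u \<and> E u id" for u
      have "adef N"
      proof -
        have "def0 (\<lambda>w :: 'a + 'a \<Rightarrow> 'a. \<theta> (\<lambda>i. w (Inl i)))" by (rule def0_reindex[OF Q(2) refl])
        from def0_conj[OF this dE] have 1: "def0 (\<lambda>w :: 'a + 'a \<Rightarrow> 'a. \<theta> (\<lambda>i. w (Inl i)) \<and> E (\<lambda>i. w (Inl i)) (\<lambda>i. w (Inr i)))" .
        have "(\<lambda>u' u. \<theta> u \<and> E u u') ` {u. \<theta> u} \<subseteq>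
            (\<lambda>A u. \<theta> u \<and> (\<forall>v. Q (case_sum v u) = A v)) ` (\<lambda>y v. Q (case_sum v y)) ` {y. \<theta> y}"
        proof (rule image_subsetI)
          fix u' assume "u' \<in> {u. \<theta> u}"
          then have m: "(\<lambda>v. Q (case_sum v u')) \<in> (\<lambda>y v. Q (case_sum v y)) ` {y. \<theta> y}" by (rule imageI)
          show "(\<lambda>u. \<theta> u \<and> E u u') \<in> (\<lambda>A u. \<theta> u \<and> (\<forall>v. Q (case_sum v u) = A v)) ` (\<lambda>y v. Q (case_sum v y)) ` {y. \<theta> y}"
            unfolding E_def by (rule image_eqI[OF _ m]) (rule refl)
        qed
        from finite_subset[OF this finite_imageI[OF Q(4)]]
        have 2: "finite ((\<lambda>u' u. \<theta> u \<and> E u u') ` {u. \<theta> u})" .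
        from adefI[OF 1 Q(2,3)] 2 show ?thesis unfolding N_def by (simp add: id_def)
      qed
      then have "adef (\<lambda>w :: unit + 'a \<Rightarrow> 'a. N (\<lambda>j. w (Inr j)))" by (rule adef_reindex) (rule refl)
      moreover have "adef (\<lambda>w :: unit + 'a \<Rightarrow> 'a. \<forall>\<rho>\<in>\<Psi>. S \<rho> (w (Inl ())) (\<lambda>j. w (Inr j)))"
      proof (rule adef_ball[OF \<Psi>(2)])
        fix \<rho> assume "\<rho> \<in> \<Psi>"
        then have "\<rho> \<in> \<Phi>" using \<Psi>(1) by blast
        from adef_option_app[of "S \<rho>", OF def0_adef[OF dS[OF this]] dfun_var dfun_var]
        show "adef (\<lambda>w :: unit + 'a \<Rightarrow> 'a. S \<rho> (w (Inl ())) (\<lambda>j. w (Inr j)))" .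
      qed
      ultimately have "adef1 (\<lambda>y. \<exists>u. N u \<and> (\<forall>\<rho>\<in>\<Psi>. S \<rho> y u))" by (intro adef_ex adef_conj)
      from h(1)[rule_format, OF this, of i]
      have e: "(\<exists>u. N u \<and> (\<forall>\<rho>\<in>\<Psi>. S \<rho> (h i) u)) = (\<exists>u. N u \<and> (\<forall>\<rho>\<in>\<Psi>. S \<rho> b u))" .
      have "N id" using Q(3) by (simp add: N_def E_def)
      moreover have "S \<rho> b id" if "\<rho> \<in> \<Psi>" for \<rho> using that \<Psi>(1) unfolding S_def \<Phi>_def by auto
      ultimately have "\<exists>u. N u \<and> (\<forall>\<rho>\<in>\<Psi>. S \<rho> b u)" by (intro exI[of _ id]) simp
      then obtain u where u: "N u" "\<forall>\<rho>\<in>\<Psi>. S \<rho> (h i) u" unfolding e[symmetric] by (elim exE conjE)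
      show "\<exists>y. \<forall>A\<in>B. A y"
      proof (intro exI[of _ u] ballI)
        fix A assume "A \<in> B"
        then have "A = (\<lambda>u. E u id) \<or> A \<in> (\<lambda>\<rho>. S \<rho> (h i)) ` \<Psi>" using \<Psi>(3) by blast
        then show "A u" using u unfolding N_def by auto
      qed
    qed simp
    then obtain u where u: "\<forall>A\<in>insert (\<lambda>u. E u id) ((\<lambda>\<rho>. S \<rho> (h i)) ` \<Phi>). A u" by (elim exE)
    have "E u id" using u[THEN bspec, OF insertI1] .
    moreover have "S \<rho> (h i) u" if "\<rho> \<in> \<Phi>" for \<rho> using u[THEN bspec, OF insertI2, OF imageI, OF that] .
    ultimately show ?thesis by (intro exI[of _ u] conjI ballI)
  qed
  have "\<forall>i. \<exists>u. (\<forall>\<rho>\<in>\<Phi>. S \<rho> (h i) u) \<and> E u id" using ex by (intro allI)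
  from choice[OF this] obtain u where u: "\<forall>i. (\<forall>\<rho>\<in>\<Phi>. S \<rho> (h i) (u i)) \<and> E (u i) id" by (elim exE)
  let ?ts = "replicate (Suc (length cs)) ()"
  have wf: "wf_fm G ([()] @ ?ts) \<psi>" using \<psi>(1) by simp
  have satu: "sat G (x # h i # map (u i) cs) \<psi> = W x (h i)" for x i
  proof -
    have "Q (case_sum v (u i)) = Q (case_sum v id)" for v using u unfolding E_def by blast
    then show ?thesis using Q\<psi>[of "\<lambda>b. if b then x else h i" "u i"] WQ[of "\<lambda>b. if b then x else h i"] by simp
  qed
  have "divides G [()] {} (\<psi>, b # cs)"
    unfolding divides_def prod.case
  proof (intro exI[of _ ?ts] exI[of _ k] exI[of _ "\<lambda>i. h i # map (u i) cs"] conjI allI impI)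
    fix i
    show "realizes G (h i # map (u i) cs) (tp G ?ts (b # cs) {})"
      unfolding realizes_def
    proof (rule ballI, clarify)
      fix \<rho> ds assume "(\<rho>, ds) \<in> tp G ?ts (b # cs) {}"
      then have ds: "ds = []" "wff (Suc (length cs)) \<rho>" "sat G (b # cs) \<rho>"
        by (auto simp: tp_def formulas_over_def)
      then have "\<rho> \<in> \<Phi>" by (simp add: \<Phi>_def)
      then have "S \<rho> (h i) (u i)" using u by blast
      then show "sat G ((h i # map (u i) cs) @ ds) \<rho>" by (simp add: ds(1) S_def)
    qed
  next
    fix I :: "nat set" assume I: "finite I \<and> card I = k"
    show "\<not> (\<exists>as\<in>tuples G [()]. \<forall>i\<in>I. sat G (as @ h i # map (u i) cs) \<psi>)"
    proof
      assume "\<exists>as\<in>tuples G [()]. \<forall>i\<in>I. sat G (as @ h i # map (u i) cs) \<psi>"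
      then obtain as where as: "length as = 1" "\<forall>i\<in>I. sat G (as @ h i # map (u i) cs) \<psi>" by auto
      then obtain x where "as = [x]" by (auto simp: length_Suc_conv)
      then have "\<forall>i\<in>I. W x (h i)" using as(2) satu by simp
      then show False using h(2)[rule_format, OF I] unfolding W_def by blast
    qed
  qed (use wf in simp_all)
  moreover have "(\<psi>, b # cs) \<in> formulas_over G [()] UNIV"
    unfolding formulas_over_def using wf by (auto intro!: exI[of _ ?ts])
  ultimately show ?thesis using sat\<psi> unfolding W_def by (intro exI[of _ \<psi>] exI[of _ "b # cs"]) simp
qed

text \<open>A type that does not fork extends to an ultrafilter q avoiding all dividing formulas, so
  q follows the definitions of types over b. The type of a over b alone does not determine its
  strong type over b; this gap is bridged by an automorphism fixing b.\<close>

lemma indep0_global_ext: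
  assumes ind: "indep0 G a b" and U: "global_ext a U" and R: "adef2 R"
  shows "R a b = U (\<lambda>x. R x b)"
proof -
  have nf: "\<not> forks G [()] {} (tp G [()] [a] {b})" using ind by (simp add: indep0_def)
  define A where "A = (\<lambda>p x. sat G (x # snd p) (fst p)) ` tp G [()] [a] {b}"
  define B where "B = (\<lambda>p x. \<not> sat G (x # snd p) (fst p)) ` {p \<in> formulas_over G [()] UNIV. divides G [()] {} p}"
  have fip: "\<exists>x. \<forall>P\<in>C. P x" if C: "finite C" "C \<subseteq> A \<union> B" for C
  proof -
    have "finite (C \<inter> A)" "finite (C \<inter> B)" using C(1) by auto
    moreover have "C \<inter> A \<subseteq> (\<lambda>p x. sat G (x # snd p) (fst p)) ` tp G [()] [a] {b}" unfolding A_def by (rule Int_lower2)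
    moreover have "C \<inter> B \<subseteq> (\<lambda>p x. \<not> sat G (x # snd p) (fst p)) ` {p \<in> formulas_over G [()] UNIV. divides G [()] {} p}"
      unfolding B_def by (rule Int_lower2)
    ultimately have "\<exists>\<pi>0\<subseteq>tp G [()] [a] {b}. finite \<pi>0 \<and> C \<inter> A = (\<lambda>p x. sat G (x # snd p) (fst p)) ` \<pi>0"
      "\<exists>\<Delta>\<subseteq>{p \<in> formulas_over G [()] UNIV. divides G [()] {} p}. finite \<Delta> \<and> C \<inter> B = (\<lambda>p x. \<not> sat G (x # snd p) (fst p)) ` \<Delta>"
      by (rule_tac [!] finite_subset_image)
    then
    obtain \<pi>0 \<Delta> where p: "\<pi>0 \<subseteq> tp G [()] [a] {b}" "finite \<pi>0" "C \<inter> A = (\<lambda>p x. sat G (x # snd p) (fst p)) ` \<pi>0"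
      "\<Delta> \<subseteq> {p \<in> formulas_over G [()] UNIV. divides G [()] {} p}" "finite \<Delta>"
      "C \<inter> B = (\<lambda>p x. \<not> sat G (x # snd p) (fst p)) ` \<Delta>" by (elim exE conjE)
    have "\<not> (\<forall>as\<in>tuples G [()]. realizes G as \<pi>0 \<longrightarrow> (\<exists>(\<psi>, cs)\<in>\<Delta>. sat G (as @ cs) \<psi>))"
    proof
      assume "\<forall>as\<in>tuples G [()]. realizes G as \<pi>0 \<longrightarrow> (\<exists>(\<psi>, cs)\<in>\<Delta>. sat G (as @ cs) \<psi>)"
      moreover have "\<Delta> \<subseteq> formulas_over G [()] UNIV" "\<forall>\<delta>\<in>\<Delta>. divides G [()] {} \<delta>" using p(4) by blast+
      ultimately have "forks G [()] {} (tp G [()] [a] {b})"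
        unfolding forks_def using p(1,2,5) by (intro exI[of _ \<pi>0] exI[of _ \<Delta>] conjI)
      with nf show False by (rule notE)
    qed
    then obtain as where as: "length as = 1" "realizes G as \<pi>0" "\<not> (\<exists>(\<psi>, cs)\<in>\<Delta>. sat G (as @ cs) \<psi>)" by auto
    then obtain x where x: "as = [x]" by (auto simp: length_Suc_conv)
    have 1: "P x" if "P \<in> C \<inter> A" for P using that as(2) unfolding p(3) x realizes_def by auto
    have 2: "P x" if "P \<in> C \<inter> B" for P using that as(3) unfolding p(6) x by auto
    have "\<forall>P\<in>C. P x"
    proof
      fix P assume "P \<in> C"
      then have "P \<in> C \<inter> A \<or> P \<in> C \<inter> B" using C(2) by blast
      then show "P x" using 1 2 by (elim disjE)
    qed
    then show ?thesis by (rule exI[of "\<lambda>x. \<forall>P\<in>C. P x"])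
  qed
  have "\<exists>q. ultra q \<and> (\<forall>P\<in>A \<union> B. q P)" by (rule ultra_extend, rule fip)
  then obtain q where q: "ultra q" "\<forall>P\<in>A \<union> B. q P" by (elim exE conjE)
  have qA: "q (\<lambda>x. sat G (x # bs) \<phi>)" if "(\<phi>, bs) \<in> tp G [()] [a] {b}" for \<phi> bs
  proof -
    have "(\<lambda>x. sat G (x # snd (\<phi>, bs)) (fst (\<phi>, bs))) \<in> A" unfolding A_def by (rule imageI[OF that])
    then show ?thesis using q(2) by (simp only: fst_conv snd_conv) blast
  qed
  have qB: "\<not> q (\<lambda>x. sat G (x # bs) \<phi>)" if "(\<phi>, bs) \<in> formulas_over G [()] UNIV" "divides G [()] {} (\<phi>, bs)" for \<phi> bs
  proof -
    have "(\<lambda>x. \<not> sat G (x # snd (\<phi>, bs)) (fst (\<phi>, bs))) \<in> B" unfolding B_def by (rule imageI) (use that in simp)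
    then have "q (\<lambda>x. \<not> sat G (x # bs) \<phi>)" using q(2) by (simp only: fst_conv snd_conv) blast
    then show ?thesis by (simp only: ultra_not[OF q(1)] simp_thms)
  qed
  obtain V where V: "global_ext b V" using global_ext_exists[of b] by (elim exE)
  have qimp: "q (\<lambda>x. V (\<lambda>y. R x y))" if R: "adef2 R" "q (\<lambda>x. R x b)" for R
  proof -
    obtain \<psi> cs where \<psi>: "(\<psi>, cs) \<in> formulas_over G [()] UNIV" "divides G [()] {} (\<psi>, cs)"
      "\<forall>x. sat G (x # cs) \<psi> = (R x b \<and> \<not> V (\<lambda>y. R x y))" using global_ext_divides0[OF V R(1)] by (elim exE conjE)
    from qB[OF \<psi>(1,2)] R(2) show ?thesis
      by (simp only: \<psi>(3)[rule_format] ultra_conj[OF q(1)] ultra_not[OF q(1)] simp_thms)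
  qed
  have qeq: "q (\<lambda>x. R x b) = q (\<lambda>x. V (\<lambda>y. R x y))" if R: "adef2 R" for R
    using qimp[OF R] qimp[OF adef_not[OF R]]
    by (auto simp: ultra_not[OF q(1)] ultra_not[OF global_ext_ultra[OF V]])
  \<comment> \<open>A realization a' is sought that stands in every almost 0-definable relation to b
    exactly as q prescribes.\<close>
  define K where "K P x \<longleftrightarrow> P (\<lambda>i. if i then x else b) = q (\<lambda>x. P (\<lambda>i. if i then x else b))" for P :: "(bool \<Rightarrow> 'a) \<Rightarrow> bool" and x
  have "\<exists>x. \<forall>D\<in>K ` {P. adef P}. D x"
  proof (rule saturated1)
    fix D assume "D \<in> K ` {P. adef P}"
    then obtain P where P: "adef P" "D = K P" by blast
    have "dfn (\<lambda>w :: unit option \<Rightarrow> 'a. P (\<lambda>i. w (if i then None else Some ())))"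
      by (rule dfn_reindex[OF adef_dfn[OF P(1)]])
    then have "dfn (\<lambda>w :: unit option \<Rightarrow> 'a. P (\<lambda>i. if i then w None else w (Some ())))"
      by (simp add: if_distrib cong: if_cong)
    from dfn_fix[of "\<lambda>x v. P (\<lambda>i. if i then x else v ())" "\<lambda>_. b", OF this]
    have d: "dfn1 (\<lambda>x. P (\<lambda>i. if i then x else b))" .
    have "dfn1 (\<lambda>x. P (\<lambda>i. if i then x else b) = c)" for c using d dfn_not[OF d] by (cases c) simp_all
    then show "dfn1 D" unfolding P(2) K_def .
  next
    show "small (K ` {P. adef P})" by (rule small_image[OF small_adef])
  next
    fix C assume C: "finite C" "C \<subseteq> K ` {P. adef P}"
    have "q D" if "D \<in> K ` {P. adef P}" for D
    proof -
      obtain P where P: "D = K P" using \<open>D \<in> K ` {P. adef P}\<close> by blast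
      show ?thesis unfolding P K_def by (simp add: ultra_iff[OF q(1)] ultra_const[OF q(1)])
    qed
    then have "q (\<lambda>x. \<forall>D\<in>C. D x)" unfolding ultra_ball[OF q(1) C(1)] using C(2) by blast
    from ultra_ex[OF q(1) this] show "\<exists>x. \<forall>D\<in>C. D x" .
  qed
  then obtain a' where a': "\<forall>D\<in>K ` {P. adef P}. D a'" by (elim exE)
  have aq: "R a' b = q (\<lambda>x. R x b)" if R: "adef2 R" for R
  proof -
    have "K (\<lambda>v. R (v True) (v False)) a'" using a' R by blast
    then show ?thesis unfolding K_def by simp
  qed
  have tpq: "sat G [a', b] \<phi> = sat G [a, b] \<phi>" if \<phi>: "wff 2 \<phi>" for \<phi>
  proof -
    have d: "adef2 (\<lambda>x y. sat G [x, y] \<phi>)"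
      using \<phi> by (intro def0_adef def0I[of "[True, False]" \<phi>]) (simp_all add: numeral_2_eq_2)
    have imp: "q (\<lambda>x. sat G (x # [b]) \<phi>)" if "sat G [a, b] \<phi>" "wff 2 \<phi>" for \<phi>
      by (rule qA) (use that in \<open>auto simp: tp_def formulas_over_def numeral_2_eq_2 intro!: exI[of _ "[()]"]\<close>)
    show ?thesis using imp[of \<phi>] imp[of "Neg \<phi>"] \<phi> aq[OF d] by (auto simp: ultra_not[OF q(1)])
  qed
  \<comment> \<open>The map to be extended to an automorphism sends a' to a and fixes b. If a'
    equals b it is still well defined, as equality is part of the common type.\<close>
  define y where "y z = (if z = b then b else a)" for z
  have ya: "y a' = a"
  proof (cases "a' = b")
    case True
    have "wff 2 (Eq (Var 0) (Var 1))"
      using has_sort.intros(1)[of 0 "[(), ()]" G] has_sort.intros(1)[of 1 "[(), ()]" G] by (auto simp: numeral_2_eq_2)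
    from tpq[OF this] True show ?thesis by (simp add: y_def)
  qed (simp add: y_def)
  have yb: "y b = b" by (simp add: y_def)
  have "\<exists>\<sigma>. elem \<sigma> \<and> (\<forall>z\<in>{a', b}. \<sigma> z = y z)"
    by (rule homogeneous[of _ "[a', b]"]) (use tpq ya yb in \<open>auto simp: numeral_2_eq_2\<close>)
  then obtain \<sigma> where \<sigma>: "elem \<sigma>" "\<sigma> a' = a" "\<sigma> b = b" using ya yb by auto
  \<comment> \<open>The relation is pulled back to a', where q decides it. Since
    \<open>\<sigma>\<close> fixes b, the image of \<open>V\<close> under \<open>\<sigma>\<close> is
    again an extension of the strong type of b, so symmetry applies after moving back to a.\<close>
  define R' where "R' x y = R (\<sigma> x) (\<sigma> y)" for x y
  have R': "adef2 R'" unfolding R'_def by (rule adef_elem[OF R \<sigma>(1)])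
  have T: "adef1 (\<lambda>x. V (\<lambda>y. R' x y))" by (rule global_ext_adef2[OF V adef2_swap[OF R']])
  have "R a b = R' a' b" by (simp add: R'_def \<sigma>)
  also have "\<dots> = q (\<lambda>x. R' x b)" by (rule aq[OF R'])
  also have "\<dots> = q (\<lambda>x. V (\<lambda>y. R' x y))" by (rule qeq[OF R'])
  also have "\<dots> = V (\<lambda>y. R' a' y)" by (rule aq[of "\<lambda>x y. V (\<lambda>y. R' x y)", symmetric], rule adef1_app[OF T dfun_var])
  also have "\<dots> = V (\<lambda>y. R a (\<sigma> y))" by (simp add: R'_def \<sigma>)
  also have "\<dots> = U (\<lambda>x. R x b)"
    using global_ext_symmetric[OF U global_ext_elem[OF V \<sigma>(1)] R] by (simp add: \<sigma>)
  finally show ?thesis .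
qed

section \<open>Stabilizers\<close>

text \<open>Invariance is asked for all definable sets and not only for those over g, which makes
  the group laws immediate; \<open>stab_iff\<close> compares the two.\<close>

definition stab :: "(('a \<Rightarrow> bool) \<Rightarrow> bool) \<Rightarrow> 'a set" where
  "stab U = {g. \<forall>D. dfn1 D \<longrightarrow> U (\<lambda>x. D (x + g)) = U D}"

lemma stabD: "g \<in> stab U \<Longrightarrow> dfn1 D \<Longrightarrow> U (\<lambda>x. D (x + g)) = U D"
  unfolding stab_def by simp

lemma dfn1_translate:
  assumes "dfn1 D" shows "dfn1 (\<lambda>x. D (x + g))"
proof -
  have "dfun (\<lambda>w :: unit option \<Rightarrow> 'a. w None + w (Some ()))" by (rule dfun_add[OF dfun_var dfun_var])
  from dfn_subst[OF assms, of "\<lambda>_ w. w None + w (Some ())", OF this]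
  have "dfn (\<lambda>w :: unit option \<Rightarrow> 'a. D (w None + w (Some ())))" .
  from dfn_fix[of "\<lambda>x v. D (x + v ())" "\<lambda>_. g", OF this] show ?thesis .
qed

lemma adef2_dfn1:
  assumes "adef2 R" shows "dfn1 (\<lambda>x. R x g)"
proof -
  have "adef (\<lambda>w :: unit option \<Rightarrow> 'a. R (w None) (w (Some ())))"
    by (rule adef2_app[OF assms dfun_var dfun_var])
  from dfn_fix[of "\<lambda>x v. R x (v ())" "\<lambda>_. g", OF adef_dfn[OF this]] show ?thesis .
qed

lemma is_subgroup_stab: "is_subgroup (stab U)"
  unfolding is_subgroup_def
proof (intro conjI ballI)
  show "0 \<in> stab U" by (simp add: stab_def)
next
  fix g h assume gh: "g \<in> stab U" "h \<in> stab U"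
  have "U (\<lambda>x. D (x + (g + h))) = U D" if D: "dfn1 D" for D
    using stabD[OF gh(1) dfn1_translate[OF D, of h]] stabD[OF gh(2) D] by (simp add: add.assoc)
  then show "g + h \<in> stab U" unfolding stab_def by simp
next
  fix g assume g: "g \<in> stab U"
  have "U (\<lambda>x. D (x + - g)) = U D" if D: "dfn1 D" for D
    using stabD[OF g dfn1_translate[OF D, of "- g"]] by simp
  then show "- g \<in> stab U" unfolding stab_def by simp
qed

lemma subgroup_diff: "is_subgroup H \<Longrightarrow> x \<in> H \<Longrightarrow> y \<in> H \<Longrightarrow> x - y \<in> H"
  unfolding is_subgroup_def by (metis diff_conv_add_uminus)

lemma mem_coset: "is_subgroup H \<Longrightarrow> y \<in> coset x H \<longleftrightarrow> y - x \<in> H"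
  unfolding coset_def by (force simp: algebra_simps)

lemma small_adef1: "small {P. adef1 P}"
proof (rule small_subset)
  show "{P. adef1 P} \<subseteq> (\<lambda>P x. P (\<lambda>_. x)) ` {P :: (unit \<Rightarrow> 'a) \<Rightarrow> bool. adef P}"
  proof
    fix P assume "P \<in> {P. adef1 P}"
    then have "adef1 P" by (rule CollectD)
    then have "(\<lambda>v :: unit \<Rightarrow> 'a. P (v ())) \<in> {P. adef P}" unfolding mem_Collect_eq .
    then show "P \<in> (\<lambda>P x. P (\<lambda>_. x)) ` {P :: (unit \<Rightarrow> 'a) \<Rightarrow> bool. adef P}"
      by (rule image_eqI[rotated]) (rule refl)
  qed
qed (rule small_image[OF small_adef])

lemma small_adef2: "small {\<lambda>x. R x g | R. adef2 R}"
proof (rule small_subset)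
  show "{\<lambda>x. R x g | R. adef2 R} \<subseteq> (\<lambda>P x. P (\<lambda>b. if b then x else g)) ` {P :: (bool \<Rightarrow> 'a) \<Rightarrow> bool. adef P}"
  proof
    fix D assume "D \<in> {\<lambda>x. R x g | R. adef2 R}"
    then obtain R where R: "D = (\<lambda>x. R x g)" "adef2 R" by (elim CollectE exE conjE)
    then show "D \<in> (\<lambda>P x. P (\<lambda>b. if b then x else g)) ` {P :: (bool \<Rightarrow> 'a) \<Rightarrow> bool. adef P}"
      by (intro image_eqI[of _ _ "\<lambda>v. R (v True) (v False)"]) simp_all
  qed
qed (rule small_image[OF small_adef])

lemma realize_ultra:
  assumes U: "ultra U" and sm: "small \<D>" and D: "\<And>D. D \<in> \<D> \<Longrightarrow> dfn1 D" "\<And>D. D \<in> \<D> \<Longrightarrow> U D"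
  shows "\<exists>x. \<forall>D\<in>\<D>. D x"
proof (rule saturated1[OF D(1) sm])
  fix B assume B: "finite B" "B \<subseteq> \<D>"
  have "\<forall>D\<in>B. U D" using B(2) D(2) by blast
  then have "U (\<lambda>x. \<forall>D\<in>B. D x)" unfolding ultra_ball[OF U B(1)] .
  from ultra_ex[OF U this] show "\<exists>x. \<forall>D\<in>B. D x" .
qed

definition same_type :: "'a \<Rightarrow> 'a \<Rightarrow> bool" where
  "same_type x y \<longleftrightarrow> (\<forall>P. adef1 P \<longrightarrow> P x = P y)"

lemma same_typeI:
  assumes "\<And>P. adef1 P \<Longrightarrow> P y \<Longrightarrow> P x" shows "same_type x y"
  unfolding same_type_def
proof (intro allI impI)
  fix P assume P: "adef1 P"
  show "P x = P y" using assms[OF P] assms[OF adef_not[OF P]] by (cases "P y") simp_all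
qed

lemma same_typeD: "same_type x y \<Longrightarrow> adef1 P \<Longrightarrow> P x = P y"
  unfolding same_type_def by (elim allE[of _ P] impE)

lemma realize_type:
  assumes U: "global_ext x U" and sm: "small \<D>" and D: "\<And>D. D \<in> \<D> \<Longrightarrow> dfn1 D" "\<And>D. D \<in> \<D> \<Longrightarrow> U D"
  shows "\<exists>t. same_type t x \<and> (\<forall>D\<in>\<D>. D t)"
proof -
  have "\<exists>t. \<forall>D\<in>\<D> \<union> {P. adef1 P \<and> P x}. D t"
  proof (rule realize_ultra[OF global_ext_ultra[OF U]])
    have "small {P. adef1 P \<and> P x}" by (rule small_subset[OF _ small_adef1]) blast
    then show "small (\<D> \<union> {P. adef1 P \<and> P x})" by (rule small_Un[OF sm])
  next
    fix E assume "E \<in> \<D> \<union> {P. adef1 P \<and> P x}"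
    then show "dfn1 E" using D(1) by (elim UnE CollectE conjE) (simp, rule adef_dfn)
  next
    fix E assume "E \<in> \<D> \<union> {P. adef1 P \<and> P x}"
    then show "U E" using D(2) global_ext_iff[OF U] by (elim UnE CollectE conjE) simp_all
  qed
  then obtain t where t: "\<forall>D\<in>\<D> \<union> {P. adef1 P \<and> P x}. D t" by (elim exE)
  have "same_type t x" by (rule same_typeI) (rule t[THEN bspec, OF UnI2, OF CollectI], rule conjI)
  moreover have "\<forall>D\<in>\<D>. D t" by (rule ballI) (rule t[THEN bspec, OF UnI1])
  ultimately show ?thesis by (intro exI conjI)
qed

lemma adef2_shift: "adef2 R \<Longrightarrow> adef2 (\<lambda>x y. R (x + y) y)"
  by (rule adef2_app[OF _ dfun_add[OF dfun_var dfun_var] dfun_var])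

text \<open>\<open>translate_eq\<close> with the same ultrafilter on both sides lifts agreement over
  g to agreement on all definable sets.\<close>

lemma stab_iff:
  assumes U: "global_ext a U"
  shows "g \<in> stab U \<longleftrightarrow> (\<forall>R. adef2 R \<longrightarrow> U (\<lambda>x. R (x + g) g) = U (\<lambda>x. R x g))"
proof
  assume g: "g \<in> stab U"
  show "\<forall>R. adef2 R \<longrightarrow> U (\<lambda>x. R (x + g) g) = U (\<lambda>x. R x g)"
    by (intro allI impI) (rule stabD[OF g adef2_dfn1])
next
  assume l: "\<forall>R. adef2 R \<longrightarrow> U (\<lambda>x. R (x + g) g) = U (\<lambda>x. R x g)"
  have "U (\<lambda>x. D (x + g)) = U D" if D: "dfn1 D" for D
    by (rule translate_eq[OF U U _ D]) (rule l[rule_format])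
  then show "g \<in> stab U" unfolding stab_def by (intro CollectI allI impI)
qed

text \<open>One realization x of the extension over g decides everything, because that extension is
  complete: were a set in it lost under translation, x would satisfy the negation of the translated
  formula, while x + g satisfies the formula.\<close>

lemma Stab_stp:
  assumes U: "global_ext a U" shows "Stab G (stp G a) = stab U"
proof (intro subset_antisym subsetI)
  fix g assume g: "g \<in> stab U"
  show "g \<in> Stab G (stp G a)"
    unfolding Stab_def realizes_nf_ext[OF U]
  proof (intro CollectI allI impI)
    fix x R assume x: "\<forall>R. adef2 R \<longrightarrow> U (\<lambda>x. R x g) \<longrightarrow> R x g" and R: "adef2 R" "U (\<lambda>x. R x g)"
    have "U (\<lambda>x. R (x + g) g)" using stabD[OF g adef2_dfn1[OF R(1)]] R(2) by simp
    then show "R (x + g) g" by (rule x[rule_format, OF adef2_shift[OF R(1)]])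
  qed
next
  fix g assume g: "g \<in> Stab G (stp G a)"
  have uU: "ultra U" by (rule global_ext_ultra[OF U])
  define \<D> where "\<D> = {D \<in> {\<lambda>x. R x g | R. adef2 R}. U D}"
  have "\<exists>x. \<forall>D\<in>\<D>. D x"
  proof (rule realize_ultra[OF uU])
    show "small \<D>" unfolding \<D>_def by (rule small_subset[OF Collect_restrict small_adef2])
  next
    fix D assume "D \<in> \<D>"
    then obtain R where "D = (\<lambda>x. R x g)" "adef2 R" unfolding \<D>_def by (elim CollectE exE conjE)
    then show "dfn1 D" using adef2_dfn1 by simp
  next
    fix D assume "D \<in> \<D>" then show "U D" unfolding \<D>_def by (elim CollectE conjE)
  qed
  then obtain x where x: "\<forall>D\<in>\<D>. D x" by (elim exE)
  have xR: "R x g" if "adef2 R" "U (\<lambda>x. R x g)" for R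
    by (rule x[THEN bspec]) (unfold \<D>_def, intro CollectI conjI exI[of _ R] refl that)
  then have "\<forall>R. adef2 R \<longrightarrow> U (\<lambda>x. R x g) \<longrightarrow> R x g" by (intro allI impI)
  then have xg: "\<forall>R. adef2 R \<longrightarrow> U (\<lambda>x. R x g) \<longrightarrow> R (x + g) g"
    using g unfolding Stab_def realizes_nf_ext[OF U] by blast
  have imp: "U (\<lambda>x. R (x + g) g)" if R: "adef2 R" "U (\<lambda>x. R x g)" for R
  proof (rule ccontr)
    assume "\<not> U (\<lambda>x. R (x + g) g)"
    then have "U (\<lambda>x. \<not> R (x + g) g)" unfolding ultra_not[OF uU] .
    from xR[OF adef_not[OF adef2_shift[OF R(1)]] this] xg[rule_format, OF R] show False by (rule notE)
  qed
  show "g \<in> stab U"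
    unfolding stab_iff[OF U]
  proof (intro allI impI)
    fix R assume R: "adef2 R"
    show "U (\<lambda>x. R (x + g) g) = U (\<lambda>x. R x g)"
      using imp[OF R] imp[OF adef_not[OF R]] unfolding ultra_not[OF uU] by blast
  qed
qed

section \<open>Independent triples with sum zero\<close>

lemma triple_translate:
  assumes z: "x + y + z = 0" and Ux: "global_ext x Ux" and Uz: "global_ext z Uz"
    and ind: "indep0 G x y" "indep0 G z y" and y': "same_type y' y" and D: "dfn1 D"
  shows "Ux (\<lambda>t. D (t + y')) = Uz (\<lambda>t. D (- t))"
proof -
  have zy: "- z = x + y" using z by (metis add.inverse_inverse eq_neg_iff_add_eq_0)
  define V where "V P = Uz (\<lambda>t. P (- t))" for P
  have V: "global_ext (- z) V" unfolding V_def by (rule global_ext_uminus[OF Uz])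
  have "Ux (\<lambda>t. D (t + y')) = V D"
  proof (rule translate_eq[OF Ux V _ D])
    fix R assume R: "adef2 R"
    have Rz: "adef2 (\<lambda>t u. R (- t) u)" by (rule adef2_app[OF R dfun_uminus[OF dfun_var] dfun_var])
    \<comment> \<open>Agreement of the two definitions at u is an almost 0-definable condition on u,
      so it passes from y to y', although y' need not satisfy any equation with x and z.\<close>
    have a: "adef1 (\<lambda>u. Ux (\<lambda>t. R (t + u) u) = V (\<lambda>t. R t u))"
      by (intro adef_iff global_ext_adef2[OF Ux adef2_shift[OF R]] global_ext_adef2[OF V R])
    have "Ux (\<lambda>t. R (t + y) y) = R (x + y) y" by (rule indep0_global_ext[OF ind(1) Ux adef2_shift[OF R], symmetric])
    also have "\<dots> = R (- z) y" by (simp only: zy)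
    also have "\<dots> = V (\<lambda>t. R t y)" unfolding V_def by (rule indep0_global_ext[OF ind(2) Uz Rz])
    finally show "Ux (\<lambda>t. R (t + y') y') = V (\<lambda>t. R t y')" using same_typeD[OF y' a] by simp
  qed
  then show ?thesis unfolding V_def .
qed

lemma triple_diff:
  assumes "x + y + z = 0" "global_ext x Ux" "indep0 G x y" "indep0 G z y" "same_type y' y" "same_type y'' y"
  shows "y' - y'' \<in> stab Ux"
proof -
  obtain Uz where Uz: "global_ext z Uz" using global_ext_exists[of z] by (elim exE)
  \<comment> \<open>\<open>triple_translate\<close> is applied at y' and at y'' to the translate of
    D by \<open>- y''\<close>. Both right-hand sides are the same statement about \<open>Uz\<close>,
    and at y'' the two shifts cancel.\<close>
  have "Ux (\<lambda>t. D (t + (y' - y''))) = Ux D" if D: "dfn1 D" for D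
    using triple_translate[OF assms(1,2) Uz assms(3,4,5) dfn1_translate[OF D, of "- y''"]]
      triple_translate[OF assms(1,2) Uz assms(3,4,6) dfn1_translate[OF D, of "- y''"]] by (simp add: algebra_simps)
  then show ?thesis unfolding stab_def by simp
qed

text \<open>Translation by u preserves \<open>U\<close>, so the strong type of y and its translate
  are both in \<open>U\<close> and can be realized together by saturation.\<close>

lemma stab_realize:
  assumes U: "global_ext y U" and u: "u \<in> stab U"
  shows "\<exists>y'. same_type y' y \<and> same_type (y' + u) y"
proof -
  have "\<exists>t. same_type t y \<and> (\<forall>D\<in>(\<lambda>P t. P (t + u)) ` {P. adef1 P \<and> P y}. D t)"
  proof (rule realize_type[OF U])
    have "small {P. adef1 P \<and> P y}" by (rule small_subset[OF _ small_adef1]) blast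
    then show "small ((\<lambda>P t. P (t + u)) ` {P. adef1 P \<and> P y})" by (rule small_image)
  next
    fix D assume "D \<in> (\<lambda>P t. P (t + u)) ` {P. adef1 P \<and> P y}"
    then obtain P where P: "D = (\<lambda>t. P (t + u))" "adef1 P" "P y" by (elim imageE CollectE conjE)
    show "dfn1 D" unfolding P(1) by (rule dfn1_translate[OF adef_dfn[OF P(2)]])
    show "U D" unfolding P(1) stabD[OF u adef_dfn[OF P(2)]] global_ext_iff[OF U P(2)] by (rule P(3))
  qed
  then obtain t where t: "same_type t y" "\<forall>D\<in>(\<lambda>P t. P (t + u)) ` {P. adef1 P \<and> P y}. D t" by (elim exE conjE)
  have "same_type (t + u) y"
    by (rule same_typeI) (rule t(2)[THEN bspec, OF imageI, OF CollectI], rule conjI)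
  with t(1) show ?thesis by (intro exI conjI)
qed

lemma triple_stab_subset:
  assumes "x + y + z = 0" "global_ext x Ux" "global_ext y Uy" "indep0 G x y" "indep0 G z y"
  shows "stab Uy \<subseteq> stab Ux"
proof
  fix u assume "u \<in> stab Uy"
  from stab_realize[OF assms(3) this] obtain y' where "same_type y' y" "same_type (y' + u) y" by (elim exE conjE)
  from triple_diff[OF assms(1,2,4,5) this(2,1)] show "u \<in> stab Ux" by simp
qed

section \<open>Definability, genericity and connectedness\<close>

lemma type_definable_mono:
  assumes "A \<subseteq> B" "type_definable G A X" shows "type_definable G B X"
proof -
  from assms(2) obtain \<pi> where \<pi>: "\<pi> \<subseteq> formulas_over Geq [Home] A" "X = {x \<in> univ G (). realizes Geq [El x] \<pi>}"
    unfolding type_definable_def by (elim exE conjE)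
  have "\<pi> \<subseteq> formulas_over Geq [Home] B" by (rule subset_trans[OF \<pi>(1) formulas_over_mono[OF assms(1)]])
  then show ?thesis unfolding type_definable_def using \<pi>(2) by (intro exI conjI)
qed

text \<open>The parameters actually used are collected in a small set, because
  \<open>type_definable_subgroup\<close> asks for a small one while the cosets are to be definable
  over all of \<open>acleq0 G\<close>.\<close>

lemma adef1_type_definable:
  assumes "\<And>P. P \<in> \<P> \<Longrightarrow> adef1 P"
  shows "\<exists>A\<subseteq>acleq0 G. small A \<and> type_definable G A {x. \<forall>P\<in>\<P>. P x}"
proof -
  have "\<forall>P\<in>\<P>. \<exists>p. p \<in> formulas_over Geq [Home] (acleq0 G) \<and> (\<forall>x. sat Geq (El x # snd p) (fst p) = P x)"
  proof
    fix P assume "P \<in> \<P>"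
    from adef1_formula[OF assms[OF this]] obtain \<phi> cs where
      "(\<phi>, cs) \<in> formulas_over Geq [Home] (acleq0 G)" "\<forall>x. sat Geq (El x # cs) \<phi> = P x" by (elim exE conjE)
    then show "\<exists>p. p \<in> formulas_over Geq [Home] (acleq0 G) \<and> (\<forall>x. sat Geq (El x # snd p) (fst p) = P x)"
      by (intro exI[of _ "(\<phi>, cs)"]) simp
  qed
  from bchoice[OF this] obtain f where
    f: "\<forall>P\<in>\<P>. f P \<in> formulas_over Geq [Home] (acleq0 G) \<and> (\<forall>x. sat Geq (El x # snd (f P)) (fst (f P)) = P x)" by (elim exE)
  define A where "A = (\<Union>P\<in>\<P>. set (snd (f P)))"
  have "small \<P>" using assms by (intro small_subset[OF _ small_adef1]) blast
  then have "small A" unfolding A_def by (rule small_UNION) (simp add: countable_finite)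
  moreover have "A \<subseteq> acleq0 G"
  proof
    fix e assume "e \<in> A"
    then obtain P where P: "P \<in> \<P>" "e \<in> set (snd (f P))" unfolding A_def by (elim UN_E)
    have "f P \<in> formulas_over Geq [Home] (acleq0 G)" using f P(1) by blast
    then show "e \<in> acleq0 G" using P(2) unfolding formulas_over_def by auto
  qed
  moreover have "type_definable G A {x. \<forall>P\<in>\<P>. P x}"
    unfolding type_definable_def
  proof (intro exI[of _ "f ` \<P>"] conjI)
    show "f ` \<P> \<subseteq> formulas_over Geq [Home] A"
    proof (rule image_subsetI)
      fix P assume P: "P \<in> \<P>"
      then have "set (snd (f P)) \<subseteq> A" unfolding A_def by blast
      moreover have "f P \<in> formulas_over Geq [Home] (acleq0 G)" using f P by blast
      ultimately show "f P \<in> formulas_over Geq [Home] A" unfolding formulas_over_def by auto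
    qed
    have "realizes Geq [El x] (f ` \<P>) \<longleftrightarrow> (\<forall>P\<in>\<P>. P x)" for x
      unfolding realizes_def using f by (simp add: split_beta)
    then show "{x. \<forall>P\<in>\<P>. P x} = {x \<in> univ G (). realizes Geq [El x] (f ` \<P>)}" by (simp add: univ_G)
  qed
  ultimately show ?thesis by (intro exI conjI)
qed

text \<open>The conditions of \<open>stab_iff\<close> as sets of g. Each is almost 0-definable since
  the definitions in \<open>U\<close> are, and this is the source of type-definability of the
  stabilizer.\<close>

definition stab_conds :: "(('a \<Rightarrow> bool) \<Rightarrow> bool) \<Rightarrow> ('a \<Rightarrow> bool) set" where
  "stab_conds U = {\<lambda>g. U (\<lambda>x. R (x + g) g) = U (\<lambda>x. R x g) | R. adef2 R}"

lemma stab_conds: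
  assumes U: "global_ext a U"
  shows "P \<in> stab_conds U \<Longrightarrow> adef1 P" and "stab U = {g. \<forall>P\<in>stab_conds U. P g}"
proof -
  assume "P \<in> stab_conds U"
  then obtain R where R: "P = (\<lambda>g. U (\<lambda>x. R (x + g) g) = U (\<lambda>x. R x g))" "adef2 R"
    unfolding stab_conds_def by (elim CollectE exE conjE)
  show "adef1 P" unfolding R(1) by (intro adef_iff global_ext_adef2[OF U adef2_shift[OF R(2)]] global_ext_adef2[OF U R(2)])
next
  have "(\<forall>R. adef2 R \<longrightarrow> U (\<lambda>x. R (x + g) g) = U (\<lambda>x. R x g)) \<longleftrightarrow> (\<forall>P\<in>stab_conds U. P g)" (is "?l \<longleftrightarrow> ?r") for g
  proof
    assume l: ?l
    show ?r
    proof
      fix P assume "P \<in> stab_conds U"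
      then obtain R where R: "P = (\<lambda>g. U (\<lambda>x. R (x + g) g) = U (\<lambda>x. R x g))" "adef2 R"
        unfolding stab_conds_def by (elim CollectE exE conjE)
      show "P g" unfolding R(1) by (rule l[rule_format, OF R(2)])
    qed
  next
    assume r: ?r
    show ?l
    proof (intro allI impI)
      fix R assume "adef2 R"
      then have "(\<lambda>g. U (\<lambda>x. R (x + g) g) = U (\<lambda>x. R x g)) \<in> stab_conds U"
        unfolding stab_conds_def by (intro CollectI exI conjI) (rule refl)
      from r[THEN bspec, OF this] show "U (\<lambda>x. R (x + g) g) = U (\<lambda>x. R x g)" .
    qed
  qed
  then show "stab U = {g. \<forall>P\<in>stab_conds U. P g}" by (intro set_eqI) (simp only: stab_iff[OF U] mem_Collect_eq)
qed

lemma small_stab_conds: "global_ext a U \<Longrightarrow> small (stab_conds U)"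
  using stab_conds(1) by (intro small_subset[OF _ small_adef1]) blast

text \<open>x itself is not an admissible parameter. It is replaced by almost all t in the sense of
  \<open>U\<close>, which is correct because every realization t of the strong type of x lies in the
  same coset.\<close>

lemma coset_conds:
  assumes U: "global_ext x U" and tr: "\<And>t. same_type t x \<Longrightarrow> t - x \<in> stab U"
  shows "coset x (stab U) = {y. \<forall>P\<in>(\<lambda>P y. U (\<lambda>t. P (y - t))) ` stab_conds U. P y}"
proof (rule set_eqI)
  fix y
  have dy: "dfn1 (\<lambda>t. P (y - t))" if "adef1 P" for P
    by (rule adef2_dfn1[of "\<lambda>t y. P (y - t)", OF adef1_app[OF that dfun_diff[OF dfun_var dfun_var]]])
  note sub = subgroup_diff[OF is_subgroup_stab]
  have "y - x \<in> stab U \<longleftrightarrow> (\<forall>P\<in>stab_conds U. U (\<lambda>t. P (y - t)))"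
  proof (intro iffI ballI)
    fix P assume y: "y - x \<in> stab U" and P: "P \<in> stab_conds U"
    show "U (\<lambda>t. P (y - t))"
    proof (rule ccontr)
      assume "\<not> U (\<lambda>t. P (y - t))"
      then have n: "U (\<lambda>t. \<not> P (y - t))" unfolding ultra_not[OF global_ext_ultra[OF U]] .
      have "\<exists>t. same_type t x \<and> (\<forall>D\<in>{\<lambda>t. \<not> P (y - t)}. D t)"
        by (rule realize_type[OF U small_finite]) (use n dfn_not[OF dy[OF stab_conds(1)[OF U P]]] in simp_all)
      then obtain t where t: "same_type t x" "\<not> P (y - t)" by (elim exE conjE) simp
      have "y - t \<in> stab U" using sub[OF y tr[OF t(1)]] by simp
      with t(2) P show False unfolding stab_conds(2)[OF U] by blast
    qed
  next
    assume a: "\<forall>P\<in>stab_conds U. U (\<lambda>t. P (y - t))"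
    have "\<exists>t. same_type t x \<and> (\<forall>D\<in>(\<lambda>P t. P (y - t)) ` stab_conds U. D t)"
    proof (rule realize_type[OF U small_image[OF small_stab_conds[OF U]]])
      fix D assume "D \<in> (\<lambda>P t. P (y - t)) ` stab_conds U"
      then obtain P where P: "D = (\<lambda>t. P (y - t))" "P \<in> stab_conds U" by (elim imageE)
      show "dfn1 D" "U D" unfolding P(1) by (rule dy[OF stab_conds(1)[OF U P(2)]], rule a[THEN bspec, OF P(2)])
    qed
    then obtain t where t: "same_type t x" "\<forall>D\<in>(\<lambda>P t. P (y - t)) ` stab_conds U. D t" by (elim exE conjE)
    have "\<forall>P\<in>stab_conds U. P (y - t)" by (rule ballI) (rule t(2)[THEN bspec, OF imageI])
    then have "y - t \<in> stab U" unfolding stab_conds(2)[OF U] by (rule CollectI)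
    moreover have "t - x \<in> stab U" by (rule tr[OF t(1)])
    ultimately have "y - t + (t - x) \<in> stab U" using is_subgroup_stab[of U] unfolding is_subgroup_def by blast
    then show "y - x \<in> stab U" by simp
  qed
  then show "y \<in> coset x (stab U) \<longleftrightarrow> y \<in> {y. \<forall>P\<in>(\<lambda>P y. U (\<lambda>t. P (y - t))) ` stab_conds U. P y}"
    unfolding mem_coset[OF is_subgroup_stab] by (simp only: mem_Collect_eq ball_simps)
qed

lemma coset_type_definable:
  assumes U: "global_ext x U" and tr: "\<And>t. same_type t x \<Longrightarrow> t - x \<in> stab U"
  shows "type_definable G (acleq0 G) (coset x (stab U))"
proof -
  have "\<exists>A\<subseteq>acleq0 G. small A \<and> type_definable G A {y. \<forall>P\<in>(\<lambda>P y. U (\<lambda>t. P (y - t))) ` stab_conds U. P y}"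
  proof (rule adef1_type_definable)
    fix Q assume "Q \<in> (\<lambda>P y. U (\<lambda>t. P (y - t))) ` stab_conds U"
    then obtain P where P: "Q = (\<lambda>y. U (\<lambda>t. P (y - t)))" "P \<in> stab_conds U" by (elim imageE)
    show "adef1 Q" unfolding P(1)
      by (rule global_ext_adef2[OF U, of "\<lambda>t y. P (y - t)", OF adef1_app[OF stab_conds(1)[OF U P(2)] dfun_diff[OF dfun_var dfun_var]]])
  qed
  then obtain A where A: "A \<subseteq> acleq0 G"
    "type_definable G A {y. \<forall>P\<in>(\<lambda>P y. U (\<lambda>t. P (y - t))) ` stab_conds U. P y}" by (elim exE conjE)
  from type_definable_mono[OF A] show ?thesis by (subst coset_conds[OF U tr])
qed

text \<open>A set that contains all realizations of the strong type need not be definable, so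
  \<open>U\<close> may miss it. By saturation it is consistent with the definable sets in
  \<open>U\<close>, and an ultrafilter with the same trace contains it.\<close>

lemma ultra_concentrate:
  assumes U: "global_ext x U" and C: "\<And>t. same_type t x \<Longrightarrow> C t"
  shows "\<exists>W. ultra W \<and> W C \<and> (\<forall>D. dfn1 D \<longrightarrow> W D = U D)"
proof -
  have "\<exists>W. ultra W \<and> (\<forall>D\<in>insert C {D. dfn1 D \<and> U D}. W D)"
  proof (rule ultra_extend)
    fix B assume B: "finite B" "B \<subseteq> insert C {D. dfn1 D \<and> U D}"
    have "\<exists>t. same_type t x \<and> (\<forall>D\<in>B - {C}. D t)"
    proof (rule realize_type[OF U small_finite])
      fix D assume "D \<in> B - {C}"
      then have "D \<in> {D. dfn1 D \<and> U D}" using B(2) by blast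
      then show "dfn1 D" "U D" by simp_all
    qed (use B(1) in simp)
    then obtain t where t: "same_type t x" "\<forall>D\<in>B - {C}. D t" by (elim exE conjE)
    have "D t" if "D \<in> B" for D
    proof (cases "D = C")
      case False
      then have "D \<in> B - {C}" using that by blast
      then show ?thesis by (rule t(2)[THEN bspec])
    qed (use C[OF t(1)] in simp)
    then show "\<exists>t. \<forall>D\<in>B. D t" by (intro exI[of _ t] ballI)
  qed
  then obtain W where W: "ultra W" "\<forall>D\<in>insert C {D. dfn1 D \<and> U D}. W D" by (elim exE conjE)
  have imp: "W D" if "dfn1 D" "U D" for D by (rule W(2)[THEN bspec, OF insertI2]) (intro CollectI conjI that)
  have "W D = U D" if D: "dfn1 D" for D
    using imp[OF D] imp[OF dfn_not[OF D]] unfolding ultra_not[OF W(1)] ultra_not[OF global_ext_ultra[OF U]] by blast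
  moreover have "W C" by (rule W(2)[THEN bspec, OF insertI1])
  ultimately show ?thesis using W(1) by (intro exI[of _ W] conjI allI impI)
qed

text \<open>Otherwise an ultrafilter Y on the coset avoids all translates of X by the stabilizer.  Then
  \<open>X (y - u)\<close> fails for Y-almost all y if u is in the stabilizer, but holds for almost all
  \<open>u = x - t\<close> with t in the type of x if y is in the coset, contrary to symmetry.\<close>

lemma stab_generic:
  assumes U: "global_ext x U" and tr: "\<And>t. same_type t x \<Longrightarrow> t - x \<in> stab U"
  shows "generic_element G (stab U) (coset x (stab U)) x"
  unfolding generic_element_def
proof (intro conjI)
  let ?C = "coset x (stab U)"
  note mem = mem_coset[OF is_subgroup_stab[of U], of _ x]
  have zero: "0 \<in> stab U" using is_subgroup_stab[of U] by (simp add: is_subgroup_def)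
  then show "x \<in> ?C" unfolding mem by simp
  have "\<exists>F. finite F \<and> F \<subseteq> stab U \<and> ?C \<subseteq> (\<Union>u\<in>F. coset u {y \<in> ?C. X y})" if X: "adef1 X" "X x" for X
  proof (rule ccontr)
    assume n: "\<not> ?thesis"
    have UX: "U X" using global_ext_iff[OF U X(1)] X(2) by simp
    have R: "adef2 (\<lambda>y u. X (y - u))" by (rule adef1_app[OF X(1) dfun_diff[OF dfun_var dfun_var]])
    have no: "no_order (\<lambda>y u. X (y - u))"
    proof -
      have "adef (\<lambda>w :: unit option \<Rightarrow> 'a. X (w None - w (Some ())))"
        by (rule adef1_app[OF X(1) dfun_diff[OF dfun_var dfun_var]])
      from no_order_dfn1[OF stable, of "\<lambda>y v. X (y - v ())", OF adef_dfn[OF this]]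
      have "no_order (\<lambda>y (v :: unit \<Rightarrow> 'a). X (y - v ()))" .
      from no_order_comp[OF this, of id "\<lambda>u _. u"] show ?thesis by simp
    qed
    have "\<exists>Y. ultra Y \<and> (\<forall>P\<in>insert (\<lambda>y. y \<in> ?C) ((\<lambda>u y. \<not> X (y - u)) ` stab U). Y P)"
    proof (rule ultra_extend)
      fix B assume B: "finite B" "B \<subseteq> insert (\<lambda>y. y \<in> ?C) ((\<lambda>u y. \<not> X (y - u)) ` stab U)"
      have "finite (B - {\<lambda>y. y \<in> ?C})" "B - {\<lambda>y. y \<in> ?C} \<subseteq> (\<lambda>u y. \<not> X (y - u)) ` stab U" using B by auto
      from finite_subset_image[OF this] obtain F where
        F: "F \<subseteq> stab U" "finite F" "B - {\<lambda>y. y \<in> ?C} = (\<lambda>u y. \<not> X (y - u)) ` F" by (elim exE conjE)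
      have "\<not> ?C \<subseteq> (\<Union>u\<in>F. coset u {y \<in> ?C. X y})" using n F(1,2) by blast
      then obtain y where y: "y \<in> ?C" "y \<notin> (\<Union>u\<in>F. coset u {y \<in> ?C. X y})" by blast
      have nX: "\<not> X (y - u)" if u: "u \<in> F" for u
      proof
        assume a: "X (y - u)"
        have "y - x - u \<in> stab U" using y(1) F(1) u subgroup_diff[OF is_subgroup_stab] unfolding mem by blast
        then have "y - u \<in> {y \<in> ?C. X y}" using a by (simp add: mem algebra_simps)
        then have "u + (y - u) \<in> coset u {y \<in> ?C. X y}" unfolding coset_def by (rule imageI)
        then have "y \<in> coset u {y \<in> ?C. X y}" by simp
        with y(2) u show False by blast
      qed
      have "P y" if "P \<in> B" for P
      proof (cases "P = (\<lambda>y. y \<in> ?C)")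
        case False
        then have "P \<in> (\<lambda>u y. \<not> X (y - u)) ` F" using that F(3) by blast
        then show ?thesis using nX by (elim imageE) simp
      qed (use y(1) in simp)
      then show "\<exists>y. \<forall>P\<in>B. P y" by (intro exI[of _ y] ballI)
    qed
    then obtain Y where Y: "ultra Y" "\<forall>P\<in>insert (\<lambda>y. y \<in> ?C) ((\<lambda>u y. \<not> X (y - u)) ` stab U). Y P" by (elim exE conjE)
    have YC: "Y (\<lambda>y. y \<in> ?C)" by (rule Y(2)[THEN bspec, OF insertI1])
    have YX: "\<not> Y (\<lambda>y. X (y - u))" if "u \<in> stab U" for u
    proof -
      have "Y (\<lambda>y. \<not> X (y - u))" by (rule Y(2)[THEN bspec, OF insertI2, OF imageI, OF that])
      then show ?thesis unfolding ultra_not[OF Y(1)] .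
    qed
    have "\<exists>W. ultra W \<and> W (\<lambda>t. t - x \<in> stab U) \<and> (\<forall>D. dfn1 D \<longrightarrow> W D = U D)"
      by (rule ultra_concentrate[OF U tr])
    then obtain W where W: "ultra W" "W (\<lambda>t. t - x \<in> stab U)" "\<forall>D. dfn1 D \<longrightarrow> W D = U D" by (elim exE conjE)
    \<comment> \<open>W is pushed forward along \<open>t \<mapsto> x - t\<close>, so that it
      concentrates on the stabilizer and can be exchanged with Y.\<close>
    define W' where "W' P = W (\<lambda>t. P (x - t))" for P
    have W': "ultra W'" unfolding W'_def by (rule ultra_map[OF W(1)])
    have "Y (\<lambda>y. W' (\<lambda>u. X (y - u)))"
    proof (rule ultra_mono[of Y "\<lambda>y. y \<in> ?C", OF Y(1) YC])
      fix y assume "y \<in> ?C"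
      then have y: "y - x \<in> stab U" unfolding mem .
      have "W (\<lambda>t. X (t + (y - x))) = U (\<lambda>t. X (t + (y - x)))"
        by (rule W(3)[rule_format]) (rule dfn1_translate[of X, OF adef_dfn[OF X(1)]])
      also have "\<dots> = U X" by (rule stabD[OF y, of X, OF adef_dfn[OF X(1)]])
      finally have "W (\<lambda>t. X (t + (y - x)))" using UX by simp
      then show "W' (\<lambda>u. X (y - u))" unfolding W'_def by (simp add: algebra_simps)
    qed
    moreover have "\<not> W' (\<lambda>u. Y (\<lambda>y. X (y - u)))"
    proof -
      have "W (\<lambda>t. \<not> Y (\<lambda>y. X (y - (x - t))))"
      proof (rule ultra_mono[of W "\<lambda>t. t - x \<in> stab U", OF W(1,2)])
        fix t assume "t - x \<in> stab U"
        from subgroup_diff[OF is_subgroup_stab zero this] have "x - t \<in> stab U" by simp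
        then show "\<not> Y (\<lambda>y. X (y - (x - t)))" by (rule YX)
      qed
      then show ?thesis unfolding W'_def ultra_not[OF W(1)] .
    qed
    ultimately show False using ultra_symmetric[OF Y(1) W' no] by simp
  qed
  note key = this
  show "\<forall>(\<phi>, bs)\<in>stp G x. \<exists>F. finite F \<and> F \<subseteq> stab U \<and> ?C \<subseteq> (\<Union>u\<in>F. coset u {y \<in> ?C. sat Geq (El y # bs) \<phi>})"
  proof (rule ballI)
    fix p assume p: "p \<in> stp G x"
    obtain \<phi> bs where pe: "p = (\<phi>, bs)" by (cases p)
    obtain ts where ts: "wf_fm Geq (Home # ts) \<phi>" "bs \<in> tuples Geq ts" "set bs \<subseteq> acleq0 G" "sat Geq (El x # bs) \<phi>"
      using p unfolding pe stp_def tp_def formulas_over_def by auto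
    from key[OF over_acleq0_adef1[OF ts(1-3)] ts(4)]
    show "case p of (\<phi>, bs) \<Rightarrow> \<exists>F. finite F \<and> F \<subseteq> stab U \<and> ?C \<subseteq> (\<Union>u\<in>F. coset u {y \<in> ?C. sat Geq (El y # bs) \<phi>})"
      unfolding pe prod.case .
  qed
qed

lemma cl_eq_sort: "cl s u = cl s' u' \<Longrightarrow> s = s'"
  by (cases s; cases s') (simp_all add: cl_def)

lemma type_definable_dfn1:
  assumes A: "small A" and \<pi>: "\<pi> \<subseteq> formulas_over Geq [Home] A"
  shows "\<exists>\<D>. small \<D> \<and> (\<forall>D\<in>\<D>. dfn1 D) \<and> (\<forall>x. realizes Geq [El x] \<pi> \<longleftrightarrow> (\<forall>D\<in>\<D>. D x))"
proof -
  \<comment> \<open>Representatives are chosen once for each imaginary, independently of the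
    formula. The resulting sets are then indexed by predicates without parameters and lists over A,
    hence few.\<close>
  define rep where "rep e = (SOME u. \<exists>s. e = cl s u)" for e :: "('f, 'r, 'a) eqel"
  define w where "w bs k = rep (bs ! fst k) (snd k)" for bs :: "('f, 'r, 'a) eqel list" and k :: "nat \<times> nat"
  have tup: "tup ts (w bs) = bs" if bs: "bs \<in> tuples Geq ts" for ts bs
  proof -
    obtain u where u: "bs = tup ts u" using tuples_eq_tup[OF bs] by (elim exE)
    show ?thesis
    proof (rule nth_equalityI)
      fix i assume i: "i < length (tup ts (w bs))"
      then have b: "bs ! i = cl (ts ! i) (\<lambda>j. u (i, j))" using u by simp
      then have "\<exists>s. bs ! i = cl s (rep (bs ! i))" unfolding rep_def by (intro someI_ex[of "\<lambda>u. \<exists>s. bs ! i = cl s u"]) blast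
      then obtain s where s: "bs ! i = cl s (rep (bs ! i))" by (elim exE)
      have "ts ! i = s" using b s by (intro cl_eq_sort) (rule trans, erule sym)
      then show "tup ts (w bs) ! i = bs ! i" using s i by (simp add: w_def)
    qed (simp add: u)
  qed
  define S where "S p x = sat Geq (El x # snd p) (fst p)" for p :: "(('f, 'r) eqsort, ('f, 'r) eqfun, 'r) fm \<times> ('f, 'r, 'a) eqel list" and x
  have S: "\<exists>Q. def0 Q \<and> S p = (\<lambda>x. Q (case_option x (w (snd p)))) \<and> snd p \<in> lists A" if p: "p \<in> \<pi>" for p
  proof -
    obtain ts where ts: "wf_fm Geq (Home # ts) (fst p)" "snd p \<in> tuples Geq ts" "set (snd p) \<subseteq> A"
      using p \<pi> by (cases p) (auto simp: formulas_over_def)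
    define Q where "Q w \<longleftrightarrow> sat Geq (El (w None) # tup ts (\<lambda>k. w (Some k))) (fst p)" for w
    have "def0 Q" unfolding Q_def by (rule eq_formula_option_def0[OF ts(1) tuples_eq_sorts[OF ts(2)]])
    moreover have "S p = (\<lambda>x. Q (case_option x (w (snd p))))"
      unfolding S_def Q_def by (simp add: tup[OF ts(2)])
    ultimately show ?thesis using ts(3) by (intro exI[of _ Q] conjI) auto
  qed
  have "S ` \<pi> \<subseteq> (\<lambda>(Q, bs) x. Q (case_option x (w bs))) ` ({Q. def0 Q} \<times> lists A)"
  proof (rule image_subsetI)
    fix p assume "p \<in> \<pi>"
    from S[OF this] obtain Q where Q: "def0 Q" "S p = (\<lambda>x. Q (case_option x (w (snd p))))" "snd p \<in> lists A" by (elim exE conjE)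
    show "S p \<in> (\<lambda>(Q, bs) x. Q (case_option x (w bs))) ` ({Q. def0 Q} \<times> lists A)"
      unfolding Q(2) by (rule image_eqI[of _ _ "(Q, snd p)"]) (use Q(1,3) in simp_all)
  qed
  from small_subset[OF this small_image[OF small_times[OF small_def0 small_lists[OF A]]]]
  have "small (S ` \<pi>)" .
  moreover have "\<forall>D\<in>S ` \<pi>. dfn1 D"
  proof
    fix D assume "D \<in> S ` \<pi>"
    then obtain p where p: "D = S p" "p \<in> \<pi>" by (elim imageE)
    from S[OF this(2)] obtain Q where Q: "def0 Q" "S p = (\<lambda>x. Q (case_option x (w (snd p))))" by (elim exE conjE)
    have "(\<lambda>k. case_option (v None) (\<lambda>j. v (Some j)) k) = v" for v :: "(nat \<times> nat) option \<Rightarrow> 'a"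
      by (rule ext) (simp split: option.split)
    then have "dfn (\<lambda>v. Q (case_option (v None) (\<lambda>j. v (Some j))))" using def0_dfn[OF Q(1)] by (simp only: eta_contract_eq)
    from dfn_fix[of "\<lambda>x u. Q (case_option x u)", OF this] show "dfn1 D" unfolding p(1) Q(2) .
  qed
  moreover have "realizes Geq [El x] \<pi> \<longleftrightarrow> (\<forall>D\<in>S ` \<pi>. D x)" for x
    unfolding realizes_def S_def by (simp add: split_beta)
  ultimately show ?thesis by (intro exI[of _ "S ` \<pi>"] conjI allI)
qed

text \<open>A proper subgroup V of bounded index would have a translate on which U is concentrated,
  and by invariance also a different one.\<close>

lemma stab_connected:
  assumes U: "global_ext x U" and tr: "\<And>t. same_type t x \<Longrightarrow> t - x \<in> stab U"
  shows "connected_subgroup G \<kappa> (stab U)"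
  unfolding connected_subgroup_def
proof (intro conjI notI)
  have uU: "ultra U" by (rule global_ext_ultra[OF U])
  have "\<exists>A\<subseteq>acleq0 G. small A \<and> type_definable G A (stab U)"
    unfolding stab_conds(2)[OF U] by (rule adef1_type_definable[OF stab_conds(1)[OF U]])
  then show "type_definable_subgroup G \<kappa> (stab U)"
    unfolding type_definable_subgroup_def small_def using is_subgroup_stab by blast
  assume "\<exists>V. V \<subset> stab U \<and> type_definable_subgroup G \<kappa> V \<and> |(\<lambda>u. coset u V) ` stab U| <o \<kappa>"
  then obtain V A \<pi> where V: "V \<subset> stab U" "is_subgroup V" "small A" "\<pi> \<subseteq> formulas_over Geq [Home] A"
    "V = {x \<in> univ G (). realizes Geq [El x] \<pi>}" "small ((\<lambda>u. coset u V) ` stab U)"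
    unfolding type_definable_subgroup_def type_definable_def small_def by (elim exE conjE)
  from type_definable_dfn1[OF V(3,4)] obtain \<D> where \<D>: "small \<D>" "\<forall>D\<in>\<D>. dfn1 D"
    "\<forall>x. realizes Geq [El x] \<pi> \<longleftrightarrow> (\<forall>D\<in>\<D>. D x)" by (elim exE conjE)
  have mV: "h \<in> V \<longleftrightarrow> (\<forall>D\<in>\<D>. D h)" for h
    unfolding V(5) mem_Collect_eq \<D>(3)[rule_format, symmetric] by (simp add: univ_G)
  have dD: "dfn1 (\<lambda>t. D (t + g))" if "D \<in> \<D>" for D g by (rule dfn1_translate[OF \<D>(2)[THEN bspec, OF that]])
  \<comment> \<open>If no translate x + u + V carried the type, each of the few cosets of V would be
    excluded by a definable set outside \<open>U\<close>. A realization t avoiding all of these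
    would still lie in the coset given by t - x.\<close>
  have "\<exists>u\<in>stab U. \<forall>D\<in>\<D>. U (\<lambda>t. D (t + (- x - u)))"
  proof (rule ccontr)
    assume n: "\<not> (\<exists>u\<in>stab U. \<forall>D\<in>\<D>. U (\<lambda>t. D (t + (- x - u))))"
    have "\<forall>K\<in>(\<lambda>u. coset u V) ` stab U. \<exists>D. dfn1 D \<and> \<not> U D \<and> (\<forall>h\<in>K. D (x + h))"
    proof
      fix K assume "K \<in> (\<lambda>u. coset u V) ` stab U"
      then obtain u where u: "K = coset u V" "u \<in> stab U" by (elim imageE)
      obtain D where D: "D \<in> \<D>" "\<not> U (\<lambda>t. D (t + (- x - u)))" using n u(2) by blast
      have "D (x + h + (- x - u))" if "h \<in> K" for h
      proof -
        have "h - u \<in> V" using that unfolding u(1) mem_coset[OF V(2)] .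
        then have "D (h - u)" using mV D(1) by blast
        then show ?thesis by (simp add: algebra_simps)
      qed
      then show "\<exists>D. dfn1 D \<and> \<not> U D \<and> (\<forall>h\<in>K. D (x + h))"
        using D(2) dD[OF D(1)] by (intro exI[of _ "\<lambda>t. D (t + (- x - u))"] conjI ballI)
    qed
    from bchoice[OF this] obtain f where
      f: "\<forall>K\<in>(\<lambda>u. coset u V) ` stab U. dfn1 (f K) \<and> \<not> U (f K) \<and> (\<forall>h\<in>K. f K (x + h))" by (elim exE)
    have "\<exists>t. same_type t x \<and> (\<forall>D\<in>(\<lambda>K t. \<not> f K t) ` (\<lambda>u. coset u V) ` stab U. D t)"
    proof (rule realize_type[OF U small_image[OF V(6)]])
      fix D assume "D \<in> (\<lambda>K t. \<not> f K t) ` (\<lambda>u. coset u V) ` stab U"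
      then obtain K where K: "D = (\<lambda>t. \<not> f K t)" "K \<in> (\<lambda>u. coset u V) ` stab U" by (rule imageE)
      note fK = conjunct1[OF f[THEN bspec, OF K(2)]] conjunct1[OF conjunct2[OF f[THEN bspec, OF K(2)]]]
      show "dfn1 D" unfolding K(1) by (rule dfn_not[OF fK(1)])
      show "U D" unfolding K(1) ultra_not[OF uU] by (rule fK(2))
    qed
    then obtain t where t: "same_type t x" "\<forall>D\<in>(\<lambda>K t. \<not> f K t) ` (\<lambda>u. coset u V) ` stab U. D t" by (elim exE conjE)
    define K where "K = coset (t - x) V"
    have K: "K \<in> (\<lambda>u. coset u V) ` stab U" unfolding K_def by (rule imageI[OF tr[OF t(1)]])
    have "t - x \<in> K" unfolding K_def mem_coset[OF V(2)] using V(2) by (simp add: is_subgroup_def)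
    then have "f K (x + (t - x))" using f[THEN bspec, OF K] by blast
    moreover have "\<not> f K t" by (rule t(2)[THEN bspec, OF imageI[OF K]])
    ultimately show False by simp
  qed
  then obtain u where u: "u \<in> stab U" "\<forall>D\<in>\<D>. U (\<lambda>t. D (t + (- x - u)))" by (elim bexE)
  obtain v where v: "v \<in> stab U" "v \<notin> V" using V(1) by blast
  \<comment> \<open>Since v stabilizes \<open>U\<close>, some t lies in x + u + V together with t +
    v; the difference v is then in V.\<close>
  have "\<exists>t. \<forall>D\<in>(\<lambda>D t. D (t + (- x - u)) \<and> D (t + v + (- x - u))) ` \<D>. D t"
  proof (rule realize_ultra[OF uU small_image[OF \<D>(1)]])
    fix E assume "E \<in> (\<lambda>D t. D (t + (- x - u)) \<and> D (t + v + (- x - u))) ` \<D>"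
    then obtain D where D: "E = (\<lambda>t. D (t + (- x - u)) \<and> D (t + v + (- x - u)))" "D \<in> \<D>" by (elim imageE)
    show "dfn1 E" unfolding D(1) by (intro dfn_conj dD D(2) dfn1_translate[of "\<lambda>t. D (t + (- x - u))"])
    have 1: "U (\<lambda>t. D (t + (- x - u)))" by (rule u(2)[THEN bspec, OF D(2)])
    have 2: "U (\<lambda>t. D (t + v + (- x - u)))" using stabD[OF v(1) dD[OF D(2)]] 1 by simp
    show "U E" unfolding D(1) ultra_conj[OF uU] using 1 2 by (rule conjI)
  qed
  then obtain t where t: "\<forall>D\<in>(\<lambda>D t. D (t + (- x - u)) \<and> D (t + v + (- x - u))) ` \<D>. D t" by (elim exE)
  have tD: "D (t + (- x - u)) \<and> D (t + v + (- x - u))" if "D \<in> \<D>" for D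
    by (rule t[THEN bspec, OF imageI, OF that])
  have "t + (- x - u) \<in> V" "t + v + (- x - u) \<in> V" unfolding mV by (rule ballI, use tD in blast)+
  from subgroup_diff[OF V(2) this(2,1)] have "v \<in> V" by (simp add: algebra_simps)
  with v(2) show False by (rule notE)
qed

lemma stab_type_definable:
  assumes U: "global_ext x U" shows "type_definable G (acleq0 G) (stab U)"
proof -
  have "\<exists>A\<subseteq>acleq0 G. small A \<and> type_definable G A (stab U)"
    unfolding stab_conds(2)[OF U] by (rule adef1_type_definable[OF stab_conds(1)[OF U]])
  then obtain A where "A \<subseteq> acleq0 G" "type_definable G A (stab U)" by (elim exE conjE)
  then show ?thesis by (rule type_definable_mono)
qed

lemma independent_triple:
  assumes ind: "pairwise_indep0 G [a, b, c]" and sum: "a + b + c = 0"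
  shows "\<exists>U. Stab G (stp G a) = U \<and> Stab G (stp G b) = U \<and> Stab G (stp G c) = U \<and>
           connected_subgroup G \<kappa> U \<and>
           type_definable G (acleq0 G) U \<and>
           (\<forall>x\<in>{a, b, c}. \<exists>C. (\<exists>g. C = coset g U) \<and> type_definable G (acleq0 G) C \<and>
              generic_element G U C x)"
proof -
  obtain Ua where Ua: "global_ext a Ua" using global_ext_exists[of a] by (elim exE)
  obtain Ub where Ub: "global_ext b Ub" using global_ext_exists[of b] by (elim exE)
  obtain Uc where Uc: "global_ext c Uc" using global_ext_exists[of c] by (elim exE)
  have i: "i < 3 \<Longrightarrow> j < 3 \<Longrightarrow> i \<noteq> j \<Longrightarrow> indep0 G ([a, b, c] ! i) ([a, b, c] ! j)" for i j
    using ind by (simp add: pairwise_indep0_def numeral_3_eq_3)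
  have ij: "indep0 G a b" "indep0 G a c" "indep0 G b a" "indep0 G b c" "indep0 G c a" "indep0 G c b"
    using i[of 0 1] i[of 0 2] i[of 1 0] i[of 1 2] i[of 2 0] i[of 2 1] by simp_all
  have s: "a + c + b = 0" "b + a + c = 0" "c + b + a = 0" using sum by (simp_all add: ac_simps)
  \<comment> \<open>The inclusions form a cycle: the stabilizer for c lies in that for a, which lies
    in that for b, which lies in that for c.\<close>
  have eq: "stab Ub = stab Ua" "stab Uc = stab Ua"
    using triple_stab_subset[OF s(1) Ua Uc ij(2,4)] triple_stab_subset[OF s(2) Ub Ua ij(3,5)]
      triple_stab_subset[OF s(3) Uc Ub ij(6,1)] by auto
  have refl: "same_type t t" for t unfolding same_type_def by simp
  have tr: "t - a \<in> stab Ua" if "same_type t a" for t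
    using triple_diff[OF s(2) Ub ij(3,5) that refl] unfolding eq .
  have trb: "t - b \<in> stab Ub" if "same_type t b" for t
    using triple_diff[OF sum Ua ij(1,6) that refl] unfolding eq .
  have trc: "t - c \<in> stab Uc" if "same_type t c" for t
    using triple_diff[OF s(1) Ua ij(2,4) that refl] unfolding eq .
  have "\<exists>C. (\<exists>g. C = coset g (stab Ua)) \<and> type_definable G (acleq0 G) C \<and> generic_element G (stab Ua) C x"
    if x: "x \<in> {a, b, c}" for x
  proof -
    have "type_definable G (acleq0 G) (coset x (stab Ua)) \<and> generic_element G (stab Ua) (coset x (stab Ua)) x"
      using x coset_type_definable[OF Ua tr] stab_generic[OF Ua tr] coset_type_definable[OF Ub trb] stab_generic[OF Ub trb]
        coset_type_definable[OF Uc trc] stab_generic[OF Uc trc] unfolding eq by auto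
    then show ?thesis by blast
  qed
  then show ?thesis
    using Stab_stp[OF Ua] Stab_stp[OF Ub] Stab_stp[OF Uc] eq stab_connected[OF Ua tr] stab_type_definable[OF Ua]
    by (intro exI[of _ "stab Ua"]) simp
qed

end

theorem theorem1:
  fixes G :: "(unit, 'f, 'r, 'a::ab_group_add) struct"
    and \<kappa> :: "'k rel"
    and a b c :: 'a
  assumes "abelian_group_struct G"
    and "monster G \<kappa>"
    and "stable_struct G"
    and "pairwise_indep0 G [a, b, c]"
    and "a + b + c = 0"
  shows "\<exists>U. Stab G (stp G a) = U \<and> Stab G (stp G b) = U \<and> Stab G (stp G c) = U \<and>
           connected_subgroup G \<kappa> U \<and>
           type_definable G (acleq0 G) U \<and>
           (\<forall>x\<in>{a, b, c}. \<exists>C. (\<exists>g. C = coset g U) \<and> type_definable G (acleq0 G) C \<and>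
              generic_element G U C x)"
proof -
  interpret stable_group G \<kappa> using assms(1-3) by unfold_locales
  show ?thesis by (rule independent_triple[OF assms(4,5)])
qed

end
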